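(* For $x,b\in\mathbb{R}$ and a positive bounded measurable function $h$ on $\mathbb{R}$ with compact support, $$\mathbb{E}_x\Big[\int_0^\infty e^{-qt}h(U_r^b(t))\,dt\Big]=\int_{-\infty}^\infty h(y)\,r_b^{(q,r)}(x,y)\,dy,$$ where, for $x,y\in\mathbb{R}$, $$r_b^{(q,r)}(x,y):=\frac{q+r}{qr}\,\frac{\Phi(q)(\Phi(q+r)-\Phi(q))}{\Phi(q+r)}\,Z^{(q,r)}(x-b)\,H^{(q+r)}(b-y,\Phi(q))-\Upsilon(x-b,y-b).$$
   Context: **Process.** $X=(X(t);t\ge0)$ is a spectrally negative Lévy process (no positive jumps), with $X(0)=x$ under $\mathbb{P}_x$ (expectation $\mathbb{E}_x$); $\mathbb{P}=\mathbb{P}_0$, $\mathbb{E}=\mathbb{E}_0$. The case where $X$ is the negative of a subordinator is excluded, so that $X$ does not have monotone paths a.s. Its Laplace exponent $\kappa$, $\mathbb{E}[e^{\theta X(t)}]=e^{t\kappa(\theta)}$, is $\kappa(\theta)=\frac{\sigma^2}{2}\theta^2+\gamma\theta+\int_{(-\infty,0)}[e^{\theta y}-1-\theta y1_{\{y>-1\}}]\Pi(dy)$, $\theta\ge0$, with $\sigma\ge0$, $\gamma\in\mathbb{R}$, $\int_{(-\infty,0)}(1\wedge y^2)\Pi(dy)<\infty$. Standing assumption: there is $\bar\theta>0$ with $\int_{(-\infty,-1]}e^{\bar\theta|z|}\Pi(dz)<\infty$ (so $\mathbb{E}[X(1)]=\kappa'(0+)>-\infty$). Fix $q,r>0$. **Parisian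 reflected process.** $N^r$ is a Poisson process of rate $r$ independent of $X$. For $b\in\mathbb{R}$, $U_r^b(t)=X(t)+R_r^b(t)$ with $R_r^b(t)=\int_{[0,t]}(b-U_r^b(s-))^+dN^r(s)$, i.e. the process is pushed up to $b$ at each arrival time of $N^r$ at which it is below $b$. **Scale functions.** For $p>0$, $\Phi(p):=\sup\{\lambda\ge0:\kappa(\lambda)=p\}$, and $W^{(p)}:\mathbb{R}\to[0,\infty)$ is zero on $(-\infty,0)$ and on $[0,\infty)$ is the strictly increasing continuous function with $\int_0^\infty e^{-\theta x}W^{(p)}(x)dx=1/(\kappa(\theta)-p)$, $\theta>\Phi(p)$. $Z^{(p)}(x):=1+p\int_0^xW^{(p)}(y)dy$; $Z^{(p)}(x,\theta):=e^{\theta x}\big(1+(p-\kappa(\theta))\int_0^xe^{-\theta z}W^{(p)}(z)dz\big)$, $\theta\ge0$; $Z^{(q,r)}(x):=\frac{r}{q+r}Z^{(q)}(x)+\frac{q}{q+r}Z^{(q)}(x,\Phi(q+r))$. With $\tau_0^-:=\inf\{t>0:X(t)<0\}$, $H^{(q+r)}(x,\theta):=\mathbb{E}_x[e^{-(q+r)\tau_0^-+\theta X(\tau_0^-)}1_{\{\tau_0^-<\infty\}}]=Z^{(q+r)}(x,\theta)-\frac{\kappa(\theta)-(q+r)}{\theta-\Phi(q+r)}W^{(q+r)}(x)$. $\Theta^{(q+r)}(x,y):=e^{\Phi(q+r)x}W^{(q+r)}(-y)-W^{(q+r)}(x-y)$, and $\Upsilon(x,y):=-\Theta^{(q+r)}(x,y)+r\int_0^xW^{(q)}(x-z)\Theta^{(q+r)}(z,y)\,dz$,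 for $x,y\in\mathbb{R}$. *)

theory Defs
  imports "HOL-Probability.Probability"
begin

section \<open>Processes\<close>

text \<open>Processes are functions of time and outcome; only times \<open>t \<ge> 0\<close> matter.
  Paths are cadlag for every outcome (as on the canonical path space), so that the path
  functionals used below are genuine random variables.\<close>

definition cadlag :: "(real \<Rightarrow> real) \<Rightarrow> bool" where
  "cadlag f \<longleftrightarrow>
     (\<forall>t\<ge>0. (f \<longlongrightarrow> f t) (at_right t)) \<and> (\<forall>t>0. \<exists>l. (f \<longlongrightarrow> l) (at_left t))"

definition levy_process :: "'w measure \<Rightarrow> (real \<Rightarrow> 'w \<Rightarrow> real) \<Rightarrow> bool" where
  "levy_process M X \<longleftrightarrow>
     prob_space M \<and>
     (\<forall>t\<ge>0. X t \<in> borel_measurable M) \<and>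
     (AE \<omega> in M. X 0 \<omega> = 0) \<and>
     (\<forall>\<omega>\<in>space M. cadlag (\<lambda>t. X t \<omega>)) \<and>
     (\<forall>(t :: nat \<Rightarrow> real) n. 0 \<le> t 0 \<and> incseq t \<longrightarrow>
        prob_space.indep_vars M (\<lambda>_. borel) (\<lambda>i \<omega>. X (t (Suc i)) \<omega> - X (t i) \<omega>) {..<n}) \<and>
     (\<forall>s\<ge>0. \<forall>t\<ge>0. distr M borel (\<lambda>\<omega>. X (s + t) \<omega> - X s \<omega>) = distr M borel (X t))"

definition subordinator :: "'w measure \<Rightarrow> (real \<Rightarrow> 'w \<Rightarrow> real) \<Rightarrow> bool" where
  "subordinator M X \<longleftrightarrow> levy_process M X \<and> (AE \<omega> in M. mono_on {0..} (\<lambda>t. X t \<omega>))"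

definition spectrally_negative_levy :: "'w measure \<Rightarrow> (real \<Rightarrow> 'w \<Rightarrow> real) \<Rightarrow> bool" where
  "spectrally_negative_levy M X \<longleftrightarrow>
     levy_process M X \<and>
     (AE \<omega> in M. \<forall>t>0. X t \<omega> \<le> Lim (at_left t) (\<lambda>s. X s \<omega>)) \<and>
     \<not> subordinator M (\<lambda>t \<omega>. - X t \<omega>)"

definition poisson_process :: "'w measure \<Rightarrow> real \<Rightarrow> (real \<Rightarrow> 'w \<Rightarrow> nat) \<Rightarrow> bool" where
  "poisson_process M r N \<longleftrightarrow>
     levy_process M (\<lambda>t \<omega>. real (N t \<omega>)) \<and>
     (\<forall>\<omega>\<in>space M. N 0 \<omega> = 0 \<and> mono_on {0..} (\<lambda>t. N t \<omega>)) \<and>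
     (\<forall>t>0. distr M (count_space UNIV) (N t) = measure_pmf (poisson_pmf (r * t)))"

definition independent_processes ::
  "'w measure \<Rightarrow> (real \<Rightarrow> 'w \<Rightarrow> real) \<Rightarrow> (real \<Rightarrow> 'w \<Rightarrow> nat) \<Rightarrow> bool" where
  "independent_processes M X N \<longleftrightarrow>
     prob_space.indep_var M
       (PiM {0..} (\<lambda>_. borel)) (\<lambda>\<omega>. \<lambda>t\<in>{0..}. X t \<omega>)
       (PiM {0..} (\<lambda>_. count_space UNIV)) (\<lambda>\<omega>. \<lambda>t\<in>{0..}. N t \<omega>)"

text \<open>\<open>parisian_reflected b \<xi> n u\<close>: the path \<open>u\<close> is obtained from \<open>\<xi>\<close> by Parisian
  reflection at \<open>b\<close> at the jump times of the counting path \<open>n\<close>, i.e. \<open>u = \<xi> + R\<close> with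
  \<open>R(t)\<close> the Stieltjes integral over \<open>[0,t]\<close> of \<open>(b - u(s-))\<^sup>+\<close> against \<open>dn(s)\<close>.
  The path \<open>n\<close> is extended by 0 to negative times; when \<open>n 0 = 0\<close> the measure has no
  atom at 0, so the value given to \<open>u(0-)\<close> is irrelevant.\<close>

definition parisian_reflected ::
  "real \<Rightarrow> (real \<Rightarrow> real) \<Rightarrow> (real \<Rightarrow> nat) \<Rightarrow> (real \<Rightarrow> real) \<Rightarrow> bool" where
  "parisian_reflected b \<xi> n u \<longleftrightarrow>
     cadlag u \<and>
     (\<forall>t\<ge>0. u t = \<xi> t +
        (LINT s:{0..t}|interval_measure (\<lambda>s. if s < 0 then 0 else real (n s)).
           max 0 (b - Lim (at_left s) u)))"

section \<open>Laplace exponent\<close>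

definition negative_levy_measure :: "real measure \<Rightarrow> bool" where
  "negative_levy_measure \<nu> \<longleftrightarrow>
     sets \<nu> = sets borel \<and> emeasure \<nu> {0..} = 0 \<and>
     (\<integral>\<^sup>+y. ennreal (min 1 (y\<^sup>2)) \<partial>\<nu>) < \<infinity>"

definition laplace_exponent :: "real \<Rightarrow> real \<Rightarrow> real measure \<Rightarrow> real \<Rightarrow> real" where
  "laplace_exponent \<sigma> \<gamma> \<nu> \<theta> =
     \<sigma>\<^sup>2 / 2 * \<theta>\<^sup>2 + \<gamma> * \<theta> +
     (LINT y:{..<0}|\<nu>. exp (\<theta> * y) - 1 - \<theta> * y * indicator {-1<..} y)"

definition right_inverse :: "(real \<Rightarrow> real) \<Rightarrow> real \<Rightarrow> real" where
  "right_inverse \<kappa> p = Sup {l. 0 \<le> l \<and> \<kappa> l = p}"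

section \<open>Scale functions\<close>

text \<open>In the Laplace transform, the right-hand side is nonzero for \<open>\<theta> > \<Phi>(p)\<close>, so the
  equation includes integrability of the left-hand side.\<close>

definition scale_function :: "(real \<Rightarrow> real) \<Rightarrow> real \<Rightarrow> (real \<Rightarrow> real) \<Rightarrow> bool" where
  "scale_function \<kappa> p w \<longleftrightarrow>
     (\<forall>x. 0 \<le> w x) \<and> (\<forall>x<0. w x = 0) \<and>
     continuous_on {0..} w \<and> strict_mono_on {0..} w \<and>
     (\<forall>\<theta>>right_inverse \<kappa> p.
        (LBINT x=0..\<infinity>. exp (- \<theta> * x) * w x) = 1 / (\<kappa> \<theta> - p))"

text \<open>In the following, \<open>W p\<close> stands for \<open>W\<^sup>(\<^sup>p\<^sup>)\<close>. Integrals from \<open>0\<close> to \<open>x\<close> are oriented.\<close>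

definition scale_Z :: "(real \<Rightarrow> real \<Rightarrow> real) \<Rightarrow> real \<Rightarrow> real \<Rightarrow> real" where
  "scale_Z W p x = 1 + p * (LBINT y=0..ereal x. W p y)"

definition scale_Z_exp ::
  "(real \<Rightarrow> real) \<Rightarrow> (real \<Rightarrow> real \<Rightarrow> real) \<Rightarrow> real \<Rightarrow> real \<Rightarrow> real \<Rightarrow> real" where
  "scale_Z_exp \<kappa> W p x \<theta> =
     exp (\<theta> * x) * (1 + (p - \<kappa> \<theta>) * (LBINT z=0..ereal x. exp (- \<theta> * z) * W p z))"

definition scale_Z_mixed ::
  "(real \<Rightarrow> real) \<Rightarrow> (real \<Rightarrow> real \<Rightarrow> real) \<Rightarrow> real \<Rightarrow> real \<Rightarrow> real \<Rightarrow> real" where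
  "scale_Z_mixed \<kappa> W q r x =
     r / (q + r) * scale_Z W q x +
     q / (q + r) * scale_Z_exp \<kappa> W q x (right_inverse \<kappa> (q + r))"

text \<open>\<open>passage_time f\<close> is the infimum of \<open>{t > 0. f t < 0}\<close>; it is only used when that set
  is nonempty, which is the event that the passage time is finite.\<close>

definition passage_time :: "(real \<Rightarrow> real) \<Rightarrow> real" where
  "passage_time f = Inf {t. 0 < t \<and> f t < 0}"

text \<open>Expectations under the law of the process started at \<open>x\<close> are expectations of
  functionals of \<open>x + X\<close>, where \<open>X\<close> starts at 0.\<close>

definition passage_transform ::
  "'w measure \<Rightarrow> (real \<Rightarrow> 'w \<Rightarrow> real) \<Rightarrow> real \<Rightarrow> real \<Rightarrow> real \<Rightarrow> real" where
  "passage_transform M X p x \<theta> =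
     (LINT \<omega>|M.
        (if \<exists>t>0. x + X t \<omega> < 0
         then (let \<tau> = passage_time (\<lambda>t. x + X t \<omega>)
               in exp (- p * \<tau> + \<theta> * (x + X \<tau> \<omega>)))
         else 0))"

definition Theta ::
  "(real \<Rightarrow> real) \<Rightarrow> (real \<Rightarrow> real \<Rightarrow> real) \<Rightarrow> real \<Rightarrow> real \<Rightarrow> real \<Rightarrow> real" where
  "Theta \<kappa> W p x y = exp (right_inverse \<kappa> p * x) * W p (- y) - W p (x - y)"

definition Upsilon ::
  "(real \<Rightarrow> real) \<Rightarrow> (real \<Rightarrow> real \<Rightarrow> real) \<Rightarrow> real \<Rightarrow> real \<Rightarrow> real \<Rightarrow> real \<Rightarrow> real" where
  "Upsilon \<kappa> W q r x y =
     - Theta \<kappa> W (q + r) x y +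
     r * (LBINT z=0..ereal x. W q (x - z) * Theta \<kappa> W (q + r) z y)"

definition resolvent_density ::
  "'w measure \<Rightarrow> (real \<Rightarrow> 'w \<Rightarrow> real) \<Rightarrow> (real \<Rightarrow> real) \<Rightarrow> (real \<Rightarrow> real \<Rightarrow> real) \<Rightarrow>
   real \<Rightarrow> real \<Rightarrow> real \<Rightarrow> real \<Rightarrow> real \<Rightarrow> real" where
  "resolvent_density M X \<kappa> W q r b x y =
     (let \<Phi> = right_inverse \<kappa> in
      (q + r) / (q * r) * (\<Phi> q * (\<Phi> (q + r) - \<Phi> q) / \<Phi> (q + r)) *
      scale_Z_mixed \<kappa> W q r (x - b) *
      passage_transform M X (q + r) (b - y) (\<Phi> q)
      - Upsilon \<kappa> W q r (x - b) (y - b))"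

end

theory Submission
  imports Defs
begin

text \<open>Let \<open>p = q + r\<close>. Between two arrivals the reflected process moves like \<open>X\<close>, so for Lipschitz \<open>h\<close>
  the discounted occupation functional \<open>\<phi>\<close> of the process reflected at \<open>b\<close> solves
  \<open>\<phi> = G\<^sub>p (h + r \<phi>(max b \<cdot>))\<close>, where \<open>G\<^sub>p\<close> is the \<open>p\<close>-resolvent of \<open>X\<close>. The solution is obtained by monotone
  iteration and identified with the functional by comparing one step of a grid chain with
  the reflected path, to which the chain converges pathwise (a discrete Gronwall estimate).

  The kernel of \<open>G\<^sub>p\<close> has density \<open>c exp (- \<Phi>(p) y) - W\<^sup>(\<^sup>p\<^sup>)(- y)\<close>: skip-freeness gives the exponential on
  the positive half line, and the semigroup equation with uniqueness of Laplace transforms gives the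
  rest. With it the equation becomes a Volterra equation on the half line above \<open>b\<close>, inverted by
  \<open>W\<^sup>(\<^sup>p\<^sup>) = W\<^sup>(\<^sup>q\<^sup>) + r W\<^sup>(\<^sup>q\<^sup>) \<star> W\<^sup>(\<^sup>p\<^sup>)\<close>; this produces \<open>Z\<^sup>(\<^sup>q\<^sup>,\<^sup>r\<^sup>)\<close> and \<open>\<Upsilon>\<close>. The remaining constant
  \<open>\<phi>(b)\<close> is found by taking Laplace transforms at \<open>\<Phi>(q)\<close>, where the unknown function cancels.\<close>

section \<open>Uniqueness of measures from test functions\<close>

text \<open>The reflected process is never treated as a Markov process. Only its grid walk is a
  chain, which takes no more than the simple Markov properties of \<open>X\<close> and
  \<open>N\<close> and their independence; Lipschitz test functions make the one-step error uniform
  in the position. The strong Markov property is used for \<open>X\<close> alone. The constant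
  \<open>c p\<close> of the resolvent density is never evaluated. In the passage transform it
  disappears because \<open>c p * (exp (\<Phi> p * x) - H p x (\<Phi> p))\<close> turns out to be
  \<open>W p x\<close>; in the reflected equation it enters only through \<open>A\<close>, which the
  equation at the level itself expresses by the value there. The choice of \<Phi>(q) in the last
  transform comes from p - \<kappa>(\<Phi>(q)) = p - q = r: the potential divides the transform of
  the source by p - \<kappa>(\<theta>), and the source contains r times the unknown function, which
  therefore has coefficient 1 on both sides. Densities that occur with a minus sign are moved to the
  other side, so that uniqueness is always a statement about nonnegative measures.\<close>

lemma nn_integral_ramp_LIMSEQ:
  fixes d :: "real \<Rightarrow> real"
  assumes M: "sets M = sets borel" and d: "d \<in> borel_measurable borel" "\<And>y. 0 \<le> d y"
  shows "(\<lambda>n. \<integral>\<^sup>+y. ennreal (min 1 (real n * d y)) \<partial>M) \<longlonglongrightarrow> emeasure M {y. 0 < d y}"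
proof -
  have "(\<lambda>n. \<integral>\<^sup>+y. ennreal (min 1 (real n * d y)) \<partial>M) \<longlonglongrightarrow> (\<integral>\<^sup>+y. indicator {y. 0 < d y} y \<partial>M)"
  proof (rule nn_integral_LIMSEQ)
    show "incseq (\<lambda>n y. ennreal (min 1 (real n * d y)))"
      unfolding incseq_def le_fun_def
      by (auto intro!: ennreal_leI min.mono mult_right_mono d(2))
    show "(\<lambda>y. ennreal (min 1 (real n * d y))) \<in> borel_measurable M" for n
      unfolding measurable_cong_sets[OF M refl] using d(1) by measurable
    show "(\<lambda>n. ennreal (min 1 (real n * d y))) \<longlonglongrightarrow> indicator {y. 0 < d y} y" for y
    proof (cases "0 < d y")
      case True
      obtain N where N: "1 / d y < real N" using reals_Archimedean2 by blast
      have "eventually (\<lambda>n. ennreal (min 1 (real n * d y)) = 1) sequentially"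
      proof (rule eventually_sequentiallyI[of N])
        fix n assume "N \<le> n"
        then have "1 / d y \<le> real n" using N by linarith
        then have "1 \<le> real n * d y" using True by (simp add: pos_divide_le_eq)
        then show "ennreal (min 1 (real n * d y)) = 1" by simp
      qed
      then show ?thesis using True by (simp add: tendsto_eventually)
    next
      case False
      then have "d y = 0" using d(2)[of y] by linarith
      then show ?thesis by simp
    qed
  qed
  moreover have "{y. 0 < d y} \<in> sets M"
    unfolding M using d(1) by measurable
  ultimately show ?thesis by simp
qed

text \<open>Ramps increase to the indicators of open half lines, and these determine a finite
  measure. Ramps are bounded and continuous, which is what polynomial approximation can reach
  below.\<close>

lemma measure_eqI_ramp:
  fixes M N :: "real measure"
  assumes sets: "sets M = sets borel" "sets N = sets borel"
  assumes fin: "emeasure M UNIV < \<infinity>"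
  assumes eq: "\<And>a n. (\<integral>\<^sup>+y. ennreal (min 1 (real n * max 0 (y - a))) \<partial>M) =
                     (\<integral>\<^sup>+y. ennreal (min 1 (real n * max 0 (y - a))) \<partial>N)"
  shows "M = N"
proof (rule measure_eqI_lessThan[OF sets])
  fix x :: real
  have "emeasure M {x<..} \<le> emeasure M UNIV" by (intro emeasure_mono) (auto simp: sets)
  with fin show "emeasure M {x<..} < \<infinity>" by (rule le_less_trans[rotated])
  have *: "{y. 0 < max 0 (y - x)} = {x<..}" by auto
  have "(\<lambda>n. \<integral>\<^sup>+y. ennreal (min 1 (real n * max 0 (y - x))) \<partial>M) \<longlonglongrightarrow> emeasure M {x<..}"
    using nn_integral_ramp_LIMSEQ[OF sets(1), of "\<lambda>y. max 0 (y - x)"] by (simp add: *)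
  moreover have "(\<lambda>n. \<integral>\<^sup>+y. ennreal (min 1 (real n * max 0 (y - x))) \<partial>N) \<longlonglongrightarrow> emeasure N {x<..}"
    using nn_integral_ramp_LIMSEQ[OF sets(2), of "\<lambda>y. max 0 (y - x)"] by (simp add: *)
  ultimately show "emeasure M {x<..} = emeasure N {x<..}"
    unfolding eq by (rule LIMSEQ_unique)
qed

text \<open>Moments give the integrals of polynomials; uniform approximation on the common support
  [0,1] extends this to continuous functions, among them the ramps.\<close>

lemma finite_measure_eqI_moments:
  fixes M N :: "real measure"
  assumes sets: "sets M = sets borel" "sets N = sets borel"
  assumes fin: "finite_measure M" "finite_measure N"
  assumes supp: "AE x in M. x \<in> {0..1}" "AE x in N. x \<in> {0..1}"
  assumes mom: "\<And>n. (LINT x|M. x ^ n) = (LINT x|N. x ^ n)"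
  shows "M = N"
proof -
  interpret M: finite_measure M by fact
  interpret N: finite_measure N by fact
  note [measurable_cong] = sets
  have pow: "integrable L (\<lambda>x. x ^ n)" if "finite_measure L" "AE x in L. x \<in> {0..1}" "sets L = sets borel"
    for L :: "real measure" and n
  proof -
    interpret L: finite_measure L by fact
    note [measurable_cong] = that(3)
    show ?thesis
    proof (rule L.integrable_const_bound[where B=1])
      show "AE x in L. norm (x ^ n) \<le> 1"
        using that(2) by eventually_elim (auto simp: power_le_one)
    qed measurable
  qed
  have poly: "(LINT x|M. p x) = (LINT x|N. p x)" "integrable M p" "integrable N p"
    if "real_polynomial_function p" for p
  proof -
    have "\<exists>a n. p = (\<lambda>x. \<Sum>i\<le>n. a i * x ^ i)"
      using that unfolding real_polynomial_function_iff_sum .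
    then obtain a n where p: "p = (\<lambda>x. \<Sum>i\<le>n. a i * x ^ i)" by (elim exE)
    have pM: "integrable M (\<lambda>x. x ^ i)" and pN: "integrable N (\<lambda>x. x ^ i)" for i
      using pow[OF fin(1) supp(1) sets(1)] pow[OF fin(2) supp(2) sets(2)] by auto
    show "integrable M p" "integrable N p" unfolding p using pM pN by auto
    show "(LINT x|M. p x) = (LINT x|N. p x)"
      unfolding p using pM pN by (simp add: mom)
  qed
  have cont: "(LINT x|M. f x) = (LINT x|N. f x)"
    if f: "continuous_on UNIV f" and bdd: "\<And>x. \<bar>f x\<bar> \<le> 1" for f :: "real \<Rightarrow> real"
  proof -
    have [measurable]: "f \<in> borel_measurable borel" using f by (rule borel_measurable_continuous_onI)
    have fi: "integrable M f" "integrable N f"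
      using bdd by (auto intro!: M.integrable_const_bound[where B=1] N.integrable_const_bound[where B=1])
    define C where "C = measure M (space M) + measure N (space N)"
    have C: "0 \<le> C" by (simp add: C_def)
    have "\<bar>(LINT x|M. f x) - (LINT x|N. f x)\<bar> \<le> e * C" if e: "0 < e" for e
    proof -
      obtain g where g: "real_polynomial_function g" "\<And>x. x \<in> {0..1} \<Longrightarrow> \<bar>f x - g x\<bar> < e"
        using Stone_Weierstrass_real_polynomial_function[OF compact_Icc continuous_on_subset[OF f subset_UNIV] e]
        by metis
      have b: "\<bar>(LINT x|L. f x) - (LINT x|L. g x)\<bar> \<le> e * measure L (space L)"
        if "finite_measure L" "AE x in L. x \<in> {0..1}" "integrable L f" "integrable L g" for L
      proof -
        interpret L: finite_measure L by fact
        have "\<bar>(LINT x|L. f x) - (LINT x|L. g x)\<bar> = \<bar>LINT x|L. f x - g x\<bar>"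
          using that by simp
        also have "\<dots> \<le> (LINT x|L. \<bar>f x - g x\<bar>)"
          using integral_norm_bound[of L "\<lambda>x. f x - g x"] by simp
        also have "\<dots> \<le> (LINT x|L. e)"
        proof (rule integral_mono_AE)
          show "AE x in L. \<bar>f x - g x\<bar> \<le> e"
            using that(2) by eventually_elim (auto intro!: less_imp_le g(2))
        qed (use that in auto)
        finally show ?thesis by (simp add: mult.commute)
      qed
      show ?thesis
        using b[OF fin(1) supp(1) fi(1) poly(2)[OF g(1)]] b[OF fin(2) supp(2) fi(2) poly(3)[OF g(1)]] poly(1)[OF g(1)]
        unfolding C_def by (simp add: algebra_simps abs_le_iff)
    qed
    then have "\<bar>(LINT x|M. f x) - (LINT x|N. f x)\<bar> \<le> 0"
    proof -
      assume *: "\<And>e. 0 < e \<Longrightarrow> \<bar>(LINT x|M. f x) - (LINT x|N. f x)\<bar> \<le> e * C"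
      show ?thesis
      proof (rule field_le_epsilon)
        fix e :: real assume "0 < e"
        \<comment> \<open>\<open>C + 1\<close> instead of \<open>C\<close>, since both measures may
          vanish.\<close>
        have "e / (C + 1) * C \<le> e" using C \<open>0 < e\<close> by (simp add: field_simps)
        then show "\<bar>(LINT x|M. f x) - (LINT x|N. f x)\<bar> \<le> 0 + e"
          using *[of "e / (C + 1)"] C \<open>0 < e\<close> by simp
      qed
    qed
    then show ?thesis by simp
  qed
  show ?thesis
  proof (rule measure_eqI_ramp[OF sets])
    show "emeasure M UNIV < \<infinity>"
      using M.emeasure_finite[of UNIV] by (simp add: less_top[symmetric])
    fix a :: real and n :: nat
    let ?f = "\<lambda>y. min 1 (real n * max 0 (y - a))"
    have f: "integrable M ?f" "integrable N ?f"
      by (auto intro!: M.integrable_const_bound[where B=1] N.integrable_const_bound[where B=1])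
    have "(LINT x|M. ?f x) = (LINT x|N. ?f x)"
      by (rule cont) (auto intro!: continuous_intros)
    then show "(\<integral>\<^sup>+y. ennreal (?f y) \<partial>M) = (\<integral>\<^sup>+y. ennreal (?f y) \<partial>N)"
      using f by (simp add: nn_integral_eq_integral)
  qed
qed

lemma density_exp_cancel:
  fixes M :: "real measure"
  assumes M: "sets M = sets borel"
  shows "density (density M (\<lambda>x. ennreal (exp (- c * x)))) (\<lambda>x. ennreal (exp (c * x))) = M"
proof -
  note [measurable_cong] = M
  have "density (density M (\<lambda>x. ennreal (exp (- c * x)))) (\<lambda>x. ennreal (exp (c * x)))
      = density M (\<lambda>x. ennreal (exp (- c * x)) * ennreal (exp (c * x)))"
    by (subst density_density_eq) auto
  also have "\<dots> = density M (\<lambda>x. 1)"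
    by (intro density_cong) (auto simp flip: ennreal_mult exp_add)
  finally show ?thesis by (simp add: density_1)
qed

text \<open>The map x to exp(-x) carries the nonnegative half line into [0,1] and turns transforms
  at \<open>d + n\<close> into moments. Tilting by \<open>exp (- d * x)\<close> makes the measures
  finite, and \<open>d = c + 1\<close> keeps every \<open>d + n\<close> in the range where the
  transforms agree.\<close>

lemma laplace_unique:
  fixes M N :: "real measure" and c :: real
  assumes sets: "sets M = sets borel" "sets N = sets borel"
  assumes supp: "AE x in M. 0 \<le> x" "AE x in N. 0 \<le> x"
  assumes fin: "\<And>\<theta>. c < \<theta> \<Longrightarrow> (\<integral>\<^sup>+x. ennreal (exp (- \<theta> * x)) \<partial>M) < \<infinity>"
  assumes eq: "\<And>\<theta>. c < \<theta> \<Longrightarrow> (\<integral>\<^sup>+x. ennreal (exp (- \<theta> * x)) \<partial>M) = (\<integral>\<^sup>+x. ennreal (exp (- \<theta> * x)) \<partial>N)"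
  shows "M = N"
proof -
  define d where "d = c + 1"
  define T where "T L = density L (\<lambda>x. ennreal (exp (- d * x)))" for L :: "real measure"
  define E where "E L = distr (T L) borel (\<lambda>x. exp (- x))" for L :: "real measure"
  have sT: "sets (T L) = sets L" for L by (simp add: T_def)
  have *: "finite_measure (E L)" "AE x in E L. x \<in> {0..1}"
    "(LINT x|E L. x ^ n) = enn2real (\<integral>\<^sup>+x. ennreal (exp (- (d + real n) * x)) \<partial>L)"
    "T L = distr (E L) borel (\<lambda>x. - ln x)"
    if L: "sets L = sets borel" "AE x in L. 0 \<le> x" "(\<integral>\<^sup>+x. ennreal (exp (- d * x)) \<partial>L) < \<infinity>" for L n
  proof -
    note [measurable_cong] = L(1)
    have [measurable_cong]: "sets (T L) = sets borel" using sT L by simp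
    show "finite_measure (E L)"
    proof (rule finite_measureI)
      have "emeasure (E L) (space (E L)) = emeasure (T L) (space (T L))"
        unfolding E_def by (simp add: emeasure_distr sets_eq_imp_space_eq[OF sT])
      also have "\<dots> = (\<integral>\<^sup>+x. ennreal (exp (- d * x)) \<partial>L)"
        unfolding T_def by (subst emeasure_density) (auto intro!: nn_integral_cong split: split_indicator)
      finally show "emeasure (E L) (space (E L)) \<noteq> \<infinity>" using L(3) by simp
    qed
    show "AE x in E L. x \<in> {0..1}"
    proof -
      have "AE x in T L. 0 \<le> x"
        unfolding T_def using L(2) by (subst AE_density) auto
      then show ?thesis unfolding E_def by (subst AE_distr_iff) auto
    qed
    have "(LINT x|E L. x ^ n) = (LINT x|T L. exp (- x) ^ n)"
      unfolding E_def by (subst integral_distr) auto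
    also have "\<dots> = enn2real (\<integral>\<^sup>+x. ennreal (exp (- x) ^ n) \<partial>T L)"
      by (rule integral_eq_nn_integral) auto
    also have "(\<integral>\<^sup>+x. ennreal (exp (- x) ^ n) \<partial>T L) = (\<integral>\<^sup>+x. ennreal (exp (- (d + real n) * x)) \<partial>L)"
      unfolding T_def by (subst nn_integral_density)
        (auto intro!: nn_integral_cong simp flip: ennreal_mult exp_add exp_of_nat_mult simp: algebra_simps)
    finally show "(LINT x|E L. x ^ n) = enn2real (\<integral>\<^sup>+x. ennreal (exp (- (d + real n) * x)) \<partial>L)" .
    \<comment> \<open>\<open>- ln\<close> undoes the substitution, so the tilted measure is
      recovered from its image on [0,1].\<close>
    have "distr (E L) borel (\<lambda>x. - ln x) = distr (T L) borel (\<lambda>x. x)"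
      unfolding E_def by (subst distr_distr) (auto simp: comp_def)
    also have "\<dots> = T L" by (rule distr_id2) (simp add: sT L)
    finally show "T L = distr (E L) borel (\<lambda>x. - ln x)" ..
  qed
  have fM: "(\<integral>\<^sup>+x. ennreal (exp (- d * x)) \<partial>M) < \<infinity>" and fN: "(\<integral>\<^sup>+x. ennreal (exp (- d * x)) \<partial>N) < \<infinity>"
    using fin[of d] eq[of d] by (auto simp: d_def)
  have "E M = E N"
  proof (rule finite_measure_eqI_moments)
    show "(LINT x|E M. x ^ n) = (LINT x|E N. x ^ n)" for n
      using *(3)[OF sets(1) supp(1) fM] *(3)[OF sets(2) supp(2) fN] eq[of "d + real n"] by (simp add: d_def)
  qed (use *(1,2)[OF sets(1) supp(1) fM] *(1,2)[OF sets(2) supp(2) fN] in \<open>auto simp: E_def\<close>)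
  then have "T M = T N" using *(4)[OF sets(1) supp(1) fM] *(4)[OF sets(2) supp(2) fN] by simp
  then show ?thesis using density_exp_cancel[OF sets(1), of d] density_exp_cancel[OF sets(2), of d]
    by (simp add: T_def)
qed

text \<open>Independence makes the joint law a product. The second variable is integrated over a
  separate outcome \<omega>' of the same space, so an independent copy never requires an enlarged
  probability space.\<close>

lemma (in prob_space) nn_integral_indep_var:
  assumes ind: "indep_var S A T B" and f[measurable]: "(\<lambda>z. f (fst z) (snd z)) \<in> borel_measurable (S \<Otimes>\<^sub>M T)"
  shows "(\<integral>\<^sup>+\<omega>. f (A \<omega>) (B \<omega>) \<partial>M) = (\<integral>\<^sup>+\<omega>. (\<integral>\<^sup>+\<omega>'. f (A \<omega>) (B \<omega>') \<partial>M) \<partial>M)"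
proof -
  have [measurable]: "A \<in> M \<rightarrow>\<^sub>M S" "B \<in> M \<rightarrow>\<^sub>M T"
    using indep_var_rv1[OF ind] indep_var_rv2[OF ind] by auto
  interpret B: prob_space "distr M T B" by (rule prob_space_distr) simp
  have D: "distr M (S \<Otimes>\<^sub>M T) (\<lambda>x. (A x, B x)) = distr M S A \<Otimes>\<^sub>M distr M T B"
    using ind by (simp add: indep_var_distribution_eq)
  have "(\<integral>\<^sup>+\<omega>. f (A \<omega>) (B \<omega>) \<partial>M) = (\<integral>\<^sup>+z. f (fst z) (snd z) \<partial>distr M (S \<Otimes>\<^sub>M T) (\<lambda>x. (A x, B x)))"
    by (subst nn_integral_distr) auto
  also have "\<dots> = (\<integral>\<^sup>+z. f (fst z) (snd z) \<partial>(distr M S A \<Otimes>\<^sub>M distr M T B))" by (simp add: D)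
  also have "\<dots> = (\<integral>\<^sup>+a. (\<integral>\<^sup>+b. f a b \<partial>distr M T B) \<partial>distr M S A)"
    by (subst B.nn_integral_fst[symmetric]) auto
  also have "\<dots> = (\<integral>\<^sup>+\<omega>. (\<integral>\<^sup>+b. f (A \<omega>) b \<partial>distr M T B) \<partial>M)"
    by (subst nn_integral_distr) auto
  also have "\<dots> = (\<integral>\<^sup>+\<omega>. (\<integral>\<^sup>+\<omega>'. f (A \<omega>) (B \<omega>') \<partial>M) \<partial>M)"
  proof (intro nn_integral_cong)
    fix \<omega> assume "\<omega> \<in> space M"
    then have "f (A \<omega>) \<in> borel_measurable T"
      using measurable_compose[OF measurable_Pair1' f, of "A \<omega>"] measurable_space[of A M S] by simp
    then show "(\<integral>\<^sup>+b. f (A \<omega>) b \<partial>distr M T B) = (\<integral>\<^sup>+\<omega>'. f (A \<omega>) (B \<omega>') \<partial>M)"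
      by (subst nn_integral_distr) auto
  qed
  finally show ?thesis .
qed

section \<open>Grid approximation of a Parisian reflected path\<close>

text \<open>One-sided limits bound \<open>f\<close> near every point, and bisection patches the
  local bounds together. The lower end is \<open>max 0 a\<close> because neighbourhoods of 0 reach
  into negative times, where nothing is known of \<open>f\<close>.\<close>

lemma cadlag_bounded:
  assumes f: "cadlag f" and T: "0 \<le> T"
  shows "\<exists>B. \<forall>s. 0 \<le> s \<and> s \<le> T \<longrightarrow> \<bar>f s\<bar> \<le> B"
proof -
  have "\<exists>B. \<forall>s. max 0 0 \<le> s \<and> s \<le> T \<longrightarrow> \<bar>f s\<bar> \<le> B"
    using T
  proof (induction rule: Bolzano[where P="\<lambda>a b. \<exists>B. \<forall>s. max 0 a \<le> s \<and> s \<le> b \<longrightarrow> \<bar>f s\<bar> \<le> B"])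
    case (trans a b c)
    then obtain B B' where "\<forall>s. max 0 a \<le> s \<and> s \<le> b \<longrightarrow> \<bar>f s\<bar> \<le> B" "\<forall>s. max 0 b \<le> s \<and> s \<le> c \<longrightarrow> \<bar>f s\<bar> \<le> B'" by blast
    then have "\<forall>s. max 0 a \<le> s \<and> s \<le> c \<longrightarrow> \<bar>f s\<bar> \<le> max B B'"
      by (metis le_max_iff_disj linear max.bounded_iff)
    then show ?case by blast
  next
    case (local x)
    have "(f \<longlongrightarrow> f x) (at_right x)" using f local by (auto simp: cadlag_def)
    then have "eventually (\<lambda>s. dist (f s) (f x) < 1) (at_right x)" by (rule tendstoD) simp
    then obtain u where u: "x < u" "\<And>s. x < s \<Longrightarrow> s < u \<Longrightarrow> \<bar>f s - f x\<bar> < 1"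
      by (auto simp: eventually_at_right_field dist_real_def)
    obtain l B where l: "l < x" "\<And>s. l < s \<Longrightarrow> s < x \<Longrightarrow> 0 \<le> s \<Longrightarrow> \<bar>f s\<bar> \<le> B"
    proof (cases "x = 0")
      case True
      show ?thesis by (rule that[of "-1" 0]) (use True in auto)
    next
      case False
      then have "0 < x" using local by simp
      then obtain L where "(f \<longlongrightarrow> L) (at_left x)" using f unfolding cadlag_def by blast
      then have "eventually (\<lambda>s. dist (f s) L < 1) (at_left x)" by (rule tendstoD) simp
      then obtain l where l: "l < x" "\<And>s. l < s \<Longrightarrow> s < x \<Longrightarrow> \<bar>f s - L\<bar> < 1"
        by (auto simp: eventually_at_left_field dist_real_def)
      show ?thesis by (rule that[of l "\<bar>L\<bar> + 1"]) (use l in \<open>auto dest!: l(2)\<close>)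
    qed
    define d where "d = min (u - x) (x - l)"
    have "\<forall>a b. a \<le> x \<and> x \<le> b \<and> b - a < d \<longrightarrow> (\<forall>s. max 0 a \<le> s \<and> s \<le> b \<longrightarrow> \<bar>f s\<bar> \<le> max B (\<bar>f x\<bar> + 1))"
    proof (intro allI impI)
      fix a b s assume ab: "a \<le> x \<and> x \<le> b \<and> b - a < d" and s: "max 0 a \<le> s \<and> s \<le> b"
      consider "s < x" | "s = x" | "x < s" by linarith
      then show "\<bar>f s\<bar> \<le> max B (\<bar>f x\<bar> + 1)"
      proof cases
        case 1 then have "\<bar>f s\<bar> \<le> B" using ab s by (intro l(2)) (auto simp: d_def)
        then show ?thesis by simp
      next
        case 3 then have "\<bar>f s - f x\<bar> < 1" using ab s by (intro u(2)) (auto simp: d_def)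
        then show ?thesis by linarith
      qed auto
    qed
    moreover have "0 < d" using l u by (simp add: d_def)
    ultimately have "\<exists>d>0. \<forall>a b. a \<le> x \<and> x \<le> b \<and> b - a < d \<longrightarrow> (\<exists>B. \<forall>s. max 0 a \<le> s \<and> s \<le> b \<longrightarrow> \<bar>f s\<bar> \<le> B)"
      by blast
    then show ?case .
  qed
  then show ?thesis by simp
qed

text \<open>The sequence may meet its limit, hence the passage from \<open>at_right\<close> to the
  closed half line. This suits grid times that approach from above.\<close>

lemma cadlag_tendsto_right:
  assumes f: "cadlag f" and t: "0 \<le> t" and s: "s \<longlonglongrightarrow> t" "\<And>n. t \<le> s n"
  shows "(\<lambda>n. f (s n)) \<longlonglongrightarrow> f t"
proof -
  have "(f \<longlongrightarrow> f t) (at_right t)" using f t by (auto simp: cadlag_def)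
  moreover have "at t within {t..} = at_right t"
    unfolding at_within_def by (rule arg_cong[where f="\<lambda>S. inf (nhds t) (principal S)"]) auto
  ultimately have "continuous (at t within {t..}) f"
    by (simp add: continuous_within)
  then show ?thesis
    using s by (auto simp: continuous_within_sequentially comp_def)
qed

lemma cadlag_tendsto_left:
  assumes f: "cadlag f" and t: "0 < t" and s: "s \<longlonglongrightarrow> t" "\<And>n. s n < t"
  shows "(\<lambda>n. f (s n)) \<longlonglongrightarrow> Lim (at_left t) f"
proof -
  obtain L where L: "(f \<longlongrightarrow> L) (at_left t)" using f t by (auto simp: cadlag_def)
  then have "Lim (at_left t) f = L" by (intro tendsto_Lim) auto
  moreover have "filterlim s (at_left t) sequentially"
    using s by (auto simp: filterlim_at intro!: always_eventually)
  ultimately show ?thesis using filterlim_compose[OF L] by simp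
qed

text \<open>The left end of the cell \<open>(\<delta> k, \<delta> (k + 1)]\<close> that contains
  \<open>s\<close>. Cells are open on the left like the intervals of an interval measure, so the
  value lies strictly below \<open>s\<close> even at grid points; hence the ceiling minus one and
  not the floor.\<close>

definition grid_left :: "real \<Rightarrow> real \<Rightarrow> real" where
  "grid_left \<delta> s = \<delta> * (real_of_int \<lceil>s / \<delta>\<rceil> - 1)"

lemma grid_left_bounds:
  assumes "0 < \<delta>" shows "grid_left \<delta> s < s" "s - \<delta> \<le> grid_left \<delta> s" "0 < s \<Longrightarrow> 0 \<le> grid_left \<delta> s"
proof -
  have *: "real_of_int \<lceil>s / \<delta>\<rceil> - 1 < s / \<delta>" "s / \<delta> \<le> real_of_int \<lceil>s / \<delta>\<rceil>" by linarith+
  have "\<delta> * (real_of_int \<lceil>s / \<delta>\<rceil> - 1) < \<delta> * (s / \<delta>)" "\<delta> * (s / \<delta>) \<le> \<delta> * real_of_int \<lceil>s / \<delta>\<rceil>"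
    by (rule mult_strict_left_mono[OF *(1) assms], rule mult_left_mono[OF *(2) less_imp_le[OF assms]])
  then show "grid_left \<delta> s < s" "s - \<delta> \<le> grid_left \<delta> s"
    using assms by (auto simp: grid_left_def right_diff_distrib)
  assume "0 < s"
  then have "1 \<le> \<lceil>s / \<delta>\<rceil>" using assms by simp
  then show "0 \<le> grid_left \<delta> s" using assms unfolding grid_left_def
    by (intro mult_nonneg_nonneg) auto
qed

lemma grid_left_eq:
  assumes "0 < \<delta>" "s \<in> {\<delta> * real k<..\<delta> * real (Suc k)}" shows "grid_left \<delta> s = \<delta> * real k"
proof -
  have "\<lceil>s / \<delta>\<rceil> = int k + 1"
    using assms by (intro ceiling_unique) (auto simp: field_simps)
  then show ?thesis by (simp add: grid_left_def)
qed

text \<open>\<open>f\<close> is arbitrary, since the composition factors through the integers with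
  all their subsets.\<close>

lemma grid_left_measurable [measurable]: "(\<lambda>s. f (grid_left \<delta> s)) \<in> borel_measurable borel"
  unfolding grid_left_def
  by (rule measurable_compose[where f="\<lambda>s. \<lceil>s / \<delta>\<rceil>" and N="count_space UNIV" and g="\<lambda>i. f (\<delta> * (real_of_int i - 1))"]) auto

text \<open>Discretisation of the Parisian reflected path: \<open>a\<close> and \<open>n\<close> are the increments of the
  driving path and of the counting path over the cells of a grid. Reflection acts on the value
  at the beginning of the cell, before the increment of the driving path.\<close>

primrec reflected_walk :: "real \<Rightarrow> real \<Rightarrow> (nat \<Rightarrow> real) \<Rightarrow> (nat \<Rightarrow> real) \<Rightarrow> nat \<Rightarrow> real" where
  "reflected_walk b y a n 0 = y"
| "reflected_walk b y a n (Suc k) =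
     reflected_walk b y a n k + a k + n k * max 0 (b - reflected_walk b y a n k)"

lemma reflected_walk_cong:
  assumes "\<And>i. i < k \<Longrightarrow> a i = a' i" "\<And>i. i < k \<Longrightarrow> n i = n' i"
  shows "reflected_walk b y a n k = reflected_walk b y a' n' k"
  using assms by (induction k) auto

section \<open>A single reflected path compared with its grid walk\<close>

locale parisian_path =
  fixes b :: real and \<xi> u :: "real \<Rightarrow> real" and n :: "real \<Rightarrow> nat"
  assumes par: "parisian_reflected b \<xi> n u"
    and \<xi>: "cadlag \<xi>" and n: "cadlag (\<lambda>t. real (n t))" "n 0 = 0" "mono_on {0..} n"
begin

definition F :: "real \<Rightarrow> real" where "F s = (if s < 0 then 0 else real (n s))"
definition dn :: "real measure" where "dn = interval_measure F"
definition u_left :: "real \<Rightarrow> real" where "u_left s = Lim (at_left s) u"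
text \<open>Reflection acts on the left limit of the path, the walk on the value at the beginning of
  the cell; this is the discrepancy caused by that replacement.\<close>

definition err :: "real \<Rightarrow> real \<Rightarrow> real" where "err \<delta> s = \<bar>u_left s - u (grid_left \<delta> s)\<bar>"

lemma u_cadlag: "cadlag u" using par by (simp add: parisian_reflected_def)

lemma F_mono: "s \<le> t \<Longrightarrow> F s \<le> F t"
  using n(3) by (auto simp: F_def mono_on_def)

lemma F_right: "continuous (at_right a) F"
proof (cases "a < 0")
  case True
  then have "eventually (\<lambda>s. F s = F a) (at_right a)"
    unfolding eventually_at_right_field by (intro exI[of _ 0]) (auto simp: F_def)
  then show ?thesis unfolding continuous_within by (rule tendsto_eventually)
next
  case False
  then have "((\<lambda>t. real (n t)) \<longlongrightarrow> real (n a)) (at_right a)" using n(1) by (auto simp: cadlag_def)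
  moreover have "eventually (\<lambda>s. real (n s) = F s) (at_right a)"
    unfolding eventually_at_right_field using False by (intro exI[of _ "a + 1"]) (auto simp: F_def)
  ultimately show ?thesis unfolding continuous_within using False
    by (auto simp: F_def elim!: Lim_transform_eventually)
qed

lemma sets_dn [simp, measurable_cong]: "sets dn = sets borel" by (simp add: dn_def)
lemma space_dn [simp]: "space dn = UNIV" by (simp add: dn_def)

lemma emeasure_dn: "s \<le> t \<Longrightarrow> emeasure dn {s<..t} = ennreal (F t - F s)"
  unfolding dn_def using F_mono F_right by (intro emeasure_interval_measure_Ioc) auto

lemma measure_dn: "s \<le> t \<Longrightarrow> measure dn {s<..t} = F t - F s"
  using F_mono by (simp add: measure_def emeasure_dn)

lemma dn_0: "emeasure dn {0} = 0"
proof -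
  have "emeasure dn {0} \<le> emeasure dn {-1<..0}" by (intro emeasure_mono) auto
  then show ?thesis by (simp add: emeasure_dn F_def n(2))
qed

lemma u_left_lim:
  assumes "0 < s" "\<And>j. 0 < \<delta> j" "\<delta> \<longlonglongrightarrow> 0"
  shows "(\<lambda>j. u (grid_left (\<delta> j) s)) \<longlonglongrightarrow> u_left s"
  unfolding u_left_def
proof (rule cadlag_tendsto_left[OF u_cadlag assms(1)])
  show "(\<lambda>j. grid_left (\<delta> j) s) \<longlonglongrightarrow> s"
  proof (rule real_tendsto_sandwich)
    show "eventually (\<lambda>j. s - \<delta> j \<le> grid_left (\<delta> j) s) sequentially"
      using grid_left_bounds(2)[OF assms(2)] by (intro always_eventually) auto
    show "eventually (\<lambda>j. grid_left (\<delta> j) s \<le> s) sequentially"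
      using grid_left_bounds(1)[OF assms(2)] by (intro always_eventually) (auto simp: less_imp_le)
    show "(\<lambda>j. s - \<delta> j) \<longlonglongrightarrow> s" using tendsto_diff[OF tendsto_const assms(3), of s] by simp
  qed auto
  show "grid_left (\<delta> j) s < s" for j using grid_left_bounds(1)[OF assms(2)] .
qed

text \<open>The left limit is a pointwise limit of step functions of \<open>u\<close> along finer
  grids. The indicator restricts to positive times, the only ones at which a left limit is known to
  exist.\<close>

lemma u_left_measurable: "(\<lambda>s. indicator {0<..} s * u_left s) \<in> borel_measurable borel"
proof (rule borel_measurable_LIMSEQ_real)
  show "(\<lambda>s. indicator {0<..} s * u (grid_left (1 / real (Suc j)) s)) \<in> borel_measurable borel" for j
    by measurable
  show "(\<lambda>j. indicator {0<..} s * u (grid_left (1 / real (Suc j)) s)) \<longlonglongrightarrow> indicator {0<..} s * u_left s" for s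
    using u_left_lim[of s "\<lambda>j. 1 / real (Suc j)"] LIMSEQ_inverse_real_of_nat
    by (cases "0 < s") (auto simp: inverse_eq_divide)
qed

lemma u_left_bdd: "\<exists>B. \<forall>s. 0 < s \<and> s \<le> T \<longrightarrow> \<bar>u_left s\<bar> \<le> B \<and> (\<forall>\<delta>>0. \<bar>u (grid_left \<delta> s)\<bar> \<le> B)"
proof (cases "0 \<le> T")
  case True
  obtain B where B: "\<And>s. 0 \<le> s \<Longrightarrow> s \<le> T \<Longrightarrow> \<bar>u s\<bar> \<le> B"
    using cadlag_bounded[OF u_cadlag True] by blast
  have *: "\<bar>u (grid_left \<delta> s)\<bar> \<le> B" if "0 < s" "s \<le> T" "0 < \<delta>" for s \<delta>
    using grid_left_bounds[OF that(3), of s] that by (intro B) auto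
  have "\<bar>u_left s\<bar> \<le> B" if "0 < s" "s \<le> T" for s
  proof (rule LIMSEQ_le_const2)
    show "(\<lambda>j. \<bar>u (grid_left (1 / real (Suc j)) s)\<bar>) \<longlonglongrightarrow> \<bar>u_left s\<bar>"
      using u_left_lim[of s "\<lambda>j. 1 / real (Suc j)"] LIMSEQ_inverse_real_of_nat that
      by (intro tendsto_rabs) (auto simp: inverse_eq_divide)
    show "\<exists>N. \<forall>n\<ge>N. \<bar>u (grid_left (1 / real (Suc n)) s)\<bar> \<le> B" using * that by auto
  qed
  with * show ?thesis by blast
qed auto

lemma integrable_dn:
  fixes f :: "real \<Rightarrow> real"
  assumes f: "(\<lambda>s. indicator {0<..} s * f s) \<in> borel_measurable borel"
    and bdd: "\<And>s. 0 < s \<Longrightarrow> s \<le> T \<Longrightarrow> \<bar>f s\<bar> \<le> B" and st: "0 \<le> s" "s \<le> t" "t \<le> T"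
  shows "integrable dn (\<lambda>x. indicator {s<..t} x * f x)"
proof (rule Bochner_Integration.integrable_bound[where f="\<lambda>x. B * indicator {s<..t} x"])
  show "integrable dn (\<lambda>x. B * indicator {s<..t} x)"
    using st emeasure_dn[of s t] by (intro integrable_mult_right) auto
  have "(\<lambda>x. indicator {s<..t} x * f x) = (\<lambda>x. indicator {s<..t} x * (indicator {0<..} x * f x))"
    using st by (auto simp: fun_eq_iff split: split_indicator)
  also have "\<dots> \<in> borel_measurable dn" using f by measurable
  finally show "(\<lambda>x. indicator {s<..t} x * f x) \<in> borel_measurable dn" .
  show "AE x in dn. norm (indicator {s<..t} x * f x) \<le> norm (B * indicator {s<..t} x)"
    using st by (intro AE_I2) (auto split: split_indicator intro!: order_trans[OF bdd])
qed

lemma pull_measurable: "(\<lambda>s. indicator {0<..} s * max 0 (b - u_left s)) \<in> borel_measurable borel"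
proof -
  have "(\<lambda>s. indicator {0<..} s * max 0 (b - u_left s))
      = (\<lambda>s. indicator {0<..} s * max 0 (b - indicator {0<..} s * u_left s))"
    by (auto simp: fun_eq_iff split: split_indicator)
  also have "\<dots> \<in> borel_measurable borel" using u_left_measurable by measurable
  finally show ?thesis .
qed

lemma err_measurable: "(\<lambda>s. indicator {0<..} s * err \<delta> s) \<in> borel_measurable borel"
proof -
  have "(\<lambda>s. indicator {0<..} s * err \<delta> s) = (\<lambda>s. indicator {0<..} s * \<bar>indicator {0<..} s * u_left s - u (grid_left \<delta> s)\<bar>)"
    by (auto simp: fun_eq_iff err_def split: split_indicator)
  also have "\<dots> \<in> borel_measurable borel" using u_left_measurable by measurable
  finally show ?thesis .
qed

lemma pull_integrable:
  assumes "0 \<le> s" "s \<le> t" shows "integrable dn (\<lambda>x. indicator {s<..t} x * max 0 (b - u_left x))"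
proof -
  obtain B where "\<forall>s. 0 < s \<and> s \<le> t \<longrightarrow> \<bar>u_left s\<bar> \<le> B" using u_left_bdd by meson
  then show ?thesis using assms
    by (intro integrable_dn[OF pull_measurable, where T=t and B="\<bar>b\<bar> + B"]) force+
qed

lemma err_integrable:
  assumes "0 \<le> s" "s \<le> t" "0 < \<delta>" shows "integrable dn (\<lambda>x. indicator {s<..t} x * err \<delta> x)"
proof -
  obtain B where "\<forall>s. 0 < s \<and> s \<le> t \<longrightarrow> \<bar>u_left s\<bar> \<le> B \<and> (\<forall>\<delta>>0. \<bar>u (grid_left \<delta> s)\<bar> \<le> B)"
    using u_left_bdd by meson
  then have "\<bar>err \<delta> x\<bar> \<le> B + B" if "0 < x" "x \<le> t" for x
    using that assms(3) unfolding err_def by (smt (verit, best))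
  then show ?thesis using assms
    by (intro integrable_dn[OF err_measurable, where T=t and B="B + B"]) auto
qed

text \<open>The integrator has no atom at 0 because \<open>n\<close> starts at 0. Without the point
  0 the integrals run over half-open intervals and add up over the cells.\<close>

lemma u_eq: "0 \<le> t \<Longrightarrow> u t = \<xi> t + (LINT x|dn. indicator {0<..t} x * max 0 (b - u_left x))"
proof -
  assume t: "0 \<le> t"
  have "u t = \<xi> t + (LINT s:{0..t}|dn. max 0 (b - u_left s))"
    using par t unfolding parisian_reflected_def dn_def F_def[abs_def] u_left_def by auto
  also have "(LINT s:{0..t}|dn. max 0 (b - u_left s)) = (LINT x|dn. indicator {0<..t} x * max 0 (b - u_left x))"
    unfolding set_lebesgue_integral_def
  proof (rule integral_cong_AE)
    show 2: "(\<lambda>x. indicator {0<..t} x * max 0 (b - u_left x)) \<in> borel_measurable dn"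
      using pull_integrable[OF order_refl t] by auto
    have "(\<lambda>x. indicat_real {0..t} x *\<^sub>R max 0 (b - u_left x))
      = (\<lambda>x. indicator {0<..t} x * max 0 (b - u_left x) + indicator {0} x * max 0 (b - u_left 0))"
      using t by (auto simp: fun_eq_iff split: split_indicator)
    also have "\<dots> \<in> borel_measurable dn" using 2 by measurable
    finally show "(\<lambda>x. indicat_real {0..t} x *\<^sub>R max 0 (b - u_left x)) \<in> borel_measurable dn" .
    have "AE x in dn. x \<noteq> 0" using dn_0 by (intro AE_I[where N="{0}"]) auto
    then show "AE x in dn. indicat_real {0..t} x *\<^sub>R max 0 (b - u_left x) = indicator {0<..t} x * max 0 (b - u_left x)"
      by eventually_elim (auto split: split_indicator)
  qed
  finally show ?thesis .
qed

lemma u_diff: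
  assumes "0 \<le> s" "s \<le> t"
  shows "u t - u s = \<xi> t - \<xi> s + (LINT x|dn. indicator {s<..t} x * max 0 (b - u_left x))"
proof -
  have "(LINT x|dn. indicator {0<..t} x * max 0 (b - u_left x)) = (LINT x|dn. indicator {0<..s} x * max 0 (b - u_left x)
       + indicator {s<..t} x * max 0 (b - u_left x))"
    using assms by (intro Bochner_Integration.integral_cong) (auto split: split_indicator)
  also have "\<dots> = (LINT x|dn. indicator {0<..s} x * max 0 (b - u_left x)) + (LINT x|dn. indicator {s<..t} x * max 0 (b - u_left x))"
    using assms by (intro Bochner_Integration.integral_add pull_integrable) auto
  finally show ?thesis using u_eq[of s] u_eq[of t] assms by simp
qed

abbreviation Y :: "real \<Rightarrow> nat \<Rightarrow> real" where
  "Y \<delta> \<equiv> reflected_walk b (\<xi> 0) (\<lambda>k. \<xi> (\<delta> * real (Suc k)) - \<xi> (\<delta> * real k))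
     (\<lambda>k. real (n (\<delta> * real (Suc k))) - real (n (\<delta> * real k)))"

text \<open>A discrete Gronwall estimate. In a cell with \<open>D\<close> arrivals the path and the
  walk receive the same increment of \<xi>. Their pulls differ by the integrated \<open>err\<close>,
  and, since the pull is 1-Lipschitz in the position, by at most \<open>D\<close> times the previous
  distance. The factors \<open>1 + D\<close> multiply up to at most the exponential of the number of
  arrivals.\<close>

lemma walk_error:
  assumes \<delta>: "0 < \<delta>"
  shows "\<bar>Y \<delta> k - u (\<delta> * real k)\<bar> \<le> exp (F (\<delta> * real k)) * (LINT x|dn. indicator {0<..\<delta> * real k} x * err \<delta> x)"
proof (induction k)
  case 0
  have "u 0 = \<xi> 0" using u_eq[of 0] by simp
  then show ?case by simp
next
  case (Suc k)
  let ?s = "\<delta> * real k" and ?t = "\<delta> * real (Suc k)"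
  define y where "y = Y \<delta> k"
  define D where "D = F ?t - F ?s"
  define I where "I s t = (LINT x|dn. indicator {s<..t} x * err \<delta> x)" for s t
  have st: "0 \<le> ?s" "?s \<le> ?t" using \<delta> by auto
  have D: "0 \<le> D" using F_mono[OF st(2)] by (simp add: D_def)
  have D': "real (n ?t) - real (n ?s) = D" using st \<delta> by (simp add: D_def F_def mult_less_0_iff)
  have I_nonneg: "0 \<le> I s t" for s t
    unfolding I_def by (intro integral_nonneg_AE AE_I2) (auto simp: err_def)
  have const: "integrable dn (\<lambda>x. indicator {?s<..?t} x * max 0 (b - u ?s))"
    using emeasure_dn[OF st(2)] by (intro integrable_mult_left) auto
  have "u ?t - u ?s = \<xi> ?t - \<xi> ?s + (LINT x|dn. indicator {?s<..?t} x * max 0 (b - u_left x))"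
    by (rule u_diff[OF st])
  moreover have "\<bar>(LINT x|dn. indicator {?s<..?t} x * max 0 (b - u_left x)) - D * max 0 (b - u ?s)\<bar> \<le> I ?s ?t"
  proof -
    have "D * max 0 (b - u ?s) = (LINT x|dn. indicator {?s<..?t} x * max 0 (b - u ?s))"
      using measure_dn[OF st(2)] by (simp add: D_def)
    then have "(LINT x|dn. indicator {?s<..?t} x * max 0 (b - u_left x)) - D * max 0 (b - u ?s)
       = (LINT x|dn. indicator {?s<..?t} x * max 0 (b - u_left x) - indicator {?s<..?t} x * max 0 (b - u ?s))"
      using pull_integrable[OF st] const by simp
    then have "\<bar>(LINT x|dn. indicator {?s<..?t} x * max 0 (b - u_left x)) - D * max 0 (b - u ?s)\<bar>
       \<le> (LINT x|dn. \<bar>indicator {?s<..?t} x * max 0 (b - u_left x) - indicator {?s<..?t} x * max 0 (b - u ?s)\<bar>)"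
      by (simp only: integral_abs_bound)
    also have "\<dots> \<le> (LINT x|dn. indicator {?s<..?t} x * err \<delta> x)"
      using integrable_abs[OF Bochner_Integration.integrable_diff[OF pull_integrable[OF st] const]]
        err_integrable[OF st \<delta>]
    proof (rule integral_mono)
      fix x
      show "\<bar>indicator {?s<..?t} x * max 0 (b - u_left x) - indicator {?s<..?t} x * max 0 (b - u ?s)\<bar> \<le> indicator {?s<..?t} x * err \<delta> x"
      proof (cases "x \<in> {?s<..?t}")
        case True
        then have "grid_left \<delta> x = ?s" by (rule grid_left_eq[OF \<delta>])
        then show ?thesis using True by (simp add: err_def del: of_nat_Suc)
      qed simp
    qed
    also have "\<dots> = I ?s ?t" by (simp only: I_def)
    finally show ?thesis .
  qed
  moreover have "\<bar>D * max 0 (b - y) - D * max 0 (b - u ?s)\<bar> \<le> D * \<bar>y - u ?s\<bar>"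
  proof -
    have "\<bar>D * max 0 (b - y) - D * max 0 (b - u ?s)\<bar> = D * \<bar>max 0 (b - y) - max 0 (b - u ?s)\<bar>"
      using D by (simp add: abs_mult flip: right_diff_distrib)
    also have "\<dots> \<le> D * \<bar>y - u ?s\<bar>" using D by (intro mult_left_mono) auto
    finally show ?thesis .
  qed
  moreover have "Y \<delta> (Suc k) = y + (\<xi> ?t - \<xi> ?s) + D * max 0 (b - y)"
    by (simp only: reflected_walk.simps y_def D')
  \<comment> \<open>Stated for plain reals, so that the combination of the four facts above is a
    matter of linear arithmetic, free of integrals.\<close>
  moreover have "\<bar>y' - u'\<bar> \<le> \<bar>y - u ?s\<bar> + e + i"
    if "u' - u ?s = x + j" "\<bar>j - p\<bar> \<le> i" "\<bar>q - p\<bar> \<le> e" "y' = y + x + q" for y' u' x j p q i e :: real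
    using that by linarith
  ultimately have "\<bar>Y \<delta> (Suc k) - u ?t\<bar> \<le> \<bar>y - u ?s\<bar> + D * \<bar>y - u ?s\<bar> + I ?s ?t"
    by blast
  also have "\<dots> = (1 + D) * \<bar>y - u ?s\<bar> + I ?s ?t" by (simp add: distrib_right)
  \<comment> \<open>The new error is enlarged by \<open>exp (F ?t)\<close>, which is at least 1;
    since \<open>D = F ?t - F ?s\<close>, both terms then carry the same factor and the two
    integrals join.\<close>
  also have "\<dots> \<le> exp D * (exp (F ?s) * I 0 ?s) + exp (F ?t) * I ?s ?t"
  proof (intro add_mono mult_mono)
    show "\<bar>y - u ?s\<bar> \<le> exp (F ?s) * I 0 ?s" using Suc.IH by (simp add: y_def I_def)
    show "I ?s ?t \<le> exp (F ?t) * I ?s ?t"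
      using I_nonneg[of ?s ?t] F_mono[of 0 ?t] st by (simp add: F_def mult_le_cancel_right1 n(2) del: of_nat_Suc)
  qed (use D exp_ge_add_one_self[of D] in auto)
  also have "\<dots> = exp (F ?t) * (I 0 ?s + I ?s ?t)"
    by (simp add: D_def distrib_left flip: exp_add mult.assoc del: of_nat_Suc)
  also have "I 0 ?s + I ?s ?t = I 0 ?t"
  proof -
    have "I 0 ?t = (LINT x|dn. indicator {0<..?s} x * err \<delta> x + indicator {?s<..?t} x * err \<delta> x)"
      unfolding I_def using st by (intro Bochner_Integration.integral_cong) (auto split: split_indicator)
    then show ?thesis unfolding I_def
      using err_integrable[OF order_refl st(1) \<delta>] err_integrable[OF st \<delta>] by simp
  qed
  finally show ?case by (simp add: I_def)
qed

text \<open>The index \<open>Suc (nat \<lfloor>t / \<delta>\<rfloor>)\<close> is the first grid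
  point to the right of \<open>t\<close>, where right continuity of \<open>u\<close> applies. The
  error integral vanishes by dominated convergence, because grid values from the left converge to
  left limits. A mesh of at most 1 confines everything to the fixed interval up to
  \<open>t + 1\<close>.\<close>

lemma walk_tendsto:
  assumes t: "0 \<le> t" and \<delta>: "\<And>j. 0 < \<delta> j" "\<And>j. \<delta> j \<le> 1" "\<delta> \<longlonglongrightarrow> 0"
  shows "(\<lambda>j. Y (\<delta> j) (Suc (nat \<lfloor>t / \<delta> j\<rfloor>))) \<longlonglongrightarrow> u t"
proof -
  define K where "K j = Suc (nat \<lfloor>t / \<delta> j\<rfloor>)" for j
  have K: "t \<le> \<delta> j * real (K j)" "\<delta> j * real (K j) \<le> t + \<delta> j" for j
  proof -
    have "real (K j) = real_of_int \<lfloor>t / \<delta> j\<rfloor> + 1" using t \<delta>(1)[of j] by (simp add: K_def)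
    then have *: "t / \<delta> j \<le> real (K j)" "real (K j) \<le> t / \<delta> j + 1" by linarith+
    have "\<delta> j * (t / \<delta> j) \<le> \<delta> j * real (K j)" "\<delta> j * real (K j) \<le> \<delta> j * (t / \<delta> j + 1)"
      by (rule mult_left_mono[OF *(1) less_imp_le[OF \<delta>(1)]], rule mult_left_mono[OF *(2) less_imp_le[OF \<delta>(1)]])
    then show "t \<le> \<delta> j * real (K j)" "\<delta> j * real (K j) \<le> t + \<delta> j"
      using \<delta>(1)[of j] by (auto simp: distrib_left)
  qed
  have K1: "\<delta> j * real (K j) \<le> t + 1" for j using K(2)[of j] \<delta>(2)[of j] by linarith
  let ?I = "\<lambda>j. (LINT x|dn. indicator {0<..t + 1} x * err (\<delta> j) x)"
  obtain B where B: "\<forall>s. 0 < s \<and> s \<le> t + 1 \<longrightarrow> \<bar>u_left s\<bar> \<le> B \<and> (\<forall>\<delta>>0. \<bar>u (grid_left \<delta> s)\<bar> \<le> B)"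
    using u_left_bdd by meson
  have "?I \<longlonglongrightarrow> (LINT x|dn. 0)"
  proof (rule integral_dominated_convergence[where w="\<lambda>x. (B + B) * indicator {0<..t + 1} x"])
    show "integrable dn (\<lambda>x. (B + B) * indicator {0<..t + 1} x)"
      using t emeasure_dn[of 0 "t + 1"] by (intro integrable_mult_right) auto
    show "(\<lambda>x. indicator {0<..t + 1} x * err (\<delta> j) x) \<in> borel_measurable dn" for j
      using err_integrable[of 0 "t + 1" "\<delta> j"] t \<delta>(1) by auto
    show "AE x in dn. (\<lambda>j. indicator {0<..t + 1} x * err (\<delta> j) x) \<longlonglongrightarrow> 0"
    proof (rule AE_I2)
      fix x
      show "(\<lambda>j. indicator {0<..t + 1} x * err (\<delta> j) x) \<longlonglongrightarrow> 0"
      proof (cases "x \<in> {0<..t + 1}")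
        case True
        then have "(\<lambda>j. \<bar>u_left x - u (grid_left (\<delta> j) x)\<bar>) \<longlonglongrightarrow> \<bar>u_left x - u_left x\<bar>"
          using \<delta> by (intro tendsto_intros u_left_lim) auto
        then show ?thesis using True by (simp add: err_def)
      qed simp
    qed
    show "AE x in dn. norm (indicator {0<..t + 1} x * err (\<delta> j) x) \<le> (B + B) * indicator {0<..t + 1} x" for j
    proof -
      have "\<bar>err (\<delta> j) x\<bar> \<le> B + B" if "0 < x" "x \<le> t + 1" for x
        using B that \<delta>(1)[of j] unfolding err_def by (smt (verit, best))
      then show ?thesis by (intro AE_I2) (auto split: split_indicator)
    qed
  qed simp
  then have I0: "(\<lambda>j. exp (F (t + 1)) * ?I j) \<longlonglongrightarrow> 0"
    by (auto intro!: tendsto_mult_right_zero)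
  have I1: "\<bar>Y (\<delta> j) (K j) - u (\<delta> j * real (K j))\<bar> \<le> exp (F (t + 1)) * ?I j" for j
  proof -
    have "(LINT x|dn. indicator {0<..\<delta> j * real (K j)} x * err (\<delta> j) x) \<le> ?I j"
    proof (rule integral_mono)
      show "integrable dn (\<lambda>x. indicator {0<..\<delta> j * real (K j)} x * err (\<delta> j) x)"
        using \<delta>(1)[of j] by (intro err_integrable) auto
      show "integrable dn (\<lambda>x. indicator {0<..t + 1} x * err (\<delta> j) x)"
        using \<delta>(1)[of j] t by (intro err_integrable) auto
      show "indicator {0<..\<delta> j * real (K j)} x * err (\<delta> j) x \<le> indicator {0<..t + 1} x * err (\<delta> j) x" for x
        using K1[of j] by (auto simp: err_def split: split_indicator)
    qed
    moreover have "F (\<delta> j * real (K j)) \<le> F (t + 1)" using K1 by (rule F_mono)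
    moreover have "0 \<le> (LINT x|dn. indicator {0<..\<delta> j * real (K j)} x * err (\<delta> j) x)"
      by (intro integral_nonneg_AE AE_I2) (auto simp: err_def)
    ultimately show ?thesis
      by (intro order_trans[OF walk_error[OF \<delta>(1)]] mult_mono) auto
  qed
  have "(\<lambda>j. Y (\<delta> j) (K j) - u (\<delta> j * real (K j))) \<longlonglongrightarrow> 0"
  proof (rule Lim_null_comparison[OF always_eventually I0], rule allI)
    show "norm (Y (\<delta> j) (K j) - u (\<delta> j * real (K j))) \<le> exp (F (t + 1)) * ?I j" for j
      using I1 by (simp only: real_norm_def)
  qed
  moreover have "(\<lambda>j. u (\<delta> j * real (K j))) \<longlonglongrightarrow> u t"
  proof (rule cadlag_tendsto_right[OF u_cadlag t])
    show "(\<lambda>j. \<delta> j * real (K j)) \<longlonglongrightarrow> t"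
      by (rule real_tendsto_sandwich[where f="\<lambda>_. t" and h="\<lambda>j. t + \<delta> j"])
         (use K tendsto_add[OF tendsto_const \<delta>(3), of t] in auto)
  qed (use K in auto)
  ultimately have "(\<lambda>j. Y (\<delta> j) (K j) - u (\<delta> j * real (K j)) + u (\<delta> j * real (K j))) \<longlonglongrightarrow> 0 + u t"
    by (rule tendsto_add)
  then show ?thesis by (simp add: K_def)
qed

end

section \<open>Levy processes and their resolvents\<close>

text \<open>Right continuity makes the process a limit of its values at grid times just above the
  current time. Each approximation takes countably many times and is therefore jointly
  measurable.\<close>

lemma cadlag_joint_measurable:
  fixes X :: "real \<Rightarrow> 'w \<Rightarrow> real"
  assumes X: "\<And>t. 0 \<le> t \<Longrightarrow> X t \<in> borel_measurable M"
    and c: "\<And>\<omega>. \<omega> \<in> space M \<Longrightarrow> cadlag (\<lambda>t. X t \<omega>)"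
  shows "(\<lambda>z. X (max 0 (fst z)) (snd z)) \<in> borel_measurable (borel \<Otimes>\<^sub>M M)"
proof (rule borel_measurable_LIMSEQ_real)
  let ?a = "\<lambda>n t. (1 / real (Suc n)) * real (Suc (nat \<lfloor>max 0 t * real (Suc n)\<rfloor>))"
  have a: "max 0 t \<le> ?a n t" "?a n t \<le> max 0 t + 1 / real (Suc n)" for n t
  proof -
    have "real (Suc (nat \<lfloor>max 0 t * real (Suc n)\<rfloor>)) = real_of_int \<lfloor>max 0 t * real (Suc n)\<rfloor> + 1" by simp
    moreover have "real_of_int \<lfloor>max 0 t * real (Suc n)\<rfloor> \<le> max 0 t * real (Suc n)"
      "max 0 t * real (Suc n) \<le> real_of_int \<lfloor>max 0 t * real (Suc n)\<rfloor> + 1" by linarith+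
    ultimately have *: "max 0 t * real (Suc n) \<le> real (Suc (nat \<lfloor>max 0 t * real (Suc n)\<rfloor>))"
      "real (Suc (nat \<lfloor>max 0 t * real (Suc n)\<rfloor>)) \<le> max 0 t * real (Suc n) + 1" by linarith+
    have "max 0 t = (1 / real (Suc n)) * (max 0 t * real (Suc n))" by simp
    also have "\<dots> \<le> ?a n t" by (rule mult_left_mono[OF *(1)]) simp
    finally show "max 0 t \<le> ?a n t" .
    have "?a n t \<le> (1 / real (Suc n)) * (max 0 t * real (Suc n) + 1)" by (rule mult_left_mono[OF *(2)]) simp
    also have "\<dots> = max 0 t + 1 / real (Suc n)" by (simp add: distrib_left del: of_nat_Suc)
    finally show "?a n t \<le> max 0 t + 1 / real (Suc n)" .
  qed
  show "(\<lambda>n. X (?a n (fst z)) (snd z)) \<longlonglongrightarrow> X (max 0 (fst z)) (snd z)" if "z \<in> space (borel \<Otimes>\<^sub>M M)" for z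
  proof (rule cadlag_tendsto_right[OF c])
    show "snd z \<in> space M" using that by (auto simp: space_pair_measure)
    show "(\<lambda>n. ?a n (fst z)) \<longlonglongrightarrow> max 0 (fst z)"
    proof (rule real_tendsto_sandwich[where f="\<lambda>_. max 0 (fst z)"])
      show "(\<lambda>n. max 0 (fst z) + 1 / real (Suc n)) \<longlonglongrightarrow> max 0 (fst z)"
        using tendsto_add[OF tendsto_const LIMSEQ_inverse_real_of_nat, of "max 0 (fst z)"] by (simp add: inverse_eq_divide)
      show "eventually (\<lambda>n. max 0 (fst z) \<le> ?a n (fst z)) sequentially"
        "eventually (\<lambda>n. ?a n (fst z) \<le> max 0 (fst z) + 1 / real (Suc n)) sequentially"
        using a by (intro always_eventually allI; blast)+
    qed (rule tendsto_const)
    show "max 0 (fst z) \<le> ?a n (fst z)" for n by (rule a)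
  qed simp
  show "(\<lambda>z. X (?a n (fst z)) (snd z)) \<in> borel_measurable (borel \<Otimes>\<^sub>M M)" for n
  proof (rule measurable_compose_countable[where f="\<lambda>i z. X ((1 / real (Suc n)) * real (Suc i)) (snd z)"])
    show "(\<lambda>z. X ((1 / real (Suc n)) * real (Suc i)) (snd z)) \<in> borel_measurable (borel \<Otimes>\<^sub>M M)" for i
      by (rule measurable_compose[OF measurable_snd X]) simp
    show "(\<lambda>z. nat \<lfloor>max 0 (fst z) * real (Suc n)\<rfloor>) \<in> borel \<Otimes>\<^sub>M M \<rightarrow>\<^sub>M count_space UNIV"
      by measurable
  qed
qed

section \<open>Hitting times of open sets and their grid versions; time 0 never counts as a
  hit\<close>

definition hits :: "real set \<Rightarrow> (real \<Rightarrow> real) \<Rightarrow> bool" where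
  "hits D f \<longleftrightarrow> (\<exists>t>0. f t \<in> D)"

definition hit_time :: "real set \<Rightarrow> (real \<Rightarrow> real) \<Rightarrow> real" where
  "hit_time D f = Inf {t. 0 < t \<and> f t \<in> D}"

definition grid_hits :: "real set \<Rightarrow> real \<Rightarrow> (real \<Rightarrow> real) \<Rightarrow> bool" where
  "grid_hits D \<delta> f \<longleftrightarrow> (\<exists>k::nat. 0 < k \<and> f (\<delta> * real k) \<in> D)"

definition grid_first :: "real set \<Rightarrow> real \<Rightarrow> (real \<Rightarrow> real) \<Rightarrow> nat" where
  "grid_first D \<delta> f = (LEAST k. 0 < k \<and> f (\<delta> * real k) \<in> D)"

text \<open>This event depends only on the positions at grid times up to \<open>k\<close>, so the
  Markov property at time \<open>\<delta> * k\<close> can be applied on it.\<close>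

definition first_at :: "real set \<Rightarrow> real \<Rightarrow> nat \<Rightarrow> (real \<Rightarrow> real) \<Rightarrow> bool" where
  "first_at D \<delta> k f \<longleftrightarrow> 0 < k \<and> f (\<delta> * real k) \<in> D \<and> (\<forall>j<k. 0 < j \<longrightarrow> f (\<delta> * real j) \<notin> D)"

lemma first_at_iff: "first_at D \<delta> k f \<longleftrightarrow> grid_hits D \<delta> f \<and> k = grid_first D \<delta> f"
proof
  assume k: "first_at D \<delta> k f"
  then have "grid_first D \<delta> f = k"
    unfolding grid_first_def first_at_def by (intro Least_equality) (auto simp: not_less[symmetric])
  with k show "grid_hits D \<delta> f \<and> k = grid_first D \<delta> f" by (auto simp: first_at_def grid_hits_def)
next
  assume k: "grid_hits D \<delta> f \<and> k = grid_first D \<delta> f"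
  then have "0 < k \<and> f (\<delta> * real k) \<in> D"
    unfolding grid_hits_def grid_first_def using LeastI_ex[of "\<lambda>k. 0 < k \<and> f (\<delta> * real k) \<in> D"] by blast
  moreover have "\<not> (0 < j \<and> f (\<delta> * real j) \<in> D)" if "j < k" for j
    using that k unfolding grid_first_def by (intro not_less_Least) simp
  ultimately show "first_at D \<delta> k f" by (auto simp: first_at_def)
qed

text \<open>Decomposition over the values of the grid hitting time: on each path at most one index
  contributes. It reduces the strong Markov property at grid times to the simple one at each fixed
  time.\<close>

lemma suminf_first_at:
  fixes \<phi> :: "nat \<Rightarrow> ennreal"
  shows "(\<Sum>k. indicator {k. first_at D \<delta> k f} k * \<phi> k) = (if grid_hits D \<delta> f then \<phi> (grid_first D \<delta> f) else 0)"
proof (cases "grid_hits D \<delta> f")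
  case True
  have "(\<Sum>k. indicator {k. first_at D \<delta> k f} k * \<phi> k) = (\<Sum>k\<in>{grid_first D \<delta> f}. indicator {k. first_at D \<delta> k f} k * \<phi> k)"
    by (rule suminf_finite) (auto simp: first_at_iff split: split_indicator)
  then show ?thesis using True by (simp add: first_at_iff)
qed (simp add: first_at_iff)

lemma hit_time_facts:
  assumes "hits D f"
  shows "0 \<le> hit_time D f" "\<And>t. 0 < t \<Longrightarrow> f t \<in> D \<Longrightarrow> hit_time D f \<le> t"
    "\<And>e. 0 < e \<Longrightarrow> \<exists>t. 0 < t \<and> f t \<in> D \<and> t < hit_time D f + e"
proof -
  let ?S = "{t. 0 < t \<and> f t \<in> D}"
  have ne: "?S \<noteq> {}" using assms by (auto simp: hits_def)
  have bd: "bdd_below ?S" by (auto intro!: bdd_belowI[of _ 0])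
  show "0 \<le> hit_time D f" unfolding hit_time_def using ne by (intro cInf_greatest) auto
  show "\<And>t. 0 < t \<Longrightarrow> f t \<in> D \<Longrightarrow> hit_time D f \<le> t"
    unfolding hit_time_def using bd by (intro cInf_lower) auto
  show "\<exists>t. 0 < t \<and> f t \<in> D \<and> t < hit_time D f + e" if "0 < e" for e
    using cInf_lessD[OF ne, of "hit_time D f + e"] that unfolding hit_time_def by auto
qed

text \<open>If the path is in the open set \<open>D\<close> at time \<open>t\<close>, right
  continuity keeps it there for a while, and a fine grid has a point in that stretch. So the grid
  hitting times converge to the hitting time, and they do so from above, where right continuity also
  gives convergence of the positions.\<close>

lemma grid_hits_tendsto:
  assumes f: "cadlag f" and D: "open D" and \<delta>: "\<And>n. 0 < \<delta> n" "\<delta> \<longlonglongrightarrow> 0" and h: "hits D f"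
  shows "eventually (\<lambda>n. grid_hits D (\<delta> n) f) sequentially"
    "(\<lambda>n. \<delta> n * real (grid_first D (\<delta> n) f)) \<longlonglongrightarrow> hit_time D f"
    "eventually (\<lambda>n. hit_time D f \<le> \<delta> n * real (grid_first D (\<delta> n) f)) sequentially"
    "(\<lambda>n. f (\<delta> n * real (grid_first D (\<delta> n) f))) \<longlonglongrightarrow> f (hit_time D f)"
proof -
  let ?\<tau> = "hit_time D f" and ?\<sigma> = "\<lambda>n. \<delta> n * real (grid_first D (\<delta> n) f)"
  have ge: "grid_hits D (\<delta> n) f \<Longrightarrow> ?\<tau> \<le> ?\<sigma> n" for n
  proof -
    assume "grid_hits D (\<delta> n) f"
    then have "first_at D (\<delta> n) (grid_first D (\<delta> n) f) f" by (simp add: first_at_iff)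
    then show "?\<tau> \<le> ?\<sigma> n" using \<delta>(1)[of n] by (intro hit_time_facts(2)[OF h]) (auto simp: first_at_def)
  qed
  have ev: "eventually (\<lambda>n. grid_hits D (\<delta> n) f \<and> ?\<sigma> n < ?\<tau> + e) sequentially" if e: "0 < e" for e
  proof -
    obtain t where t: "0 < t" "f t \<in> D" "t < ?\<tau> + e" using hit_time_facts(3)[OF h e] by blast
    have "(f \<longlongrightarrow> f t) (at_right t)" using f t by (auto simp: cadlag_def)
    then have "eventually (\<lambda>s. f s \<in> D) (at_right t)" using D t(2) by (rule topological_tendstoD)
    then obtain u where u: "t < u" "\<And>s. t < s \<Longrightarrow> s < u \<Longrightarrow> f s \<in> D"
      by (auto simp: eventually_at_right_field)
    define v where "v = min u (?\<tau> + e)"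
    have v: "t < v" "v \<le> u" "v \<le> ?\<tau> + e" using t u by (auto simp: v_def)
    have "eventually (\<lambda>n. \<delta> n < v - t) sequentially"
      using order_tendstoD(2)[OF \<delta>(2), of "v - t"] v by simp
    then show ?thesis
    proof eventually_elim
      case (elim n)
      define k where "k = Suc (nat \<lfloor>t / \<delta> n\<rfloor>)"
      have "real k = real_of_int \<lfloor>t / \<delta> n\<rfloor> + 1" using t \<delta>(1)[of n] by (simp add: k_def)
      then have *: "t / \<delta> n < real k" "real k \<le> t / \<delta> n + 1" by linarith+
      have "\<delta> n * (t / \<delta> n) < \<delta> n * real k" "\<delta> n * real k \<le> \<delta> n * (t / \<delta> n + 1)"
        by (rule mult_strict_left_mono[OF *(1) \<delta>(1)], rule mult_left_mono[OF *(2) less_imp_le[OF \<delta>(1)]])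
      then have k: "t < \<delta> n * real k" "\<delta> n * real k \<le> t + \<delta> n"
        using \<delta>(1)[of n] by (auto simp: distrib_left)
      then have kD: "0 < k \<and> f (\<delta> n * real k) \<in> D" using u(2) elim v by (auto simp: k_def)
      then have "grid_first D (\<delta> n) f \<le> k" unfolding grid_first_def by (rule Least_le)
      then have "?\<sigma> n \<le> \<delta> n * real k" using \<delta>(1)[of n] by simp
      then have "?\<sigma> n < ?\<tau> + e" using k elim v by linarith
      then show ?case using kD by (auto simp: grid_hits_def)
    qed
  qed
  show e1: "eventually (\<lambda>n. grid_hits D (\<delta> n) f) sequentially"
    using ev[of 1] by (auto elim: eventually_mono)
  show e2: "eventually (\<lambda>n. ?\<tau> \<le> ?\<sigma> n) sequentially"
    using e1 by (rule eventually_mono) (rule ge)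
  show lim: "?\<sigma> \<longlonglongrightarrow> ?\<tau>"
  proof (rule order_tendstoI)
    fix a assume "a < ?\<tau>" with e2 show "eventually (\<lambda>n. a < ?\<sigma> n) sequentially"
      by (auto elim!: eventually_mono)
  next
    fix a assume "?\<tau> < a" with ev[of "a - ?\<tau>"] show "eventually (\<lambda>n. ?\<sigma> n < a) sequentially"
      by (auto elim!: eventually_mono)
  qed
  have "(\<lambda>n. f (max ?\<tau> (?\<sigma> n))) \<longlonglongrightarrow> f ?\<tau>"
  proof (rule cadlag_tendsto_right[OF f hit_time_facts(1)[OF h]])
    show "(\<lambda>n. max ?\<tau> (?\<sigma> n)) \<longlonglongrightarrow> ?\<tau>" using tendsto_max[OF tendsto_const lim, of ?\<tau>] by simp
  qed auto
  then show "(\<lambda>n. f (?\<sigma> n)) \<longlonglongrightarrow> f ?\<tau>"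
    by (rule Lim_transform_eventually) (use e2 in \<open>auto elim!: eventually_mono simp: max_def\<close>)
qed

lemma not_hits: "0 < \<delta> \<Longrightarrow> \<not> hits D f \<Longrightarrow> \<not> grid_hits D \<delta> f"
  by (auto simp: hits_def grid_hits_def)

section \<open>Levy processes and the Markov property at grid times\<close>

locale levy = prob_space M for M :: "'w measure" +
  fixes X :: "real \<Rightarrow> 'w \<Rightarrow> real"
  assumes levy_process: "levy_process M X"
begin

lemma X_measurable: "0 \<le> t \<Longrightarrow> X t \<in> borel_measurable M"
  using levy_process by (auto simp: levy_process_def)

lemma X_measurable' [measurable]: "X (\<bar>t\<bar>) \<in> borel_measurable M" "X (max 0 t) \<in> borel_measurable M"
  by (auto intro: X_measurable)

lemma X_0: "AE \<omega> in M. X 0 \<omega> = 0"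
  using levy_process by (auto simp: levy_process_def)

lemma X_cadlag: "\<omega> \<in> space M \<Longrightarrow> cadlag (\<lambda>t. X t \<omega>)"
  using levy_process by (auto simp: levy_process_def)

lemma X_joint [measurable]: "(\<lambda>z. X (max 0 (fst z)) (snd z)) \<in> borel_measurable (borel \<Otimes>\<^sub>M M)"
  by (rule cadlag_joint_measurable[OF X_measurable X_cadlag])

lemma X_joint2 [measurable (raw)]:
  assumes "f \<in> borel_measurable N" "g \<in> N \<rightarrow>\<^sub>M M"
  shows "(\<lambda>x. X (max 0 (f x)) (g x)) \<in> borel_measurable N"
  using measurable_compose[OF measurable_Pair[OF assms] X_joint] by simp

lemma X_stationary:
  assumes "0 \<le> s" "0 \<le> t" and [measurable]: "f \<in> borel_measurable borel"
  shows "(\<integral>\<^sup>+\<omega>. f (X (s + t) \<omega> - X s \<omega>) \<partial>M) = (\<integral>\<^sup>+\<omega>. f (X t \<omega>) \<partial>M)"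
proof -
  have [measurable]: "X (s + t) \<in> borel_measurable M" "X s \<in> borel_measurable M" "X t \<in> borel_measurable M"
    using assms by (auto intro: X_measurable)
  have "distr M borel (\<lambda>\<omega>. X (s + t) \<omega> - X s \<omega>) = distr M borel (X t)"
    using levy_process assms by (auto simp: levy_process_def)
  then have "(\<integral>\<^sup>+z. f z \<partial>distr M borel (\<lambda>\<omega>. X (s + t) \<omega> - X s \<omega>)) = (\<integral>\<^sup>+z. f z \<partial>distr M borel (X t))" by simp
  then show ?thesis by (simp add: nn_integral_distr)
qed

text \<open>The past up to time \<open>\<delta> * k\<close> is encoded by its vector of increments,
  the form in which independence is available. Partial sums return the path minus
  \<open>X 0\<close>, which vanishes only almost surely.\<close>

definition increments :: "real \<Rightarrow> nat \<Rightarrow> 'w \<Rightarrow> nat \<Rightarrow> real" where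
  "increments \<delta> k \<omega> = (\<lambda>i\<in>{..<k}. X (\<delta> * real (Suc i)) \<omega> - X (\<delta> * real i) \<omega>)"

lemma sum_increments: "j \<le> k \<Longrightarrow> (\<Sum>i<j. increments \<delta> k \<omega> i) = X (\<delta> * real j) \<omega> - X 0 \<omega>"
proof -
  assume "j \<le> k"
  then have "(\<Sum>i<j. increments \<delta> k \<omega> i) = (\<Sum>i<j. X (\<delta> * real (Suc i)) \<omega> - X (\<delta> * real i) \<omega>)"
    by (intro sum.cong) (auto simp: increments_def)
  also have "\<dots> = X (\<delta> * real j) \<omega> - X (\<delta> * real 0) \<omega>" by (rule sum_lessThan_telescope)
  finally show ?thesis by simp
qed

lemma indep_increments:
  assumes "0 < \<delta>" "0 \<le> t"
  shows "indep_var (PiM {..<k} (\<lambda>_. borel)) (increments \<delta> k)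
    (PiM {k} (\<lambda>_. borel)) (\<lambda>\<omega>. \<lambda>i\<in>{k}. X (\<delta> * real k + t) \<omega> - X (\<delta> * real k) \<omega>)"
proof -
  \<comment> \<open>Grid times up to index \<open>k\<close>, and from then on the constant time
    \<open>\<delta> * k + t\<close>: the increment with index \<open>k\<close> is the future one,
    and all later increments are zero.\<close>
  define \<tau> where "\<tau> i = (if i \<le> k then \<delta> * real i else \<delta> * real k + t)" for i
  let ?V = "\<lambda>i \<omega>. X (\<tau> (Suc i)) \<omega> - X (\<tau> i) \<omega>"
  have "incseq \<tau>" using assms by (auto simp: incseq_def \<tau>_def intro: order_trans[of _ "\<delta> * real k"])
  moreover have "0 \<le> \<tau> 0" by (simp add: \<tau>_def)
  ultimately have "indep_vars (\<lambda>_. borel) ?V {..<Suc k}"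
    using levy_process unfolding levy_process_def by blast
  then have "indep_var (PiM {..<k} (\<lambda>_. borel)) (\<lambda>\<omega>. restrict (\<lambda>i. ?V i \<omega>) {..<k})
     (PiM {k} (\<lambda>_. borel)) (\<lambda>\<omega>. restrict (\<lambda>i. ?V i \<omega>) {k})"
    by (rule indep_var_restrict) auto
  also have "(\<lambda>\<omega>. restrict (\<lambda>i. ?V i \<omega>) {..<k}) = increments \<delta> k"
    by (auto simp: fun_eq_iff increments_def \<tau>_def)
  also have "(\<lambda>\<omega>. restrict (\<lambda>i. ?V i \<omega>) {k}) = (\<lambda>\<omega>. \<lambda>i\<in>{k}. X (\<delta> * real k + t) \<omega> - X (\<delta> * real k) \<omega>)"
    by (auto simp: fun_eq_iff \<tau>_def)
  finally show ?thesis .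
qed

text \<open>The increment after time \<open>\<delta> * k\<close> is independent of the vector of
  past increments and, by stationarity, distributed like \<open>X t\<close>; so it may be replaced
  by an independent copy.\<close>

lemma markov_grid:
  assumes \<delta>: "0 < \<delta>" and t: "0 \<le> t"
    and F[measurable]: "(\<lambda>z. F (fst z) (snd z)) \<in> borel_measurable (PiM {..<k} (\<lambda>_. borel) \<Otimes>\<^sub>M borel)"
  shows "(\<integral>\<^sup>+\<omega>. F (increments \<delta> k \<omega>) (X (\<delta> * real k + t) \<omega> - X (\<delta> * real k) \<omega>) \<partial>M) =
    (\<integral>\<^sup>+\<omega>. (\<integral>\<^sup>+\<omega>'. F (increments \<delta> k \<omega>) (X t \<omega>') \<partial>M) \<partial>M)"
proof -
  have "(\<lambda>z. (fst z, (snd z) k)) \<in> PiM {..<k} (\<lambda>_. borel) \<Otimes>\<^sub>M PiM {k} (\<lambda>_. borel) \<rightarrow>\<^sub>M PiM {..<k} (\<lambda>_. borel) \<Otimes>\<^sub>M (borel :: real measure)"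
    by (intro measurable_Pair measurable_fst measurable_compose[OF measurable_snd measurable_component_singleton]) auto
  from measurable_compose[OF this F]
  have F': "(\<lambda>z. F (fst z) ((snd z) k)) \<in> borel_measurable (PiM {..<k} (\<lambda>_. borel) \<Otimes>\<^sub>M PiM {k} (\<lambda>_. borel))"
    by simp
  have "(\<integral>\<^sup>+\<omega>. F (increments \<delta> k \<omega>) (X (\<delta> * real k + t) \<omega> - X (\<delta> * real k) \<omega>) \<partial>M) =
    (\<integral>\<^sup>+\<omega>. (\<integral>\<^sup>+\<omega>'. F (increments \<delta> k \<omega>) (X (\<delta> * real k + t) \<omega>' - X (\<delta> * real k) \<omega>') \<partial>M) \<partial>M)"
    using nn_integral_indep_var[OF indep_increments[OF \<delta> t], where f="\<lambda>a z. F a (z k)", OF F'] by simp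
  also have "\<dots> = (\<integral>\<^sup>+\<omega>. (\<integral>\<^sup>+\<omega>'. F (increments \<delta> k \<omega>) (X t \<omega>') \<partial>M) \<partial>M)"
  proof (rule nn_integral_cong)
    fix \<omega> assume "\<omega> \<in> space M"
    have "increments \<delta> k \<omega> \<in> space (PiM {..<k} (\<lambda>_. borel))"
      by (auto simp: increments_def space_PiM)
    then have "F (increments \<delta> k \<omega>) \<in> borel_measurable borel"
      using measurable_compose[OF measurable_Pair1' F] by simp
    then show "(\<integral>\<^sup>+\<omega>'. F (increments \<delta> k \<omega>) (X (\<delta> * real k + t) \<omega>' - X (\<delta> * real k) \<omega>') \<partial>M) =
        (\<integral>\<^sup>+\<omega>'. F (increments \<delta> k \<omega>) (X t \<omega>') \<partial>M)"
      using \<delta> t by (intro X_stationary) auto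
  qed
  finally show ?thesis .
qed

lemma first_at_measurable [measurable]:
  assumes [measurable]: "D \<in> sets borel" and "0 < \<delta>"
  shows "Measurable.pred M (\<lambda>\<omega>. first_at D \<delta> k (\<lambda>t. x + X t \<omega>))"
proof -
  have [measurable]: "X (\<delta> * real i) \<in> borel_measurable M" for i
    using assms by (intro X_measurable) auto
  show ?thesis unfolding first_at_def by measurable
qed

lemma markov_first_at:
  assumes \<delta>: "0 < \<delta>" and t: "0 \<le> t" and [measurable]: "D \<in> sets borel" "g \<in> borel_measurable borel"
  shows "(\<integral>\<^sup>+\<omega>. indicator {\<omega>. first_at D \<delta> k (\<lambda>t. x + X t \<omega>)} \<omega> * g (x + X (\<delta> * real k + t) \<omega>) \<partial>M) =
    (\<integral>\<^sup>+\<omega>. indicator {\<omega>. first_at D \<delta> k (\<lambda>t. x + X t \<omega>)} \<omega> * (\<integral>\<^sup>+\<omega>'. g (x + X (\<delta> * real k) \<omega> + X t \<omega>') \<partial>M) \<partial>M)"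
proof -
  \<comment> \<open>\<open>A\<close> reads the event \<open>first_at\<close> off the increments. The
    two descriptions agree where \<open>X 0\<close> vanishes, that is, almost everywhere.\<close>
  define A where "A = {a :: nat \<Rightarrow> real. 0 < k \<and> x + (\<Sum>i<k. a i) \<in> D \<and> (\<forall>j<k. 0 < j \<longrightarrow> x + (\<Sum>i<j. a i) \<notin> D)}"
  define F where "F a z = indicator A a * g (x + (\<Sum>i<k. a i) + z)" for a z
  have s[measurable]: "(\<lambda>a. \<Sum>i<j. a i :: real) \<in> borel_measurable (PiM {..<k} (\<lambda>_. borel))" if "j \<le> k" for j
  proof -
    show ?thesis by (rule borel_measurable_sum[where f="\<lambda>i a. a i"]) (use that in auto)
  qed
  have [measurable]: "(\<lambda>z. \<Sum>i<k. (fst z) i :: real) \<in> borel_measurable (PiM {..<k} (\<lambda>_. borel) \<Otimes>\<^sub>M (borel :: real measure))"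
    using measurable_compose[OF measurable_fst s[OF order_refl]] by simp
  have "Measurable.pred (PiM {..<k} (\<lambda>_. borel)) (\<lambda>a. a \<in> A)"
  proof -
    have [measurable]: "Measurable.pred (PiM {..<k} (\<lambda>_. borel)) (\<lambda>a. \<forall>j\<in>{..<k}. 0 < j \<longrightarrow> x + (\<Sum>i<j. a i) \<notin> D)"
    proof (rule pred_intros_finite)
      fix j assume "j \<in> {..<k}"
      then have [measurable]: "(\<lambda>a. \<Sum>i<j. a i :: real) \<in> borel_measurable (PiM {..<k} (\<lambda>_. borel))" by (intro s) simp
      show "Measurable.pred (PiM {..<k} (\<lambda>_. borel)) (\<lambda>a. 0 < j \<longrightarrow> x + (\<Sum>i<j. a i) \<notin> D)" by measurable
    qed simp
    have [measurable]: "(\<lambda>a. \<Sum>i<k. a i :: real) \<in> borel_measurable (PiM {..<k} (\<lambda>_. borel))" by (intro s) simp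
    have "Measurable.pred (PiM {..<k} (\<lambda>_. borel)) (\<lambda>a. (0 < k \<and> x + (\<Sum>i<k. a i) \<in> D) \<and> (\<forall>j\<in>{..<k}. 0 < j \<longrightarrow> x + (\<Sum>i<j. a i) \<notin> D))"
      by measurable
    then show ?thesis by (simp add: A_def Ball_def conj_assoc)
  qed
  then have [measurable]: "(\<lambda>z. indicator A (fst z) :: ennreal) \<in> borel_measurable (PiM {..<k} (\<lambda>_. borel) \<Otimes>\<^sub>M (borel :: real measure))"
    by (intro measurable_compose[OF measurable_fst, where g="indicator A"] borel_measurable_indicator') auto
  have F: "(\<lambda>z. F (fst z) (snd z)) \<in> borel_measurable (PiM {..<k} (\<lambda>_. borel) \<Otimes>\<^sub>M borel)"
    unfolding F_def by measurable
  have eq: "AE \<omega> in M. \<forall>y z. F (increments \<delta> k \<omega>) z = indicator {\<omega>. first_at D \<delta> k (\<lambda>t. x + X t \<omega>)} \<omega> * g (x + X (\<delta> * real k) \<omega> + z)"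
    using X_0
  proof eventually_elim
    case (elim \<omega>)
    then have "(\<Sum>i<j. increments \<delta> k \<omega> i) = X (\<delta> * real j) \<omega>" if "j \<le> k" for j
      using sum_increments[OF that] by simp
    then show ?case by (auto simp: F_def A_def first_at_def split: split_indicator)
  qed
  have "(\<integral>\<^sup>+\<omega>. indicator {\<omega>. first_at D \<delta> k (\<lambda>t. x + X t \<omega>)} \<omega> * g (x + X (\<delta> * real k + t) \<omega>) \<partial>M)
      = (\<integral>\<^sup>+\<omega>. F (increments \<delta> k \<omega>) (X (\<delta> * real k + t) \<omega> - X (\<delta> * real k) \<omega>) \<partial>M)"
    by (rule nn_integral_cong_AE) (use eq in \<open>auto simp: algebra_simps elim!: eventually_mono\<close>)
  also have "\<dots> = (\<integral>\<^sup>+\<omega>. (\<integral>\<^sup>+\<omega>'. F (increments \<delta> k \<omega>) (X t \<omega>') \<partial>M) \<partial>M)"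
    by (rule markov_grid[OF \<delta> t F])
  also have "\<dots> = (\<integral>\<^sup>+\<omega>. indicator {\<omega>. first_at D \<delta> k (\<lambda>t. x + X t \<omega>)} \<omega> * (\<integral>\<^sup>+\<omega>'. g (x + X (\<delta> * real k) \<omega> + X t \<omega>') \<partial>M) \<partial>M)"
  proof (rule nn_integral_cong_AE)
    have [measurable]: "X t \<in> borel_measurable M" using t by (rule X_measurable)
    show "AE \<omega> in M. (\<integral>\<^sup>+\<omega>'. F (increments \<delta> k \<omega>) (X t \<omega>') \<partial>M)
      = indicator {\<omega>. first_at D \<delta> k (\<lambda>t. x + X t \<omega>)} \<omega> * (\<integral>\<^sup>+\<omega>'. g (x + X (\<delta> * real k) \<omega> + X t \<omega>') \<partial>M)"
      using eq by eventually_elim (simp add: nn_integral_cmult)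
  qed
  finally show ?thesis .
qed

text \<open>The discounted occupation measure of \<open>X\<close> started at 0: the image of exp(-p
  t) dt times the probability. Working with the measure instead of an operator on functions allows
  densities and uniqueness theorems to be applied directly. \<open>max 0\<close> only keeps the time
  index in range; negative times carry no mass.\<close>

definition resolvent :: "real \<Rightarrow> real measure" where
  "resolvent p = distr (density (lborel \<Otimes>\<^sub>M M) (\<lambda>z. indicator {0..} (fst z) * ennreal (exp (- p * fst z)))) borel
     (\<lambda>z. X (max 0 (fst z)) (snd z))"

lemma sets_resolvent [simp, measurable_cong]: "sets (resolvent p) = sets borel"
  by (simp add: resolvent_def)

lemma space_resolvent [simp]: "space (resolvent p) = UNIV"
  by (simp add: resolvent_def)

lemma nn_integral_resolvent:
  assumes [measurable]: "f \<in> borel_measurable borel"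
  shows "(\<integral>\<^sup>+z. f z \<partial>resolvent p) = (\<integral>\<^sup>+t. indicator {0..} t * ennreal (exp (- p * t)) * (\<integral>\<^sup>+\<omega>. f (X (max 0 t) \<omega>) \<partial>M) \<partial>lborel)"
proof -
  have "(\<integral>\<^sup>+z. f z \<partial>resolvent p) =
     (\<integral>\<^sup>+z. indicator {0..} (fst z) * ennreal (exp (- p * fst z)) * f (X (max 0 (fst z)) (snd z)) \<partial>(lborel \<Otimes>\<^sub>M M))"
    unfolding resolvent_def by (subst nn_integral_distr, simp_all, subst nn_integral_density, simp_all)
  also have "\<dots> = (\<integral>\<^sup>+t. (\<integral>\<^sup>+\<omega>. indicator {0..} t * ennreal (exp (- p * t)) * f (X (max 0 t) \<omega>) \<partial>M) \<partial>lborel)"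
    by (subst nn_integral_fst[symmetric]) simp_all
  also have "\<dots> = (\<integral>\<^sup>+t. indicator {0..} t * ennreal (exp (- p * t)) * (\<integral>\<^sup>+\<omega>. f (X (max 0 t) \<omega>) \<partial>M) \<partial>lborel)"
    by (intro nn_integral_cong nn_integral_cmult) auto
  finally show ?thesis .
qed

end

lemma nn_integral_exp_tail:
  assumes "0 < (p::real)" "0 \<le> a"
  shows "(\<integral>\<^sup>+t. indicator {a..} t * ennreal (exp (- p * t)) \<partial>lborel) = ennreal (exp (- p * a) / p)"
proof -
  have "(\<integral>\<^sup>+t. ennreal (exp (- p * t)) * indicator {a..} t \<partial>lborel) = ennreal (0 - (- exp (- p * a) / p))"
  proof (rule nn_integral_FTC_atLeast)
    show "((\<lambda>t. - exp (- p * t) / p) has_real_derivative exp (- p * t)) (at t)" for t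
      using assms by (auto intro!: derivative_eq_intros)
    have "((\<lambda>t. exp (- (p * t))) \<longlongrightarrow> 0) at_top"
      using assms by (intro filterlim_compose[OF exp_at_bot])
        (auto simp: filterlim_uminus_at_bot intro!: filterlim_tendsto_pos_mult_at_top[OF tendsto_const] filterlim_ident)
    then show "((\<lambda>t. - exp (- p * t) / p) \<longlongrightarrow> 0) at_top"
      using tendsto_divide[OF tendsto_minus tendsto_const, of _ 0 at_top p] assms by simp
  qed auto
  then show ?thesis by (simp add: mult.commute)
qed

context levy begin

lemma emeasure_resolvent: "0 < p \<Longrightarrow> emeasure (resolvent p) UNIV = ennreal (1 / p)"
  using nn_integral_resolvent[of "\<lambda>_. 1" p] nn_integral_exp_tail[of p 0] by (simp add: emeasure_space_1)

lemma finite_resolvent: "0 < p \<Longrightarrow> finite_measure (resolvent p)"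
  by (rule finite_measureI) (simp add: emeasure_resolvent)

end

section \<open>The strong Markov property at hitting times of open sets\<close>

context levy begin

lemma time_measurable: "\<omega> \<in> space M \<Longrightarrow> (\<lambda>t. X (max 0 t) \<omega>) \<in> borel_measurable borel"
  using measurable_compose[OF measurable_Pair1'[of \<omega> M borel] _] X_joint2[of "\<lambda>t. t" borel "\<lambda>_. \<omega>"] by simp

definition tail_integral :: "real \<Rightarrow> (real \<Rightarrow> ennreal) \<Rightarrow> real \<Rightarrow> real \<Rightarrow> 'w \<Rightarrow> ennreal" where
  "tail_integral p g x a \<omega> = (\<integral>\<^sup>+t. indicator {a..} t * (ennreal (exp (- p * t)) * g (x + X (max 0 t) \<omega>)) \<partial>lborel)"

lemma tail_integral_measurable [measurable]:
  assumes [measurable]: "g \<in> borel_measurable borel"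
  shows "tail_integral p g x a \<in> borel_measurable M"
  unfolding tail_integral_def by measurable

definition Res :: "real \<Rightarrow> (real \<Rightarrow> ennreal) \<Rightarrow> real \<Rightarrow> ennreal" where
  "Res p g y = (\<integral>\<^sup>+z. g (y + z) \<partial>resolvent p)"

lemma Res_eq:
  assumes [measurable]: "g \<in> borel_measurable borel"
  shows "Res p g y = (\<integral>\<^sup>+t. indicator {0..} t * ennreal (exp (- p * t)) * (\<integral>\<^sup>+\<omega>. g (y + X (max 0 t) \<omega>) \<partial>M) \<partial>lborel)"
  unfolding Res_def by (subst nn_integral_resolvent) auto

lemma nn_integral_lborel_swap:
  assumes "(\<lambda>z. f (fst z) (snd z)) \<in> borel_measurable (lborel \<Otimes>\<^sub>M M)"
  shows "(\<integral>\<^sup>+\<omega>. (\<integral>\<^sup>+t. f t \<omega> \<partial>lborel) \<partial>M) = (\<integral>\<^sup>+(t::real). (\<integral>\<^sup>+\<omega>. f t \<omega> \<partial>M) \<partial>lborel)"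
proof -
  interpret L: pair_sigma_finite lborel M ..
  show ?thesis using assms by (intro L.Fubini') (simp add: case_prod_beta')
qed

text \<open>On the event that the first grid hit has index \<open>k\<close>, time is shifted by
  \<open>s = \<delta> * k\<close>, the Markov property is applied at each time \<open>s + t\<close>,
  and Fubini collects the results into the resolvent at the position reached. The factor
  \<open>exp (- p * s)\<close> is the discount up to the hit.\<close>

lemma strong_markov_step:
  assumes \<delta>: "0 < \<delta>" and [measurable]: "D \<in> sets borel" "g \<in> borel_measurable borel"
  shows "(\<integral>\<^sup>+\<omega>. indicator {\<omega>. first_at D \<delta> k (\<lambda>t. x + X t \<omega>)} \<omega> * tail_integral p g x (\<delta> * real k) \<omega> \<partial>M) =
    (\<integral>\<^sup>+\<omega>. indicator {\<omega>. first_at D \<delta> k (\<lambda>t. x + X t \<omega>)} \<omega> *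
       (ennreal (exp (- p * (\<delta> * real k))) * Res p g (x + X (\<delta> * real k) \<omega>)) \<partial>M)"
proof -
  define s where "s = \<delta> * real k"
  have s: "0 \<le> s" using \<delta> by (simp add: s_def)
  have [measurable]: "X s \<in> borel_measurable M" using s by (rule X_measurable)
  define E where "E = {\<omega>. first_at D \<delta> k (\<lambda>t. x + X t \<omega>)}"
  have [measurable]: "Measurable.pred M (\<lambda>\<omega>. \<omega> \<in> E)" using \<delta> by (simp add: E_def)
  have [measurable]: "(indicator E :: 'w \<Rightarrow> ennreal) \<in> borel_measurable M" by (intro borel_measurable_indicator') auto
  have "(\<integral>\<^sup>+\<omega>. indicator E \<omega> * tail_integral p g x s \<omega> \<partial>M)
     = (\<integral>\<^sup>+\<omega>. (\<integral>\<^sup>+t. indicator E \<omega> * (indicator {s..} t * (ennreal (exp (- p * t)) * g (x + X (max 0 t) \<omega>))) \<partial>lborel) \<partial>M)"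
    unfolding tail_integral_def
    by (intro nn_integral_cong nn_integral_cmult[symmetric]) (use time_measurable in measurable)
  also have "\<dots> = (\<integral>\<^sup>+t. (\<integral>\<^sup>+\<omega>. indicator E \<omega> * (indicator {s..} t * (ennreal (exp (- p * t)) * g (x + X (max 0 t) \<omega>))) \<partial>M) \<partial>lborel)"
    by (rule nn_integral_lborel_swap) measurable
  also have "\<dots> = (\<integral>\<^sup>+t. (\<integral>\<^sup>+\<omega>. indicator E \<omega> * (indicator {s..} (s + t) * (ennreal (exp (- p * (s + t))) * g (x + X (max 0 (s + t)) \<omega>))) \<partial>M) \<partial>lborel)"
    by (subst nn_integral_real_affine[where c=1 and t=s]) auto
  also have "\<dots> = (\<integral>\<^sup>+t. indicator {0..} t * ennreal (exp (- p * (s + t))) * (\<integral>\<^sup>+\<omega>. indicator E \<omega> * (\<integral>\<^sup>+\<omega>'. g (x + X s \<omega> + X (max 0 t) \<omega>') \<partial>M) \<partial>M) \<partial>lborel)"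
  proof (rule nn_integral_cong)
    fix t
    show "(\<integral>\<^sup>+\<omega>. indicator E \<omega> * (indicator {s..} (s + t) * (ennreal (exp (- p * (s + t))) * g (x + X (max 0 (s + t)) \<omega>))) \<partial>M)
      = indicator {0..} t * ennreal (exp (- p * (s + t))) * (\<integral>\<^sup>+\<omega>. indicator E \<omega> * (\<integral>\<^sup>+\<omega>'. g (x + X s \<omega> + X (max 0 t) \<omega>') \<partial>M) \<partial>M)"
    proof (cases "0 \<le> t")
      case True
      have [measurable]: "X (s + t) \<in> borel_measurable M" using True s by (intro X_measurable) auto
      have "(\<integral>\<^sup>+\<omega>. indicator E \<omega> * (indicator {s..} (s + t) * (ennreal (exp (- p * (s + t))) * g (x + X (max 0 (s + t)) \<omega>))) \<partial>M)
        = (\<integral>\<^sup>+\<omega>. ennreal (exp (- p * (s + t))) * (indicator E \<omega> * g (x + X (s + t) \<omega>)) \<partial>M)"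
        using True s by (intro nn_integral_cong) (simp add: max_absorb2 mult.left_commute)
      also have "\<dots> = ennreal (exp (- p * (s + t))) * (\<integral>\<^sup>+\<omega>. indicator E \<omega> * g (x + X (s + t) \<omega>) \<partial>M)"
        by (rule nn_integral_cmult) measurable
      also have "(\<integral>\<^sup>+\<omega>. indicator E \<omega> * g (x + X (s + t) \<omega>) \<partial>M) = (\<integral>\<^sup>+\<omega>. indicator E \<omega> * (\<integral>\<^sup>+\<omega>'. g (x + X s \<omega> + X t \<omega>') \<partial>M) \<partial>M)"
        unfolding E_def s_def using markov_first_at[OF \<delta> True, of D g] by simp
      finally show ?thesis using True by (simp add: max_absorb2)
    qed simp
  qed
  also have "\<dots> = (\<integral>\<^sup>+t. (\<integral>\<^sup>+\<omega>. indicator {0..} t * ennreal (exp (- p * (s + t))) * (indicator E \<omega> * (\<integral>\<^sup>+\<omega>'. g (x + X s \<omega> + X (max 0 t) \<omega>') \<partial>M)) \<partial>M) \<partial>lborel)"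
    by (intro nn_integral_cong nn_integral_cmult[symmetric]) measurable
  also have "\<dots> = (\<integral>\<^sup>+\<omega>. (\<integral>\<^sup>+t. indicator {0..} t * ennreal (exp (- p * (s + t))) * (indicator E \<omega> * (\<integral>\<^sup>+\<omega>'. g (x + X s \<omega> + X (max 0 t) \<omega>') \<partial>M)) \<partial>lborel) \<partial>M)"
    by (rule nn_integral_lborel_swap[symmetric]) measurable
  also have "\<dots> = (\<integral>\<^sup>+\<omega>. indicator E \<omega> * (ennreal (exp (- p * s)) * Res p g (x + X s \<omega>)) \<partial>M)"
  proof (rule nn_integral_cong)
    fix \<omega>
    have ee: "ennreal (exp (- p * (s + t))) = ennreal (exp (- p * s)) * ennreal (exp (- p * t))" for t
      by (simp add: algebra_simps flip: ennreal_mult exp_add)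
    have mm: "a * e * (b * c) = b * d * (a * f * c)" if "e = d * f" for a b c d e f :: ennreal
      using that by (simp add: ac_simps)
    have "(\<integral>\<^sup>+t. indicator {0..} t * ennreal (exp (- p * (s + t))) * (indicator E \<omega> * (\<integral>\<^sup>+\<omega>'. g (x + X s \<omega> + X (max 0 t) \<omega>') \<partial>M)) \<partial>lborel)
      = (\<integral>\<^sup>+t. (indicator E \<omega> * ennreal (exp (- p * s))) * (indicator {0..} t * ennreal (exp (- p * t)) * (\<integral>\<^sup>+\<omega>'. g (x + X s \<omega> + X (max 0 t) \<omega>') \<partial>M)) \<partial>lborel)"
      by (intro nn_integral_cong) (rule mm[OF ee])
    also have "\<dots> = (indicator E \<omega> * ennreal (exp (- p * s))) * (\<integral>\<^sup>+t. indicator {0..} t * ennreal (exp (- p * t)) * (\<integral>\<^sup>+\<omega>'. g (x + X s \<omega> + X (max 0 t) \<omega>') \<partial>M) \<partial>lborel)"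
      by (rule nn_integral_cmult) measurable
    finally show "(\<integral>\<^sup>+t. indicator {0..} t * ennreal (exp (- p * (s + t))) * (indicator E \<omega> * (\<integral>\<^sup>+\<omega>'. g (x + X s \<omega> + X (max 0 t) \<omega>') \<partial>M)) \<partial>lborel)
      = indicator E \<omega> * (ennreal (exp (- p * s)) * Res p g (x + X s \<omega>))"
      by (simp add: Res_eq mult.assoc)
  qed
  finally show ?thesis by (simp add: E_def s_def)
qed

lemma Res_measurable [measurable]:
  assumes "0 < p" and [measurable]: "g \<in> borel_measurable borel"
  shows "Res p g \<in> borel_measurable borel"
proof -
  interpret R: finite_measure "resolvent p" using finite_resolvent assms by simp
  show ?thesis unfolding Res_def by measurable
qed

abbreviation path :: "real \<Rightarrow> 'w \<Rightarrow> real \<Rightarrow> real" where "path x \<omega> \<equiv> (\<lambda>t. x + X t \<omega>)"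

lemma path_cadlag: "\<omega> \<in> space M \<Longrightarrow> cadlag (path x \<omega>)"
  using X_cadlag[of \<omega>] unfolding cadlag_def by (auto intro!: tendsto_add) (metis tendsto_add[OF tendsto_const])

lemma strong_markov_grid:
  assumes p: "0 < p" and \<delta>: "0 < \<delta>" and [measurable]: "D \<in> sets borel" "g \<in> borel_measurable borel"
  shows "(\<lambda>\<omega>. if grid_hits D \<delta> (path x \<omega>) then tail_integral p g x (\<delta> * real (grid_first D \<delta> (path x \<omega>))) \<omega> else 0) \<in> borel_measurable M" (is "?A \<in> _")
    "(\<lambda>\<omega>. if grid_hits D \<delta> (path x \<omega>) then ennreal (exp (- p * (\<delta> * real (grid_first D \<delta> (path x \<omega>))))) * Res p g (x + X (\<delta> * real (grid_first D \<delta> (path x \<omega>))) \<omega>) else 0) \<in> borel_measurable M" (is "?B \<in> _")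
    "(\<integral>\<^sup>+\<omega>. (if grid_hits D \<delta> (path x \<omega>) then tail_integral p g x (\<delta> * real (grid_first D \<delta> (path x \<omega>))) \<omega> else 0) \<partial>M) =
     (\<integral>\<^sup>+\<omega>. (if grid_hits D \<delta> (path x \<omega>) then ennreal (exp (- p * (\<delta> * real (grid_first D \<delta> (path x \<omega>))))) * Res p g (x + X (\<delta> * real (grid_first D \<delta> (path x \<omega>))) \<omega>) else 0) \<partial>M)"
proof -
  let ?i = "\<lambda>k. indicator {\<omega>. first_at D \<delta> k (\<lambda>t. x + X t \<omega>)} :: 'w \<Rightarrow> ennreal"
  let ?r = "\<lambda>k \<omega>. ennreal (exp (- p * (\<delta> * real k))) * Res p g (x + X (\<delta> * real k) \<omega>)"
  have [measurable]: "X (\<delta> * real k) \<in> borel_measurable M" for k using \<delta> by (intro X_measurable) auto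
  have [measurable]: "?i k \<in> borel_measurable M" for k using \<delta> by (intro borel_measurable_indicator') auto
  have [measurable]: "Res p g \<in> borel_measurable borel" using p by measurable
  have i: "?i k \<omega> = indicator {k. first_at D \<delta> k (path x \<omega>)} k" for k \<omega> by (auto split: split_indicator)
  have A: "?A = (\<lambda>\<omega>. \<Sum>k. ?i k \<omega> * tail_integral p g x (\<delta> * real k) \<omega>)"
    unfolding i suminf_first_at  ..
  have B: "?B = (\<lambda>\<omega>. \<Sum>k. ?i k \<omega> * ?r k \<omega>)"
    unfolding i suminf_first_at  ..
  show "?A \<in> borel_measurable M" unfolding A by measurable
  show "?B \<in> borel_measurable M" unfolding B by measurable
  show "(\<integral>\<^sup>+\<omega>. ?A \<omega> \<partial>M) = (\<integral>\<^sup>+\<omega>. ?B \<omega> \<partial>M)"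
    unfolding A B by (subst (1 2) nn_integral_suminf) (auto simp: strong_markov_step[OF \<delta>])
qed

definition potential :: "real \<Rightarrow> (real \<Rightarrow> real) \<Rightarrow> real \<Rightarrow> real" where
  "potential p g y = (LINT z|resolvent p. g (y + z))"

lemma integrable_resolvent:
  fixes g :: "real \<Rightarrow> real"
  assumes "0 < p" "g \<in> borel_measurable borel" "\<And>y. \<bar>g y\<bar> \<le> B"
  shows "integrable (resolvent p) (\<lambda>z. g (y + z))"
proof -
  interpret R: finite_measure "resolvent p" using finite_resolvent assms by simp
  show ?thesis using assms by (intro R.integrable_const_bound[where B=B]) auto
qed

lemma Res_potential:
  fixes g :: "real \<Rightarrow> real" and B :: real
  assumes "0 < p" "g \<in> borel_measurable borel" "\<And>y. 0 \<le> g y" "\<And>y. g y \<le> B"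
  shows "Res p (\<lambda>y. ennreal (g y)) y = ennreal (potential p g y)"
  unfolding Res_def potential_def using assms
  by (intro nn_integral_eq_integral integrable_resolvent[where B=B]) auto

lemma potential_bounds:
  fixes g :: "real \<Rightarrow> real" and B :: real
  assumes "0 < p" "g \<in> borel_measurable borel" "\<And>y. 0 \<le> g y" "\<And>y. g y \<le> B"
  shows "0 \<le> potential p g y" "potential p g y \<le> B / p"
proof -
  interpret R: finite_measure "resolvent p" using finite_resolvent assms by simp
  show "0 \<le> potential p g y" unfolding potential_def using assms by (intro integral_nonneg_AE) auto
  have "potential p g y \<le> (LINT z|resolvent p. B)"
    unfolding potential_def using assms order_trans[OF assms(3)[of 0] assms(4)[of 0]]
    by (intro integral_mono integrable_resolvent[where B=B]) auto
  also have "\<dots> = B / p" using assms(1) by (simp add: measure_def emeasure_resolvent)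
  finally show "potential p g y \<le> B / p" .
qed

text \<open>Translation is continuous and the resolvent is finite. This carries the potential
  through the limit of the grid positions in the strong Markov property.\<close>

lemma potential_continuous:
  assumes p: "0 < p" and g: "continuous_on UNIV g" "\<And>y. \<bar>g y\<bar> \<le> B" and y: "y \<longlonglongrightarrow> l"
  shows "(\<lambda>n. potential p g (y n)) \<longlonglongrightarrow> potential p g l"
  unfolding potential_def
proof (rule integral_dominated_convergence[where w="\<lambda>_. B"])
  interpret R: finite_measure "resolvent p" using finite_resolvent p by simp
  have [measurable]: "g \<in> borel_measurable borel" using g(1) by (rule borel_measurable_continuous_onI)
  show "(\<lambda>z. g (l + z)) \<in> borel_measurable (resolvent p)" by measurable
  show "(\<lambda>z. g (y n + z)) \<in> borel_measurable (resolvent p)" for n by measurable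
  show "integrable (resolvent p) (\<lambda>_. B)" by simp
  show "AE z in resolvent p. (\<lambda>n. g (y n + z)) \<longlonglongrightarrow> g (l + z)"
    using g(1) y by (intro AE_I2 continuous_on_tendsto_compose[OF g(1)] tendsto_intros) auto
  show "AE z in resolvent p. norm (g (y n + z)) \<le> B" for n using g(2) by auto
qed

definition hit_transform :: "real set \<Rightarrow> real \<Rightarrow> real \<Rightarrow> (real \<Rightarrow> real) \<Rightarrow> real" where
  "hit_transform D p x v = (LINT \<omega>|M. (if hits D (path x \<omega>)
     then exp (- p * hit_time D (path x \<omega>)) * v (x + X (hit_time D (path x \<omega>)) \<omega>) else 0))"

lemma grid_measurable:
  assumes "0 < \<delta>" and [measurable]: "D \<in> sets borel"
  shows "(\<lambda>\<omega>. if grid_hits D \<delta> (path x \<omega>) then 1 else 0 :: real) \<in> borel_measurable M"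
    "(\<lambda>\<omega>. if grid_hits D \<delta> (path x \<omega>) then \<delta> * real (grid_first D \<delta> (path x \<omega>)) else 0) \<in> borel_measurable M"
    "(\<lambda>\<omega>. if grid_hits D \<delta> (path x \<omega>) then x + X (\<delta> * real (grid_first D \<delta> (path x \<omega>))) \<omega> else 0) \<in> borel_measurable M"
proof -
  have [measurable]: "X (\<delta> * real k) \<in> borel_measurable M" for k using assms by (intro X_measurable) auto
  have [measurable]: "Measurable.pred M (\<lambda>\<omega>. grid_hits D \<delta> (path x \<omega>))" unfolding grid_hits_def by measurable
  have [measurable]: "(\<lambda>\<omega>. grid_first D \<delta> (path x \<omega>)) \<in> M \<rightarrow>\<^sub>M count_space UNIV" unfolding grid_first_def by measurable
  have "(\<lambda>\<omega>. x + X (\<delta> * real (grid_first D \<delta> (path x \<omega>))) \<omega>) \<in> borel_measurable M"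
    by (rule measurable_compose_countable[where f="\<lambda>k \<omega>. x + X (\<delta> * real k) \<omega>"]) measurable
  then show "(\<lambda>\<omega>. if grid_hits D \<delta> (path x \<omega>) then x + X (\<delta> * real (grid_first D \<delta> (path x \<omega>))) \<omega> else 0) \<in> borel_measurable M"
    by measurable
  show "(\<lambda>\<omega>. if grid_hits D \<delta> (path x \<omega>) then 1 else 0 :: real) \<in> borel_measurable M"
    "(\<lambda>\<omega>. if grid_hits D \<delta> (path x \<omega>) then \<delta> * real (grid_first D \<delta> (path x \<omega>)) else 0) \<in> borel_measurable M"
    by measurable
qed

abbreviation mesh :: "nat \<Rightarrow> real" where "mesh n \<equiv> 1 / real (Suc n)"

lemma mesh_tendsto: "mesh \<longlonglongrightarrow> 0"
  using LIMSEQ_inverse_real_of_nat by (simp add: inverse_eq_divide)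

lemma hit_measurable:
  assumes D: "open D"
  shows "Measurable.pred M (\<lambda>\<omega>. hits D (path x \<omega>))" (is ?thesis1)
    "(\<lambda>\<omega>. if hits D (path x \<omega>) then hit_time D (path x \<omega>) else 0) \<in> borel_measurable M" (is ?thesis2)
    "(\<lambda>\<omega>. if hits D (path x \<omega>) then x + X (hit_time D (path x \<omega>)) \<omega> else 0) \<in> borel_measurable M" (is ?thesis3)
proof -
  have [measurable]: "D \<in> sets borel" using D by simp
  have lim: "(\<lambda>n. if grid_hits D (mesh n) (path x \<omega>) then f n else 0) \<longlonglongrightarrow> (if hits D (path x \<omega>) then l else (0::real))"
    if "\<omega> \<in> space M" "hits D (path x \<omega>) \<Longrightarrow> f \<longlonglongrightarrow> l" for \<omega> f l
  proof (cases "hits D (path x \<omega>)")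
    case True
    have "eventually (\<lambda>n. f n = (if grid_hits D (mesh n) (path x \<omega>) then f n else 0)) sequentially"
      by (rule eventually_mono[OF grid_hits_tendsto(1)[OF path_cadlag[OF that(1)] D _ mesh_tendsto True]]) auto
    from Lim_transform_eventually[OF that(2)[OF True] this] show ?thesis using True by simp
  next
    case False
    then show ?thesis using not_hits[of "mesh n" D "path x \<omega>" for n] by simp
  qed
  have "(\<lambda>\<omega>. if hits D (path x \<omega>) then 1 else 0 :: real) \<in> borel_measurable M"
  proof (rule borel_measurable_LIMSEQ_real)
    show "(\<lambda>n. if grid_hits D (mesh n) (path x \<omega>) then 1 else 0) \<longlonglongrightarrow> (if hits D (path x \<omega>) then 1 else 0 :: real)"
      if "\<omega> \<in> space M" for \<omega>
      by (rule lim[OF that]) simp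
  qed (rule grid_measurable, simp_all)
  then have "Measurable.pred M (\<lambda>\<omega>. (if hits D (path x \<omega>) then 1 else 0 :: real) = 1)" by measurable
  then show ?thesis1 by (rule measurable_cong[THEN iffD1, rotated]) auto
  show ?thesis2
  proof (rule borel_measurable_LIMSEQ_real)
    show "(\<lambda>n. if grid_hits D (mesh n) (path x \<omega>) then mesh n * real (grid_first D (mesh n) (path x \<omega>)) else 0)
      \<longlonglongrightarrow> (if hits D (path x \<omega>) then hit_time D (path x \<omega>) else 0)" if "\<omega> \<in> space M" for \<omega>
      by (rule lim[OF that grid_hits_tendsto(2)[OF path_cadlag[OF that] D _ mesh_tendsto]]) simp_all
  qed (rule grid_measurable, simp_all)
  show ?thesis3
  proof (rule borel_measurable_LIMSEQ_real)
    show "(\<lambda>n. if grid_hits D (mesh n) (path x \<omega>) then x + X (mesh n * real (grid_first D (mesh n) (path x \<omega>))) \<omega> else 0)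
      \<longlonglongrightarrow> (if hits D (path x \<omega>) then x + X (hit_time D (path x \<omega>)) \<omega> else 0)" if "\<omega> \<in> space M" for \<omega>
      by (rule lim[OF that grid_hits_tendsto(4)[OF path_cadlag[OF that] D _ mesh_tendsto]]) simp_all
  qed (rule grid_measurable, simp_all)
qed

lemma hit_transform_measurable:
  assumes D: "open D" and [measurable]: "v \<in> borel_measurable borel"
  shows "(\<lambda>\<omega>. if hits D (path x \<omega>)
     then exp (- p * hit_time D (path x \<omega>)) * v (x + X (hit_time D (path x \<omega>)) \<omega>) else 0) \<in> borel_measurable M"
proof -
  define A where "A \<omega> = (if hits D (path x \<omega>) then hit_time D (path x \<omega>) else 0)" for \<omega>
  define B where "B \<omega> = (if hits D (path x \<omega>) then x + X (hit_time D (path x \<omega>)) \<omega> else 0)" for \<omega>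
  define H where "H \<omega> = hits D (path x \<omega>)" for \<omega>
  have [measurable]: "A \<in> borel_measurable M" unfolding A_def[abs_def] by (rule hit_measurable(2)[OF D])
  have [measurable]: "B \<in> borel_measurable M" unfolding B_def[abs_def] by (rule hit_measurable(3)[OF D])
  have [measurable]: "Measurable.pred M H" unfolding H_def[abs_def] by (rule hit_measurable(1)[OF D])
  have "(\<lambda>\<omega>. if H \<omega> then exp (- p * A \<omega>) * v (B \<omega>) else 0) \<in> borel_measurable M" by measurable
  also have "(\<lambda>\<omega>. if H \<omega> then exp (- p * A \<omega>) * v (B \<omega>) else 0) = (\<lambda>\<omega>. if hits D (path x \<omega>)
     then exp (- p * hit_time D (path x \<omega>)) * v (x + X (hit_time D (path x \<omega>)) \<omega>) else 0)"
    by (auto simp: fun_eq_iff A_def B_def H_def)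
  finally show ?thesis .
qed

text \<open>Both sides are limits of their grid versions, dominated by \<open>B / p\<close>: on the
  left the lower limit of the time integral converges, on the right the potential is continuous and
  the positions converge. Measurability of the limit expressions comes from the same
  convergence.\<close>

lemma strong_markov:
  assumes p: "0 < p" and D: "open D" and g: "continuous_on UNIV g" "\<And>y. 0 \<le> g y" "\<And>y. g y \<le> B"
  shows "(\<lambda>\<omega>. if hits D (path x \<omega>) then tail_integral p (\<lambda>y. ennreal (g y)) x (hit_time D (path x \<omega>)) \<omega> else 0) \<in> borel_measurable M"
   "(\<integral>\<^sup>+\<omega>. (if hits D (path x \<omega>) then tail_integral p (\<lambda>y. ennreal (g y)) x (hit_time D (path x \<omega>)) \<omega> else 0) \<partial>M)
     = ennreal (hit_transform D p x (potential p g))"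
proof -
  let ?g = "\<lambda>y. ennreal (g y)"
  have [measurable]: "D \<in> sets borel" using D by simp
  have [measurable]: "g \<in> borel_measurable borel" using g(1) by (rule borel_measurable_continuous_onI)
  have B: "0 \<le> B" using g(2)[of 0] g(3)[of 0] by linarith
  have gabs: "\<bar>g y\<bar> \<le> B" for y using g(2)[of y] g(3)[of y] by simp
  let ?v = "potential p g"
  have vb: "0 \<le> ?v y" "?v y \<le> B / p" for y
    using potential_bounds[OF p, of g B] g by auto
  define A where "A n \<omega> = (if grid_hits D (mesh n) (path x \<omega>) then tail_integral p ?g x (mesh n * real (grid_first D (mesh n) (path x \<omega>))) \<omega> else 0)" for n \<omega>
  define C where "C n \<omega> = (if grid_hits D (mesh n) (path x \<omega>) then ennreal (exp (- p * (mesh n * real (grid_first D (mesh n) (path x \<omega>))))) * Res p ?g (x + X (mesh n * real (grid_first D (mesh n) (path x \<omega>))) \<omega>) else 0)" for n \<omega>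
  define A' where "A' \<omega> = (if hits D (path x \<omega>) then tail_integral p ?g x (hit_time D (path x \<omega>)) \<omega> else 0)" for \<omega>
  define C' where "C' \<omega> = ennreal (if hits D (path x \<omega>) then exp (- p * hit_time D (path x \<omega>)) * ?v (x + X (hit_time D (path x \<omega>)) \<omega>) else 0)" for \<omega>
  have m0: "0 < mesh n" for n by simp
  have [measurable]: "A n \<in> borel_measurable M" for n
    unfolding A_def[abs_def] by (rule strong_markov_grid(1)[OF p m0]) auto
  have [measurable]: "C n \<in> borel_measurable M" for n
    unfolding C_def[abs_def] by (rule strong_markov_grid(2)[OF p m0]) auto
  have AC: "(\<integral>\<^sup>+\<omega>. A n \<omega> \<partial>M) = (\<integral>\<^sup>+\<omega>. C n \<omega> \<partial>M)" for n
    unfolding A_def C_def by (rule strong_markov_grid(3)[OF p m0]) auto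
  have Ri: "Res p ?g y = ennreal (?v y)" for y using Res_potential[OF p, of g B] g by auto
  have kb: "indicator {a..} t * (ennreal (exp (- p * t)) * ?g y) \<le> ennreal B * (indicator {0..} t * ennreal (exp (- p * t)))"
    if "0 \<le> a" for a t y :: real
  proof -
    have "ennreal (exp (- p * t)) * ?g y \<le> ennreal B * ennreal (exp (- p * t))"
      by (subst mult.commute) (intro mult_right_mono ennreal_leI g(3) zero_le)
    then show ?thesis using that by (auto split: split_indicator)
  qed
  have tail_le: "tail_integral p ?g x a \<omega> \<le> ennreal (B / p)" if a: "0 \<le> a" for a \<omega>
  proof -
    have "tail_integral p ?g x a \<omega> \<le> (\<integral>\<^sup>+t. ennreal B * (indicator {0..} t * ennreal (exp (- p * t))) \<partial>lborel)"
      unfolding tail_integral_def by (intro nn_integral_mono kb a)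
    also have "\<dots> = ennreal B * ennreal (1 / p)"
      using nn_integral_exp_tail[OF p, of 0] by (subst nn_integral_cmult) auto
    also have "\<dots> = ennreal (B / p)" using B p by (simp flip: ennreal_mult)
    finally show ?thesis .
  qed
  have Alim: "(\<lambda>n. A n \<omega>) \<longlonglongrightarrow> A' \<omega>" if \<omega>: "\<omega> \<in> space M" for \<omega>
  proof (cases "hits D (path x \<omega>)")
    case False
    then show ?thesis using not_hits[of "mesh n" D "path x \<omega>" for n] by (simp add: A_def A'_def)
  next
    case True
    note G = grid_hits_tendsto[OF path_cadlag[OF \<omega>] D _ mesh_tendsto True, simplified]
    let ?\<sigma> = "\<lambda>n. mesh n * real (grid_first D (mesh n) (path x \<omega>))"
    have [measurable]: "(\<lambda>t. X (max 0 t) \<omega>) \<in> borel_measurable borel" by (rule time_measurable[OF \<omega>])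
    have "(\<lambda>n. tail_integral p ?g x (?\<sigma> n) \<omega>) \<longlonglongrightarrow> A' \<omega>"
      unfolding A'_def if_P[OF True] tail_integral_def
    proof (rule nn_integral_dominated_convergence[where w="\<lambda>t. ennreal B * (indicator {0..} t * ennreal (exp (- p * t)))"])
      show "AE t in lborel. indicator {?\<sigma> n..} t * (ennreal (exp (- p * t)) * ?g (x + X (max 0 t) \<omega>))
         \<le> ennreal B * (indicator {0..} t * ennreal (exp (- p * t)))" for n
        by (intro AE_I2 kb) simp
      show "(\<integral>\<^sup>+t. ennreal B * (indicator {0..} t * ennreal (exp (- p * t))) \<partial>lborel) < \<infinity>"
        using nn_integral_exp_tail[OF p, of 0] by (subst nn_integral_cmult) (auto simp: ennreal_mult_less_top)
      show "AE t in lborel. (\<lambda>n. indicator {?\<sigma> n..} t * (ennreal (exp (- p * t)) * ?g (x + X (max 0 t) \<omega>)))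
         \<longlonglongrightarrow> indicator {hit_time D (path x \<omega>)..} t * (ennreal (exp (- p * t)) * ?g (x + X (max 0 t) \<omega>))"
        \<comment> \<open>At the hitting time itself the indicators need not converge, but a single
          time is a null set.\<close>
        using AE_lborel_singleton[of "hit_time D (path x \<omega>)"]
      proof eventually_elim
        case (elim t)
        have "eventually (\<lambda>n. indicator {?\<sigma> n..} t = (indicator {hit_time D (path x \<omega>)..} t :: ennreal)) sequentially"
        proof (cases "t < hit_time D (path x \<omega>)")
          case True
          show ?thesis using G(3) by eventually_elim (use True in \<open>auto split: split_indicator\<close>)
        next
          case False
          then have "hit_time D (path x \<omega>) < t" using elim by simp
          then have "eventually (\<lambda>n. ?\<sigma> n < t) sequentially" using order_tendstoD(2)[OF G(2)] by simp
          then show ?thesis by eventually_elim (use False in \<open>auto split: split_indicator\<close>)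
        qed
        then have "eventually (\<lambda>n. indicator {?\<sigma> n..} t * (ennreal (exp (- p * t)) * ?g (x + X (max 0 t) \<omega>))
          = indicator {hit_time D (path x \<omega>)..} t * (ennreal (exp (- p * t)) * ?g (x + X (max 0 t) \<omega>))) sequentially"
          by eventually_elim (simp only:)
        then show ?case by (rule tendsto_eventually)
      qed
    qed measurable
    then show ?thesis
      by (rule Lim_transform_eventually) (rule eventually_mono[OF G(1)], simp add: A_def)
  qed
  have Clim: "(\<lambda>n. C n \<omega>) \<longlonglongrightarrow> C' \<omega>" if \<omega>: "\<omega> \<in> space M" for \<omega>
  proof (cases "hits D (path x \<omega>)")
    case False
    then show ?thesis using not_hits[of "mesh n" D "path x \<omega>" for n] by (simp add: C_def C'_def)
  next
    case True
    note G = grid_hits_tendsto[OF path_cadlag[OF \<omega>] D m0 mesh_tendsto True]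
    let ?\<sigma> = "\<lambda>n. mesh n * real (grid_first D (mesh n) (path x \<omega>))"
    have "(\<lambda>n. ennreal (exp (- p * ?\<sigma> n) * ?v (x + X (?\<sigma> n) \<omega>))) \<longlonglongrightarrow> C' \<omega>"
      unfolding C'_def if_P[OF True]
      by (intro tendsto_ennrealI tendsto_mult tendsto_exp tendsto_const potential_continuous[OF p g(1) gabs] G(2) G(4))
    then show ?thesis
      by (rule Lim_transform_eventually)
         (rule eventually_mono[OF G(1)], simp add: C_def Ri ennreal_mult[OF _ vb(1)])
  qed
  show A'm: "A' \<in> borel_measurable M"
    by (rule borel_measurable_LIMSEQ_order[OF Alim]) auto
  have C'm: "C' \<in> borel_measurable M"
    by (rule borel_measurable_LIMSEQ_order[OF Clim]) auto
  have l1: "(\<lambda>n. (\<integral>\<^sup>+\<omega>. A n \<omega> \<partial>M)) \<longlonglongrightarrow> (\<integral>\<^sup>+\<omega>. A' \<omega> \<partial>M)"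
  proof (rule nn_integral_dominated_convergence[where w="\<lambda>_. ennreal (B / p)"])
    show "AE \<omega> in M. A n \<omega> \<le> ennreal (B / p)" for n
    proof (rule AE_I2)
      have "0 \<le> mesh n * real k" for k by simp
      then show "A n \<omega> \<le> ennreal (B / p)" for \<omega> unfolding A_def by (auto intro!: tail_le simp del: of_nat_Suc)
    qed
    show "AE \<omega> in M. (\<lambda>n. A n \<omega>) \<longlonglongrightarrow> A' \<omega>" by (intro AE_I2 Alim)
  qed (use A'm in \<open>simp_all add: emeasure_space_1\<close>)
  have l2: "(\<lambda>n. (\<integral>\<^sup>+\<omega>. C n \<omega> \<partial>M)) \<longlonglongrightarrow> (\<integral>\<^sup>+\<omega>. C' \<omega> \<partial>M)"
  proof (rule nn_integral_dominated_convergence[where w="\<lambda>_. ennreal (B / p)"])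
    have "exp (- p * (mesh n * real k)) * ?v y \<le> 1 * (B / p)" for n k y
      using p vb by (intro mult_mono) auto
    then show "AE \<omega> in M. C n \<omega> \<le> ennreal (B / p)" for n
      by (intro AE_I2) (auto simp: C_def Ri simp flip: ennreal_mult[OF _ vb(1)] intro!: ennreal_leI)
    show "AE \<omega> in M. (\<lambda>n. C n \<omega>) \<longlonglongrightarrow> C' \<omega>" by (intro AE_I2 Clim)
  qed (use C'm in \<open>simp_all add: emeasure_space_1\<close>)
  have "(\<integral>\<^sup>+\<omega>. A' \<omega> \<partial>M) = (\<integral>\<^sup>+\<omega>. C' \<omega> \<partial>M)"
    using LIMSEQ_unique[OF l1] l2 by (simp add: AC)
  also have "\<dots> = ennreal (hit_transform D p x ?v)"
  proof -
    have vm: "?v \<in> borel_measurable borel"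
      by (intro borel_measurable_continuous_onI continuous_at_imp_continuous_on ballI)
         (auto simp: continuous_at_sequentially comp_def intro!: potential_continuous[OF p g(1) gabs])
    have b: "exp (- p * hit_time D (path x \<omega>)) * ?v y \<le> 1 * (B / p)" if "hits D (path x \<omega>)" for \<omega> y
      using p vb hit_time_facts(1)[OF that] by (intro mult_mono) auto
    have nn: "0 \<le> exp a * ?v y" for a y using vb(1) by simp
    show ?thesis
      unfolding C'_def hit_transform_def
    proof (rule nn_integral_eq_integral)
      show "integrable M (\<lambda>\<omega>. if hits D (path x \<omega>) then exp (- p * hit_time D (path x \<omega>)) * ?v (x + X (hit_time D (path x \<omega>)) \<omega>) else 0)"
      proof (rule integrable_const_bound[OF _ hit_transform_measurable[OF D vm]])
        show "AE \<omega> in M. norm (if hits D (path x \<omega>) then exp (- p * hit_time D (path x \<omega>)) * ?v (x + X (hit_time D (path x \<omega>)) \<omega>) else 0) \<le> B / p"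
        proof (rule AE_I2)
          fix \<omega>
          show "norm (if hits D (path x \<omega>) then exp (- p * hit_time D (path x \<omega>)) * ?v (x + X (hit_time D (path x \<omega>)) \<omega>) else 0) \<le> B / p"
            using b[of \<omega>] B p nn by (cases "hits D (path x \<omega>)") (simp_all only: if_True if_False real_norm_def abs_of_nonneg mult_1 abs_zero, simp)
        qed
      qed
      show "AE \<omega> in M. 0 \<le> (if hits D (path x \<omega>) then exp (- p * hit_time D (path x \<omega>)) * ?v (x + X (hit_time D (path x \<omega>)) \<omega>) else 0)"
        using nn by (intro AE_I2) simp
    qed
  qed
  finally show "(\<integral>\<^sup>+\<omega>. A' \<omega> \<partial>M) = ennreal (hit_transform D p x ?v)" .
qed

text \<open>The transform of the potential is the part of the discounted occupation after the
  hitting time. What is left out is nonnegative, and it is zero if \<open>g\<close> vanishes outside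
  \<open>D\<close>, because the path is outside \<open>D\<close> before the hitting time.\<close>

lemma strong_markov_le:
  assumes p: "0 < p" and D: "open D" and g: "continuous_on UNIV g" "\<And>y. 0 \<le> g y" "\<And>y. g y \<le> B"
  shows "hit_transform D p x (potential p g) \<le> potential p g x"
    and "(\<And>y. y \<notin> D \<Longrightarrow> g y = 0) \<Longrightarrow> hit_transform D p x (potential p g) = potential p g x"
proof -
  let ?g = "\<lambda>y. ennreal (g y)"
  have [measurable]: "g \<in> borel_measurable borel" using g(1) by (rule borel_measurable_continuous_onI)
  have "ennreal (potential p g x) = Res p ?g x" using Res_potential[OF p, of g B] g by auto
  also have "\<dots> = (\<integral>\<^sup>+t. (\<integral>\<^sup>+\<omega>. indicator {0..} t * (ennreal (exp (- p * t)) * ?g (x + X (max 0 t) \<omega>)) \<partial>M) \<partial>lborel)"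
    by (subst Res_eq) (auto intro!: nn_integral_cong simp: nn_integral_cmult mult.assoc)
  also have "\<dots> = (\<integral>\<^sup>+\<omega>. tail_integral p ?g x 0 \<omega> \<partial>M)"
    unfolding tail_integral_def by (rule nn_integral_lborel_swap[symmetric]) measurable
  finally have eq: "ennreal (potential p g x) = (\<integral>\<^sup>+\<omega>. tail_integral p ?g x 0 \<omega> \<partial>M)" .
  have pos: "0 \<le> potential p g x" using potential_bounds[OF p, of g B] g by auto
  have "ennreal (hit_transform D p x (potential p g)) \<le> ennreal (potential p g x)"
    unfolding strong_markov(2)[OF p D g, symmetric] eq tail_integral_def
  proof (intro nn_integral_mono)
    fix \<omega>
    show "(if hits D (path x \<omega>) then \<integral>\<^sup>+t. indicator {hit_time D (path x \<omega>)..} t * (ennreal (exp (- p * t)) * ?g (x + X (max 0 t) \<omega>)) \<partial>lborel else 0)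
      \<le> (\<integral>\<^sup>+t. indicator {0..} t * (ennreal (exp (- p * t)) * ?g (x + X (max 0 t) \<omega>)) \<partial>lborel)"
      using hit_time_facts(1)[of D "path x \<omega>"]
      by (auto intro!: nn_integral_mono split: split_indicator)
  qed
  then show "hit_transform D p x (potential p g) \<le> potential p g x" using pos by simp
  assume z: "\<And>y. y \<notin> D \<Longrightarrow> g y = 0"
  have "ennreal (hit_transform D p x (potential p g)) = ennreal (potential p g x)"
    unfolding strong_markov(2)[OF p D g, symmetric] eq
  proof (intro nn_integral_cong)
    fix \<omega>
    have tz: "tail_integral p ?g x 0 \<omega> = (\<integral>\<^sup>+t. indicator {0<..} t * (ennreal (exp (- p * t)) * ?g (x + X t \<omega>)) \<partial>lborel)"
      unfolding tail_integral_def
      by (intro nn_integral_cong_AE eventually_mono[OF AE_lborel_singleton[of 0]]) (auto split: split_indicator)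
    show "(if hits D (path x \<omega>) then tail_integral p ?g x (hit_time D (path x \<omega>)) \<omega> else 0) = tail_integral p ?g x 0 \<omega>"
    proof (cases "hits D (path x \<omega>)")
      case True
      have "g (x + X t \<omega>) = 0" if "0 < t" "t < hit_time D (path x \<omega>)" for t
        using hit_time_facts(2)[OF True, of t] that by (intro z) auto
      then show ?thesis unfolding tz if_P[OF True] tail_integral_def
        using hit_time_facts(1)[OF True]
        by (intro nn_integral_cong_AE eventually_mono[OF AE_lborel_singleton[of 0]]) (auto split: split_indicator)
    next
      case False
      then have g0: "g (x + X t \<omega>) = 0" if "0 < t" for t using that by (intro z) (auto simp: hits_def)
      have "(\<integral>\<^sup>+t. indicator {0<..} t * (ennreal (exp (- p * t)) * ?g (x + X t \<omega>)) \<partial>lborel) = (\<integral>\<^sup>+(t::real). 0 \<partial>lborel)"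
        by (intro nn_integral_cong) (auto simp: g0 split: split_indicator)
      then show ?thesis unfolding tz using False by simp
    qed
  qed
  moreover have "0 \<le> hit_transform D p x (potential p g)"
    unfolding hit_transform_def using potential_bounds[OF p, of g B] g by (intro integral_nonneg_AE) auto
  ultimately show "hit_transform D p x (potential p g) = potential p g x" using pos by simp
qed

end

section \<open>Exponent and scale functions of a spectrally negative process\<close>

text \<open>An identity between a measure and a difference of densities is proved by adding the
  subtracted density to the measure; this lemma supplies the sum.\<close>

lemma sum_measure_ex:
  fixes M N :: "'a measure"
  assumes s: "sets N = sets M"
  shows "\<exists>S. sets S = sets M \<and> (\<forall>f\<in>borel_measurable M. (\<integral>\<^sup>+x. f x \<partial>S) = (\<integral>\<^sup>+x. f x \<partial>M) + (\<integral>\<^sup>+x. f x \<partial>N))"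
proof -
  define S where "S = measure_of (space M) (sets M) (\<lambda>A. emeasure M A + emeasure N A)"
  have sets: "sets S = sets M" by (simp add: S_def)
  note [measurable_cong] = s sets
  have sN: "space N = space M" using s by (rule sets_eq_imp_space_eq)
  have em: "emeasure S A = emeasure M A + emeasure N A" if "A \<in> sets M" for A
  proof (rule emeasure_measure_of[OF S_def])
    show "countably_additive (sets S) (\<lambda>A. emeasure M A + emeasure N A)"
    proof (rule countably_additiveI)
      fix A :: "nat \<Rightarrow> 'a set" assume A: "range A \<subseteq> sets S" "disjoint_family A" "\<Union> (range A) \<in> sets S"
      have "(\<Sum>i. emeasure M (A i) + emeasure N (A i)) = (\<Sum>i. emeasure M (A i)) + (\<Sum>i. emeasure N (A i))"
        by (rule suminf_add[symmetric]) auto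
      also have "\<dots> = emeasure M (\<Union> (range A)) + emeasure N (\<Union> (range A))"
        using A by (simp add: suminf_emeasure sets s)
      finally show "(\<Sum>i. emeasure M (A i) + emeasure N (A i)) = emeasure M (\<Union> (range A)) + emeasure N (\<Union> (range A))" .
    qed
  qed (use that sets.space_closed in \<open>auto simp: positive_def sets\<close>)
  have "(\<integral>\<^sup>+x. f x \<partial>S) = (\<integral>\<^sup>+x. f x \<partial>M) + (\<integral>\<^sup>+x. f x \<partial>N)" if "f \<in> borel_measurable M" for f
    using that
  proof (induction rule: borel_measurable_induct)
    case (cong f g)
    have "(\<integral>\<^sup>+x. f x \<partial>L) = (\<integral>\<^sup>+x. g x \<partial>L)" if "space L = space M" for L
      using cong(3) that by (intro nn_integral_cong) auto
    from this[of S] this[of M] this[of N] show ?case using cong(4) sN by (simp add: sets_eq_imp_space_eq[OF sets])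
  next
    case (set A)
    then show ?case by (simp add: em s sets)
  next
    case (mult u c)
    then have "u \<in> borel_measurable S" "u \<in> borel_measurable N" by simp_all
    then show ?case using mult by (simp add: nn_integral_cmult distrib_left)
  next
    case (add u v)
    then have "u \<in> borel_measurable S" "u \<in> borel_measurable N" "v \<in> borel_measurable S" "v \<in> borel_measurable N"
      by simp_all
    then show ?case using add by (simp add: nn_integral_add ac_simps)
  next
    case (seq U)
    have lim: "(\<lambda>i. \<integral>\<^sup>+x. U i x \<partial>L) \<longlonglongrightarrow> (\<integral>\<^sup>+x. (SUP i. U i) x \<partial>L)" if "sets L = sets M" for L
    proof (rule nn_integral_LIMSEQ)
      show "incseq U" by (rule seq)
      show "U i \<in> borel_measurable L" for i using seq(1) measurable_cong_sets[OF that refl] by blast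
      show "(\<lambda>i. U i x) \<longlonglongrightarrow> (SUP i. U i) x" for x
      proof -
        have "incseq (\<lambda>i. U i x)" using \<open>incseq U\<close> by (auto simp: incseq_def le_fun_def)
        then have "(\<lambda>i. U i x) \<longlonglongrightarrow> (SUP i. U i x)" by (rule LIMSEQ_SUP)
        moreover have "(SUP i. U i) x = (SUP i. U i x)" by (simp add: image_comp)
        ultimately show ?thesis by simp
      qed
    qed
    have "(\<lambda>i. (\<integral>\<^sup>+x. U i x \<partial>M) + (\<integral>\<^sup>+x. U i x \<partial>N)) \<longlonglongrightarrow> (\<integral>\<^sup>+x. (SUP i. U i) x \<partial>M) + (\<integral>\<^sup>+x. (SUP i. U i) x \<partial>N)"
      by (intro tendsto_add lim s refl)
    then show ?case using LIMSEQ_unique[OF lim[OF sets]] seq.IH by simp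
  qed
  then show ?thesis using sets by blast
qed

section \<open>The Laplace exponent, its right inverse and passage upwards\<close>

locale spectrally_negative = levy M X for M :: "'w measure" and X +
  fixes \<kappa> :: "real \<Rightarrow> real" and W :: "real \<Rightarrow> real \<Rightarrow> real"
  assumes no_positive_jumps: "AE \<omega> in M. \<forall>t>0. X t \<omega> \<le> Lim (at_left t) (\<lambda>s. X s \<omega>)"
    and exponent: "\<And>\<theta> t. 0 \<le> \<theta> \<Longrightarrow> 0 \<le> t \<Longrightarrow> (LINT \<omega>|M. exp (\<theta> * X t \<omega>)) = exp (t * \<kappa> \<theta>)"
    and W: "\<And>p. 0 < p \<Longrightarrow> scale_function \<kappa> p (W p)"
begin

abbreviation "\<Phi> \<equiv> right_inverse \<kappa>"

text \<open>A function that is not integrable has integral 0, whereas the given value of the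
  integral is positive.\<close>

lemma exp_integrable: "0 \<le> \<theta> \<Longrightarrow> 0 \<le> t \<Longrightarrow> integrable M (\<lambda>\<omega>. exp (\<theta> * X t \<omega>))"
  using exponent[of \<theta> t] not_integrable_integral_eq[of M "\<lambda>\<omega>. exp (\<theta> * X t \<omega>)"] by fastforce

lemma nn_exponent: "0 \<le> \<theta> \<Longrightarrow> 0 \<le> t \<Longrightarrow> (\<integral>\<^sup>+\<omega>. ennreal (exp (\<theta> * X t \<omega>)) \<partial>M) = ennreal (exp (t * \<kappa> \<theta>))"
  using nn_integral_eq_integral[OF exp_integrable[of \<theta> t]] exponent[of \<theta> t] by simp

lemma \<kappa>_0: "\<kappa> 0 = 0"
  using exponent[of 0 1] by (simp add: prob_space)

text \<open>Each exponential is normalised to mean 1 by subtracting its \<kappa>. Pointwise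
  convexity of \<open>exp\<close> then bounds the mean of \<open>exp (c * X 1 - k)\<close> by 1,
  which says that \<kappa>(c) is at most k.\<close>

lemma \<kappa>_convex:
  assumes "0 \<le> a" "0 \<le> b" "0 \<le> u" "u \<le> 1"
  shows "\<kappa> (u * a + (1 - u) * b) \<le> u * \<kappa> a + (1 - u) * \<kappa> b"
proof -
  define c where "c = u * a + (1 - u) * b"
  define k where "k = u * \<kappa> a + (1 - u) * \<kappa> b"
  have c: "0 \<le> c" using assms by (simp add: c_def)
  have i: "integrable M (\<lambda>\<omega>. exp (\<theta> * X 1 \<omega> - d))" "(LINT \<omega>|M. exp (\<theta> * X 1 \<omega> - d)) = exp (\<kappa> \<theta> - d)"
    if "0 \<le> \<theta>" for \<theta> d
    using exp_integrable[OF that, of 1] exponent[OF that, of 1] by (simp_all add: exp_diff)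
  have "exp (\<kappa> c - k) = (LINT \<omega>|M. exp (c * X 1 \<omega> - k))" using i(2)[OF c] by simp
  also have "\<dots> \<le> (LINT \<omega>|M. u * exp (a * X 1 \<omega> - \<kappa> a) + (1 - u) * exp (b * X 1 \<omega> - \<kappa> b))"
  proof (rule integral_mono)
    fix \<omega>
    have "exp ((1 - (1 - u)) * (a * X 1 \<omega> - \<kappa> a) + (1 - u) * (b * X 1 \<omega> - \<kappa> b))
      \<le> (1 - (1 - u)) * exp (a * X 1 \<omega> - \<kappa> a) + (1 - u) * exp (b * X 1 \<omega> - \<kappa> b)"
      using convex_onD[OF exp_convex, of "1 - u" "a * X 1 \<omega> - \<kappa> a" "b * X 1 \<omega> - \<kappa> b"] assms by simp
    then show "exp (c * X 1 \<omega> - k) \<le> u * exp (a * X 1 \<omega> - \<kappa> a) + (1 - u) * exp (b * X 1 \<omega> - \<kappa> b)"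
      by (simp add: c_def k_def algebra_simps)
  qed (use assms i c in auto)
  also have "\<dots> = 1" using i assms by simp
  finally show ?thesis by (simp add: c_def k_def)
qed

lemma \<kappa>_continuous: "continuous_on {0<..} \<kappa>"
proof (rule convex_on_continuous)
  show "convex_on {0<..} \<kappa>"
  proof (rule convex_onI)
    fix t x y :: real assume "0 < t" "t < 1" "x \<in> {0<..}" "y \<in> {0<..}"
    then show "\<kappa> ((1 - t) *\<^sub>R x + t *\<^sub>R y) \<le> (1 - t) * \<kappa> x + t * \<kappa> y"
      using \<kappa>_convex[of x y "1 - t"] by simp
  qed simp
qed simp

lemma \<kappa>_star: "0 \<le> a \<Longrightarrow> 0 \<le> u \<Longrightarrow> u \<le> 1 \<Longrightarrow> \<kappa> (u * a) \<le> u * \<kappa> a"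
  using \<kappa>_convex[of a 0 u] \<kappa>_0 by simp

lemma W_nonneg: "0 < p \<Longrightarrow> 0 \<le> W p x" and W_neg: "0 < p \<Longrightarrow> x < 0 \<Longrightarrow> W p x = 0"
  and W_cont: "0 < p \<Longrightarrow> continuous_on {0..} (W p)"
  using W[of p] by (auto simp: scale_function_def)

lemma W_mono: assumes "0 < p" "x \<le> y" shows "W p x \<le> W p y"
proof (cases "0 \<le> x")
  case True
  have "strict_mono_on {0..} (W p)" using W[OF assms(1)] by (simp add: scale_function_def)
  then show ?thesis using True assms(2)
    by (cases "x = y") (auto simp: strict_mono_on_def less_le)
qed (use W_nonneg[OF assms(1)] W_neg[OF assms(1), of x] in auto)

lemma W_measurable [measurable]: assumes "0 < p" shows "W p \<in> borel_measurable borel"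
proof -
  have "(\<lambda>x. indicator {0..} x *\<^sub>R W p x) \<in> borel_measurable borel"
    using W_cont[OF assms] by (intro borel_measurable_continuous_on_indicator) auto
  also have "(\<lambda>x. indicator {0..} x *\<^sub>R W p x) = W p"
    using W_neg[OF assms] by (auto simp: fun_eq_iff split: split_indicator)
  finally show ?thesis .
qed

lemma W_laplace:
  assumes "0 < p" "\<Phi> p < \<theta>"
  shows "(LINT x|lborel. exp (- \<theta> * x) * W p x) = 1 / (\<kappa> \<theta> - p)"
proof -
  have "1 / (\<kappa> \<theta> - p) = (LINT x:{0<..}|lborel. exp (- \<theta> * x) * W p x)"
    using W[OF assms(1)] assms(2) by (simp add: scale_function_def interval_lebesgue_integral_0_infty)
  also have "\<dots> = (LINT x|lborel. exp (- \<theta> * x) * W p x)"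
    unfolding set_lebesgue_integral_def
  proof (rule integral_cong_AE)
    show "AE x in lborel. indicat_real {0<..} x *\<^sub>R (exp (- \<theta> * x) * W p x) = exp (- \<theta> * x) * W p x"
      using AE_lborel_singleton[of 0] by eventually_elim (use W_neg[OF assms(1)] in \<open>auto split: split_indicator\<close>)
  qed (use assms in measurable)
  finally show ?thesis ..
qed

text \<open>The transform of the nonnegative function \<open>W p\<close> is nonnegative. Equality is
  not excluded at this point, because division by zero gives 0; strictness follows in
  \<open>\<Phi>_root\<close>.\<close>

lemma \<kappa>_large: assumes "0 < p" "\<Phi> p < \<theta>" shows "p \<le> \<kappa> \<theta>"
proof -
  have "0 \<le> (LINT x|lborel. exp (- \<theta> * x) * W p x)"
    using W_nonneg[OF assms(1)] by (intro integral_nonneg_AE) auto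
  then show ?thesis unfolding W_laplace[OF assms] by (simp add: zero_le_divide_iff)
qed

text \<open>Convexity and \<kappa>(0) = 0 make \<kappa>(\<theta>)/\<theta> nondecreasing. So once
  \<kappa> takes the positive value \<open>p\<close> at a point \<open>l\<close>, it is below
  \<open>p\<close> to the left and above \<open>p\<close> to the right: the set in the definition of
  the right inverse is the singleton of \<open>l\<close>, and its supremum is an actual
  root.\<close>

lemma \<Phi>_root:
  assumes p: "0 < p"
  shows "0 < \<Phi> p" "\<kappa> (\<Phi> p) = p" "\<And>\<theta>. 0 \<le> \<theta> \<Longrightarrow> \<theta> < \<Phi> p \<Longrightarrow> \<kappa> \<theta> < p" "\<And>\<theta>. \<Phi> p < \<theta> \<Longrightarrow> p < \<kappa> \<theta>"
proof -
  \<comment> \<open>So far \<Phi>(p) is the supremum of a set that might be empty, so its sign is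
    unknown; the maximum with 0 provides a positive point to which \<open>\<kappa>_large\<close>
    applies.\<close>
  define \<theta>1 where "\<theta>1 = max 0 (\<Phi> p) + 1"
  have \<theta>1: "0 < \<theta>1" "p \<le> \<kappa> \<theta>1" using \<kappa>_large[OF p, of \<theta>1] by (auto simp: \<theta>1_def)
  \<comment> \<open>Chosen so that \<kappa> is at most \<open>p / 2\<close> at
    \<open>u * \<theta>1\<close>, still inside the positive half line, where \<kappa> is
    continuous.\<close>
  define u where "u = p / (2 * \<kappa> \<theta>1)"
  have u: "0 < u" "u \<le> 1 / 2" using p \<theta>1 by (auto simp: u_def field_simps)
  have "\<kappa> (u * \<theta>1) \<le> u * \<kappa> \<theta>1" using u \<theta>1 by (intro \<kappa>_star) auto
  also have "\<dots> = p / 2" using p \<theta>1 by (simp add: u_def)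
  finally have "\<kappa> (u * \<theta>1) \<le> p" using p by simp
  moreover have "u * \<theta>1 \<le> \<theta>1" using u \<theta>1 by simp
  moreover have u1: "0 < u * \<theta>1" using u \<theta>1 by simp
  moreover have "continuous_on {u * \<theta>1..\<theta>1} \<kappa>"
    using u1 by (intro continuous_on_subset[OF \<kappa>_continuous]) auto
  ultimately obtain l where l: "u * \<theta>1 \<le> l" "l \<le> \<theta>1" "\<kappa> l = p"
    using IVT'[of \<kappa> "u * \<theta>1" p \<theta>1] \<theta>1 by blast
  have l0: "0 < l" using l(1) u1 by linarith
  have below: "\<kappa> \<theta> < p" if "0 \<le> \<theta>" "\<theta> < l" for \<theta>
  proof -
    have "\<kappa> \<theta> \<le> \<theta> / l * p" using \<kappa>_star[of l "\<theta> / l"] that l0 l by simp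
    also have "\<dots> < p" using that l0 p by (simp add: field_simps)
    finally show ?thesis .
  qed
  have above: "p < \<kappa> \<theta>" if "l < \<theta>" for \<theta>
  proof -
    have *: "p \<le> l / \<theta> * \<kappa> \<theta>" using \<kappa>_star[of \<theta> "l / \<theta>"] that l0 l by simp
    then have "0 < \<kappa> \<theta>" using p that l0 by (smt (verit) divide_pos_pos mult_nonneg_nonpos)
    then have "l / \<theta> * \<kappa> \<theta> < \<kappa> \<theta>" using that l0 by (simp add: field_simps)
    with * show ?thesis by linarith
  qed
  have "{m. 0 \<le> m \<and> \<kappa> m = p} = {l}"
    using l(3) l0 below above by (auto, metis linorder_cases order_less_irrefl)
  then have "\<Phi> p = l" by (simp add: right_inverse_def)
  then show "0 < \<Phi> p" "\<kappa> (\<Phi> p) = p" "\<And>\<theta>. 0 \<le> \<theta> \<Longrightarrow> \<theta> < \<Phi> p \<Longrightarrow> \<kappa> \<theta> < p" "\<And>\<theta>. \<Phi> p < \<theta> \<Longrightarrow> p < \<kappa> \<theta>"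
    using l0 l below above by auto
qed

lemma \<Phi>_less: assumes "0 < q" "q < p" shows "\<Phi> q < \<Phi> p"
  using \<Phi>_root(2,4)[of p] \<Phi>_root(1,2)[of q] assms by (metis linorder_cases order_less_asym less_trans)

lemma W_integrable: "0 < p \<Longrightarrow> \<Phi> p < \<theta> \<Longrightarrow> integrable lborel (\<lambda>x. exp (- \<theta> * x) * W p x)"
  using W_laplace[of p \<theta>] \<Phi>_root(4)[of p \<theta>] not_integrable_integral_eq[of lborel "\<lambda>x. exp (- \<theta> * x) * W p x"] by fastforce

lemma W_laplace_nn: "0 < p \<Longrightarrow> \<Phi> p < \<theta> \<Longrightarrow> (\<integral>\<^sup>+x. ennreal (exp (- \<theta> * x) * W p x) \<partial>lborel) = ennreal (1 / (\<kappa> \<theta> - p))"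
  using nn_integral_eq_integral[OF W_integrable[of p \<theta>]] W_laplace[of p \<theta>] W_nonneg[of p] by simp

text \<open>Below \<Phi>(p) the effective discount rate p - \<kappa>(\<theta>) is positive. Above
  \<Phi>(p) the full exponential integral is infinite, and only truncated ones are used
  later.\<close>

lemma resolvent_exp:
  assumes "0 < p" "0 \<le> \<theta>" "\<theta> < \<Phi> p"
  shows "(\<integral>\<^sup>+y. ennreal (exp (\<theta> * y)) \<partial>resolvent p) = ennreal (1 / (p - \<kappa> \<theta>))"
proof -
  have "(\<integral>\<^sup>+y. ennreal (exp (\<theta> * y)) \<partial>resolvent p)
     = (\<integral>\<^sup>+t. indicator {0..} t * ennreal (exp (- (p - \<kappa> \<theta>) * t)) \<partial>lborel)"
    by (subst nn_integral_resolvent)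
       (auto intro!: nn_integral_cong simp: nn_exponent assms split: split_indicator simp flip: ennreal_mult exp_add simp: algebra_simps)
  then show ?thesis using nn_integral_exp_tail[of "p - \<kappa> \<theta>" 0] \<Phi>_root(3)[OF assms] by simp
qed

text \<open>Right continuity puts the position at the hitting time at or above \<open>z\<close>, the
  left limit there is at most \<open>z\<close>, and there is no upward jump. The hitting time is
  positive because the path starts at 0, below \<open>z\<close>.\<close>

lemma crossing_level:
  assumes z: "0 < z"
  shows "AE \<omega> in M. hits {z<..} (\<lambda>t. X t \<omega>) \<longrightarrow> X (hit_time {z<..} (\<lambda>t. X t \<omega>)) \<omega> = z"
proof -
  have "AE \<omega> in M. \<omega> \<in> space M" by (rule AE_space)
  then show ?thesis using X_0 no_positive_jumps
  proof eventually_elim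
    case (elim \<omega>)
    let ?f = "\<lambda>t. X t \<omega>"
    have c: "cadlag ?f" using X_cadlag elim by simp
    show ?case
    proof
      assume h: "hits {z<..} ?f"
      define \<tau> where "\<tau> = hit_time {z<..} ?f"
      note H = hit_time_facts[OF h, folded \<tau>_def]
      have ge: "z \<le> ?f \<tau>"
      proof (rule ccontr)
        assume "\<not> z \<le> ?f \<tau>"
        moreover have "(?f \<longlongrightarrow> ?f \<tau>) (at_right \<tau>)" using c H(1) by (auto simp: cadlag_def)
        ultimately have "eventually (\<lambda>s. ?f s < z) (at_right \<tau>)" by (intro order_tendstoD(2)) auto
        then obtain u where u: "\<tau> < u" "\<And>s. \<tau> < s \<Longrightarrow> s < u \<Longrightarrow> ?f s < z"
          by (auto simp: eventually_at_right_field)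
        obtain t where t: "0 < t" "?f t \<in> {z<..}" "t < \<tau> + (u - \<tau>)" using H(3)[of "u - \<tau>"] u by auto
        have "\<tau> \<le> t" using H(2) t by auto
        then show False using t u(2)[of t] \<open>\<not> z \<le> ?f \<tau>\<close> by (cases "t = \<tau>") auto
      qed
      then have "\<tau> \<noteq> 0" using elim z by auto
      then have \<tau>: "0 < \<tau>" using H(1) by simp
      then obtain L where L: "(?f \<longlongrightarrow> L) (at_left \<tau>)" using c by (auto simp: cadlag_def)
      have "L \<le> z"
      proof (rule tendsto_upperbound[OF L])
        have "?f s \<le> z" if "0 < s" "s < \<tau>" for s using H(2)[of s] that by force
        then show "eventually (\<lambda>s. ?f s \<le> z) (at_left \<tau>)"
          unfolding eventually_at_left_field using \<tau> by blast
      qed simp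
      moreover have "Lim (at_left \<tau>) ?f = L" using L by (intro tendsto_Lim) auto
      ultimately have "?f \<tau> \<le> z" using elim \<tau> by force
      with ge show "X (hit_time {z<..} ?f) \<omega> = z" by (simp add: \<tau>_def)
    qed
  qed
qed

text \<open>The Laplace transform at \<open>p\<close> of the first passage time above
  \<open>z\<close>; \<open>\<rho>_eq\<close> finds it to be exp(-\<Phi>(p) z).\<close>

definition \<rho> :: "real \<Rightarrow> real \<Rightarrow> real" where
  "\<rho> p z = hit_transform {z<..} p 0 (\<lambda>_. 1)"

lemma \<rho>_nonneg: "0 \<le> \<rho> p z"
  unfolding \<rho>_def hit_transform_def by (intro integral_nonneg_AE) auto

lemma hit_transform_up:
  assumes z: "0 < z" and [measurable]: "v \<in> borel_measurable borel"
  shows "hit_transform {z<..} p 0 v = \<rho> p z * v z"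
proof -
  have "hit_transform {z<..} p 0 v = (LINT \<omega>|M. (if hits {z<..} (path 0 \<omega>)
     then exp (- p * hit_time {z<..} (path 0 \<omega>)) * 1 else 0) * v z)"
    unfolding hit_transform_def
  proof (rule integral_cong_AE)
    show "(\<lambda>\<omega>. if hits {z<..} (path 0 \<omega>) then exp (- p * hit_time {z<..} (path 0 \<omega>)) * v (0 + X (hit_time {z<..} (path 0 \<omega>)) \<omega>) else 0) \<in> borel_measurable M"
      by (rule hit_transform_measurable) auto
    show "(\<lambda>\<omega>. (if hits {z<..} (path 0 \<omega>) then exp (- p * hit_time {z<..} (path 0 \<omega>)) * 1 else 0) * v z) \<in> borel_measurable M"
      by (intro borel_measurable_times hit_transform_measurable[where v="\<lambda>_. 1"]) auto
    show "AE \<omega> in M. (if hits {z<..} (path 0 \<omega>) then exp (- p * hit_time {z<..} (path 0 \<omega>)) * v (0 + X (hit_time {z<..} (path 0 \<omega>)) \<omega>) else 0)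
       = (if hits {z<..} (path 0 \<omega>) then exp (- p * hit_time {z<..} (path 0 \<omega>)) * 1 else 0) * v z"
      using crossing_level[OF z] by eventually_elim auto
  qed
  also have "\<dots> = \<rho> p z * v z" by (simp add: \<rho>_def hit_transform_def)
  finally show ?thesis .
qed

text \<open>Time spent above \<open>z\<close> is spent after the first passage over
  \<open>z\<close>, and by the absence of positive jumps the process restarts exactly at
  \<open>z\<close>. Hence the resolvent above \<open>z\<close> is \<rho> times a translate of the
  resolvent on the positive half line. Ramps give this for half lines, and half lines determine the
  measures.\<close>

lemma resolvent_shift:
  assumes p: "0 < p" and z: "0 < z" and f[measurable]: "f \<in> borel_measurable borel"
  shows "(\<integral>\<^sup>+y. indicator {z<..} y * f (y - z) \<partial>resolvent p) = ennreal (\<rho> p z) * (\<integral>\<^sup>+y. indicator {0<..} y * f y \<partial>resolvent p)"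
proof -
  interpret R: finite_measure "resolvent p" using finite_resolvent p by simp
  have tail: "emeasure (resolvent p) {z + a<..} = ennreal (\<rho> p z) * emeasure (resolvent p) {a<..}" if a: "0 \<le> a" for a
  proof -
    let ?g = "\<lambda>n y. min 1 (real n * max 0 (y - (z + a)))"
    have g: "continuous_on UNIV (?g n)" "\<And>y. 0 \<le> ?g n y" "\<And>y. ?g n y \<le> 1" "?g n \<in> borel_measurable borel" for n
      by (auto intro!: continuous_intros)
    have vm: "potential p (?g n) \<in> borel_measurable borel" for n
      by (intro borel_measurable_continuous_onI continuous_at_imp_continuous_on ballI)
         (auto simp: continuous_at_sequentially comp_def intro!: potential_continuous[OF p g(1), of n 1])
    have "potential p (?g n) 0 = \<rho> p z * potential p (?g n) z" for n
      using strong_markov_le(2)[OF p _ g(1,2,3), of "{z<..}" n 0] hit_transform_up[OF z vm, of p n] a by simp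
    then have "Res p (\<lambda>y. ennreal (?g n y)) 0 = ennreal (\<rho> p z) * Res p (\<lambda>y. ennreal (?g n y)) z" for n
      using Res_potential[OF p g(4,2,3)] potential_bounds(1)[OF p g(4,2,3)] \<rho>_nonneg by (simp add: ennreal_mult)
    then have eq: "(\<integral>\<^sup>+y. ennreal (min 1 (real n * max 0 (y - (z + a)))) \<partial>resolvent p)
       = ennreal (\<rho> p z) * (\<integral>\<^sup>+y. ennreal (min 1 (real n * max 0 (y - a))) \<partial>resolvent p)" for n
      by (simp add: Res_def)
    have *: "{y. 0 < max 0 (y - c)} = {c<..}" for c :: real by auto
    have lim: "(\<lambda>n. \<integral>\<^sup>+y. ennreal (min 1 (real n * max 0 (y - c))) \<partial>resolvent p) \<longlonglongrightarrow> emeasure (resolvent p) {c<..}" for c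
      using nn_integral_ramp_LIMSEQ[of "resolvent p" "\<lambda>y. max 0 (y - c)"] by (simp add: *)
    have "(\<lambda>n. ennreal (\<rho> p z) * (\<integral>\<^sup>+y. ennreal (min 1 (real n * max 0 (y - a))) \<partial>resolvent p)) \<longlonglongrightarrow> ennreal (\<rho> p z) * emeasure (resolvent p) {a<..}"
      by (intro ennreal_tendsto_cmult lim) simp
    from LIMSEQ_unique[OF lim[of "z + a", unfolded eq] this] show ?thesis .
  qed
  define M1 where "M1 = distr (density (resolvent p) (indicator {z<..})) borel (\<lambda>y. y - z)"
  define M2 where "M2 = density (resolvent p) (\<lambda>y. ennreal (\<rho> p z) * indicator {0<..} y)"
  have "M1 = M2"
  proof (rule measure_eqI_lessThan)
    fix a
    have "emeasure M1 {a<..} = (\<integral>\<^sup>+y. indicator {z<..} y * indicator {z + a<..} y \<partial>resolvent p)"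
      unfolding M1_def
      by (subst nn_integral_indicator[symmetric], simp, subst nn_integral_distr, simp, simp, subst nn_integral_density)
         (auto intro!: nn_integral_cong split: split_indicator)
    also have "\<dots> = (\<integral>\<^sup>+y. indicator {z + max 0 a<..} y \<partial>resolvent p)"
      by (intro nn_integral_cong) (auto split: split_indicator)
    finally have 1: "emeasure M1 {a<..} = emeasure (resolvent p) {z + max 0 a<..}" by simp
    have "emeasure M2 {a<..} = (\<integral>\<^sup>+y. ennreal (\<rho> p z) * indicator {max 0 a<..} y \<partial>resolvent p)"
      unfolding M2_def by (subst emeasure_density) (auto intro!: nn_integral_cong split: split_indicator)
    then have 2: "emeasure M2 {a<..} = ennreal (\<rho> p z) * emeasure (resolvent p) {max 0 a<..}"
      by (simp add: nn_integral_cmult)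
    show "emeasure M1 {a<..} = emeasure M2 {a<..}" unfolding 1 2 by (rule tail) simp
    show "emeasure M1 {a<..} < \<infinity>" unfolding 1 using R.emeasure_finite by (simp add: less_top[symmetric])
  qed (auto simp: M1_def M2_def)
  then have "(\<integral>\<^sup>+y. f y \<partial>M1) = (\<integral>\<^sup>+y. f y \<partial>M2)" by simp
  moreover have "(\<integral>\<^sup>+y. f y \<partial>M1) = (\<integral>\<^sup>+y. indicator {z<..} y * f (y - z) \<partial>resolvent p)"
    unfolding M1_def by (subst nn_integral_distr, simp, simp, subst nn_integral_density) auto
  moreover have "(\<integral>\<^sup>+y. f y \<partial>M2) = ennreal (\<rho> p z) * (\<integral>\<^sup>+y. indicator {0<..} y * f y \<partial>resolvent p)"
    unfolding M2_def by (subst nn_integral_density) (auto simp: nn_integral_cmult mult.assoc)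
  ultimately show ?thesis by simp
qed

end

section \<open>The resolvent density\<close>

lemma has_bochner_integral_exp_tail:
  assumes k: "0 < (k::real)"
  shows "has_bochner_integral lborel (\<lambda>s. indicator {a<..} s * exp (- k * s)) (exp (- k * a) / k)"
proof (rule has_bochner_integral_nn_integral)
  have "(\<integral>\<^sup>+t. ennreal (exp (- k * t)) * indicator {a..} t \<partial>lborel) = ennreal (0 - (- exp (- k * a) / k))"
  proof (rule nn_integral_FTC_atLeast)
    show "((\<lambda>t. - exp (- k * t) / k) has_real_derivative exp (- k * t)) (at t)" for t
      using assms by (auto intro!: derivative_eq_intros)
    have "((\<lambda>t. exp (- (k * t))) \<longlongrightarrow> 0) at_top"
      using assms by (intro filterlim_compose[OF exp_at_bot])
        (auto simp: filterlim_uminus_at_bot intro!: filterlim_tendsto_pos_mult_at_top[OF tendsto_const] filterlim_ident)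
    then show "((\<lambda>t. - exp (- k * t) / k) \<longlongrightarrow> 0) at_top"
      using tendsto_divide[OF tendsto_minus tendsto_const, of _ 0 at_top k] assms by simp
  qed auto
  moreover have "(\<integral>\<^sup>+t. ennreal (exp (- k * t)) * indicator {a..} t \<partial>lborel) = (\<integral>\<^sup>+s. ennreal (indicator {a<..} s * exp (- k * s)) \<partial>lborel)"
    by (intro nn_integral_cong_AE eventually_mono[OF AE_lborel_singleton[of a]]) (auto split: split_indicator)
  ultimately show "(\<integral>\<^sup>+s. ennreal (indicator {a<..} s * exp (- k * s)) \<partial>lborel) = ennreal (exp (- k * a) / k)" by simp
qed (use k in auto)

lemma nn_integral_exp_Icc:
  assumes "(k::real) \<noteq> 0" "0 \<le> a"
  shows "(\<integral>\<^sup>+t. ennreal (exp (k * t)) * indicator {0..a} t \<partial>lborel) = ennreal ((exp (k * a) - 1) / k)"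
proof -
  have "(\<integral>\<^sup>+t. ennreal (exp (k * t)) * indicator {0..a} t \<partial>lborel) = ennreal (exp (k * a) / k - exp (k * 0) / k)"
  proof (rule nn_integral_FTC_Icc)
    show "((\<lambda>t. exp (k * t) / k) has_real_derivative exp (k * t)) (at t)" for t
      using assms by (auto intro!: derivative_eq_intros)
  qed (use assms in auto)
  then show ?thesis by (simp add: diff_divide_distrib)
qed

context levy begin

text \<open>The Markov property on the grid of mesh \<open>t\<close> with a single cell, hence the
  requirement that \<open>t\<close> be positive.\<close>

lemma two_times:
  assumes t: "0 < t" and s: "0 \<le> s" and [measurable]: "f \<in> borel_measurable borel"
  shows "(\<integral>\<^sup>+\<omega>. f (X (t + s) \<omega>) \<partial>M) = (\<integral>\<^sup>+\<omega>. (\<integral>\<^sup>+\<omega>'. f (X t \<omega> + X s \<omega>') \<partial>M) \<partial>M)"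
proof -
  have [measurable]: "(\<lambda>z. (fst z) 0) \<in> borel_measurable (PiM {..<1::nat} (\<lambda>_. borel) \<Otimes>\<^sub>M (borel::real measure))"
    by (rule measurable_compose[OF measurable_fst measurable_component_singleton]) simp
  have "(\<lambda>z. f ((fst z) 0 + snd z)) \<in> borel_measurable (PiM {..<1::nat} (\<lambda>_. borel) \<Otimes>\<^sub>M borel)"
    by measurable
  from markov_grid[OF t s this]
  have *: "(\<integral>\<^sup>+\<omega>. f (increments t 1 \<omega> 0 + (X (t + s) \<omega> - X t \<omega>)) \<partial>M) = (\<integral>\<^sup>+\<omega>. (\<integral>\<^sup>+\<omega>'. f (increments t 1 \<omega> 0 + X s \<omega>') \<partial>M) \<partial>M)"
    by simp
  have i: "AE \<omega> in M. increments t 1 \<omega> 0 = X t \<omega>"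
    using X_0 by eventually_elim (simp add: increments_def)
  have "(\<integral>\<^sup>+\<omega>. f (X (t + s) \<omega>) \<partial>M) = (\<integral>\<^sup>+\<omega>. f (increments t 1 \<omega> 0 + (X (t + s) \<omega> - X t \<omega>)) \<partial>M)"
    by (rule nn_integral_cong_AE, rule eventually_mono[OF i]) simp
  also have "\<dots> = (\<integral>\<^sup>+\<omega>. (\<integral>\<^sup>+\<omega>'. f (X t \<omega> + X s \<omega>') \<partial>M) \<partial>M)"
    unfolding * by (rule nn_integral_cong_AE, rule eventually_mono[OF i]) simp
  finally show ?thesis .
qed

text \<open>The discounted time integral is split at \<open>t\<close>; after \<open>t\<close> the
  process restarts from \<open>X t\<close>, discounted by \<open>exp (- p * t)\<close>.\<close>

lemma resolvent_semigroup:
  assumes p: "0 < p" and t: "0 < t" and f[measurable]: "f \<in> borel_measurable borel"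
  shows "Res p f x = (\<integral>\<^sup>+s. indicator {0..<t} s * ennreal (exp (- p * s)) * (\<integral>\<^sup>+\<omega>. f (x + X (max 0 s) \<omega>) \<partial>M) \<partial>lborel)
     + ennreal (exp (- p * t)) * (\<integral>\<^sup>+\<omega>. Res p f (x + X t \<omega>) \<partial>M)"
proof -
  let ?P = "\<lambda>s y. \<integral>\<^sup>+\<omega>. f (y + X (max 0 s) \<omega>) \<partial>M"
  have [measurable]: "X t \<in> borel_measurable M" using t by (intro X_measurable) simp
  have "Res p f x = (\<integral>\<^sup>+s. indicator {0..<t} s * ennreal (exp (- p * s)) * ?P s x + indicator {t..} s * ennreal (exp (- p * s)) * ?P s x \<partial>lborel)"
    unfolding Res_eq[OF f] using t by (intro nn_integral_cong) (auto split: split_indicator)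
  also have "\<dots> = (\<integral>\<^sup>+s. indicator {0..<t} s * ennreal (exp (- p * s)) * ?P s x \<partial>lborel) + (\<integral>\<^sup>+s. indicator {t..} s * ennreal (exp (- p * s)) * ?P s x \<partial>lborel)"
    by (rule nn_integral_add) auto
  also have "(\<integral>\<^sup>+s. indicator {t..} s * ennreal (exp (- p * s)) * ?P s x \<partial>lborel)
     = (\<integral>\<^sup>+s. indicator {t..} (t + s) * ennreal (exp (- p * (t + s))) * ?P (t + s) x \<partial>lborel)"
    by (subst nn_integral_real_affine[where c=1 and t=t]) auto
  also have "\<dots> = (\<integral>\<^sup>+s. ennreal (exp (- p * t)) * (\<integral>\<^sup>+\<omega>. indicator {0..} s * ennreal (exp (- p * s)) * ?P s (x + X t \<omega>) \<partial>M) \<partial>lborel)"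
  proof (rule nn_integral_cong)
    fix s
    show "indicator {t..} (t + s) * ennreal (exp (- p * (t + s))) * ?P (t + s) x
      = ennreal (exp (- p * t)) * (\<integral>\<^sup>+\<omega>. indicator {0..} s * ennreal (exp (- p * s)) * ?P s (x + X t \<omega>) \<partial>M)"
    proof (cases "0 \<le> s")
      case True
      have "?P (t + s) x = (\<integral>\<^sup>+\<omega>. ?P s (x + X t \<omega>) \<partial>M)"
        using two_times[OF t True, of "\<lambda>y. f (x + y)"] True t by (simp add: max_absorb2 add.assoc)
      moreover have "ennreal (exp (- p * (t + s))) = ennreal (exp (- p * t)) * ennreal (exp (- p * s))"
        by (simp add: algebra_simps flip: ennreal_mult exp_add)
      moreover have "(\<integral>\<^sup>+\<omega>. indicator {0..} s * ennreal (exp (- p * s)) * ?P s (x + X t \<omega>) \<partial>M)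
        = indicator {0..} s * ennreal (exp (- p * s)) * (\<integral>\<^sup>+\<omega>. ?P s (x + X t \<omega>) \<partial>M)"
        by (rule nn_integral_cmult) measurable
      moreover have "indicator {t..} (t + s) = (1::ennreal)" "indicator {0..} s = (1::ennreal)" using True by auto
      ultimately show ?thesis by (simp only: mult_1 mult.assoc)
    qed simp
  qed
  also have "\<dots> = ennreal (exp (- p * t)) * (\<integral>\<^sup>+s. (\<integral>\<^sup>+\<omega>. indicator {0..} s * ennreal (exp (- p * s)) * ?P s (x + X t \<omega>) \<partial>M) \<partial>lborel)"
    by (rule nn_integral_cmult) measurable
  also have "(\<integral>\<^sup>+s. (\<integral>\<^sup>+\<omega>. indicator {0..} s * ennreal (exp (- p * s)) * ?P s (x + X t \<omega>) \<partial>M) \<partial>lborel)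
     = (\<integral>\<^sup>+\<omega>. (\<integral>\<^sup>+s. indicator {0..} s * ennreal (exp (- p * s)) * ?P s (x + X t \<omega>) \<partial>lborel) \<partial>M)"
    by (rule nn_integral_lborel_swap[symmetric]) measurable
  also have "\<dots> = (\<integral>\<^sup>+\<omega>. Res p f (x + X t \<omega>) \<partial>M)" by (simp add: Res_eq)
  finally show ?thesis .
qed

end

section \<open>The resolvent on the two half lines\<close>

context spectrally_negative begin

text \<open>Let E(\<theta>) be the exponential integral over the positive half line. By
  \<open>resolvent_shift\<close>, (1 - exp(\<theta> z) \<rho>) E(\<theta>) is the integral over
  (0,z], which stays bounded. But E(\<theta>) tends to infinity as \<theta> increases to \<Phi>(p),
  because the full integral 1/(p - \<kappa>(\<theta>)) does and the other half line contributes at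
  most 1/p. So the first factor must vanish in the limit.\<close>

lemma \<rho>_eq:
  assumes p: "0 < p" and z: "0 < z"
  shows "\<rho> p z = exp (- \<Phi> p * z)"
proof -
  note F = \<Phi>_root[OF p]
  define E where "E \<theta> = enn2real (\<integral>\<^sup>+y. indicator {0<..} y * ennreal (exp (\<theta> * y)) \<partial>resolvent p)" for \<theta>
  \<comment> \<open>Bounds the integral over (0,z]: the integrand is at most exp(\<Phi>(p) z) and
    the total mass is 1/p.\<close>
  define C where "C = exp (\<Phi> p * z) / p"
  have key: "E \<theta> - exp (\<theta> * z) * \<rho> p z * E \<theta> \<in> {0..C} \<and> 1 / (p - \<kappa> \<theta>) - 1 / p \<le> E \<theta>" if \<theta>: "0 \<le> \<theta>" "\<theta> < \<Phi> p" for \<theta>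
  proof -
    let ?I = "\<lambda>S. \<integral>\<^sup>+y. indicator S y * ennreal (exp (\<theta> * y)) \<partial>resolvent p"
    have tot: "(\<integral>\<^sup>+y. ennreal (exp (\<theta> * y)) \<partial>resolvent p) = ennreal (1 / (p - \<kappa> \<theta>))" by (rule resolvent_exp[OF p \<theta>])
    have "?I {0<..} \<le> (\<integral>\<^sup>+y. ennreal (exp (\<theta> * y)) \<partial>resolvent p)"
      by (intro nn_integral_mono) (auto split: split_indicator)
    then have fin: "?I {0<..} = ennreal (E \<theta>)" unfolding tot E_def by (simp add: top.not_eq_extremum le_less_trans)
    have E0: "0 \<le> E \<theta>" by (simp add: E_def)
    have "?I {z<..} = (\<integral>\<^sup>+y. ennreal (exp (\<theta> * z)) * (indicator {z<..} y * ennreal (exp (\<theta> * (y - z)))) \<partial>resolvent p)"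
      by (intro nn_integral_cong) (auto split: split_indicator simp: algebra_simps simp flip: ennreal_mult exp_add)
    also have "\<dots> = ennreal (exp (\<theta> * z)) * (ennreal (\<rho> p z) * ?I {0<..})"
      using resolvent_shift[OF p z, of "\<lambda>y. ennreal (exp (\<theta> * y))"] by (simp add: nn_integral_cmult)
    also have "\<dots> = ennreal (exp (\<theta> * z) * \<rho> p z * E \<theta>)" using \<rho>_nonneg E0 by (simp add: fin ennreal_mult mult.assoc)
    finally have z1: "?I {z<..} = ennreal (exp (\<theta> * z) * \<rho> p z * E \<theta>)" .
    have "?I {0<..z} \<le> (\<integral>\<^sup>+y. ennreal (exp (\<Phi> p * z)) \<partial>resolvent p)"
      using \<theta> z by (intro nn_integral_mono) (auto split: split_indicator intro!: ennreal_leI mult_mono)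
    also have "\<dots> = ennreal C" using p by (simp add: emeasure_resolvent C_def flip: ennreal_mult)
    finally have z2: "?I {0<..z} \<le> ennreal C" .
    have "?I {0<..} = (\<integral>\<^sup>+y. indicator {0<..z} y * ennreal (exp (\<theta> * y)) + indicator {z<..} y * ennreal (exp (\<theta> * y)) \<partial>resolvent p)"
      using z by (intro nn_integral_cong) (auto split: split_indicator)
    also have "\<dots> = ?I {0<..z} + ?I {z<..}" by (rule nn_integral_add) auto
    finally have s: "ennreal (E \<theta>) = ?I {0<..z} + ennreal (exp (\<theta> * z) * \<rho> p z * E \<theta>)" by (simp add: fin z1)
    obtain A where A: "?I {0<..z} = ennreal A" "0 \<le> A" "A \<le> C"
      using z2 p by (cases "?I {0<..z}") (auto simp: C_def top_unique)
    have "E \<theta> = A + exp (\<theta> * z) * \<rho> p z * E \<theta>"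
      using s E0 A \<rho>_nonneg[of p z] by (simp flip: ennreal_plus)
    moreover have "1 / (p - \<kappa> \<theta>) - 1 / p \<le> E \<theta>"
    proof -
      have "ennreal (1 / (p - \<kappa> \<theta>)) = (\<integral>\<^sup>+y. indicator {0<..} y * ennreal (exp (\<theta> * y)) + indicator {..0} y * ennreal (exp (\<theta> * y)) \<partial>resolvent p)"
        unfolding tot[symmetric] by (intro nn_integral_cong) (auto split: split_indicator)
      also have "\<dots> = ennreal (E \<theta>) + ?I {..0}" by (subst nn_integral_add) (auto simp: fin)
      also have "?I {..0} \<le> (\<integral>\<^sup>+y. 1 \<partial>resolvent p)"
        using \<theta> by (intro nn_integral_mono) (auto split: split_indicator simp: mult_nonneg_nonpos)
      also have "\<dots> = ennreal (1 / p)" using emeasure_resolvent[OF p] by simp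
      finally have "ennreal (1 / (p - \<kappa> \<theta>)) \<le> ennreal (E \<theta> + 1 / p)" using E0 p by (simp add: add_mono)
      then show ?thesis using E0 p F(3)[OF \<theta>] by (subst (asm) ennreal_le_iff) auto
    qed
    ultimately show ?thesis using A by auto
  qed
  have \<kappa>l: "(\<kappa> \<longlongrightarrow> p) (at_left (\<Phi> p))"
  proof -
    have "isCont \<kappa> (\<Phi> p)" using \<kappa>_continuous F(1) by (simp add: continuous_on_eq_continuous_at)
    then have "(\<kappa> \<longlongrightarrow> \<kappa> (\<Phi> p)) (at_left (\<Phi> p))" by (simp add: isCont_def filterlim_at_split)
    then show ?thesis by (simp add: F(2))
  qed
  have "((\<lambda>\<theta>. 1 - exp (\<theta> * z) * \<rho> p z) \<longlongrightarrow> 1 - exp (\<Phi> p * z) * \<rho> p z) (at_left (\<Phi> p))"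
    by (intro tendsto_intros)
  moreover have "((\<lambda>\<theta>. 1 - exp (\<theta> * z) * \<rho> p z) \<longlongrightarrow> 0) (at_left (\<Phi> p))"
  proof (rule real_tendsto_sandwich)
    have ev: "eventually (\<lambda>\<theta>. 0 < \<theta> \<and> \<theta> < \<Phi> p) (at_left (\<Phi> p))"
      unfolding eventually_at_left_field using F(1) by blast
    have ev2: "eventually (\<lambda>\<theta>. 0 < \<kappa> \<theta>) (at_left (\<Phi> p))" using order_tendstoD(1)[OF \<kappa>l p] .
    have b: "eventually (\<lambda>\<theta>. 0 \<le> 1 - exp (\<theta> * z) * \<rho> p z \<and> 1 - exp (\<theta> * z) * \<rho> p z \<le> C * (p * (p - \<kappa> \<theta>) / \<kappa> \<theta>)) (at_left (\<Phi> p))"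
      using ev ev2
    proof eventually_elim
      case (elim \<theta>)
      have \<theta>: "0 \<le> \<theta>" "\<theta> < \<Phi> p" using elim by auto
      have k: "\<kappa> \<theta> < p" by (rule F(3)[OF \<theta>])
      \<comment> \<open>A lower bound for E(\<theta>) that is positive as soon as \<kappa>(\<theta>)
        is, and whose reciprocal tends to 0 at \<Phi>(p).\<close>
      define e0 where "e0 = 1 / (p - \<kappa> \<theta>) - 1 / p"
      have e0: "0 < e0" "1 / e0 = p * (p - \<kappa> \<theta>) / \<kappa> \<theta>" using k elim p by (auto simp: e0_def field_simps)
      define s where "s = 1 - exp (\<theta> * z) * \<rho> p z"
      have K: "0 \<le> s * E \<theta>" "s * E \<theta> \<le> C" "e0 \<le> E \<theta>" using key[OF \<theta>] by (auto simp: s_def e0_def algebra_simps)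
      then have s0: "0 \<le> s" using e0 by (auto simp: zero_le_mult_iff)
      have "s * e0 \<le> C" using K(2) mult_left_mono[OF K(3) s0] by linarith
      then have "s \<le> C * (1 / e0)" using e0(1) by (simp add: field_simps)
      then show ?case using s0 by (simp only: e0(2) s_def)
    qed
    show "eventually (\<lambda>\<theta>. 0 \<le> 1 - exp (\<theta> * z) * \<rho> p z) (at_left (\<Phi> p))" by (rule eventually_mono[OF b]) simp
    show "eventually (\<lambda>\<theta>. 1 - exp (\<theta> * z) * \<rho> p z \<le> C * (p * (p - \<kappa> \<theta>) / \<kappa> \<theta>)) (at_left (\<Phi> p))" by (rule eventually_mono[OF b]) simp
    have "((\<lambda>\<theta>. C * (p * (p - \<kappa> \<theta>) / \<kappa> \<theta>)) \<longlongrightarrow> C * (p * (p - p) / p)) (at_left (\<Phi> p))"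
      using p by (intro tendsto_intros \<kappa>l) auto
    then show "((\<lambda>\<theta>. C * (p * (p - \<kappa> \<theta>) / \<kappa> \<theta>)) \<longlongrightarrow> 0) (at_left (\<Phi> p))" by simp
  qed simp
  ultimately have "1 - exp (\<Phi> p * z) * \<rho> p z = 0"
    by (intro tendsto_unique[of "at_left (\<Phi> p)"]) auto
  then show ?thesis by (simp add: exp_minus field_simps)
qed

text \<open>The resolvent has density \<open>c p * exp (- \<Phi> p * y)\<close> at \<open>y > 0\<close>.\<close>

definition c :: "real \<Rightarrow> real" where "c p = \<Phi> p * measure (resolvent p) {0<..}"

lemma c_nonneg: "0 < p \<Longrightarrow> 0 \<le> c p"
  using \<Phi>_root(1)[of p] by (simp add: c_def)

text \<open>Shift and passage transform together give exponential tails with rate \<Phi>(p) and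
  total mass \<open>measure (resolvent p) {0<..}\<close>. The constant \<open>c p\<close> is the
  rate times this mass.\<close>

lemma nn_integral_resolvent_pos:
  assumes p: "0 < p" and [measurable]: "f \<in> borel_measurable borel"
  shows "(\<integral>\<^sup>+y. indicator {0<..} y * f y \<partial>resolvent p) = (\<integral>\<^sup>+y. indicator {0<..} y * (ennreal (c p * exp (- \<Phi> p * y)) * f y) \<partial>lborel)"
proof -
  interpret R: finite_measure "resolvent p" using finite_resolvent p by simp
  note F = \<Phi>_root(1)[OF p]
  define M1 where "M1 = density (resolvent p) (indicator {0<..})"
  define M2 where "M2 = density lborel (\<lambda>y. indicator {0<..} y * ennreal (c p * exp (- \<Phi> p * y)))"
  have "M1 = M2"
  proof (rule measure_eqI_lessThan)
    fix a
    have "emeasure M1 {a<..} = (\<integral>\<^sup>+y. indicator {0<..} y * indicator {a<..} y \<partial>resolvent p)"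
      unfolding M1_def by (subst emeasure_density) auto
    also have "\<dots> = (\<integral>\<^sup>+y. indicator {max 0 a<..} y \<partial>resolvent p)"
      by (intro nn_integral_cong) (auto split: split_indicator)
    also have "\<dots> = emeasure (resolvent p) {max 0 a<..}" by simp
    finally have 1: "emeasure M1 {a<..} = emeasure (resolvent p) {max 0 a<..}" .
    have tail: "emeasure (resolvent p) {z<..} = ennreal (exp (- \<Phi> p * z) * measure (resolvent p) {0<..})" if "0 \<le> z" for z
    proof (cases "z = 0")
      case False
      have "emeasure (resolvent p) {z<..} = (\<integral>\<^sup>+y. indicator {z<..} y * 1 \<partial>resolvent p)" by simp
      also have "\<dots> = ennreal (\<rho> p z) * (\<integral>\<^sup>+y. indicator {0<..} y * 1 \<partial>resolvent p)"
        using resolvent_shift[OF p, of z "\<lambda>_. 1"] that False by simp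
      finally show ?thesis using \<rho>_eq[OF p, of z] that False by (simp add: R.emeasure_eq_measure ennreal_mult)
    qed (simp add: R.emeasure_eq_measure)
    have "emeasure M2 {a<..} = (\<integral>\<^sup>+y. ennreal (c p) * ennreal (indicator {max 0 a<..} y * exp (- \<Phi> p * y)) \<partial>lborel)"
      unfolding M2_def using c_nonneg[OF p]
      by (subst emeasure_density) (auto intro!: nn_integral_cong split: split_indicator simp: ennreal_mult)
    also have "\<dots> = ennreal (c p) * ennreal (exp (- \<Phi> p * max 0 a) / \<Phi> p)"
      using has_bochner_integral_exp_tail[OF F, of "max 0 a"]
      by (subst nn_integral_cmult) (auto simp: nn_integral_eq_integral has_bochner_integral_iff)
    also have "\<dots> = ennreal (exp (- \<Phi> p * max 0 a) * measure (resolvent p) {0<..})"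
      using F c_nonneg[OF p] by (simp add: c_def mult.commute flip: ennreal_mult)
    finally show "emeasure M1 {a<..} = emeasure M2 {a<..}" unfolding 1 using tail[of "max 0 a"] by simp
    show "emeasure M1 {a<..} < \<infinity>" unfolding 1 using R.emeasure_finite by (simp add: less_top[symmetric])
  qed (auto simp: M1_def M2_def)
  then have "(\<integral>\<^sup>+y. f y \<partial>M1) = (\<integral>\<^sup>+y. f y \<partial>M2)" by simp
  then show ?thesis unfolding M1_def M2_def by (simp add: nn_integral_density mult.assoc)
qed

lemma resolvent_truncated_exp:
  assumes p: "0 < p" and \<theta>: "\<Phi> p < \<theta>" and a: "0 \<le> a"
  shows "(\<integral>\<^sup>+y. indicator {..a} y * ennreal (exp (\<theta> * y)) \<partial>resolvent p) =
     (\<integral>\<^sup>+y. indicator {..0} y * ennreal (exp (\<theta> * y)) \<partial>resolvent p) + ennreal (c p * ((exp ((\<theta> - \<Phi> p) * a) - 1) / (\<theta> - \<Phi> p)))"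
proof -
  have "(\<integral>\<^sup>+y. indicator {..a} y * ennreal (exp (\<theta> * y)) \<partial>resolvent p) =
    (\<integral>\<^sup>+y. indicator {..0} y * ennreal (exp (\<theta> * y)) + indicator {0<..} y * (indicator {..a} y * ennreal (exp (\<theta> * y))) \<partial>resolvent p)"
    using a by (intro nn_integral_cong) (auto split: split_indicator)
  also have "\<dots> = (\<integral>\<^sup>+y. indicator {..0} y * ennreal (exp (\<theta> * y)) \<partial>resolvent p)
     + (\<integral>\<^sup>+y. indicator {0<..} y * (indicator {..a} y * ennreal (exp (\<theta> * y))) \<partial>resolvent p)"
    by (rule nn_integral_add) auto
  also have "(\<integral>\<^sup>+y. indicator {0<..} y * (indicator {..a} y * ennreal (exp (\<theta> * y))) \<partial>resolvent p)
    = (\<integral>\<^sup>+y. indicator {0<..} y * (ennreal (c p * exp (- \<Phi> p * y)) * (indicator {..a} y * ennreal (exp (\<theta> * y)))) \<partial>lborel)"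
    by (rule nn_integral_resolvent_pos[OF p]) measurable
  also have "\<dots> = (\<integral>\<^sup>+y. ennreal (c p) * (ennreal (exp ((\<theta> - \<Phi> p) * y)) * indicator {0..a} y) \<partial>lborel)"
  proof (rule nn_integral_cong_AE, rule eventually_mono[OF AE_lborel_singleton[of 0]])
    fix y :: real assume y: "y \<noteq> 0"
    have "ennreal (c p * exp (- \<Phi> p * y)) * ennreal (exp (\<theta> * y)) = ennreal (c p) * ennreal (exp ((\<theta> - \<Phi> p) * y))"
      using c_nonneg[OF p] by (simp add: mult.assoc algebra_simps flip: ennreal_mult exp_add)
    then show "indicator {0<..} y * (ennreal (c p * exp (- \<Phi> p * y)) * (indicator {..a} y * ennreal (exp (\<theta> * y))))
        = ennreal (c p) * (ennreal (exp ((\<theta> - \<Phi> p) * y)) * indicator {0..a} y)"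
      using y by (auto split: split_indicator)
  qed
  also have "\<dots> = ennreal (c p) * ennreal ((exp ((\<theta> - \<Phi> p) * a) - 1) / (\<theta> - \<Phi> p))"
    using \<theta> a by (subst nn_integral_cmult) (auto simp: nn_integral_exp_Icc)
  also have "\<dots> = ennreal (c p * ((exp ((\<theta> - \<Phi> p) * a) - 1) / (\<theta> - \<Phi> p)))"
    using c_nonneg[OF p] \<theta> a by (intro ennreal_mult[symmetric]) auto
  finally show ?thesis .
qed

text \<open>The value below is forced by the growth of the truncated transform
  \<open>R a = \<integral>\<^bsub>y \<le> a\<^esub> exp (\<theta> y) G(dy)\<close>: the resolvent equation between times \<open>0\<close> and \<open>1\<close>
  determines its constant term as \<open>a \<rightarrow> \<infinity>\<close>.\<close>

lemma resolvent_exp_neg: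
  assumes p: "0 < p" and \<theta>: "\<Phi> p < \<theta>"
  shows "(\<integral>\<^sup>+y. indicator {..0} y * ennreal (exp (\<theta> * y)) \<partial>resolvent p) = ennreal (c p / (\<theta> - \<Phi> p) - 1 / (\<kappa> \<theta> - p))"
    "0 \<le> c p / (\<theta> - \<Phi> p) - 1 / (\<kappa> \<theta> - p)"
proof -
  interpret R: finite_measure "resolvent p" using finite_resolvent p by simp
  note F = \<Phi>_root[OF p]
  have \<theta>0: "0 < \<theta>" using F(1) \<theta> by simp
  have k: "0 < \<kappa> \<theta> - p" using F(4)[OF \<theta>] by simp
  define f where "f a y = indicator {..a} y * ennreal (exp (\<theta> * y))" for a y
  have [measurable]: "f a \<in> borel_measurable borel" for a unfolding f_def by measurable
  define R where "R a = enn2real (\<integral>\<^sup>+y. f a y \<partial>resolvent p)" for a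
  have fin: "(\<integral>\<^sup>+y. f a y \<partial>resolvent p) = ennreal (R a)" for a
  proof -
    have "(\<integral>\<^sup>+y. f a y \<partial>resolvent p) \<le> (\<integral>\<^sup>+y. ennreal (exp (\<theta> * a)) \<partial>resolvent p)"
      using \<theta>0 by (intro nn_integral_mono) (auto simp: f_def split: split_indicator)
    also have "\<dots> < top" using p by (simp add: emeasure_resolvent ennreal_mult_less_top)
    finally show ?thesis by (simp add: R_def)
  qed
  have R0: "0 \<le> R a" for a by (simp add: R_def)
  define B where "B = R 0"
  define C' where "C' = c p / (\<theta> - \<Phi> p)"
  define D where "D = B - C'"
  have C'0: "0 \<le> C'" using c_nonneg[OF p] \<theta> by (simp add: C'_def)
  have R_pos: "R a = D + C' * exp ((\<theta> - \<Phi> p) * a)" if "0 \<le> a" for a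
  proof -
    have "ennreal (R a) = ennreal (R 0) + ennreal (c p * ((exp ((\<theta> - \<Phi> p) * a) - 1) / (\<theta> - \<Phi> p)))"
      using resolvent_truncated_exp[OF p \<theta> that] unfolding fin[symmetric] f_def .
    also have "\<dots> = ennreal (R 0 + c p * ((exp ((\<theta> - \<Phi> p) * a) - 1) / (\<theta> - \<Phi> p)))"
      using c_nonneg[OF p] \<theta> that R0[of 0] by (intro ennreal_plus[symmetric]) auto
    finally have "R a = R 0 + c p * ((exp ((\<theta> - \<Phi> p) * a) - 1) / (\<theta> - \<Phi> p))"
      using c_nonneg[OF p] \<theta> that R0 by (subst (asm) ennreal_inj) auto
    also have "\<dots> = D + C' * exp ((\<theta> - \<Phi> p) * a)" by (simp add: D_def C'_def B_def right_diff_distrib diff_divide_distrib)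
    finally show ?thesis .
  qed
  have R_le: "R a \<le> B" if "a \<le> 0" for a
  proof -
    have "ennreal (R a) \<le> ennreal B"
      unfolding B_def fin[symmetric] using that by (intro nn_integral_mono) (auto simp: f_def split: split_indicator)
    then show ?thesis using R0[of 0] by (simp add: B_def)
  qed
  have [measurable]: "R \<in> borel_measurable borel"
  proof (rule borel_measurable_mono)
    show "mono R"
    proof (rule monoI)
      fix a b :: real assume "a \<le> b"
      then have "ennreal (R a) \<le> ennreal (R b)"
        unfolding fin[symmetric] by (intro nn_integral_mono) (auto simp: f_def split: split_indicator)
      then show "R a \<le> R b" using R0 by simp
    qed
  qed
  \<comment> \<open>The closed form of \<open>R\<close> holds for nonnegative \<open>a\<close>;
    \<open>e\<close> is its deviation elsewhere. It is bounded and vanishes for nonnegative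
    \<open>a\<close>, so its mean against the integrable weight \<open>exp (\<theta> * X 1)\<close>
    tends to 0 as \<open>a\<close> grows.\<close>
  define e where "e a = R a - (D + C' * exp ((\<theta> - \<Phi> p) * a))" for a
  define K where "K = B + \<bar>D\<bar> + C'"
  have [measurable]: "e \<in> borel_measurable borel" unfolding e_def by measurable
  have e0: "0 \<le> a \<Longrightarrow> e a = 0" for a using R_pos[of a] by (simp add: e_def)
  have K0: "0 \<le> K" using R0[of 0] C'0 by (simp add: K_def B_def)
  have eK: "\<bar>e a\<bar> \<le> K" for a
  proof (cases "0 \<le> a")
    case False
    then have "exp ((\<theta> - \<Phi> p) * a) \<le> 1" using \<theta> by (simp add: mult_nonneg_nonpos)
    then have "C' * exp ((\<theta> - \<Phi> p) * a) \<le> C'" "0 \<le> C' * exp ((\<theta> - \<Phi> p) * a)"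
      using C'0 mult_left_mono[of _ 1 C'] by fastforce+
    then show ?thesis using R0[of a] R_le[of a] False unfolding e_def K_def by linarith
  qed (use e0 K0 in auto)
  have [measurable]: "X 1 \<in> borel_measurable M" by (rule X_measurable) simp
  define L where "L a = (LINT \<omega>|M. exp (\<theta> * X 1 \<omega>) * e (a - X 1 \<omega>))" for a
  have Li: "integrable M (\<lambda>\<omega>. exp (\<theta> * X 1 \<omega>) * e (a - X 1 \<omega>))" for a
    by (rule Bochner_Integration.integrable_bound[OF integrable_mult_right[OF exp_integrable[of \<theta> 1], of K]])
       (use \<theta>0 eK K0 in \<open>auto simp: abs_mult mult.commute[of K] intro!: mult_left_mono\<close>)
  have Llim: "(\<lambda>n. L (real n)) \<longlonglongrightarrow> 0"
  proof -
    have "(\<lambda>n. L (real n)) \<longlonglongrightarrow> (LINT \<omega>|M. 0)"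
      unfolding L_def
    proof (rule integral_dominated_convergence[where w="\<lambda>\<omega>. K * exp (\<theta> * X 1 \<omega>)"])
      show "integrable M (\<lambda>\<omega>. K * exp (\<theta> * X 1 \<omega>))" using exp_integrable[of \<theta> 1] \<theta>0 by simp
      show "AE \<omega> in M. (\<lambda>n. exp (\<theta> * X 1 \<omega>) * e (real n - X 1 \<omega>)) \<longlonglongrightarrow> 0"
      proof (rule AE_I2)
        fix \<omega>
        obtain m where m: "X 1 \<omega> \<le> real m" using real_arch_simple by blast
        have "eventually (\<lambda>n. exp (\<theta> * X 1 \<omega>) * e (real n - X 1 \<omega>) = 0) sequentially"
          by (rule eventually_sequentiallyI[of m]) (use m in \<open>auto intro!: e0\<close>)
        then show "(\<lambda>n. exp (\<theta> * X 1 \<omega>) * e (real n - X 1 \<omega>)) \<longlonglongrightarrow> 0" by (rule tendsto_eventually)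
      qed
      show "AE \<omega> in M. norm (exp (\<theta> * X 1 \<omega>) * e (real n - X 1 \<omega>)) \<le> K * exp (\<theta> * X 1 \<omega>)" for n
        using eK by (intro AE_I2) (auto simp: abs_mult mult.commute[of K] intro!: mult_left_mono)
    qed auto
    then show ?thesis by simp
  qed
  define J where "J a = (\<integral>\<^sup>+s. indicator {0..<1} s * ennreal (exp (- p * s)) * (\<integral>\<^sup>+\<omega>. f a (X (max 0 s) \<omega>) \<partial>M) \<partial>lborel)" for a
  \<comment> \<open>The growing terms cancel, because the mean of
    \<open>exp (\<Phi> p * X 1)\<close> is \<open>exp p\<close> and compensates the discount over
    one unit of time. There remain the constant \<open>D\<close>, multiplied by 1 -
    exp(\<kappa>(\<theta>) - p), and the vanishing term \<open>L\<close>.\<close>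
  have Jeq: "J a = ennreal (D * (1 - exp (\<kappa> \<theta> - p)) - exp (- p) * L a)" if a: "0 \<le> a" for a
  proof -
    have Rf: "Res p (f a) x = ennreal (exp (\<theta> * x) * R (a - x))" for x
    proof -
      have "Res p (f a) x = (\<integral>\<^sup>+z. ennreal (exp (\<theta> * x)) * f (a - x) z \<partial>resolvent p)"
        unfolding Res_def f_def
        by (intro nn_integral_cong) (auto split: split_indicator simp: distrib_left simp flip: ennreal_mult exp_add)
      also have "\<dots> = ennreal (exp (\<theta> * x)) * ennreal (R (a - x))" by (subst nn_integral_cmult) (auto simp: fin)
      finally show ?thesis using R0 by (simp add: ennreal_mult)
    qed
    define E where "E \<omega> = exp (\<theta> * X 1 \<omega>) * R (a - X 1 \<omega>)" for \<omega>
    have Ee: "E \<omega> = D * exp (\<theta> * X 1 \<omega>) + C' * exp ((\<theta> - \<Phi> p) * a) * exp (\<Phi> p * X 1 \<omega>) + exp (\<theta> * X 1 \<omega>) * e (a - X 1 \<omega>)" for \<omega>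
    proof -
      have "exp (\<theta> * X 1 \<omega>) * exp ((\<theta> - \<Phi> p) * (a - X 1 \<omega>)) = exp ((\<theta> - \<Phi> p) * a) * exp (\<Phi> p * X 1 \<omega>)"
        by (simp add: algebra_simps flip: exp_add)
      then show ?thesis by (simp add: E_def e_def algebra_simps)
    qed
    have Ei: "integrable M E" "(LINT \<omega>|M. E \<omega>) = D * exp (\<kappa> \<theta>) + C' * exp ((\<theta> - \<Phi> p) * a) * exp p + L a"
      unfolding Ee[abs_def] using exp_integrable[of \<theta> 1] exp_integrable[of "\<Phi> p" 1] \<theta>0 F(1,2) Li[of a] exponent[of \<theta> 1] exponent[of "\<Phi> p" 1]
      by (auto simp: L_def)
    have E0: "0 \<le> E \<omega>" for \<omega> using R0 by (simp add: E_def)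
    have LE: "0 \<le> (LINT \<omega>|M. E \<omega>)" using E0 by (intro integral_nonneg_AE) auto
    have "ennreal (R a) = J a + ennreal (exp (- p)) * (\<integral>\<^sup>+\<omega>. ennreal (E \<omega>) \<partial>M)"
      using resolvent_semigroup[OF p, of 1 "f a" 0] Rf[of 0] by (simp add: J_def Rf E_def)
    also have "(\<integral>\<^sup>+\<omega>. ennreal (E \<omega>) \<partial>M) = ennreal (LINT \<omega>|M. E \<omega>)"
      using Ei(1) E0 by (intro nn_integral_eq_integral) auto
    also have "ennreal (exp (- p)) * ennreal (LINT \<omega>|M. E \<omega>) = ennreal (exp (- p) * (LINT \<omega>|M. E \<omega>))"
      using LE by (simp add: ennreal_mult)
    finally have J1: "ennreal (R a) = J a + ennreal (exp (- p) * (LINT \<omega>|M. E \<omega>))" .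
    obtain j where j: "J a = ennreal j" "0 \<le> j" using J1 by (cases "J a") (auto simp: top_unique)
    have "R a = j + exp (- p) * (LINT \<omega>|M. E \<omega>)"
      using J1 j R0[of a] LE by (simp flip: ennreal_plus)
    then have "j = D + C' * exp ((\<theta> - \<Phi> p) * a) - exp (- p) * (D * exp (\<kappa> \<theta>) + C' * exp ((\<theta> - \<Phi> p) * a) * exp p + L a)"
      using R_pos[OF a] Ei(2) by simp
    also have "\<dots> = D * (1 - exp (\<kappa> \<theta> - p)) - exp (- p) * L a"
      by (simp add: algebra_simps exp_diff exp_minus field_simps)
    finally show ?thesis using j by simp
  qed
  \<comment> \<open>As \<open>a\<close> grows the truncation disappears, and monotone convergence
    leaves the integral of exp((\<kappa>(\<theta>) - p) s) over the unit interval. Comparison with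
    \<open>Jeq\<close> determines \<open>D\<close>.\<close>
  have Jlim: "(\<lambda>n. J (real n)) \<longlonglongrightarrow> ennreal ((exp (\<kappa> \<theta> - p) - 1) / (\<kappa> \<theta> - p))"
  proof -
    have inc: "incseq (\<lambda>n. f (real n) y)" for y
      by (auto simp: f_def incseq_def split: split_indicator)
    have inner: "(\<lambda>n. \<integral>\<^sup>+\<omega>. f (real n) (X (max 0 s) \<omega>) \<partial>M) \<longlonglongrightarrow> ennreal (exp (max 0 s * \<kappa> \<theta>))" for s
    proof -
      have "(\<lambda>n. \<integral>\<^sup>+\<omega>. f (real n) (X (max 0 s) \<omega>) \<partial>M) \<longlonglongrightarrow> (\<integral>\<^sup>+\<omega>. ennreal (exp (\<theta> * X (max 0 s) \<omega>)) \<partial>M)"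
      proof (rule nn_integral_LIMSEQ)
        show "incseq (\<lambda>n \<omega>. f (real n) (X (max 0 s) \<omega>))" using inc by (auto simp: incseq_def le_fun_def)
        fix \<omega>
        obtain m where m: "X (max 0 s) \<omega> \<le> real m" using real_arch_simple by blast
        have "eventually (\<lambda>n. f (real n) (X (max 0 s) \<omega>) = ennreal (exp (\<theta> * X (max 0 s) \<omega>))) sequentially"
          by (rule eventually_sequentiallyI[of m]) (use m in \<open>auto simp: f_def split: split_indicator\<close>)
        then show "(\<lambda>n. f (real n) (X (max 0 s) \<omega>)) \<longlonglongrightarrow> ennreal (exp (\<theta> * X (max 0 s) \<omega>))" by (rule tendsto_eventually)
      qed auto
      then show ?thesis using \<theta>0 by (simp add: nn_exponent)
    qed
    have "(\<lambda>n. J (real n)) \<longlonglongrightarrow> (\<integral>\<^sup>+s. indicator {0..<1} s * ennreal (exp (- p * s)) * ennreal (exp (max 0 s * \<kappa> \<theta>)) \<partial>lborel)"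
      unfolding J_def
    proof (rule nn_integral_LIMSEQ)
      show "incseq (\<lambda>n s. indicator {0..<1} s * ennreal (exp (- p * s)) * (\<integral>\<^sup>+\<omega>. f (real n) (X (max 0 s) \<omega>) \<partial>M))"
        using inc by (auto simp: incseq_def le_fun_def intro!: mult_left_mono nn_integral_mono)
      show "(\<lambda>n. indicator {0..<1} s * ennreal (exp (- p * s)) * (\<integral>\<^sup>+\<omega>. f (real n) (X (max 0 s) \<omega>) \<partial>M))
         \<longlonglongrightarrow> indicator {0..<1} s * ennreal (exp (- p * s)) * ennreal (exp (max 0 s * \<kappa> \<theta>))" for s
        by (intro ennreal_tendsto_cmult inner) (auto split: split_indicator)
    qed measurable
    also have "(\<integral>\<^sup>+s. indicator {0..<1} s * ennreal (exp (- p * s)) * ennreal (exp (max 0 s * \<kappa> \<theta>)) \<partial>lborel)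
      = (\<integral>\<^sup>+s. ennreal (exp ((\<kappa> \<theta> - p) * s)) * indicator {0..1} s \<partial>lborel)"
      by (rule nn_integral_cong_AE, rule eventually_mono[OF AE_lborel_singleton[of 1]])
         (auto split: split_indicator simp: algebra_simps simp flip: ennreal_mult exp_add)
    also have "\<dots> = ennreal ((exp (\<kappa> \<theta> - p) - 1) / (\<kappa> \<theta> - p))"
      using nn_integral_exp_Icc[of "\<kappa> \<theta> - p" 1] k by simp
    finally show ?thesis .
  qed
  have "(\<lambda>n. ennreal (D * (1 - exp (\<kappa> \<theta> - p)) - exp (- p) * L (real n))) \<longlonglongrightarrow> ennreal (D * (1 - exp (\<kappa> \<theta> - p)) - exp (- p) * 0)"
    by (intro tendsto_ennrealI tendsto_intros Llim)
  then have "(\<lambda>n. J (real n)) \<longlonglongrightarrow> ennreal (D * (1 - exp (\<kappa> \<theta> - p)))" by (simp add: Jeq)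
  from LIMSEQ_unique[OF this Jlim]
  have en: "ennreal (D * (1 - exp (\<kappa> \<theta> - p))) = ennreal ((exp (\<kappa> \<theta> - p) - 1) / (\<kappa> \<theta> - p))" .
  define u where "u = exp (\<kappa> \<theta> - p) - 1"
  have u: "0 < u" using k by (simp add: u_def)
  \<comment> \<open>\<open>ennreal\<close> sends negative numbers to 0, so the sign has to be
    settled before it can be removed: a negative left side would give 0, but the right side is
    positive.\<close>
  have "D * (1 - exp (\<kappa> \<theta> - p)) = u / (\<kappa> \<theta> - p)"
  proof (cases "0 \<le> D * (1 - exp (\<kappa> \<theta> - p))")
    case True then show ?thesis using en k u by (subst (asm) ennreal_inj) (auto simp: u_def)
  next
    case False
    then have "ennreal (D * (1 - exp (\<kappa> \<theta> - p))) = 0" by (simp add: ennreal_neg)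
    then show ?thesis using en k u by (auto simp: u_def ennreal_eq_0_iff divide_le_0_iff)
  qed
  then have "- D * u = u / (\<kappa> \<theta> - p)" by (simp add: u_def algebra_simps)
  then have "(- D) * u = (1 / (\<kappa> \<theta> - p)) * u" by simp
  then have "- D = 1 / (\<kappa> \<theta> - p)" using u by (simp only: mult_right_cancel)
  then have R0': "R 0 = C' - 1 / (\<kappa> \<theta> - p)" unfolding D_def B_def by linarith
  then show "(\<integral>\<^sup>+y. indicator {..0} y * ennreal (exp (\<theta> * y)) \<partial>resolvent p) = ennreal (c p / (\<theta> - \<Phi> p) - 1 / (\<kappa> \<theta> - p))"
    using fin[of 0] by (simp add: f_def C'_def)
  show "0 \<le> c p / (\<theta> - \<Phi> p) - 1 / (\<kappa> \<theta> - p)" using R0[of 0] R0' by (simp add: C'_def)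
qed

lemma nn_integral_lborel_reflect:
  assumes [measurable]: "f \<in> borel_measurable borel"
  shows "(\<integral>\<^sup>+x. f (- x) \<partial>lborel) = (\<integral>\<^sup>+(x::real). f x \<partial>lborel)"
  using nn_integral_real_affine[of f "-1" 0] by simp

text \<open>On the negative half line, reflected, resolvent plus W has the transform c/(\<theta> -
  \<Phi>(p)), which is that of c exp(\<Phi>(p) x) on the nonnegative half line. On the positive half
  line the W term is zero and the exponential density is already known. The additive form keeps all
  terms nonnegative and requires no integrability of \<open>f\<close>.\<close>

lemma resolvent_density:
  assumes p: "0 < p" and f[measurable]: "f \<in> borel_measurable borel"
  shows "(\<integral>\<^sup>+y. f y \<partial>resolvent p) + (\<integral>\<^sup>+y. f y * ennreal (W p (- y)) \<partial>lborel) = (\<integral>\<^sup>+y. f y * ennreal (c p * exp (- \<Phi> p * y)) \<partial>lborel)"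
proof -
  note F = \<Phi>_root[OF p]
  have [measurable]: "W p \<in> borel_measurable borel" using p by measurable
  define M1 where "M1 = distr (density (resolvent p) (indicator {..0})) borel (\<lambda>y. - y)"
  define M2 where "M2 = density lborel (\<lambda>x. ennreal (W p x))"
  define N where "N = density lborel (\<lambda>x. indicator {0..} x * ennreal (c p * exp (\<Phi> p * x)))"
  have 1: "(\<integral>\<^sup>+x. g x \<partial>M1) = (\<integral>\<^sup>+y. indicator {..0} y * g (- y) \<partial>resolvent p)" if [measurable]: "g \<in> borel_measurable borel" for g
    unfolding M1_def by (subst nn_integral_distr, simp, simp, subst nn_integral_density) auto
  have 2: "(\<integral>\<^sup>+x. g x \<partial>M2) = (\<integral>\<^sup>+x. ennreal (W p x) * g x \<partial>lborel)" if [measurable]: "g \<in> borel_measurable borel" for g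
    unfolding M2_def by (subst nn_integral_density) auto
  have 3: "(\<integral>\<^sup>+x. g x \<partial>N) = (\<integral>\<^sup>+x. indicator {0..} x * ennreal (c p * exp (\<Phi> p * x)) * g x \<partial>lborel)" if [measurable]: "g \<in> borel_measurable borel" for g
    unfolding N_def by (subst nn_integral_density) auto
  have s12: "sets M2 = sets M1" by (simp add: M1_def M2_def)
  obtain S where S: "sets S = sets M1" "\<And>g. g \<in> borel_measurable M1 \<Longrightarrow> (\<integral>\<^sup>+x. g x \<partial>S) = (\<integral>\<^sup>+x. g x \<partial>M1) + (\<integral>\<^sup>+x. g x \<partial>M2)"
    using sum_measure_ex[OF s12] by blast
  have sM1: "sets M1 = sets borel" by (simp add: M1_def)
  then have mb: "borel_measurable M1 = borel_measurable borel" by (rule measurable_cong_sets) simp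
  have sS: "sets S = sets borel" using S(1) sM1 by simp
  have "S = N"
  proof (rule laplace_unique[where c="\<Phi> p"])
    show "sets S = sets borel" by (rule sS)
    show "sets N = sets borel" by (simp add: N_def)
    have "emeasure S {..<0} = (\<integral>\<^sup>+x. indicator {..<0} x \<partial>S)" using sS by simp
    also have "\<dots> = 0" using W_neg[OF p] by (subst S(2)) (auto simp: mb 1 2 nn_integral_0_iff_AE split: split_indicator)
    finally show "AE x in S. 0 \<le> x" by (intro AE_I[where N="{..<0}"]) (auto simp: sS)
    show "AE x in N. 0 \<le> x" unfolding N_def by (subst AE_density) (auto split: split_indicator)
    fix \<theta> assume \<theta>: "\<Phi> p < \<theta>"
    have k: "p < \<kappa> \<theta>" by (rule F(4)[OF \<theta>])
    define m where "m = c p / (\<theta> - \<Phi> p) - 1 / (\<kappa> \<theta> - p)"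
    have "(\<integral>\<^sup>+x. ennreal (exp (- \<theta> * x)) \<partial>S) = (\<integral>\<^sup>+y. indicator {..0} y * ennreal (exp (\<theta> * y)) \<partial>resolvent p) + (\<integral>\<^sup>+x. ennreal (exp (- \<theta> * x) * W p x) \<partial>lborel)"
      by (subst S(2)) (auto simp: mb 1 2 mult.commute W_nonneg[OF p] ennreal_mult)
    also have "\<dots> = ennreal m + ennreal (1 / (\<kappa> \<theta> - p))"
      unfolding resolvent_exp_neg(1)[OF p \<theta>] W_laplace_nn[OF p \<theta>] m_def ..
    finally have eS: "(\<integral>\<^sup>+x. ennreal (exp (- \<theta> * x)) \<partial>S) = ennreal m + ennreal (1 / (\<kappa> \<theta> - p))" .
    then show "(\<integral>\<^sup>+x. ennreal (exp (- \<theta> * x)) \<partial>S) < \<infinity>" by simp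
    have "(\<integral>\<^sup>+x. ennreal (exp (- \<theta> * x)) \<partial>N) = (\<integral>\<^sup>+x. ennreal (c p) * (indicator {0..} x * ennreal (exp (- (\<theta> - \<Phi> p) * x))) \<partial>lborel)"
      using c_nonneg[OF p] by (subst 3)
        (auto intro!: nn_integral_cong split: split_indicator simp: mult.assoc algebra_simps simp flip: ennreal_mult exp_add)
    also have "\<dots> = ennreal (c p / (\<theta> - \<Phi> p))"
      using nn_integral_exp_tail[of "\<theta> - \<Phi> p" 0] \<theta> c_nonneg[OF p] by (subst nn_integral_cmult) (auto simp flip: ennreal_mult)
    finally have eN: "(\<integral>\<^sup>+x. ennreal (exp (- \<theta> * x)) \<partial>N) = ennreal (c p / (\<theta> - \<Phi> p))" .
    show "(\<integral>\<^sup>+x. ennreal (exp (- \<theta> * x)) \<partial>S) = (\<integral>\<^sup>+x. ennreal (exp (- \<theta> * x)) \<partial>N)"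
    proof -
      have "0 \<le> m" unfolding m_def by (rule resolvent_exp_neg(2)[OF p \<theta>])
      then have "ennreal m + ennreal (1 / (\<kappa> \<theta> - p)) = ennreal (m + 1 / (\<kappa> \<theta> - p))"
        using k by (intro ennreal_plus[symmetric]) auto
      also have "m + 1 / (\<kappa> \<theta> - p) = c p / (\<theta> - \<Phi> p)" by (simp add: m_def)
      finally show ?thesis unfolding eS eN .
    qed
  qed
  then have "(\<integral>\<^sup>+x. f (- x) \<partial>S) = (\<integral>\<^sup>+x. f (- x) \<partial>N)" by simp
  then have neg: "(\<integral>\<^sup>+y. indicator {..0} y * f y \<partial>resolvent p) + (\<integral>\<^sup>+x. ennreal (W p x) * f (- x) \<partial>lborel)
     = (\<integral>\<^sup>+x. indicator {0..} x * ennreal (c p * exp (\<Phi> p * x)) * f (- x) \<partial>lborel)"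
    by (subst (asm) S(2)) (auto simp: mb 1 2 3)
  have r1: "(\<integral>\<^sup>+x. ennreal (W p x) * f (- x) \<partial>lborel) = (\<integral>\<^sup>+y. f y * ennreal (W p (- y)) \<partial>lborel)"
    by (subst nn_integral_lborel_reflect[symmetric]) (auto simp: mult.commute)
  have r2: "(\<integral>\<^sup>+x. indicator {0..} x * ennreal (c p * exp (\<Phi> p * x)) * f (- x) \<partial>lborel)
    = (\<integral>\<^sup>+y. indicator {..0} y * (f y * ennreal (c p * exp (- \<Phi> p * y))) \<partial>lborel)"
    by (subst nn_integral_lborel_reflect[symmetric])
       (auto intro!: nn_integral_cong split: split_indicator simp: mult.commute)
  have "(\<integral>\<^sup>+y. f y \<partial>resolvent p) = (\<integral>\<^sup>+y. indicator {..0} y * f y + indicator {0<..} y * f y \<partial>resolvent p)"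
    by (intro nn_integral_cong) (auto split: split_indicator)
  also have "\<dots> = (\<integral>\<^sup>+y. indicator {..0} y * f y \<partial>resolvent p) + (\<integral>\<^sup>+y. indicator {0<..} y * f y \<partial>resolvent p)"
    by (rule nn_integral_add) auto
  also have "(\<integral>\<^sup>+y. indicator {0<..} y * f y \<partial>resolvent p) = (\<integral>\<^sup>+y. indicator {0<..} y * (f y * ennreal (c p * exp (- \<Phi> p * y))) \<partial>lborel)"
    by (subst nn_integral_resolvent_pos[OF p f]) (simp add: mult.commute)
  finally have "(\<integral>\<^sup>+y. f y \<partial>resolvent p) + (\<integral>\<^sup>+y. f y * ennreal (W p (- y)) \<partial>lborel)
     = (\<integral>\<^sup>+y. indicator {..0} y * (f y * ennreal (c p * exp (- \<Phi> p * y))) \<partial>lborel) + (\<integral>\<^sup>+y. indicator {0<..} y * (f y * ennreal (c p * exp (- \<Phi> p * y))) \<partial>lborel)"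
    using neg unfolding r1 r2 by (simp add: ac_simps)
  also have "\<dots> = (\<integral>\<^sup>+y. indicator {..0} y * (f y * ennreal (c p * exp (- \<Phi> p * y))) + indicator {0<..} y * (f y * ennreal (c p * exp (- \<Phi> p * y))) \<partial>lborel)"
    by (rule nn_integral_add[symmetric]) auto
  also have "\<dots> = (\<integral>\<^sup>+y. f y * ennreal (c p * exp (- \<Phi> p * y)) \<partial>lborel)"
    by (intro nn_integral_cong) (auto split: split_indicator)
  finally show ?thesis .
qed

end

section \<open>Transform at first passage below zero\<close>

lemma has_bochner_integral_reflect:
  fixes f :: "real \<Rightarrow> real"
  assumes "has_bochner_integral lborel f v" shows "has_bochner_integral lborel (\<lambda>x. f (- x)) v"
  using lborel_has_bochner_integral_real_affine_iff[of "-1" f v 0] assms by simp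

lemma has_bochner_integral_le:
  fixes f g :: "'a \<Rightarrow> real"
  assumes "has_bochner_integral M f a" "has_bochner_integral M g b" "\<And>x. f x \<le> g x"
  shows "a \<le> b"
proof -
  have "integrable M f" "integrable M g" "a = (LINT x|M. f x)" "b = (LINT x|M. g x)"
    using assms(1,2) by (auto simp: has_bochner_integral_iff)
  then show ?thesis using integral_mono[OF _ _ assms(3), of M] by simp
qed

section \<open>Resolvent integrals of signed functions and the transform at passage below
  zero\<close>

context spectrally_negative begin

text \<open>If the exponential term is finite, so are the two summands on the other side of
  \<open>resolvent_density\<close>, and the identity can be solved for the resolvent
  integral.\<close>

lemma resolvent_integral_nonneg:
  fixes f :: "real \<Rightarrow> real"
  assumes p: "0 < p" and f[measurable]: "f \<in> borel_measurable borel" "\<And>y. 0 \<le> f y"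
    and i: "integrable lborel (\<lambda>y. f y * (c p * exp (- \<Phi> p * y)))"
  shows "integrable (resolvent p) f" "integrable lborel (\<lambda>y. f y * W p (- y))"
    "(LINT y|resolvent p. f y) = (LINT y|lborel. f y * (c p * exp (- \<Phi> p * y))) - (LINT y|lborel. f y * W p (- y))"
proof -
  have [measurable]: "W p \<in> borel_measurable borel" using p by measurable
  define v where "v = (LINT y|lborel. f y * (c p * exp (- \<Phi> p * y)))"
  have "(\<integral>\<^sup>+y. ennreal (f y) * ennreal (c p * exp (- \<Phi> p * y)) \<partial>lborel) = (\<integral>\<^sup>+y. ennreal (f y * (c p * exp (- \<Phi> p * y))) \<partial>lborel)"
    using f c_nonneg[OF p] by (simp add: ennreal_mult)
  also have "\<dots> = ennreal v"
    unfolding v_def using i f c_nonneg[OF p] by (intro nn_integral_eq_integral) auto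
  finally have e: "(\<integral>\<^sup>+y. ennreal (f y) \<partial>resolvent p) + (\<integral>\<^sup>+y. ennreal (f y * W p (- y)) \<partial>lborel) = ennreal v"
    using resolvent_density[OF p, of "\<lambda>y. ennreal (f y)"] f W_nonneg[OF p] by (simp add: ennreal_mult)
  obtain a b where ab: "(\<integral>\<^sup>+y. ennreal (f y) \<partial>resolvent p) = ennreal a" "0 \<le> a"
    "(\<integral>\<^sup>+y. ennreal (f y * W p (- y)) \<partial>lborel) = ennreal b" "0 \<le> b"
    using e by (cases "(\<integral>\<^sup>+y. ennreal (f y) \<partial>resolvent p)"; cases "(\<integral>\<^sup>+y. ennreal (f y * W p (- y)) \<partial>lborel)") auto
  have 1: "has_bochner_integral (resolvent p) f a"
    using ab f by (intro has_bochner_integral_nn_integral) auto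
  have 2: "has_bochner_integral lborel (\<lambda>y. f y * W p (- y)) b"
    using ab f W_nonneg[OF p] by (intro has_bochner_integral_nn_integral) auto
  have "0 \<le> v" unfolding v_def using f c_nonneg[OF p] by (intro integral_nonneg_AE) auto
  moreover have "ennreal (a + b) = ennreal v" using e ab by simp
  ultimately have "v = a + b" using ab by (simp del: ennreal_plus)
  then show "integrable (resolvent p) f" "integrable lborel (\<lambda>y. f y * W p (- y))"
    "(LINT y|resolvent p. f y) = (LINT y|lborel. f y * (c p * exp (- \<Phi> p * y))) - (LINT y|lborel. f y * W p (- y))"
    using 1 2 by (auto simp: has_bochner_integral_iff v_def)
qed

lemma resolvent_integral:
  fixes f :: "real \<Rightarrow> real"
  assumes p: "0 < p" and f[measurable]: "f \<in> borel_measurable borel"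
    and i: "integrable lborel (\<lambda>y. f y * (c p * exp (- \<Phi> p * y)))"
  shows "integrable (resolvent p) f" "integrable lborel (\<lambda>y. f y * W p (- y))"
    "(LINT y|resolvent p. f y) = (LINT y|lborel. f y * (c p * exp (- \<Phi> p * y))) - (LINT y|lborel. f y * W p (- y))"
proof -
  have [measurable]: "W p \<in> borel_measurable borel" using p by measurable
  let ?w = "\<lambda>y. c p * exp (- \<Phi> p * y)"
  define g where "g y = max 0 (f y)" for y
  define h where "h y = max 0 (- f y)" for y
  have [measurable]: "g \<in> borel_measurable borel" "h \<in> borel_measurable borel" unfolding g_def h_def by measurable
  have gi: "integrable lborel (\<lambda>y. g y * ?w y)" "integrable lborel (\<lambda>y. h y * ?w y)"
    by (rule Bochner_Integration.integrable_bound[OF i]; use c_nonneg[OF p] in \<open>auto simp: g_def h_def abs_mult intro!: mult_right_mono\<close>)+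
  note G = resolvent_integral_nonneg[OF p, of g] and H = resolvent_integral_nonneg[OF p, of h]
  have fgh: "f = (\<lambda>y. g y - h y)" by (auto simp: g_def h_def fun_eq_iff)
  have g0: "0 \<le> g y" "0 \<le> h y" for y by (auto simp: g_def h_def)
  show "integrable (resolvent p) f" "integrable lborel (\<lambda>y. f y * W p (- y))"
    "(LINT y|resolvent p. f y) = (LINT y|lborel. f y * ?w y) - (LINT y|lborel. f y * W p (- y))"
    unfolding fgh left_diff_distrib using G H gi g0 by simp_all
qed

text \<open>The exponential splits under translation, so the dependence on the starting point
  \<open>y\<close> is explicit: one multiple of exp(\<Phi>(p) y), with a coefficient given by
  \<open>g\<close>, minus a convolution with W.\<close>

lemma potential_formula:
  fixes g :: "real \<Rightarrow> real"
  assumes p: "0 < p" and g[measurable]: "g \<in> borel_measurable borel"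
    and i: "integrable lborel (\<lambda>z. g z * exp (- \<Phi> p * z))"
  shows "integrable (resolvent p) (\<lambda>z. g (y + z))" "integrable lborel (\<lambda>z. g z * W p (y - z))"
    "(LINT z|resolvent p. g (y + z)) = c p * exp (\<Phi> p * y) * (LINT z|lborel. g z * exp (- \<Phi> p * z)) - (LINT z|lborel. g z * W p (y - z))"
proof -
  define A where "A = (LINT z|lborel. g z * exp (- \<Phi> p * z))"
  have "has_bochner_integral lborel (\<lambda>z. c p * exp (\<Phi> p * y) * (g z * exp (- \<Phi> p * z))) (c p * exp (\<Phi> p * y) * A)"
    using i by (intro has_bochner_integral_mult_right) (simp add: A_def has_bochner_integral_iff)
  then have "has_bochner_integral lborel (\<lambda>z. c p * exp (\<Phi> p * y) * (g (y + 1 * z) * exp (- \<Phi> p * (y + 1 * z)))) ((c p * exp (\<Phi> p * y) * A) /\<^sub>R \<bar>1\<bar>)"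
    by (rule lborel_has_bochner_integral_real_affine_iff[OF one_neq_zero, THEN iffD1])
  moreover have "c p * exp (\<Phi> p * y) * (g (y + 1 * z) * exp (- \<Phi> p * (y + 1 * z))) = g (y + z) * (c p * exp (- \<Phi> p * z))" for z
  proof -
    have "exp (\<Phi> p * y) * exp (- \<Phi> p * (y + z)) = exp (- \<Phi> p * z)" by (simp add: algebra_simps flip: exp_add)
    then have "c p * (exp (\<Phi> p * y) * exp (- \<Phi> p * (y + z))) * g (y + z) = c p * exp (- \<Phi> p * z) * g (y + z)" by simp
    then show ?thesis by (simp add: ac_simps)
  qed
  then have eqf: "(\<lambda>z. c p * exp (\<Phi> p * y) * (g (y + 1 * z) * exp (- \<Phi> p * (y + 1 * z)))) = (\<lambda>z. g (y + z) * (c p * exp (- \<Phi> p * z)))"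
    by (intro ext)
  ultimately have 2: "has_bochner_integral lborel (\<lambda>z. g (y + z) * (c p * exp (- \<Phi> p * z))) (c p * exp (\<Phi> p * y) * A)"
    unfolding eqf by (simp only: abs_one inverse_1 scaleR_one)
  have gm: "(\<lambda>z. g (y + z)) \<in> borel_measurable borel" by measurable
  note R = resolvent_integral[OF p gm]
  have i: "integrable lborel (\<lambda>z. g (y + z) * W p (- z))" using R(2) 2 by (simp add: has_bochner_integral_iff)
  have eq: "(\<lambda>z. g (y + (- y + 1 * z)) * W p (- (- y + 1 * z))) = (\<lambda>z. g z * W p (y - z))" by simp
  show "integrable (resolvent p) (\<lambda>z. g (y + z))" using R(1) 2 by (simp add: has_bochner_integral_iff)
  show "integrable lborel (\<lambda>z. g z * W p (y - z))"
    using lborel_integrable_real_affine[OF i, of 1 "- y"] unfolding eq by simp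
  have "(LINT z|lborel. g (y + z) * W p (- z)) = (LINT z|lborel. g z * W p (y - z))"
    using lborel_integral_real_affine[of 1 "\<lambda>z. g (y + z) * W p (- z)" "- y"] unfolding eq by simp
  then show "(LINT z|resolvent p. g (y + z)) = c p * exp (\<Phi> p * y) * (LINT z|lborel. g z * exp (- \<Phi> p * z)) - (LINT z|lborel. g z * W p (y - z))"
    using R(3) 2 by (simp add: has_bochner_integral_iff A_def)
qed

text \<open>The integral of exp(-\<theta> s) W(s) from 0 to \<open>x\<close>. Since W vanishes on
  the negative half line, no lower bound is written and the value for negative \<open>x\<close> is
  0.\<close>

definition I :: "real \<Rightarrow> real \<Rightarrow> real \<Rightarrow> real" where
  "I p \<theta> x = (LINT s|lborel. indicator {..x} s * (exp (- \<theta> * s) * W p s))"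

lemma W_loc_integrable:
  assumes p: "0 < p" shows "integrable lborel (\<lambda>s. indicator {..x} s * (exp (- \<theta> * s) * W p s))"
proof (rule Bochner_Integration.integrable_bound[where f="\<lambda>s. exp (\<bar>\<theta>\<bar> * \<bar>x\<bar>) * W p x * indicator {0..x} s"])
  have [measurable]: "W p \<in> borel_measurable borel" using p by measurable
  show "integrable lborel (\<lambda>s. exp (\<bar>\<theta>\<bar> * \<bar>x\<bar>) * W p x * indicator {0..x} s)"
    by (intro integrable_mult_right integrable_real_indicator) (auto simp: emeasure_lborel_Icc_eq)
  show "(\<lambda>s. indicator {..x} s * (exp (- \<theta> * s) * W p s)) \<in> borel_measurable lborel" by measurable
  show "AE s in lborel. norm (indicator {..x} s * (exp (- \<theta> * s) * W p s)) \<le> norm (exp (\<bar>\<theta>\<bar> * \<bar>x\<bar>) * W p x * indicator {0..x} s)"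
  proof (rule AE_I2)
    fix s
    show "norm (indicator {..x} s * (exp (- \<theta> * s) * W p s)) \<le> norm (exp (\<bar>\<theta>\<bar> * \<bar>x\<bar>) * W p x * indicator {0..x} s)"
    proof (cases "0 \<le> s \<and> s \<le> x")
      case True
      have "- \<theta> * s \<le> \<bar>\<theta>\<bar> * s" using True by (intro mult_right_mono) auto
      also have "\<dots> \<le> \<bar>\<theta>\<bar> * \<bar>x\<bar>" using True by (intro mult_left_mono) auto
      finally have "- \<theta> * s \<le> \<bar>\<theta>\<bar> * \<bar>x\<bar>" .
      then have "exp (- \<theta> * s) * W p s \<le> exp (\<bar>\<theta>\<bar> * \<bar>x\<bar>) * W p x"
        using W_mono[OF p, of s x] W_nonneg[OF p] True by (intro mult_mono) auto
      then show ?thesis using True W_nonneg[OF p] by (simp add: abs_mult)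
    qed (use W_neg[OF p, of s] in \<open>auto split: split_indicator\<close>)
  qed
qed

lemma I_neg: assumes "0 < p" "x \<le> 0" shows "I p \<theta> x = 0"
proof -
  have "I p \<theta> x = (LINT (s::real)|lborel. 0)"
    unfolding I_def
  proof (rule integral_cong_AE)
    show "AE s in lborel. indicator {..x} s * (exp (- \<theta> * s) * W p s) = 0"
      by (rule eventually_mono[OF AE_lborel_singleton[of 0]]) (use W_neg[OF assms(1)] assms(2) in \<open>auto split: split_indicator\<close>)
    show "(\<lambda>s. indicator {..x} s * (exp (- \<theta> * s) * W p s)) \<in> borel_measurable lborel"
      by (rule borel_measurable_integrable[OF W_loc_integrable[OF assms(1)]])
  qed simp
  also have "\<dots> = 0" by simp
  finally show ?thesis .
qed

lemma W_tail:
  assumes p: "0 < p" and \<theta>: "\<Phi> p < \<theta>"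
  shows "has_bochner_integral lborel (\<lambda>s. indicator {x<..} s * (exp (- \<theta> * s) * W p s)) (1 / (\<kappa> \<theta> - p) - I p \<theta> x)"
proof -
  have "has_bochner_integral lborel (\<lambda>s. exp (- \<theta> * s) * W p s - indicator {..x} s * (exp (- \<theta> * s) * W p s)) (1 / (\<kappa> \<theta> - p) - I p \<theta> x)"
    using W_integrable[OF p \<theta>] W_laplace[OF p \<theta>] W_loc_integrable[OF p, of x \<theta>]
    by (intro has_bochner_integral_diff) (auto simp: has_bochner_integral_iff I_def)
  also have "(\<lambda>s. exp (- \<theta> * s) * W p s - indicator {..x} s * (exp (- \<theta> * s) * W p s)) = (\<lambda>s. indicator {x<..} s * (exp (- \<theta> * s) * W p s))"
    by (auto simp: fun_eq_iff split: split_indicator)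
  finally show ?thesis .
qed

text \<open>The potential, seen from \<open>x\<close>, of the function equal to exp(\<theta> y) for
  negative \<open>y\<close> and 0 otherwise.\<close>

definition P :: "real \<Rightarrow> real \<Rightarrow> real \<Rightarrow> real" where
  "P p \<theta> x = (LINT y|resolvent p. indicator {..<- x} y * exp (\<theta> * (x + y)))"

text \<open>Above \<Phi>(p) both parts of the density are integrable against the exponential near
  minus infinity and are integrated directly; below \<Phi>(p) the complement is. The two routes give
  one expression, with a pole at \<Phi>(p).\<close>

lemma P_eq:
  assumes p: "0 < p" and \<theta>: "0 \<le> \<theta>" "\<theta> \<noteq> \<Phi> p"
  shows "P p \<theta> x = exp (\<theta> * x) * (1 / (p - \<kappa> \<theta>) + I p \<theta> x) + c p * exp (\<Phi> p * x) / (\<theta> - \<Phi> p)"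
proof (cases "\<Phi> p < \<theta>")
  case True
  define f where "f y = indicator {..<- x} y * exp (\<theta> * (x + y))" for y :: real
  have [measurable]: "f \<in> borel_measurable borel" unfolding f_def by measurable
  have "has_bochner_integral lborel (\<lambda>y. c p * exp (\<theta> * x) * (indicator {x<..} (- y) * exp (- (\<theta> - \<Phi> p) * (- y))))
     (c p * exp (\<theta> * x) * (exp (- (\<theta> - \<Phi> p) * x) / (\<theta> - \<Phi> p)))"
    using True by (intro has_bochner_integral_mult_right has_bochner_integral_reflect has_bochner_integral_exp_tail) auto
  also have "(\<lambda>y. c p * exp (\<theta> * x) * (indicator {x<..} (- y) * exp (- (\<theta> - \<Phi> p) * (- y)))) = (\<lambda>y. f y * (c p * exp (- \<Phi> p * y)))"
    by (auto simp: f_def fun_eq_iff algebra_simps split: split_indicator simp flip: exp_add)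
  finally have 1: "has_bochner_integral lborel (\<lambda>y. f y * (c p * exp (- \<Phi> p * y))) (c p * exp (\<theta> * x) * (exp (- (\<theta> - \<Phi> p) * x) / (\<theta> - \<Phi> p)))" .
  have e1: "c p * exp (\<theta> * x) * (exp (- (\<theta> - \<Phi> p) * x) / (\<theta> - \<Phi> p)) = c p * exp (\<Phi> p * x) / (\<theta> - \<Phi> p)"
    by (simp add: algebra_simps flip: exp_add)
  have "has_bochner_integral lborel (\<lambda>y. exp (\<theta> * x) * (indicator {x<..} (- y) * (exp (- \<theta> * (- y)) * W p (- y)))) (exp (\<theta> * x) * (1 / (\<kappa> \<theta> - p) - I p \<theta> x))"
    by (intro has_bochner_integral_mult_right has_bochner_integral_reflect[OF W_tail[OF p True]])
  also have "(\<lambda>y. exp (\<theta> * x) * (indicator {x<..} (- y) * (exp (- \<theta> * (- y)) * W p (- y)))) = (\<lambda>y. f y * W p (- y))"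
    by (auto simp: f_def fun_eq_iff algebra_simps split: split_indicator simp flip: exp_add)
  finally have 2: "has_bochner_integral lborel (\<lambda>y. f y * W p (- y)) (exp (\<theta> * x) * (1 / (\<kappa> \<theta> - p) - I p \<theta> x))" .
  have "P p \<theta> x = c p * exp (\<Phi> p * x) / (\<theta> - \<Phi> p) - exp (\<theta> * x) * (1 / (\<kappa> \<theta> - p) - I p \<theta> x)"
    using resolvent_integral(3)[OF p, of f] 1 2 e1 by (simp add: P_def f_def has_bochner_integral_iff)
  moreover have "1 / (p - \<kappa> \<theta>) = - (1 / (\<kappa> \<theta> - p))" by (metis minus_diff_eq minus_divide_right)
  ultimately show ?thesis by (simp add: algebra_simps)
next
  case False
  then have \<theta>': "\<theta> < \<Phi> p" using \<theta> by simp
  \<comment> \<open>Here the exponential part of the density is not integrable near minus infinity,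
    so the complementary half line is integrated and subtracted from the full exponential
    integral.\<close>
  define f where "f y = indicator {- x..} y * exp (\<theta> * (x + y))" for y :: real
  have [measurable]: "f \<in> borel_measurable borel" unfolding f_def by measurable
  have "has_bochner_integral lborel (\<lambda>y. c p * exp (\<theta> * x) * (indicator {- x<..} y * exp (- (\<Phi> p - \<theta>) * y)))
     (c p * exp (\<theta> * x) * (exp (- (\<Phi> p - \<theta>) * (- x)) / (\<Phi> p - \<theta>)))"
    using \<theta>' by (intro has_bochner_integral_mult_right has_bochner_integral_exp_tail) auto
  then have "has_bochner_integral lborel (\<lambda>y. f y * (c p * exp (- \<Phi> p * y))) (c p * exp (\<theta> * x) * (exp (- (\<Phi> p - \<theta>) * (- x)) / (\<Phi> p - \<theta>)))"
  proof (rule has_bochner_integral_cong_AE[THEN iffD1, rotated 3])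
    show "AE y in lborel. c p * exp (\<theta> * x) * (indicator {- x<..} y * exp (- (\<Phi> p - \<theta>) * y)) = f y * (c p * exp (- \<Phi> p * y))"
      by (rule eventually_mono[OF AE_lborel_singleton[of "- x"]])
         (auto simp: f_def algebra_simps split: split_indicator simp flip: exp_add)
  qed auto
  moreover have e1: "c p * exp (\<theta> * x) * (exp (- (\<Phi> p - \<theta>) * (- x)) / (\<Phi> p - \<theta>)) = c p * exp (\<Phi> p * x) / (\<Phi> p - \<theta>)"
    by (simp add: algebra_simps flip: exp_add)
  ultimately have 1: "has_bochner_integral lborel (\<lambda>y. f y * (c p * exp (- \<Phi> p * y))) (c p * exp (\<Phi> p * x) / (\<Phi> p - \<theta>))" by (simp only: e1)
  have "has_bochner_integral lborel (\<lambda>s. indicator {..x} s * (exp (- \<theta> * s) * W p s)) (I p \<theta> x)"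
    using W_loc_integrable[OF p, of x \<theta>] by (simp add: has_bochner_integral_iff I_def)
  then have "has_bochner_integral lborel (\<lambda>y. exp (\<theta> * x) * (indicator {..x} (- y) * (exp (- \<theta> * (- y)) * W p (- y)))) (exp (\<theta> * x) * I p \<theta> x)"
    by (intro has_bochner_integral_mult_right has_bochner_integral_reflect)
  also have "(\<lambda>y. exp (\<theta> * x) * (indicator {..x} (- y) * (exp (- \<theta> * (- y)) * W p (- y)))) = (\<lambda>y. f y * W p (- y))"
    by (auto simp: f_def fun_eq_iff algebra_simps split: split_indicator simp flip: exp_add)
  finally have 2: "has_bochner_integral lborel (\<lambda>y. f y * W p (- y)) (exp (\<theta> * x) * I p \<theta> x)" .
  have 3: "integrable (resolvent p) f" "(LINT y|resolvent p. f y) = c p * exp (\<Phi> p * x) / (\<Phi> p - \<theta>) - exp (\<theta> * x) * I p \<theta> x"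
    using resolvent_integral[OF p, of f] 1 2 by (simp_all add: has_bochner_integral_iff)
  have 4: "has_bochner_integral (resolvent p) (\<lambda>y. exp (\<theta> * y)) (1 / (p - \<kappa> \<theta>))"
    using resolvent_exp[OF p \<theta>(1) \<theta>'] \<Phi>_root(3)[OF p \<theta>(1) \<theta>'] by (intro has_bochner_integral_nn_integral) auto
  have 5: "has_bochner_integral (resolvent p) (\<lambda>y. exp (\<theta> * x) * exp (\<theta> * y) - f y)
     (exp (\<theta> * x) * (1 / (p - \<kappa> \<theta>)) - (c p * exp (\<Phi> p * x) / (\<Phi> p - \<theta>) - exp (\<theta> * x) * I p \<theta> x))"
    using 3 4 by (intro has_bochner_integral_diff has_bochner_integral_mult_right) (auto simp: has_bochner_integral_iff)
  have "(\<lambda>y. exp (\<theta> * x) * exp (\<theta> * y) - f y) = (\<lambda>y. indicator {..<- x} y * exp (\<theta> * (x + y)))"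
    by (auto simp: f_def fun_eq_iff distrib_left exp_add split: split_indicator)
  then have "P p \<theta> x = exp (\<theta> * x) * (1 / (p - \<kappa> \<theta>)) - (c p * exp (\<Phi> p * x) / (\<Phi> p - \<theta>) - exp (\<theta> * x) * I p \<theta> x)"
    using 5 by (simp add: P_def has_bochner_integral_iff)
  moreover have "c p * exp (\<Phi> p * x) / (\<Phi> p - \<theta>) = - (c p * exp (\<Phi> p * x) / (\<theta> - \<Phi> p))" by (metis minus_diff_eq minus_divide_right)
  ultimately show ?thesis by (simp add: algebra_simps)
qed

lemma hit_neg:
  assumes c: "cadlag f" and h: "hits {..<0} f" shows "f (hit_time {..<0} f) \<le> 0"
proof (rule ccontr)
  let ?\<tau> = "hit_time {..<0} f"
  assume n: "\<not> f ?\<tau> \<le> 0"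
  moreover have "(f \<longlongrightarrow> f ?\<tau>) (at_right ?\<tau>)" using c hit_time_facts(1)[OF h] by (auto simp: cadlag_def)
  ultimately have "eventually (\<lambda>s. 0 < f s) (at_right ?\<tau>)" by (intro order_tendstoD(1)) auto
  then obtain u where u: "?\<tau> < u" "\<And>s. ?\<tau> < s \<Longrightarrow> s < u \<Longrightarrow> 0 < f s"
    by (auto simp: eventually_at_right_field)
  obtain t where t: "0 < t" "f t < 0" "t < ?\<tau> + (u - ?\<tau>)" using hit_time_facts(3)[OF h, of "u - ?\<tau>"] u by auto
  have "?\<tau> \<le> t" using hit_time_facts(2)[OF h] t by auto
  then show False using t u(2)[of t] n by (cases "t = ?\<tau>") auto
qed

abbreviation "H p x \<theta> \<equiv> hit_transform {..<0} p x (\<lambda>y. exp (\<theta> * y))"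

text \<open>The transform is determined by the values of \<open>v\<close> on the negative half line, where the
  process is at the passage time.\<close>

lemma hit_transform_bdd:
  assumes p: "0 < p" and v[measurable]: "v \<in> borel_measurable borel" and B: "\<And>y. y \<le> 0 \<Longrightarrow> \<bar>v y\<bar> \<le> B"
  shows "integrable M (\<lambda>\<omega>. if hits {..<0} (path x \<omega>)
     then exp (- p * hit_time {..<0} (path x \<omega>)) * v (x + X (hit_time {..<0} (path x \<omega>)) \<omega>) else 0)"
    "AE \<omega> in M. norm (if hits {..<0} (path x \<omega>)
     then exp (- p * hit_time {..<0} (path x \<omega>)) * v (x + X (hit_time {..<0} (path x \<omega>)) \<omega>) else 0) \<le> B"
proof -
  have B0: "0 \<le> B" using B[of 0] by linarith
  show ae: "AE \<omega> in M. norm (if hits {..<0} (path x \<omega>)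
     then exp (- p * hit_time {..<0} (path x \<omega>)) * v (x + X (hit_time {..<0} (path x \<omega>)) \<omega>) else 0) \<le> B"
  proof (rule AE_I2)
    fix \<omega> assume \<omega>: "\<omega> \<in> space M"
    show "norm (if hits {..<0} (path x \<omega>)
     then exp (- p * hit_time {..<0} (path x \<omega>)) * v (x + X (hit_time {..<0} (path x \<omega>)) \<omega>) else 0) \<le> B"
    proof (cases "hits {..<0} (path x \<omega>)")
      case True
      have "exp (- p * hit_time {..<0} (path x \<omega>)) * \<bar>v (x + X (hit_time {..<0} (path x \<omega>)) \<omega>)\<bar> \<le> 1 * B"
        using B[OF hit_neg[OF path_cadlag[OF \<omega>] True]] hit_time_facts(1)[OF True] p by (intro mult_mono) auto
      then show ?thesis using True by (simp add: abs_mult)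
    qed (use B0 in simp)
  qed
  show "integrable M (\<lambda>\<omega>. if hits {..<0} (path x \<omega>)
     then exp (- p * hit_time {..<0} (path x \<omega>)) * v (x + X (hit_time {..<0} (path x \<omega>)) \<omega>) else 0)"
    by (rule integrable_const_bound[OF ae hit_transform_measurable]) auto
qed

lemma hit_transform_lincomb:
  assumes p: "0 < p" and [measurable]: "v \<in> borel_measurable borel" and v: "\<And>y. y \<le> 0 \<Longrightarrow> v y = a * exp (\<theta> * y) + b * exp (\<eta> * y)"
    and "0 \<le> \<theta>" "0 \<le> \<eta>"
  shows "hit_transform {..<0} p x v = a * H p x \<theta> + b * H p x \<eta>"
proof -
  let ?h = "\<lambda>v \<omega>. if hits {..<0} (path x \<omega>) then exp (- p * hit_time {..<0} (path x \<omega>)) * v (x + X (hit_time {..<0} (path x \<omega>)) \<omega>) else 0"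
  have e: "integrable M (?h (\<lambda>y. exp (\<theta> * y)))" if "0 \<le> \<theta>" for \<theta>
    by (rule hit_transform_bdd[OF p, where B=1]) (use that in \<open>auto simp: mult_nonneg_nonpos\<close>)
  have "hit_transform {..<0} p x v = (LINT \<omega>|M. a * ?h (\<lambda>y. exp (\<theta> * y)) \<omega> + b * ?h (\<lambda>y. exp (\<eta> * y)) \<omega>)"
    unfolding hit_transform_def
  proof (rule Bochner_Integration.integral_cong[OF refl])
    fix \<omega> assume \<omega>: "\<omega> \<in> space M"
    show "?h v \<omega> = a * ?h (\<lambda>y. exp (\<theta> * y)) \<omega> + b * ?h (\<lambda>y. exp (\<eta> * y)) \<omega>"
      using v[OF hit_neg[OF path_cadlag[OF \<omega>]], of x] by (auto simp: algebra_simps)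
  qed
  also have "\<dots> = a * H p x \<theta> + b * H p x \<eta>"
    unfolding hit_transform_def using e[OF assms(4)] e[OF assms(5)] by (subst Bochner_Integration.integral_add) auto
  finally show ?thesis .
qed

lemma H_nonneg: "0 \<le> H p x \<theta>"
  unfolding hit_transform_def by (intro integral_nonneg_AE) auto

lemma potential_measurable:
  assumes p: "0 < p" and g: "continuous_on UNIV g" "\<And>y. \<bar>g y\<bar> \<le> B"
  shows "potential p g \<in> borel_measurable borel"
  by (intro borel_measurable_continuous_onI continuous_at_imp_continuous_on ballI)
     (auto simp: continuous_at_sequentially comp_def intro!: potential_continuous[OF p g])

text \<open>\<open>P\<close> is a potential of a function that lives on the negative half line, so
  the strong Markov property at passage below zero reproduces it. At that time the position is not
  positive, where \<open>I\<close> vanishes and \<open>P\<close> is a combination of two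
  exponentials; their transforms are the two values of \<open>H\<close>.\<close>

lemma H_relation:
  assumes p: "0 < p" and \<theta>: "0 \<le> \<theta>" "\<theta> \<noteq> \<Phi> p"
  shows "H p x \<theta> / (p - \<kappa> \<theta>) + c p * H p x (\<Phi> p) / (\<theta> - \<Phi> p) = P p \<theta> x"
proof -
  interpret R: finite_measure "resolvent p" using finite_resolvent p by simp
  \<comment> \<open>Continuous functions that tend to the discontinuous integrand of
    \<open>P\<close> and vanish off the open half line, as the strong Markov property demands.
    \<open>min 0 y\<close> keeps the exponential bounded.\<close>
  define g where "g n y = exp (\<theta> * min 0 y) * min 1 (real n * max 0 (- y))" for n y
  have gc: "continuous_on UNIV (g n)" for n unfolding g_def by (intro continuous_intros)
  have g01: "0 \<le> g n y" "g n y \<le> 1" for n y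
  proof -
    show "0 \<le> g n y" by (simp add: g_def)
    have "exp (\<theta> * min 0 y) * min 1 (real n * max 0 (- y)) \<le> 1 * 1"
      using \<theta> by (intro mult_mono) (auto simp: mult_nonneg_nonpos)
    then show "g n y \<le> 1" by (simp add: g_def)
  qed
  have gz: "y \<notin> {..<0} \<Longrightarrow> g n y = 0" for n y by (simp add: g_def)
  have gabs: "\<bar>g n y\<bar> \<le> 1" for n y using g01[of n y] by simp
  have [measurable]: "g n \<in> borel_measurable borel" for n using gc by (rule borel_measurable_continuous_onI)
  have glim: "(\<lambda>n. g n y) \<longlonglongrightarrow> indicator {..<0} y * exp (\<theta> * y)" for y
  proof (cases "y < 0")
    case True
    obtain m where m: "1 / (- y) < real m" using reals_Archimedean2 by blast
    have "eventually (\<lambda>n. g n y = indicator {..<0} y * exp (\<theta> * y)) sequentially"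
    proof (rule eventually_sequentiallyI[of m])
      fix n assume "m \<le> n"
      then have "1 / (- y) \<le> real n" using m by linarith
      then have "1 \<le> real n * (- y)" using True by (simp add: field_simps)
      then show "g n y = indicator {..<0} y * exp (\<theta> * y)" using True by (simp add: g_def)
    qed
    then show ?thesis by (rule tendsto_eventually)
  qed (simp add: g_def)
  have pl: "(\<lambda>n. potential p (g n) y) \<longlonglongrightarrow> P p \<theta> y" for y
    unfolding potential_def P_def
  proof (rule integral_dominated_convergence[where w="\<lambda>_. 1"])
    show "AE z in resolvent p. (\<lambda>n. g n (y + z)) \<longlonglongrightarrow> indicator {..<- y} z * exp (\<theta> * (y + z))"
    proof (rule AE_I2)
      fix z
      have "indicator {..<- y} z = (indicator {..<0} (y + z) :: real)" by (auto split: split_indicator)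
      then show "(\<lambda>n. g n (y + z)) \<longlonglongrightarrow> indicator {..<- y} z * exp (\<theta> * (y + z))" using glim[of "y + z"] by simp
    qed
  qed (use gabs in auto)
  have Pm[measurable]: "P p \<theta> \<in> borel_measurable borel"
    by (rule borel_measurable_LIMSEQ_real[OF pl]) (rule potential_measurable[OF p gc gabs])
  have pb: "\<bar>potential p (g n) y\<bar> \<le> 1 / p" for n y
    using potential_bounds[OF p, of "g n" 1 y] g01 by simp
  have "(\<lambda>n. hit_transform {..<0} p x (potential p (g n))) \<longlonglongrightarrow> hit_transform {..<0} p x (P p \<theta>)"
    unfolding hit_transform_def
  proof (rule integral_dominated_convergence[where w="\<lambda>_. 1 / p"])
    show "(\<lambda>\<omega>. if hits {..<0} (path x \<omega>) then exp (- p * hit_time {..<0} (path x \<omega>)) * P p \<theta> (x + X (hit_time {..<0} (path x \<omega>)) \<omega>) else 0) \<in> borel_measurable M"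
      by (rule hit_transform_measurable) auto
    show "(\<lambda>\<omega>. if hits {..<0} (path x \<omega>) then exp (- p * hit_time {..<0} (path x \<omega>)) * potential p (g n) (x + X (hit_time {..<0} (path x \<omega>)) \<omega>) else 0) \<in> borel_measurable M" for n
      by (rule hit_transform_measurable) (auto intro: potential_measurable[OF p gc gabs])
    show "AE \<omega> in M. norm (if hits {..<0} (path x \<omega>) then exp (- p * hit_time {..<0} (path x \<omega>)) * potential p (g n) (x + X (hit_time {..<0} (path x \<omega>)) \<omega>) else 0) \<le> 1 / p" for n
      by (rule hit_transform_bdd(2)[OF p potential_measurable[OF p gc gabs] pb])
    show "AE \<omega> in M. (\<lambda>n. if hits {..<0} (path x \<omega>) then exp (- p * hit_time {..<0} (path x \<omega>)) * potential p (g n) (x + X (hit_time {..<0} (path x \<omega>)) \<omega>) else 0)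
      \<longlonglongrightarrow> (if hits {..<0} (path x \<omega>) then exp (- p * hit_time {..<0} (path x \<omega>)) * P p \<theta> (x + X (hit_time {..<0} (path x \<omega>)) \<omega>) else 0)"
      by (rule AE_I2) (auto intro!: tendsto_intros pl)
  qed simp
  moreover have "hit_transform {..<0} p x (potential p (g n)) = potential p (g n) x" for n
    by (rule strong_markov_le(2)[OF p open_lessThan gc g01 gz])
  ultimately have "hit_transform {..<0} p x (P p \<theta>) = P p \<theta> x"
    using LIMSEQ_unique[OF pl[of x]] by simp
  moreover have "hit_transform {..<0} p x (P p \<theta>) = (1 / (p - \<kappa> \<theta>)) * H p x \<theta> + (c p / (\<theta> - \<Phi> p)) * H p x (\<Phi> p)"
    using \<Phi>_root(1)[OF p] \<theta> by (intro hit_transform_lincomb[OF p Pm]) (auto simp: P_eq[OF p \<theta>] I_neg[OF p])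
  ultimately show ?thesis by simp
qed

section \<open>Recovering the scale function from the passage transform\<close>

lemma W_tendsto_right:
  assumes "0 < p" "0 \<le> x" shows "((\<lambda>\<delta>. W p (x + \<delta>)) \<longlongrightarrow> W p x) (at_right 0)"
proof -
  have "continuous (at x within {0..}) (W p)" using W_cont[OF assms(1)] assms(2) by (auto simp: continuous_on_eq_continuous_within)
  then have "(W p \<longlongrightarrow> W p x) (at x within {0..})" by (simp add: continuous_within)
  moreover have "filterlim (\<lambda>\<delta>. x + \<delta>) (at x within {0..}) (at_right 0)"
    unfolding filterlim_at using assms(2)
    by (auto simp: eventually_at_right_field intro!: exI[of _ 1] tendsto_eq_intros)
  ultimately show ?thesis by (rule filterlim_compose)
qed

lemma W_tendsto_left:
  assumes "0 < p" "0 < x" shows "((\<lambda>\<delta>. W p (x - \<delta>)) \<longlongrightarrow> W p x) (at_right 0)"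
proof -
  have "isCont (W p) x" by (rule continuous_on_interior[OF W_cont[OF assms(1)]]) (use assms(2) in simp)
  moreover have "((\<lambda>\<delta>. x - \<delta>) \<longlongrightarrow> x) (at_right 0)" by (auto intro!: tendsto_eq_intros)
  ultimately show ?thesis by (auto intro: isCont_tendsto_compose)
qed

text \<open>Candidate for W: equal to \<open>W p x\<close> for positive \<open>x\<close>, as the two
  inequalities below show. This identity removes the unevaluated \<open>c p\<close> from the passage
  transform.\<close>

definition \<omega>' :: "real \<Rightarrow> real \<Rightarrow> real" where
  "\<omega>' p x = c p * (exp (\<Phi> p * x) - H p x (\<Phi> p))"

text \<open>Dropping the nonnegative transform at \<theta> from \<open>H_relation\<close> bounds the
  candidate by (\<theta> - \<Phi>(p)) exp(\<theta> x) times the integral of exp(-\<theta> s) W(s)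
  beyond \<open>x\<close>. For large \<theta> this concentrates at \<open>x\<close>, and right
  continuity of W finishes the bound.\<close>

lemma \<omega>'_le:
  assumes p: "0 < p" and x: "0 \<le> x"
  shows "\<omega>' p x \<le> W p x"
proof -
  note F = \<Phi>_root[OF p]
  define \<theta>1 where "\<theta>1 = \<Phi> p + 1"
  have \<theta>1: "\<Phi> p < \<theta>1" by (simp add: \<theta>1_def)
  define C where "C = 1 / (\<kappa> \<theta>1 - p) - I p \<theta>1 x"
  have bound: "\<omega>' p x \<le> W p (x + \<delta>) + (C * exp (\<theta>1 * (x + \<delta>))) * ((\<theta> - \<Phi> p) * exp (- \<theta> * \<delta>))"
    if \<theta>: "\<theta>1 < \<theta>" and \<delta>: "0 < \<delta>" for \<theta> \<delta>
  proof -
    have \<theta>': "\<Phi> p < \<theta>" "0 < \<theta>" using \<theta> \<theta>1 F(1) by auto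
    have k: "0 < \<kappa> \<theta> - p" using F(4)[OF \<theta>'(1)] by simp
    define T where "T = 1 / (\<kappa> \<theta> - p) - I p \<theta> x"
    have "H p x \<theta> / (p - \<kappa> \<theta>) + c p * H p x (\<Phi> p) / (\<theta> - \<Phi> p) = exp (\<theta> * x) * (1 / (p - \<kappa> \<theta>) + I p \<theta> x) + c p * exp (\<Phi> p * x) / (\<theta> - \<Phi> p)"
      using H_relation[OF p, of \<theta> x] P_eq[OF p, of \<theta> x] \<theta>' by simp
    moreover have "1 / (p - \<kappa> \<theta>) = - (1 / (\<kappa> \<theta> - p))" "H p x \<theta> / (p - \<kappa> \<theta>) = - (H p x \<theta> / (\<kappa> \<theta> - p))"
      by (metis minus_diff_eq minus_divide_right)+
    ultimately have "\<omega>' p x / (\<theta> - \<Phi> p) = exp (\<theta> * x) * T - H p x \<theta> / (\<kappa> \<theta> - p)"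
      by (simp add: \<omega>'_def T_def algebra_simps diff_divide_distrib)
    also have "\<dots> \<le> exp (\<theta> * x) * T" using H_nonneg[of p x \<theta>] k by simp
    finally have "\<omega>' p x \<le> (\<theta> - \<Phi> p) * (exp (\<theta> * x) * T)" using \<theta>' by (simp add: field_simps)
    \<comment> \<open>The tail is split at \<open>x + \<delta>\<close>. Before it, W is at most
      \<open>W p (x + \<delta>)\<close>; beyond it, the exponential is compared with the one at the
      fixed exponent \<open>\<theta>1\<close>, whose integral is controlled by \<open>C\<close>, and
      the comparison factor decays in \<theta>.\<close>
    also have "T \<le> W p (x + \<delta>) * (exp (- \<theta> * x) / \<theta>) + exp (- (\<theta> - \<theta>1) * (x + \<delta>)) * C"
    proof (rule has_bochner_integral_le)
      show "has_bochner_integral lborel (\<lambda>s. indicator {x<..} s * (exp (- \<theta> * s) * W p s)) T"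
        unfolding T_def by (rule W_tail[OF p \<theta>'(1)])
      show "has_bochner_integral lborel (\<lambda>s. W p (x + \<delta>) * (indicator {x<..} s * exp (- \<theta> * s)) + exp (- (\<theta> - \<theta>1) * (x + \<delta>)) * (indicator {x<..} s * (exp (- \<theta>1 * s) * W p s)))
         (W p (x + \<delta>) * (exp (- \<theta> * x) / \<theta>) + exp (- (\<theta> - \<theta>1) * (x + \<delta>)) * C)"
        unfolding C_def by (intro has_bochner_integral_add has_bochner_integral_mult_right has_bochner_integral_exp_tail W_tail[OF p \<theta>1] \<theta>'(2))
      fix s
      show "indicator {x<..} s * (exp (- \<theta> * s) * W p s) \<le> W p (x + \<delta>) * (indicator {x<..} s * exp (- \<theta> * s)) + exp (- (\<theta> - \<theta>1) * (x + \<delta>)) * (indicator {x<..} s * (exp (- \<theta>1 * s) * W p s))"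
      proof (cases "x < s")
        case xs: True
        have i1: "indicator {x<..} s = (1::real)" using xs by simp
        have n1: "0 \<le> exp (- (\<theta> - \<theta>1) * (x + \<delta>)) * (exp (- \<theta>1 * s) * W p s)" using W_nonneg[OF p] by simp
        have n2: "0 \<le> W p (x + \<delta>) * exp (- \<theta> * s)" using W_nonneg[OF p] by simp
        show ?thesis
        proof (cases "s \<le> x + \<delta>")
          case True
          have "exp (- \<theta> * s) * W p s \<le> exp (- \<theta> * s) * W p (x + \<delta>)" using W_mono[OF p True] by (intro mult_left_mono) auto
          also have "\<dots> = W p (x + \<delta>) * exp (- \<theta> * s)" by (rule mult.commute)
          finally show ?thesis unfolding i1 mult_1 using n1 by linarith
        next
          case False
          have "exp (- \<theta> * s) = exp (- (\<theta> - \<theta>1) * s) * exp (- \<theta>1 * s)" by (simp add: algebra_simps flip: exp_add)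
          also have "\<dots> \<le> exp (- (\<theta> - \<theta>1) * (x + \<delta>)) * exp (- \<theta>1 * s)" using False \<theta> by (intro mult_right_mono) (auto intro: mult_left_mono)
          finally have "exp (- \<theta> * s) * W p s \<le> exp (- (\<theta> - \<theta>1) * (x + \<delta>)) * exp (- \<theta>1 * s) * W p s"
            using W_nonneg[OF p] by (intro mult_right_mono) auto
          then show ?thesis unfolding i1 mult_1 mult.assoc using n2 by linarith
        qed
      qed simp
    qed
    also have "(\<theta> - \<Phi> p) * (exp (\<theta> * x) * (W p (x + \<delta>) * (exp (- \<theta> * x) / \<theta>) + exp (- (\<theta> - \<theta>1) * (x + \<delta>)) * C))
      = W p (x + \<delta>) * ((\<theta> - \<Phi> p) / \<theta>) + (C * exp (\<theta>1 * (x + \<delta>))) * ((\<theta> - \<Phi> p) * exp (- \<theta> * \<delta>))"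
    proof -
      have "exp (\<theta> * x) * exp (- \<theta> * x) = 1" by (simp flip: exp_add)
      moreover have "exp (\<theta> * x) * exp (- (\<theta> - \<theta>1) * (x + \<delta>)) = exp (\<theta>1 * (x + \<delta>)) * exp (- \<theta> * \<delta>)"
        by (simp add: algebra_simps flip: exp_add)
      ultimately have "(\<theta> - \<Phi> p) * (W p (x + \<delta>) * ((exp (\<theta> * x) * exp (- \<theta> * x)) / \<theta>) + (exp (\<theta> * x) * exp (- (\<theta> - \<theta>1) * (x + \<delta>))) * C)
        = W p (x + \<delta>) * ((\<theta> - \<Phi> p) / \<theta>) + (C * exp (\<theta>1 * (x + \<delta>))) * ((\<theta> - \<Phi> p) * exp (- \<theta> * \<delta>))"
        by (simp add: algebra_simps)
      then show ?thesis by (simp add: distrib_left mult.assoc mult.left_commute)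
    qed
    also have "W p (x + \<delta>) * ((\<theta> - \<Phi> p) / \<theta>) \<le> W p (x + \<delta>) * 1"
      using W_nonneg[OF p] \<theta>' F(1) by (intro mult_left_mono) auto
    finally show ?thesis using \<theta>' by simp
  qed
  have le: "\<omega>' p x \<le> W p (x + \<delta>)" if \<delta>: "0 < \<delta>" for \<delta>
  proof (rule tendsto_lowerbound)
    have "((\<lambda>\<theta>. \<theta> * exp (- (\<theta> * \<delta>))) \<longlongrightarrow> 0) at_top"
    proof -
      have "((\<lambda>u. u ^ 1 / exp u) \<longlongrightarrow> (0::real)) at_top" by (rule tendsto_power_div_exp_0)
      moreover have "filterlim (\<lambda>\<theta>. \<theta> * \<delta>) at_top at_top"
        using \<delta> by (simp add: filterlim_at_top_mult_tendsto_pos[OF tendsto_const] filterlim_ident)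
      ultimately have "((\<lambda>\<theta>. (\<theta> * \<delta>) ^ 1 / exp (\<theta> * \<delta>)) \<longlongrightarrow> 0) at_top" by (rule filterlim_compose)
      then have "((\<lambda>\<theta>. (1 / \<delta>) * ((\<theta> * \<delta>) ^ 1 / exp (\<theta> * \<delta>))) \<longlongrightarrow> (1 / \<delta>) * 0) at_top" by (intro tendsto_intros)
      then show ?thesis using \<delta> by (simp add: exp_minus field_simps)
    qed
    moreover have "((\<lambda>\<theta>. exp (- (\<theta> * \<delta>))) \<longlongrightarrow> 0) at_top"
      using \<delta> by (intro filterlim_compose[OF exp_at_bot])
        (auto simp: filterlim_uminus_at_bot filterlim_at_top_mult_tendsto_pos[OF tendsto_const] filterlim_ident)
    ultimately have "((\<lambda>\<theta>. W p (x + \<delta>) + (C * exp (\<theta>1 * (x + \<delta>))) * (\<theta> * exp (- (\<theta> * \<delta>)) - \<Phi> p * exp (- (\<theta> * \<delta>)))) \<longlongrightarrow> W p (x + \<delta>) + (C * exp (\<theta>1 * (x + \<delta>))) * (0 - \<Phi> p * 0)) at_top"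
      by (intro tendsto_intros)
    then show "((\<lambda>\<theta>. W p (x + \<delta>) + (C * exp (\<theta>1 * (x + \<delta>))) * ((\<theta> - \<Phi> p) * exp (- \<theta> * \<delta>))) \<longlongrightarrow> W p (x + \<delta>)) at_top"
      by (simp add: left_diff_distrib)
    show "eventually (\<lambda>\<theta>. \<omega>' p x \<le> W p (x + \<delta>) + (C * exp (\<theta>1 * (x + \<delta>))) * ((\<theta> - \<Phi> p) * exp (- \<theta> * \<delta>))) at_top"
      by (rule eventually_mono[OF eventually_gt_at_top[of \<theta>1]]) (rule bound[OF _ \<delta>])
  qed simp
  show ?thesis
  proof (rule tendsto_lowerbound[OF W_tendsto_right[OF p x]])
    show "eventually (\<lambda>\<delta>. \<omega>' p x \<le> W p (x + \<delta>)) (at_right 0)"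
      unfolding eventually_at_right_field using le by (intro exI[of _ 1]) auto
  qed simp
qed

text \<open>For \<open>g\<close> supported in [0,\<epsilon>] the potential is a multiple of
  exp(\<Phi>(p) y) below 0. The strong Markov inequality then bounds the convolution of
  \<open>g\<close> with W at \<open>x\<close> by the candidate times \<open>A\<close>. Since W is
  monotone, the convolution is at least \<open>W p (x - \<epsilon>) * A\<close>; left continuity at
  positive \<open>x\<close> completes the argument.\<close>

lemma \<omega>'_ge:
  assumes p: "0 < p" and x: "0 < x"
  shows "W p x \<le> \<omega>' p x"
proof -
  have [measurable]: "W p \<in> borel_measurable borel" using p by measurable
  have ge: "W p (x - \<epsilon>) \<le> \<omega>' p x" if \<epsilon>: "0 < \<epsilon>" for \<epsilon>
  proof -
    \<comment> \<open>A tent of width \<epsilon>: continuous, supported in [0,\<epsilon>], and at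
      least \<epsilon>/4 on the middle half, which makes \<open>A\<close> positive.\<close>
    define g where "g y = max 0 (min y (\<epsilon> - y))" for y :: real
    have gc: "continuous_on UNIV g" unfolding g_def by (intro continuous_intros)
    have [measurable]: "g \<in> borel_measurable borel" using gc by (rule borel_measurable_continuous_onI)
    have g0: "0 \<le> g y" "g y \<le> \<epsilon>" for y using \<epsilon> by (auto simp: g_def)
    have gout: "g y = 0" if "y \<notin> {0..\<epsilon>}" for y using that by (auto simp: g_def)
    have ind: "integrable lborel (\<lambda>y. indicator {0..\<epsilon>} y * (B::real))" for B
      using \<epsilon> by (intro integrable_mult_left integrable_real_indicator) auto
    define A where "A = (LINT y|lborel. g y * exp (- \<Phi> p * y))"
    have Ai: "integrable lborel (\<lambda>y. g y * exp (- \<Phi> p * y))"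
    proof (rule Bochner_Integration.integrable_bound[OF ind[of \<epsilon>]])
      show "AE y in lborel. norm (g y * exp (- \<Phi> p * y)) \<le> norm (indicator {0..\<epsilon>} y * \<epsilon>)"
      proof (rule AE_I2)
        fix y
        have "g y * exp (- \<Phi> p * y) \<le> \<epsilon> * 1" if "0 \<le> y"
          using that g0 \<Phi>_root(1)[OF p] \<epsilon> by (intro mult_mono) auto
        then show "norm (g y * exp (- \<Phi> p * y)) \<le> norm (indicator {0..\<epsilon>} y * \<epsilon>)"
          using g0[of y] gout[of y] by (cases "y \<in> {0..\<epsilon>}") (auto simp: abs_mult)
      qed
    qed measurable
    have A0: "0 < A"
    proof -
      have "(LINT y|lborel. indicator {\<epsilon> / 4..3 * \<epsilon> / 4} y * (\<epsilon> / 4 * exp (- \<Phi> p * \<epsilon>))) \<le> A"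
        unfolding A_def
      proof (rule integral_mono[OF _ Ai])
        show "integrable lborel (\<lambda>y. indicator {\<epsilon> / 4..3 * \<epsilon> / 4} y * (\<epsilon> / 4 * exp (- \<Phi> p * \<epsilon>)))"
          using \<epsilon> by (intro integrable_mult_left integrable_real_indicator) auto
        fix y
        show "indicator {\<epsilon> / 4..3 * \<epsilon> / 4} y * (\<epsilon> / 4 * exp (- \<Phi> p * \<epsilon>)) \<le> g y * exp (- \<Phi> p * y)"
        proof (cases "y \<in> {\<epsilon> / 4..3 * \<epsilon> / 4}")
          case True
          then have "\<epsilon> / 4 * exp (- \<Phi> p * \<epsilon>) \<le> g y * exp (- \<Phi> p * y)"
            using \<Phi>_root(1)[OF p] \<epsilon> by (intro mult_mono) (auto simp: g_def)
          then show ?thesis using True by simp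
        qed (use g0 in simp)
      qed
      moreover have "(LINT y|lborel. indicator {\<epsilon> / 4..3 * \<epsilon> / 4} y * (\<epsilon> / 4 * exp (- \<Phi> p * \<epsilon>))) = \<epsilon> / 2 * (\<epsilon> / 4 * exp (- \<Phi> p * \<epsilon>))"
        using \<epsilon> by simp
      moreover have "0 < \<epsilon> / 2 * (\<epsilon> / 4 * exp (- \<Phi> p * \<epsilon>))" using \<epsilon> by simp
      ultimately show ?thesis by linarith
    qed
    have pot: "potential p g y = c p * exp (\<Phi> p * y) * A - (LINT z|lborel. g z * W p (y - z))"
      "integrable lborel (\<lambda>z. g z * W p (y - z))" for y
      using potential_formula[OF p, of g y] Ai by (simp_all add: A_def potential_def)
    have neg: "potential p g y = c p * A * exp (\<Phi> p * y) + 0 * exp (0 * y)" if "y \<le> 0" for y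
    proof -
      have "(LINT z|lborel. g z * W p (y - z)) = (LINT (z::real)|lborel. 0)"
      proof (rule Bochner_Integration.integral_cong[OF refl])
        fix z
        show "g z * W p (y - z) = 0"
          using that W_neg[OF p, of "y - z"] by (cases "0 < z") (auto simp: g_def)
      qed
      then show ?thesis by (simp add: pot)
    qed
    have "hit_transform {..<0} p x (potential p g) = c p * A * H p x (\<Phi> p) + 0 * H p x 0"
      using \<Phi>_root(1)[OF p] neg g0 by (intro hit_transform_lincomb[OF p potential_measurable[OF p gc, of \<epsilon>]]) auto
    moreover have "hit_transform {..<0} p x (potential p g) \<le> potential p g x"
      by (rule strong_markov_le(1)[OF p open_lessThan gc g0])
    ultimately have "(LINT z|lborel. g z * W p (x - z)) \<le> \<omega>' p x * A"
      by (simp add: pot \<omega>'_def algebra_simps)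
    moreover have "W p (x - \<epsilon>) * A \<le> (LINT z|lborel. g z * W p (x - z))"
    proof -
      have "W p (x - \<epsilon>) * A = (LINT z|lborel. W p (x - \<epsilon>) * (g z * exp (- \<Phi> p * z)))" by (simp add: A_def)
      also have "\<dots> \<le> (LINT z|lborel. g z * W p (x - z))"
      proof (rule integral_mono)
        show "integrable lborel (\<lambda>z. W p (x - \<epsilon>) * (g z * exp (- \<Phi> p * z)))" using Ai by simp
        show "integrable lborel (\<lambda>z. g z * W p (x - z))" by (rule pot)
        fix z
        show "W p (x - \<epsilon>) * (g z * exp (- \<Phi> p * z)) \<le> g z * W p (x - z)"
        proof (cases "z \<in> {0..\<epsilon>}")
          case True
          have "W p (x - \<epsilon>) * exp (- \<Phi> p * z) \<le> W p (x - z) * 1"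
            using True W_mono[OF p, of "x - \<epsilon>" "x - z"] W_nonneg[OF p] \<Phi>_root(1)[OF p] by (intro mult_mono) auto
          then have "g z * (W p (x - \<epsilon>) * exp (- \<Phi> p * z)) \<le> g z * (W p (x - z) * 1)" using g0 by (intro mult_left_mono) auto
          then show ?thesis by (simp add: ac_simps)
        qed (simp add: gout)
      qed
      finally show ?thesis .
    qed
    ultimately have "W p (x - \<epsilon>) * A \<le> \<omega>' p x * A" by linarith
    then show ?thesis using A0 by simp
  qed
  show ?thesis
  proof (rule tendsto_upperbound[OF W_tendsto_left[OF p x]])
    show "eventually (\<lambda>\<delta>. W p (x - \<delta>) \<le> \<omega>' p x) (at_right 0)"
      unfolding eventually_at_right_field using ge by (intro exI[of _ 1]) auto
  qed simp
qed

text \<open>With the candidate identified as W, the terms with \<open>c p\<close> in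
  \<open>H_relation\<close> and in \<open>P_eq\<close> combine to W(x)/(\<theta> - \<Phi>(p)), and
  the relation can be solved for \<open>H\<close> at \<theta>.\<close>

theorem H_pos:
  assumes p: "0 < p" and x: "0 < x" and \<theta>: "0 \<le> \<theta>" "\<theta> < \<Phi> p"
  shows "H p x \<theta> = exp (\<theta> * x) * (1 + (p - \<kappa> \<theta>) * I p \<theta> x) - (p - \<kappa> \<theta>) / (\<Phi> p - \<theta>) * W p x"
proof -
  have k: "0 < p - \<kappa> \<theta>" using \<Phi>_root(3)[OF p \<theta>] by simp
  have w: "W p x = c p * exp (\<Phi> p * x) - c p * H p x (\<Phi> p)"
    using \<omega>'_le[OF p] \<omega>'_ge[OF p x] x by (simp add: \<omega>'_def order_antisym right_diff_distrib)
  have "H p x \<theta> / (p - \<kappa> \<theta>) = exp (\<theta> * x) * (1 / (p - \<kappa> \<theta>) + I p \<theta> x) + W p x / (\<theta> - \<Phi> p)"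
    using H_relation[OF p, of \<theta> x] P_eq[OF p, of \<theta> x] \<theta> unfolding w diff_divide_distrib by simp
  moreover have "W p x / (\<theta> - \<Phi> p) = - (W p x / (\<Phi> p - \<theta>))" by (metis minus_diff_eq minus_divide_right)
  moreover have "H p x \<theta> = (p - \<kappa> \<theta>) * (H p x \<theta> / (p - \<kappa> \<theta>))" using k by simp
  ultimately have "H p x \<theta> = (p - \<kappa> \<theta>) * (exp (\<theta> * x) * (1 / (p - \<kappa> \<theta>) + I p \<theta> x) - W p x / (\<Phi> p - \<theta>))"
    by simp
  also have "\<dots> = exp (\<theta> * x) * ((p - \<kappa> \<theta>) * (1 / (p - \<kappa> \<theta>)) + (p - \<kappa> \<theta>) * I p \<theta> x) - (p - \<kappa> \<theta>) / (\<Phi> p - \<theta>) * W p x"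
  proof -
    have "a * (e * (1 / a + i) - w / b) = e * (a * (1 / a) + a * i) - a / b * w" for a e i w b :: real
      by (simp add: algebra_simps)
    then show ?thesis .
  qed
  finally show ?thesis using k by simp
qed

text \<open>A path started below 0 stays there for a short time, so the infimum over positive
  passage times is 0 and the position is the starting point.\<close>

lemma H_neg:
  assumes x: "x < 0" shows "H p x \<theta> = exp (\<theta> * x)"
proof -
  have "AE \<omega> in M. \<omega> \<in> space M" by (rule AE_space)
  then have ae: "AE \<omega> in M. hits {..<0} (path x \<omega>) \<and> hit_time {..<0} (path x \<omega>) = 0 \<and> X 0 \<omega> = 0"
    using X_0
  proof eventually_elim
    case (elim \<omega>)
    have "(path x \<omega> \<longlongrightarrow> path x \<omega> 0) (at_right 0)" using path_cadlag[of \<omega> x] elim by (auto simp: cadlag_def)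
    then have "eventually (\<lambda>s. path x \<omega> s < 0) (at_right 0)" using elim x by (intro order_tendstoD(2)) auto
    then obtain u where u: "0 < u" "\<And>s. 0 < s \<Longrightarrow> s < u \<Longrightarrow> path x \<omega> s < 0" by (auto simp: eventually_at_right_field)
    have h: "hits {..<0} (path x \<omega>)" unfolding hits_def using u(1) u(2)[of "u / 2"] by (intro exI[of _ "u / 2"]) auto
    have "hit_time {..<0} (path x \<omega>) \<le> e" if "0 < e" for e
      using hit_time_facts(2)[OF h, of "min (u / 2) e"] u(1) u(2)[of "min (u / 2) e"] that by auto
    then have "hit_time {..<0} (path x \<omega>) \<le> 0" by (rule field_le_epsilon) simp
    then show ?case using h hit_time_facts(1)[OF h] elim by auto
  qed
  have "H p x \<theta> = (LINT \<omega>|M. exp (\<theta> * x))"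
    unfolding hit_transform_def
    by (rule integral_cong_AE[OF hit_transform_measurable]) (auto intro: eventually_mono[OF ae])
  then show ?thesis by (simp add: prob_space)
qed

end

section \<open>Convolutions of scale functions\<close>

lemma integrable_compact_supp:
  fixes f :: "real \<Rightarrow> real"
  assumes f: "f \<in> borel_measurable borel" and b: "\<And>y. \<bar>f y\<bar> \<le> B" and s: "\<And>y. y \<notin> {u..v} \<Longrightarrow> f y = 0"
  shows "integrable lborel f"
proof (rule Bochner_Integration.integrable_bound[where f="\<lambda>y. indicator {u..v} y * B"])
  show "integrable lborel (\<lambda>y. indicator {u..v} y * B)"
    by (intro integrable_mult_left integrable_real_indicator) (auto simp: emeasure_lborel_Icc_eq)
  show "AE y in lborel. norm (f y) \<le> norm (indicator {u..v} y * B)"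
  proof (rule AE_I2)
    fix y
    show "norm (f y) \<le> norm (indicator {u..v} y * B)"
      using b[of y] s[of y] by (cases "y \<in> {u..v}") auto
  qed
qed (use f in simp)

lemma integrable_box_supp:
  fixes f :: "real \<Rightarrow> real \<Rightarrow> real"
  assumes f: "(\<lambda>z. f (fst z) (snd z)) \<in> borel_measurable (borel \<Otimes>\<^sub>M borel)" and b: "\<And>x y. \<bar>f x y\<bar> \<le> B"
    and s: "\<And>x y. x \<notin> {u..v} \<or> y \<notin> {u'..v'} \<Longrightarrow> f x y = 0"
  shows "(LINT y|lborel. LINT x|lborel. f x y) = (LINT x|lborel. LINT y|lborel. f x y)"
    "integrable lborel (\<lambda>x. LINT y|lborel. f x y)"
proof -
  have I: "integrable (lborel \<Otimes>\<^sub>M lborel) (case_prod f)"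
  proof (rule Bochner_Integration.integrable_bound[where f="\<lambda>z. indicator ({u..v} \<times> {u'..v'}) z * B"])
    have "emeasure (lborel \<Otimes>\<^sub>M lborel) ({u..v} \<times> {u'..v'}) = emeasure lborel {u..v} * emeasure lborel {u'..v'}"
      by (rule lborel.emeasure_pair_measure_Times) auto
    also have "\<dots> < \<infinity>" by (auto simp: emeasure_lborel_Icc_eq ennreal_mult_less_top)
    finally show "integrable (lborel \<Otimes>\<^sub>M lborel) (\<lambda>z. indicator ({u..v} \<times> {u'..v'}) z * B)"
      by (intro integrable_mult_left integrable_real_indicator) auto
    show "AE z in lborel \<Otimes>\<^sub>M lborel. norm (case_prod f z) \<le> norm (indicator ({u..v} \<times> {u'..v'}) z * B)"
    proof (rule AE_I2)
      fix z :: "real \<times> real"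
      obtain x y where z: "z = (x, y)" by (cases z)
      show "norm (case_prod f z) \<le> norm (indicator ({u..v} \<times> {u'..v'}) z * B)"
        using b[of x y] s[of x y] by (cases "x \<in> {u..v} \<and> y \<in> {u'..v'}") (auto simp: z)
    qed
    show "case_prod f \<in> borel_measurable (lborel \<Otimes>\<^sub>M lborel)"
      using f by (simp add: case_prod_beta' lborel_prod[symmetric] borel_prod cong: measurable_cong_sets)
  qed
  show "(LINT y|lborel. LINT x|lborel. f x y) = (LINT x|lborel. LINT y|lborel. f x y)"
    by (rule lborel_pair.Fubini_integral[OF I])
  show "integrable lborel (\<lambda>x. LINT y|lborel. f x y)"
    using lborel_pair.integrable_fst'[OF I] by simp
qed

lemma integral_reflect_shift:
  fixes f :: "real \<Rightarrow> real"
  shows "(LINT y|lborel. f y) = (LINT u|lborel. f (x - u))"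
  using lborel_integral_real_affine[of "-1" f x] by simp

context spectrally_negative begin

text \<open>W cuts the integral off at \<open>x\<close>, so the oriented integral becomes one over
  the whole line. For negative \<open>x\<close> the orientation sign is harmless because both sides
  are 0.\<close>

lemma W_interval:
  assumes p: "0 < p" and f[measurable]: "f \<in> borel_measurable borel"
  shows "(LBINT z=0..ereal x. W p (x - z) * f z) = (LINT z|lborel. indicator {0<..} z * (W p (x - z) * f z))"
proof (cases "0 \<le> x")
  case True
  have [measurable]: "W p \<in> borel_measurable borel" using p by measurable
  have "(LBINT z=0..ereal x. W p (x - z) * f z) = (LINT z:{0<..<x}|lborel. W p (x - z) * f z)"
    using True by (simp add: interval_lebesgue_integral_le_eq zero_ereal_def)
  also have "\<dots> = (LINT z|lborel. indicator {0<..} z * (W p (x - z) * f z))"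
    unfolding set_lebesgue_integral_def
  proof (rule integral_cong_AE)
    show "AE z in lborel. indicat_real {0<..<x} z *\<^sub>R (W p (x - z) * f z) = indicator {0<..} z * (W p (x - z) * f z)"
    proof (rule eventually_mono[OF AE_lborel_singleton[of x]])
      fix z :: real assume "z \<noteq> x"
      then show "indicat_real {0<..<x} z *\<^sub>R (W p (x - z) * f z) = indicator {0<..} z * (W p (x - z) * f z)"
        using W_neg[OF p, of "x - z"] by (cases "z < x") (auto split: split_indicator)
    qed
  qed measurable
  finally show ?thesis .
next
  case False
  have "(LBINT z=0..ereal x. W p (x - z) * f z) = - (LINT z:{x<..<0}|lborel. W p (x - z) * f z)"
    using False by (simp add: interval_lebesgue_integral_gt_eq zero_ereal_def)
  also have "(LINT z:{x<..<0}|lborel. W p (x - z) * f z) = (LINT (z::real)|lborel. 0)"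
    unfolding set_lebesgue_integral_def using W_neg[OF p]
    by (intro Bochner_Integration.integral_cong refl) (auto split: split_indicator)
  also have "(LINT (z::real)|lborel. 0) = (LINT z|lborel. indicator {0<..} z * (W p (x - z) * f z))"
    using W_neg[OF p] False by (intro Bochner_Integration.integral_cong refl) (auto split: split_indicator)
  also have "- (LINT z|lborel. indicator {0<..} z * (W p (x - z) * f z)) = (LINT z|lborel. indicator {0<..} z * (W p (x - z) * f z))"
  proof -
    have "(LINT z|lborel. indicator {0<..} z * (W p (x - z) * f z)) = (LINT (z::real)|lborel. 0)"
      using W_neg[OF p] False by (intro Bochner_Integration.integral_cong refl) (auto split: split_indicator)
    then show ?thesis by simp
  qed
  finally show ?thesis .
qed

lemma W_exp_conv:
  assumes p: "0 < p"
  shows "(LINT z|lborel. indicator {0<..} z * (W p (x - z) * exp (\<theta> * z))) = exp (\<theta> * x) * I p \<theta> x"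
    "integrable lborel (\<lambda>z. indicator {0<..} z * (W p (x - z) * exp (\<theta> * z)))"
proof -
  have [measurable]: "W p \<in> borel_measurable borel" using p by measurable
  have i: "has_bochner_integral lborel (\<lambda>s. indicator {..<x} s * (exp (- \<theta> * s) * W p s)) (I p \<theta> x)"
  proof (rule has_bochner_integral_cong_AE[THEN iffD1, rotated 3])
    show "has_bochner_integral lborel (\<lambda>s. indicator {..x} s * (exp (- \<theta> * s) * W p s)) (I p \<theta> x)"
      using W_loc_integrable[OF p, of x \<theta>] by (simp add: I_def has_bochner_integral_iff)
    show "AE s in lborel. indicator {..x} s * (exp (- \<theta> * s) * W p s) = indicator {..<x} s * (exp (- \<theta> * s) * W p s)"
      by (rule eventually_mono[OF AE_lborel_singleton[of x]]) (auto split: split_indicator)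
  qed measurable
  have "has_bochner_integral lborel (\<lambda>s. exp (\<theta> * x) * (indicator {..<x} s * (exp (- \<theta> * s) * W p s))) (exp (\<theta> * x) * I p \<theta> x)"
    by (rule has_bochner_integral_mult_right) (rule i)
  then have "has_bochner_integral lborel (\<lambda>z. exp (\<theta> * x) * (indicator {..<x} (x + - 1 * z) * (exp (- \<theta> * (x + - 1 * z)) * W p (x + - 1 * z)))) ((exp (\<theta> * x) * I p \<theta> x) /\<^sub>R \<bar>- 1\<bar>)"
    by (rule lborel_has_bochner_integral_real_affine_iff[THEN iffD1, rotated]) simp
  also have "(\<lambda>z. exp (\<theta> * x) * (indicator {..<x} (x + - 1 * z) * (exp (- \<theta> * (x + - 1 * z)) * W p (x + - 1 * z)))) = (\<lambda>z. indicator {0<..} z * (W p (x - z) * exp (\<theta> * z)))"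
    by (auto simp: fun_eq_iff algebra_simps split: split_indicator simp flip: exp_add)
  finally have *: "has_bochner_integral lborel (\<lambda>z. indicator {0<..} z * (W p (x - z) * exp (\<theta> * z))) (exp (\<theta> * x) * I p \<theta> x)"
    by simp
  then show "(LINT z|lborel. indicator {0<..} z * (W p (x - z) * exp (\<theta> * z))) = exp (\<theta> * x) * I p \<theta> x"
    "integrable lborel (\<lambda>z. indicator {0<..} z * (W p (x - z) * exp (\<theta> * z)))"
    by (auto simp: has_bochner_integral_iff)
qed

lemma I_interval:
  assumes p: "0 < p" shows "(LBINT z=0..ereal x. exp (- \<theta> * z) * W p z) = I p \<theta> x"
proof (cases "0 \<le> x")
  case True
  have [measurable]: "W p \<in> borel_measurable borel" using p by measurable
  have "(LBINT z=0..ereal x. exp (- \<theta> * z) * W p z) = (LINT z:{0<..<x}|lborel. exp (- \<theta> * z) * W p z)"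
    using True by (simp add: interval_lebesgue_integral_le_eq zero_ereal_def)
  also have "\<dots> = I p \<theta> x"
    unfolding set_lebesgue_integral_def I_def
  proof (rule integral_cong_AE)
    have "AE z::real in lborel. z \<noteq> x \<and> z \<noteq> 0" using AE_lborel_singleton[of x] AE_lborel_singleton[of "0::real"] by eventually_elim simp
    then show "AE z in lborel. indicat_real {0<..<x} z *\<^sub>R (exp (- \<theta> * z) * W p z) = indicator {..x} z * (exp (- \<theta> * z) * W p z)"
      by eventually_elim (use W_neg[OF p] in \<open>auto split: split_indicator\<close>)
  qed measurable
  finally show ?thesis .
next
  case False
  have "(LBINT z=0..ereal x. exp (- \<theta> * z) * W p z) = - (LINT z:{x<..<0}|lborel. exp (- \<theta> * z) * W p z)"
    using False by (simp add: interval_lebesgue_integral_gt_eq zero_ereal_def)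
  also have "(LINT z:{x<..<0}|lborel. exp (- \<theta> * z) * W p z) = (LINT (z::real)|lborel. 0)"
    unfolding set_lebesgue_integral_def using W_neg[OF p]
    by (intro Bochner_Integration.integral_cong refl) (auto split: split_indicator)
  finally show ?thesis using False I_neg[OF p, of x \<theta>] by simp
qed

lemma W_le: "0 < p \<Longrightarrow> u \<le> v \<Longrightarrow> \<bar>W p u\<bar> \<le> W p v"
  using W_mono[of p u v] W_nonneg[of p u] by simp

definition WW :: "real \<Rightarrow> real \<Rightarrow> real \<Rightarrow> real" where
  "WW q p u = (LINT v|lborel. W q (u - v) * W p v)"

lemma WW_nn:
  assumes q: "0 < q" and p: "0 < p"
  shows "(\<integral>\<^sup>+v. ennreal (W q (u - v) * W p v) \<partial>lborel) = ennreal (WW q p u)" "0 \<le> WW q p u"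
proof -
  have [measurable]: "W p \<in> borel_measurable borel" "W q \<in> borel_measurable borel" using p q by measurable
  have "integrable lborel (\<lambda>v. W q (u - v) * W p v)"
  proof (rule integrable_compact_supp[where u=0 and v=u and B="W q u * W p u"])
    fix v
    show "\<bar>W q (u - v) * W p v\<bar> \<le> W q u * W p u"
    proof (cases "0 \<le> v \<and> v \<le> u")
      case True
      then show ?thesis unfolding abs_mult by (intro mult_mono W_le p q) (auto simp: W_nonneg[OF p] W_nonneg[OF q])
    qed (use W_neg[OF p, of v] W_neg[OF q, of "u - v"] W_nonneg[OF p] W_nonneg[OF q] in auto)
    assume "v \<notin> {0..u}" then show "W q (u - v) * W p v = 0" using W_neg[OF p, of v] W_neg[OF q, of "u - v"] by auto
  qed measurable
  then show "(\<integral>\<^sup>+v. ennreal (W q (u - v) * W p v) \<partial>lborel) = ennreal (WW q p u)"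
    unfolding WW_def by (rule nn_integral_eq_integral) (simp add: W_nonneg[OF p] W_nonneg[OF q])
  show "0 \<le> WW q p u" unfolding WW_def by (intro integral_nonneg_AE) (simp add: W_nonneg[OF p] W_nonneg[OF q])
qed

text \<open>Both sides have the Laplace transform \<open>1 / (\<kappa> \<theta> - p)\<close>.\<close>

lemma W_resolvent_identity:
  assumes q: "0 < q" and r: "0 < r"
  shows "AE u in lborel. W (q + r) u = W q u + r * WW q (q + r) u"
proof -
  define p where "p = q + r"
  have p: "0 < p" using q r by (simp add: p_def)
  have [measurable]: "W p \<in> borel_measurable borel" "W q \<in> borel_measurable borel" using p q by measurable
  have [measurable]: "WW q p \<in> borel_measurable borel" unfolding WW_def[abs_def] by measurable
  \<comment> \<open>Tilting by an exponent above \<Phi>(p) makes both sides finite measures, so that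
    their densities can be compared almost everywhere.\<close>
  define d where "d = \<Phi> p + 1"
  define f where "f x = ennreal (exp (- d * x) * W p x)" for x
  define g where "g x = ennreal (exp (- d * x) * (W q x + r * WW q p x))" for x
  have [measurable]: "f \<in> borel_measurable borel" "g \<in> borel_measurable borel" unfolding f_def g_def by measurable
  have WW_neg: "WW q p u = 0" if "u < 0" for u
  proof -
    have z: "W q (u - v) * W p v = 0" for v using that W_neg[OF p, of v] W_neg[OF q, of "u - v"] by (cases "v < 0") auto
    show ?thesis unfolding WW_def z by simp
  qed
  have F: "(\<integral>\<^sup>+x. ennreal (exp (- \<theta> * x)) * f x \<partial>lborel) = ennreal (1 / (\<kappa> (\<theta> + d) - p))" if "0 \<le> \<theta>" for \<theta>
  proof -
    have "(\<integral>\<^sup>+x. ennreal (exp (- \<theta> * x)) * f x \<partial>lborel) = (\<integral>\<^sup>+x. ennreal (exp (- (\<theta> + d) * x) * W p x) \<partial>lborel)"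
    proof (rule nn_integral_cong)
      fix x
      have e: "exp (- (\<theta> + d) * x) = exp (- \<theta> * x) * exp (- d * x)" by (simp add: algebra_simps flip: exp_add)
      show "ennreal (exp (- \<theta> * x)) * f x = ennreal (exp (- (\<theta> + d) * x) * W p x)"
        unfolding f_def e by (simp add: W_nonneg[OF p] mult.assoc flip: ennreal_mult)
    qed
    then show ?thesis using W_laplace_nn[OF p, of "\<theta> + d"] that by (simp add: d_def)
  qed
  have G: "(\<integral>\<^sup>+x. ennreal (exp (- \<theta> * x)) * g x \<partial>lborel) = ennreal (1 / (\<kappa> (\<theta> + d) - p))" if "0 \<le> \<theta>" for \<theta>
  proof -
    define t where "t = \<theta> + d"
    have t: "\<Phi> p < t" "\<Phi> q < t" using that \<Phi>_less[OF q, of p] r by (auto simp: t_def d_def p_def)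
    have kp: "0 < \<kappa> t - p" "0 < \<kappa> t - q" using \<Phi>_root(4)[OF p t(1)] \<Phi>_root(4)[OF q t(2)] by auto
    have "(\<integral>\<^sup>+x. ennreal (exp (- t * x)) * ennreal (WW q p x) \<partial>lborel)
       = (\<integral>\<^sup>+x. (\<integral>\<^sup>+v. ennreal (exp (- t * x)) * ennreal (W q (x - v) * W p v) \<partial>lborel) \<partial>lborel)"
      unfolding WW_nn(1)[OF q p, symmetric] by (intro nn_integral_cong nn_integral_cmult[symmetric]) measurable
    also have "\<dots> = (\<integral>\<^sup>+v. (\<integral>\<^sup>+x. ennreal (exp (- t * x)) * ennreal (W q (x - v) * W p v) \<partial>lborel) \<partial>lborel)"
      by (rule lborel_pair.Fubini') measurable
    also have "\<dots> = (\<integral>\<^sup>+v. ennreal (exp (- t * v) * W p v) * ennreal (1 / (\<kappa> t - q)) \<partial>lborel)"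
    proof (rule nn_integral_cong)
      fix v
      have "(\<integral>\<^sup>+x. ennreal (exp (- t * x)) * ennreal (W q (x - v) * W p v) \<partial>lborel) = (\<integral>\<^sup>+x. ennreal (exp (- t * (v + x))) * ennreal (W q (v + x - v) * W p v) \<partial>lborel)"
        by (subst nn_integral_real_affine[where c=1 and t=v]) auto
      also have "\<dots> = (\<integral>\<^sup>+x. ennreal (exp (- t * v) * W p v) * ennreal (exp (- t * x) * W q x) \<partial>lborel)"
      proof (rule nn_integral_cong)
        fix x
        have e: "exp (- t * (v + x)) = exp (- t * v) * exp (- t * x)" by (simp add: algebra_simps flip: exp_add)
        show "ennreal (exp (- t * (v + x))) * ennreal (W q (v + x - v) * W p v) = ennreal (exp (- t * v) * W p v) * ennreal (exp (- t * x) * W q x)"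
          unfolding e by (simp add: W_nonneg[OF p] W_nonneg[OF q] ac_simps flip: ennreal_mult)
      qed
      also have "\<dots> = ennreal (exp (- t * v) * W p v) * ennreal (1 / (\<kappa> t - q))"
        using W_laplace_nn[OF q t(2)] by (subst nn_integral_cmult) auto
      finally show "(\<integral>\<^sup>+x. ennreal (exp (- t * x)) * ennreal (W q (x - v) * W p v) \<partial>lborel) = ennreal (exp (- t * v) * W p v) * ennreal (1 / (\<kappa> t - q))" .
    qed
    also have "\<dots> = ennreal (1 / (\<kappa> t - p)) * ennreal (1 / (\<kappa> t - q))"
      using W_laplace_nn[OF p t(1)] by (subst nn_integral_multc) auto
    finally have ww: "(\<integral>\<^sup>+x. ennreal (exp (- t * x)) * ennreal (WW q p x) \<partial>lborel) = ennreal (1 / (\<kappa> t - p)) * ennreal (1 / (\<kappa> t - q))" .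
    have "(\<integral>\<^sup>+x. ennreal (exp (- \<theta> * x)) * g x \<partial>lborel) = (\<integral>\<^sup>+x. ennreal (exp (- t * x) * W q x) + ennreal r * (ennreal (exp (- t * x)) * ennreal (WW q p x)) \<partial>lborel)"
    proof (rule nn_integral_cong)
      fix x
      have e: "exp (- \<theta> * x) * exp (- d * x) = exp (- t * x)" by (simp add: t_def algebra_simps flip: exp_add)
      have "ennreal (exp (- \<theta> * x)) * g x = ennreal ((exp (- \<theta> * x) * exp (- d * x)) * (W q x + r * WW q p x))"
        using W_nonneg[OF q] WW_nn(2)[OF q p] r by (simp add: g_def mult.assoc flip: ennreal_mult)
      also have "\<dots> = ennreal (exp (- t * x) * W q x + r * (exp (- t * x) * WW q p x))" unfolding e by (simp add: algebra_simps)
      also have "\<dots> = ennreal (exp (- t * x) * W q x) + ennreal r * (ennreal (exp (- t * x)) * ennreal (WW q p x))"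
        using W_nonneg[OF q] WW_nn(2)[OF q p] r by (simp add: ennreal_mult ennreal_plus)
      finally show "ennreal (exp (- \<theta> * x)) * g x = ennreal (exp (- t * x) * W q x) + ennreal r * (ennreal (exp (- t * x)) * ennreal (WW q p x))" .
    qed
    also have "\<dots> = ennreal (1 / (\<kappa> t - q)) + ennreal r * (ennreal (1 / (\<kappa> t - p)) * ennreal (1 / (\<kappa> t - q)))"
      by (subst nn_integral_add, simp, simp, subst nn_integral_cmult, simp) (simp only: ww W_laplace_nn[OF q t(2)])
    also have "\<dots> = ennreal (1 / (\<kappa> t - q) + r * (1 / (\<kappa> t - p) * (1 / (\<kappa> t - q))))"
      using kp r by (simp flip: ennreal_mult ennreal_plus)
    \<comment> \<open>The partial fraction identity behind the relation, since \<kappa>(t) - q and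
      \<kappa>(t) - p differ by \<open>r\<close>.\<close>
    also have "1 / (\<kappa> t - q) + r * (1 / (\<kappa> t - p) * (1 / (\<kappa> t - q))) = 1 / (\<kappa> t - p)"
    proof -
      define a where "a = \<kappa> t - p"
      have b: "\<kappa> t - q = a + r" by (simp add: a_def p_def)
      have "0 < a" using kp by (simp add: a_def)
      then have nz: "a \<noteq> 0" "a + r \<noteq> 0" using r by auto
      have gen: "x + r * (y * x) = x * (1 + r * y)" for x y :: real by (simp add: algebra_simps)
      have "1 / (a + r) + r * (1 / a * (1 / (a + r))) = (1 / (a + r)) * (1 + r / a)" using gen[of "1 / (a + r)" "1 / a"] by simp
      also have "1 + r / a = (a + r) / a" using nz by (simp add: add_divide_distrib)
      also have "(1 / (a + r)) * ((a + r) / a) = 1 / a" using nz by simp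
      finally show ?thesis unfolding b a_def[symmetric] .
    qed
    finally show ?thesis by (simp add: t_def)
  qed
  have "density lborel f = density lborel g"
  proof (rule laplace_unique[where c=0])
    show "AE x in density lborel f. 0 \<le> x" "AE x in density lborel g. 0 \<le> x"
      using W_neg[OF p] W_neg[OF q] WW_neg by (auto simp: AE_density f_def g_def not_less[symmetric])
    fix \<theta> :: real assume "0 < \<theta>"
    then show "(\<integral>\<^sup>+x. ennreal (exp (- \<theta> * x)) \<partial>density lborel f) < \<infinity>"
      "(\<integral>\<^sup>+x. ennreal (exp (- \<theta> * x)) \<partial>density lborel f) = (\<integral>\<^sup>+x. ennreal (exp (- \<theta> * x)) \<partial>density lborel g)"
      using F[of \<theta>] G[of \<theta>] by (simp_all add: nn_integral_density mult.commute[of "f _"] mult.commute[of "g _"])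
  qed auto
  then have "AE x in lborel. f x = g x"
    using F[of 0] by (subst (asm) finite_density_unique) auto
  then show ?thesis
  proof eventually_elim
    case (elim x)
    then have "exp (- d * x) * W p x = exp (- d * x) * (W q x + r * WW q p x)"
      using W_nonneg[OF p] W_nonneg[OF q] WW_nn(2)[OF q p] r unfolding f_def g_def
      by (subst (asm) ennreal_inj) auto
    then show ?case by (simp add: p_def)
  qed
qed

end

section \<open>Solving the resolvent equation of the reflected process\<close>

text \<open>The equation for reflection at level 0, to which a general level is reduced by
  translating \<open>h\<close> and \<phi>. Nothing here refers to the reflected process; a bounded
  solution of the equation is enough.\<close>

locale reflected_resolvent = spectrally_negative M X \<kappa> W for M :: "'w measure" and X \<kappa> W +
  fixes q r K B :: real and h \<phi> :: "real \<Rightarrow> real"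
  assumes q: "0 < q" and r: "0 < r"
    and h_measurable [measurable]: "h \<in> borel_measurable borel" and h_bdd: "\<And>y. \<bar>h y\<bar> \<le> B"
    and h_supp: "\<And>y. y \<notin> {- K..K} \<Longrightarrow> h y = 0"
    and \<phi>_measurable [measurable]: "\<phi> \<in> borel_measurable borel" and \<phi>_bdd: "\<And>y. \<bar>\<phi> y\<bar> \<le> B"
    and \<phi>_eq: "\<And>x. \<phi> x = (LINT z|resolvent (q + r). h (x + z) + r * \<phi> (max 0 (x + z)))"
begin

abbreviation "p \<equiv> q + r"

lemma p: "0 < p" using q r by simp

lemma W_meas [measurable]: "W p \<in> borel_measurable borel" "W q \<in> borel_measurable borel"
  using p q by measurable

lemma B_nonneg: "0 \<le> B" using h_bdd[of 0] by linarith

text \<open>Subtracting \<open>\<phi> 0\<close> makes the source term \<open>\<phi> (max 0 y)\<close> vanish on the negative half line, at the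
  cost of a constant in the equation.\<close>

definition F :: "real \<Rightarrow> real" where "F y = indicator {0<..} y * (\<phi> y - \<phi> 0)"
definition m :: "real \<Rightarrow> real" where "m y = h y + r * F y"
definition A :: real where "A = c p * (LINT y|lborel. m y * exp (- \<Phi> p * y))"

lemma F_measurable [measurable]: "F \<in> borel_measurable borel" unfolding F_def[abs_def] by measurable
lemma m_measurable [measurable]: "m \<in> borel_measurable borel" unfolding m_def[abs_def] by measurable

lemma F_bdd: "\<bar>F y\<bar> \<le> 2 * B"
  using \<phi>_bdd[of y] \<phi>_bdd[of 0] B_nonneg by (auto simp: F_def split: split_indicator)

lemma F_neg: "y \<le> 0 \<Longrightarrow> F y = 0" by (simp add: F_def)

definition Bm :: real where "Bm = B + r * (2 * B)"

lemma m_bdd: "\<bar>m y\<bar> \<le> Bm"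
proof -
  have "\<bar>r * F y\<bar> \<le> r * (2 * B)" using F_bdd[of y] r by (simp add: abs_mult)
  then show ?thesis using h_bdd[of y] unfolding m_def Bm_def by linarith
qed

lemma m_supp: "y < - \<bar>K\<bar> \<Longrightarrow> m y = 0"
  using h_supp[of y] F_neg[of y] by (auto simp: m_def abs_if split: if_splits)

lemma Bm_nonneg: "0 \<le> Bm" using m_bdd[of 0] by linarith

lemma m_exp_integrable: assumes k: "0 < k" shows "integrable lborel (\<lambda>y. m y * exp (- k * y))"
proof (rule Bochner_Integration.integrable_bound[where f="\<lambda>y. Bm * (indicator {- \<bar>K\<bar> - 1<..} y * exp (- k * y))"])
  show "integrable lborel (\<lambda>y. Bm * (indicator {- \<bar>K\<bar> - 1<..} y * exp (- k * y)))"
    using has_bochner_integral_exp_tail[OF k, of "- \<bar>K\<bar> - 1"] by (intro integrable_mult_right) (simp add: has_bochner_integral_iff)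
  show "AE y in lborel. norm (m y * exp (- k * y)) \<le> norm (Bm * (indicator {- \<bar>K\<bar> - 1<..} y * exp (- k * y)))"
  proof (rule AE_I2)
    fix y
    show "norm (m y * exp (- k * y)) \<le> norm (Bm * (indicator {- \<bar>K\<bar> - 1<..} y * exp (- k * y)))"
      using m_bdd[of y] m_supp[of y] Bm_nonneg
      by (cases "- \<bar>K\<bar> - 1 < y") (auto simp: abs_mult intro!: mult_right_mono)
  qed
qed measurable

text \<open>The source equals \<open>m\<close> plus the constant \<open>r * \<phi> 0\<close>, whose
  potential is \<open>r * \<phi> 0 / p\<close>. \<open>m\<close> vanishes far to the left, so
  \<open>potential_formula\<close> applies to it.\<close>

lemma \<phi>_decomp: "\<phi> x = r * \<phi> 0 / p + A * exp (\<Phi> p * x) - (LINT y|lborel. m y * W p (x - y))"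
proof -
  interpret R: finite_measure "resolvent p" using finite_resolvent p by simp
  note P = potential_formula[OF p m_measurable m_exp_integrable[OF \<Phi>_root(1)[OF p]], of x]
  have "\<phi> x = (LINT z|resolvent p. m (x + z) + r * \<phi> 0)"
    unfolding \<phi>_eq[of x]
    by (intro Bochner_Integration.integral_cong refl) (auto simp: m_def F_def max_def algebra_simps split: split_indicator)
  also have "\<dots> = (LINT z|resolvent p. m (x + z)) + r * \<phi> 0 * measure (resolvent p) UNIV"
    using P(1) by (subst Bochner_Integration.integral_add) auto
  also have "measure (resolvent p) UNIV = 1 / p" using emeasure_resolvent[OF p] p by (simp add: measure_def)
  finally show ?thesis unfolding P(3) by (simp add: A_def algebra_simps)
qed

lemma hW_integrable: "integrable lborel (\<lambda>y. h y * W p (x - y))"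
proof (rule integrable_compact_supp[where u="- K" and v=K and B="B * W p (x + \<bar>K\<bar>)"])
  show "\<bar>h y * W p (x - y)\<bar> \<le> B * W p (x + \<bar>K\<bar>)" for y
  proof (cases "y \<in> {- K..K}")
    case True
    then show ?thesis unfolding abs_mult by (intro mult_mono h_bdd W_le[OF p]) (auto simp: B_nonneg)
  qed (use h_supp[of y] B_nonneg W_nonneg[OF p] in simp)
qed (use h_supp in auto)

lemma FW_integrable: assumes s: "0 < s" shows "integrable lborel (\<lambda>y. F y * W s (x - y))"
proof (rule integrable_compact_supp[where u=0 and v=x and B="2 * B * W s x"])
  have [measurable]: "W s \<in> borel_measurable borel" using s by measurable
  show "(\<lambda>y. F y * W s (x - y)) \<in> borel_measurable borel" by measurable
  show "\<bar>F y * W s (x - y)\<bar> \<le> 2 * B * W s x" for y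
  proof (cases "0 \<le> y")
    case True
    then show ?thesis unfolding abs_mult by (intro mult_mono F_bdd W_le[OF s]) (auto simp: B_nonneg)
  qed (use F_neg[of y] B_nonneg W_nonneg[OF s] in simp)
  show "y \<notin> {0..x} \<Longrightarrow> F y * W s (x - y) = 0" for y
    using F_neg[of y] W_neg[OF s, of "x - y"] by auto
qed

section \<open>The Volterra equation above the reflection level\<close>

definition conv :: "real \<Rightarrow> real" where "conv x = (LINT y|lborel. F y * W p (x - y))"

lemma conv_measurable [measurable]: "conv \<in> borel_measurable borel" unfolding conv_def[abs_def] by measurable

lemma conv_neg: "x \<le> 0 \<Longrightarrow> conv x = 0"
proof -
  assume "x \<le> 0"
  then have z: "F y * W p (x - y) = 0" for y using F_neg[of y] W_neg[OF p, of "x - y"] by (cases "0 < y") auto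
  show ?thesis unfolding conv_def z by simp
qed

lemma m_split: "(LINT y|lborel. m y * W p (x - y)) = (LINT y|lborel. h y * W p (x - y)) + r * conv x"
proof -
  have "(LINT y|lborel. m y * W p (x - y)) = (LINT y|lborel. h y * W p (x - y) + r * (F y * W p (x - y)))"
    by (simp add: m_def algebra_simps)
  also have "\<dots> = (LINT y|lborel. h y * W p (x - y)) + r * conv x"
    unfolding conv_def using hW_integrable FW_integrable[OF p] by (subst Bochner_Integration.integral_add) auto
  finally show ?thesis .
qed

definition w0 :: real where "w0 = (LINT y|lborel. h y * W p (- y))"

text \<open>The decomposition at 0, where the convolution of \<open>F\<close> vanishes. It replaces
  the integral of the unknown function in \<open>A\<close>, and the constant \<open>c p\<close> with
  it, by the single number \<open>\<phi> 0\<close>.\<close>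

lemma A_eq: "A = q * \<phi> 0 / p + w0"
proof -
  have "\<phi> 0 = r * \<phi> 0 / p + A - w0"
    using \<phi>_decomp[of 0] m_split[of 0] conv_neg[of 0] by (simp add: w0_def)
  moreover have "\<phi> 0 - r * \<phi> 0 / p = q * \<phi> 0 / p" using p by (simp add: field_simps)
  ultimately show ?thesis by linarith
qed

lemma Theta_integral:
  "(LINT y|lborel. h y * Theta \<kappa> W p x y) = exp (\<Phi> p * x) * w0 - (LINT y|lborel. h y * W p (x - y))"
  "integrable lborel (\<lambda>y. h y * Theta \<kappa> W p x y)"
proof -
  have e: "h y * Theta \<kappa> W p x y = exp (\<Phi> p * x) * (h y * W p (0 - y)) - h y * W p (x - y)" for y
    by (simp add: Theta_def algebra_simps)
  show "(LINT y|lborel. h y * Theta \<kappa> W p x y) = exp (\<Phi> p * x) * w0 - (LINT y|lborel. h y * W p (x - y))"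
    unfolding e using hW_integrable[of x] hW_integrable[of 0]
    by (subst Bochner_Integration.integral_diff) (auto simp: w0_def)
  show "integrable lborel (\<lambda>y. h y * Theta \<kappa> W p x y)"
    unfolding e using hW_integrable[of x] hW_integrable[of 0] by auto
qed

text \<open>The part of the equation that is known up to the number \<open>\<phi> 0\<close>; the
  unknown function remains only in \<open>conv\<close>.\<close>

definition k :: "real \<Rightarrow> real" where
  "k x = q * \<phi> 0 / p * (exp (\<Phi> p * x) - 1) + (LINT y|lborel. h y * Theta \<kappa> W p x y)"

lemma k_eq: "\<phi> x = \<phi> 0 + k x - r * conv x"
proof -
  have "r * \<phi> 0 / p = \<phi> 0 - q * \<phi> 0 / p" using p by (simp add: field_simps)
  then show ?thesis
    unfolding k_def Theta_integral(1) using \<phi>_decomp[of x] m_split[of x] A_eq by (simp add: algebra_simps)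
qed

lemma k_pos: "0 < x \<Longrightarrow> k x = F x + r * conv x"
  using k_eq[of x] by (simp add: F_def)

text \<open>Associativity of convolution. The supports confine the double integral to a box on which
  the integrand is bounded, so Fubini applies.\<close>

lemma Wq_conv: "(LINT z|lborel. W q (x - z) * conv z) = (LINT y|lborel. F y * WW q p (x - y))"
  "integrable lborel (\<lambda>z. W q (x - z) * conv z)"
proof -
  have cb: "\<bar>conv z\<bar> \<le> 2 * B * W p x * x" if "0 \<le> z" "z \<le> x" for z
  proof -
    have "\<bar>conv z\<bar> \<le> (LINT y|lborel. \<bar>F y * W p (z - y)\<bar>)" unfolding conv_def by (rule integral_abs_bound)
    also have "\<dots> \<le> (LINT y|lborel. indicator {0..x} y * (2 * B * W p x))"
    proof (rule integral_mono)
      show "integrable lborel (\<lambda>y. \<bar>F y * W p (z - y)\<bar>)" by (intro integrable_abs FW_integrable p)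
      show "integrable lborel (\<lambda>y. indicator {0..x} y * (2 * B * W p x))"
        by (intro integrable_mult_left integrable_real_indicator) (auto simp: emeasure_lborel_Icc_eq)
      fix y
      show "\<bar>F y * W p (z - y)\<bar> \<le> indicator {0..x} y * (2 * B * W p x)"
      proof (cases "y \<in> {0..x}")
        case True
        have "\<bar>F y\<bar> * \<bar>W p (z - y)\<bar> \<le> 2 * B * W p x" using True that by (intro mult_mono F_bdd W_le[OF p]) (auto simp: B_nonneg)
        then show ?thesis using True by (simp add: abs_mult)
      qed (use F_neg[of y] W_neg[OF p, of "z - y"] that in auto)
    qed
    also have "\<dots> = 2 * B * W p x * x" using that by simp
    finally show ?thesis .
  qed
  show "integrable lborel (\<lambda>z. W q (x - z) * conv z)"
  proof (rule integrable_compact_supp[where u=0 and v=x and B="W q x * (2 * B * W p x * \<bar>x\<bar>)"])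
    have out: "z \<notin> {0..x} \<Longrightarrow> W q (x - z) * conv z = 0" for z
      using conv_neg[of z] W_neg[OF q, of "x - z"] by auto
    show "\<And>z. z \<notin> {0..x} \<Longrightarrow> W q (x - z) * conv z = 0" by (rule out)
    show "\<bar>W q (x - z) * conv z\<bar> \<le> W q x * (2 * B * W p x * \<bar>x\<bar>)" for z
    proof (cases "z \<in> {0..x}")
      case True
      then show ?thesis unfolding abs_mult using cb[of z] by (intro mult_mono W_le[OF q]) (auto simp: W_nonneg[OF q])
    next
      case False
      show ?thesis unfolding out[OF False] using B_nonneg W_nonneg[OF q] W_nonneg[OF p] by simp
    qed
  qed measurable
  define f where "f y z = W q (x - z) * (F y * W p (z - y))" for y z
  have f0: "f y z = 0" if "y \<notin> {0..x} \<or> z \<notin> {0..x}" for y z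
  proof (rule ccontr)
    assume "f y z \<noteq> 0"
    then have "W q (x - z) \<noteq> 0" "F y \<noteq> 0" "W p (z - y) \<noteq> 0" by (auto simp: f_def)
    then have "\<not> x - z < 0" "\<not> y \<le> 0" "\<not> z - y < 0" using W_neg[OF q] W_neg[OF p] F_neg by blast+
    then show False using that by auto
  qed
  have "(LINT z|lborel. W q (x - z) * conv z) = (LINT z|lborel. (LINT y|lborel. f y z))"
    unfolding conv_def f_def by simp
  also have "\<dots> = (LINT y|lborel. (LINT z|lborel. f y z))"
  proof (rule integrable_box_supp[where B="W q x * (2 * B * W p x)"])
    show "(\<lambda>z. f (fst z) (snd z)) \<in> borel_measurable (borel \<Otimes>\<^sub>M borel)" unfolding f_def by measurable
    show "\<bar>f y z\<bar> \<le> W q x * (2 * B * W p x)" for y z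
    proof (cases "y \<notin> {0..x} \<or> z \<notin> {0..x}")
      case True
      then show ?thesis using f0[OF True] B_nonneg W_nonneg[OF q] W_nonneg[OF p] by simp
    next
      case False
      then show ?thesis unfolding f_def abs_mult
        by (intro mult_mono F_bdd W_le[OF q] W_le[OF p]) (auto simp: B_nonneg W_nonneg[OF q] W_nonneg[OF p])
    qed
  qed (rule f0)
  also have "\<dots> = (LINT y|lborel. F y * WW q p (x - y))"
  proof (rule Bochner_Integration.integral_cong[OF refl])
    fix y
    have "(LINT z|lborel. f y z) = F y * (LINT z|lborel. W q (x - z) * W p (z - y))"
      unfolding f_def by (simp add: mult.left_commute)
    also have "(LINT z|lborel. W q (x - z) * W p (z - y)) = WW q p (x - y)"
      using lborel_integral_real_affine[of 1 "\<lambda>z. W q (x - z) * W p (z - y)" y]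
      by (simp add: WW_def algebra_simps)
    finally show "(LINT z|lborel. f y z) = F y * WW q p (x - y)" .
  qed
  finally show "(LINT z|lborel. W q (x - z) * conv z) = (LINT y|lborel. F y * WW q p (x - y))" .
qed

text \<open>For positive arguments \<open>k\<close> is \<open>F\<close> plus \<open>r\<close> times
  the convolution of \<open>F\<close> with \<open>W p\<close>. Convolving with \<open>W q\<close>
  and using the relation between the two scale functions leaves exactly \<open>conv\<close>: the
  unknown convolution is computed from \<open>k\<close> alone.\<close>

lemma volterra: "(LINT z|lborel. indicator {0<..} z * (W q (x - z) * k z)) = conv x"
  "integrable lborel (\<lambda>z. indicator {0<..} z * (W q (x - z) * k z))"
proof -
  have e: "indicator {0<..} z * (W q (x - z) * k z) = F z * W q (x - z) + r * (W q (x - z) * conv z)" for z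
    by (auto simp: k_pos F_neg conv_neg algebra_simps split: split_indicator)
  show "integrable lborel (\<lambda>z. indicator {0<..} z * (W q (x - z) * k z))"
    unfolding e using Wq_conv(2)[of x] FW_integrable[OF q, of x] by auto
  have "(LINT z|lborel. indicator {0<..} z * (W q (x - z) * k z)) = (LINT z|lborel. F z * W q (x - z) + r * (W q (x - z) * conv z))"
    by (simp only: e)
  also have "\<dots> = (LINT z|lborel. F z * W q (x - z)) + r * (LINT y|lborel. F y * WW q p (x - y))"
    using Wq_conv[of x] FW_integrable[OF q] by (subst Bochner_Integration.integral_add) auto
  also have "(LINT y|lborel. F y * WW q p (x - y)) = (LINT u|lborel. F (x - u) * WW q p u)"
    by (subst integral_reflect_shift[of _ x]) simp
  also have "r * \<dots> = (LINT u|lborel. F (x - u) * W p u - F (x - u) * W q u)"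
  proof -
    have "r * (LINT u|lborel. F (x - u) * WW q p u) = (LINT u|lborel. r * (F (x - u) * WW q p u))" by simp
    also have "\<dots> = (LINT u|lborel. F (x - u) * W p u - F (x - u) * W q u)"
    proof (rule integral_cong_AE)
      show "(\<lambda>u. r * (F (x - u) * WW q p u)) \<in> borel_measurable lborel" unfolding WW_def by measurable
      show "AE u in lborel. r * (F (x - u) * WW q p u) = F (x - u) * W p u - F (x - u) * W q u"
        using W_resolvent_identity[OF q r] by eventually_elim (simp add: algebra_simps)
    qed measurable
    finally show ?thesis .
  qed
  also have "\<dots> = (LINT u|lborel. F (x - u) * W p u) - (LINT u|lborel. F (x - u) * W q u)"
  proof (rule Bochner_Integration.integral_diff)
    show "integrable lborel (\<lambda>u. F (x - u) * W p u)" "integrable lborel (\<lambda>u. F (x - u) * W q u)"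
      using lborel_integrable_real_affine[OF FW_integrable[OF p, of x], of "-1" x]
        lborel_integrable_real_affine[OF FW_integrable[OF q, of x], of "-1" x] by simp_all
  qed
  also have "(LINT u|lborel. F (x - u) * W p u) = conv x"
    unfolding conv_def by (subst (2) integral_reflect_shift[of _ x]) simp
  also have "(LINT u|lborel. F (x - u) * W q u) = (LINT z|lborel. F z * W q (x - z))"
    by (subst (2) integral_reflect_shift[of _ x]) simp
  finally show "(LINT z|lborel. indicator {0<..} z * (W q (x - z) * k z)) = conv x" by simp
qed

definition \<Psi> :: "real \<Rightarrow> real \<Rightarrow> real" where
  "\<Psi> x y = (LINT z|lborel. indicator {0<..} z * (W q (x - z) * Theta \<kappa> W p z y))"

lemma Upsilon_eq: "Upsilon \<kappa> W q r x y = - Theta \<kappa> W p x y + r * \<Psi> x y"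
proof -
  have [measurable]: "(\<lambda>z. Theta \<kappa> W p z y) \<in> borel_measurable borel" unfolding Theta_def by measurable
  show ?thesis unfolding Upsilon_def \<Psi>_def by (subst W_interval[OF q]) simp_all
qed

lemma Theta_bdd:
  assumes "0 \<le> z" "z \<le> x" "\<bar>y\<bar> \<le> \<bar>K\<bar>"
  shows "\<bar>Theta \<kappa> W p z y\<bar> \<le> exp (\<Phi> p * x) * W p \<bar>K\<bar> + W p (x + \<bar>K\<bar>)"
proof -
  have "\<bar>exp (\<Phi> p * z) * W p (- y)\<bar> \<le> exp (\<Phi> p * x) * W p \<bar>K\<bar>"
    unfolding abs_mult using assms \<Phi>_root(1)[OF p] by (intro mult_mono W_le[OF p]) auto
  moreover have "\<bar>W p (z - y)\<bar> \<le> W p (x + \<bar>K\<bar>)" using assms by (intro W_le[OF p]) auto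
  ultimately show ?thesis unfolding Theta_def by linarith
qed

lemma h_Psi:
  "(LINT z|lborel. indicator {0<..} z * (W q (x - z) * (LINT y|lborel. h y * Theta \<kappa> W p z y))) = (LINT y|lborel. h y * \<Psi> x y)"
  "integrable lborel (\<lambda>y. h y * \<Psi> x y)"
proof -
  define f where "f y z = h y * (indicator {0<..} z * (W q (x - z) * Theta \<kappa> W p z y))" for y z
  define C where "C = W q x * (exp (\<Phi> p * x) * W p \<bar>K\<bar> + W p (x + \<bar>K\<bar>))"
  have C: "0 \<le> C" unfolding C_def using W_nonneg[OF p] W_nonneg[OF q] by simp
  have f0: "f y z = 0" if "y \<notin> {- \<bar>K\<bar>..\<bar>K\<bar>} \<or> z \<notin> {0..x}" for y z
  proof (rule ccontr)
    assume "f y z \<noteq> 0"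
    then have "h y \<noteq> 0" "0 < z" "W q (x - z) \<noteq> 0" by (auto simp: f_def split: split_indicator_asm)
    then have "y \<in> {- K..K}" "0 < z" "\<not> x - z < 0" using h_supp[of y] W_neg[OF q, of "x - z"] by blast+
    then show False using that by auto
  qed
  have m: "(\<lambda>z. f (fst z) (snd z)) \<in> borel_measurable (borel \<Otimes>\<^sub>M borel)" unfolding f_def Theta_def by measurable
  have b: "\<bar>f y z\<bar> \<le> B * C" for y z
  proof (cases "y \<notin> {- \<bar>K\<bar>..\<bar>K\<bar>} \<or> z \<notin> {0..x}")
    case True
    then show ?thesis using f0[OF True] B_nonneg C by simp
  next
    case False
    then have "\<bar>W q (x - z) * Theta \<kappa> W p z y\<bar> \<le> C"
      unfolding C_def abs_mult by (intro mult_mono W_le[OF q] Theta_bdd) (auto simp: W_nonneg[OF q])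
    then have "\<bar>indicator {0<..} z * (W q (x - z) * Theta \<kappa> W p z y)\<bar> \<le> C"
      using C by (auto split: split_indicator)
    then show ?thesis unfolding f_def abs_mult[of "h y"] using h_bdd[of y] B_nonneg by (intro mult_mono) auto
  qed
  note S = integrable_box_supp[of f "B * C" "- \<bar>K\<bar>" "\<bar>K\<bar>" 0 x, OF m b f0]
  have e: "(LINT z|lborel. f y z) = h y * \<Psi> x y" for y unfolding f_def \<Psi>_def by simp
  have e': "(LINT y|lborel. f y z) = indicator {0<..} z * (W q (x - z) * (LINT y|lborel. h y * Theta \<kappa> W p z y))" for z
  proof -
    have "(LINT y|lborel. f y z) = (LINT y|lborel. (indicator {0<..} z * W q (x - z)) * (h y * Theta \<kappa> W p z y))"
      unfolding f_def by (simp add: mult_ac)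
    then show ?thesis by simp
  qed
  show "integrable lborel (\<lambda>y. h y * \<Psi> x y)" using S(2) by (simp add: e)
  show "(LINT z|lborel. indicator {0<..} z * (W q (x - z) * (LINT y|lborel. h y * Theta \<kappa> W p z y))) = (LINT y|lborel. h y * \<Psi> x y)"
    using S(1) by (simp add: e e')
qed

lemma conv_eq:
  "conv x = q * \<phi> 0 / p * (exp (\<Phi> p * x) * I q (\<Phi> p) x - I q 0 x) + (LINT y|lborel. h y * \<Psi> x y)"
proof -
  let ?a = "q * \<phi> 0 / p"
  let ?f = "\<lambda>z. indicator {0<..} z * (W q (x - z) * k z) :: real"
  let ?g = "\<lambda>\<theta> z. indicator {0<..} z * (W q (x - z) * exp (\<theta> * z)) :: real"
  have "(LINT z|lborel. indicator {0<..} z * (W q (x - z) * (LINT y|lborel. h y * Theta \<kappa> W p z y)))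
      = (LINT z|lborel. ?f z - (?a * ?g (\<Phi> p) z - ?a * ?g 0 z))"
    unfolding k_def by (intro Bochner_Integration.integral_cong refl) (simp add: algebra_simps)
  also have "\<dots> = (LINT z|lborel. ?f z) - (LINT z|lborel. ?a * ?g (\<Phi> p) z - ?a * ?g 0 z)"
    by (intro Bochner_Integration.integral_diff Bochner_Integration.integrable_diff volterra(2) integrable_mult_right W_exp_conv(2)[OF q])
  also have "(LINT z|lborel. ?a * ?g (\<Phi> p) z - ?a * ?g 0 z) = ?a * (LINT z|lborel. ?g (\<Phi> p) z) - ?a * (LINT z|lborel. ?g 0 z)"
    by (subst Bochner_Integration.integral_diff) (intro integrable_mult_right W_exp_conv(2)[OF q], intro integrable_mult_right W_exp_conv(2)[OF q], simp)
  finally show ?thesis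
    unfolding h_Psi(1) volterra(1) W_exp_conv(1)[OF q] by (simp add: algebra_simps)
qed

text \<open>Inserting \<open>conv_eq\<close> into \<phi> = \<phi>(0) + k - r conv makes the terms
  with \<open>\<phi> 0\<close> a common factor, which is the mixed Z because q - \<kappa>(\<Phi>(p))
  = -r; the terms with \<open>h\<close> form \<Upsilon>.\<close>

lemma \<phi>_eq_scale:
  "\<phi> x = \<phi> 0 * scale_Z_mixed \<kappa> W q r x - (LINT y|lborel. h y * Upsilon \<kappa> W q r x y)"
  "integrable lborel (\<lambda>y. h y * Upsilon \<kappa> W q r x y)"
proof -
  let ?E = "exp (\<Phi> p * x)" and ?J = "I q (\<Phi> p) x" and ?Jz = "I q 0 x"
  have U: "h y * Upsilon \<kappa> W q r x y = r * (h y * \<Psi> x y) - h y * Theta \<kappa> W p x y" for y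
    by (simp add: Upsilon_eq algebra_simps)
  show "integrable lborel (\<lambda>y. h y * Upsilon \<kappa> W q r x y)"
    unfolding U using h_Psi(2)[of x] Theta_integral(2)[of x] by auto
  have UI: "(LINT y|lborel. h y * Upsilon \<kappa> W q r x y) = r * (LINT y|lborel. h y * \<Psi> x y) - (LINT y|lborel. h y * Theta \<kappa> W p x y)"
    unfolding U using h_Psi(2)[of x] Theta_integral(2)[of x] by (subst Bochner_Integration.integral_diff) auto
  have Z: "scale_Z_mixed \<kappa> W q r x = r / p * (1 + q * ?Jz) + q / p * (?E * (1 - r * ?J))"
    using I_interval[OF q, where x=x and \<theta>=0] I_interval[OF q, where x=x and \<theta>="\<Phi> p"]
    by (simp add: scale_Z_mixed_def scale_Z_def scale_Z_exp_def \<Phi>_root(2)[OF p])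
  \<comment> \<open>Pure algebra with \<open>u = r / p\<close> and \<open>v = q / p\<close>: their
    sum is 1, and \<open>r * v = q * u\<close> matches the two integral terms.\<close>
  have gen: "f + (a * (E - 1) + T) - r * (a * (E * J - J0) + S) = f * (u * (1 + q * J0) + v * (E * (1 - r * J))) - (r * S - T)"
    if "a = v * f" "u = 1 - v" "r * v = q * u" for f a E T J J0 S u v :: real
  proof -
    have e: "f * (u * (1 + q * J0) + v * (E * (1 - r * J))) = f * u + f * (q * u) * J0 + v * f * E - r * (v * f) * E * J"
      by (simp add: algebra_simps)
    show ?thesis unfolding e unfolding that(3)[symmetric] unfolding that(1,2) by (simp add: algebra_simps)
  qed
  have "\<phi> x = \<phi> 0 + (q * \<phi> 0 / p * (?E - 1) + (LINT y|lborel. h y * Theta \<kappa> W p x y)) - r * (q * \<phi> 0 / p * (?E * ?J - ?Jz) + (LINT y|lborel. h y * \<Psi> x y))"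
    using k_eq[of x] unfolding conv_eq k_def .
  also have "\<dots> = \<phi> 0 * (r / p * (1 + q * ?Jz) + q / p * (?E * (1 - r * ?J))) - (r * (LINT y|lborel. h y * \<Psi> x y) - (LINT y|lborel. h y * Theta \<kappa> W p x y))"
    using p by (intro gen) (simp_all add: field_simps)
  finally show "\<phi> x = \<phi> 0 * scale_Z_mixed \<kappa> W q r x - (LINT y|lborel. h y * Upsilon \<kappa> W q r x y)"
    unfolding Z UI .
qed

section \<open>The value at the reflection level\<close>

lemma integrable_pair_resolvent:
  fixes f :: "real \<Rightarrow> real \<Rightarrow> real"
  assumes f: "(\<lambda>z. f (fst z) (snd z)) \<in> borel_measurable (borel \<Otimes>\<^sub>M borel)"
    and b: "\<And>z. (\<integral>\<^sup>+x. ennreal \<bar>f z x\<bar> \<partial>lborel) \<le> ennreal C"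
  shows "(LINT x|lborel. LINT z|resolvent p. f z x) = (LINT z|resolvent p. LINT x|lborel. f z x)"
    "integrable lborel (\<lambda>x. LINT z|resolvent p. f z x)"
proof -
  interpret R: finite_measure "resolvent p" using finite_resolvent p by simp
  interpret RL: pair_sigma_finite "resolvent p" lborel ..
  have fm: "case_prod f \<in> borel_measurable (resolvent p \<Otimes>\<^sub>M lborel)"
    using f by (simp add: case_prod_beta' cong: measurable_cong_sets)
  have I: "integrable (resolvent p \<Otimes>\<^sub>M lborel) (case_prod f)"
  proof (rule integrableI_bounded[OF fm])
    have "(\<integral>\<^sup>+z. ennreal (norm (case_prod f z)) \<partial>(resolvent p \<Otimes>\<^sub>M lborel)) = (\<integral>\<^sup>+z. (\<integral>\<^sup>+x. ennreal \<bar>f z x\<bar> \<partial>lborel) \<partial>resolvent p)"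
      using fm by (subst lborel.nn_integral_fst[symmetric]) auto
    also have "\<dots> \<le> (\<integral>\<^sup>+z. ennreal C \<partial>resolvent p)" by (intro nn_integral_mono b)
    also have "\<dots> < \<infinity>" using R.emeasure_finite[of UNIV] by (simp add: ennreal_mult_less_top) (simp add: less_top[symmetric])
    finally show "(\<integral>\<^sup>+z. ennreal (norm (case_prod f z)) \<partial>(resolvent p \<Otimes>\<^sub>M lborel)) < \<infinity>" .
  qed
  show "(LINT x|lborel. LINT z|resolvent p. f z x) = (LINT z|resolvent p. LINT x|lborel. f z x)"
    by (rule RL.Fubini_integral[OF I])
  show "integrable lborel (\<lambda>x. LINT z|resolvent p. f z x)"
    using RL.integrable_snd[OF I] .
qed

text \<open>The substitution y = x + z and Fubini move the transform in the starting point
  \<open>x\<close> onto the kernel. Integrating exp(-\<theta> x) over positive \<open>x\<close> is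
  integrating exp(\<theta> (z - y)) over z below y, which is the function \<open>P\<close> seen from
  \<open>- y\<close>.\<close>

lemma laplace_potential:
  assumes \<theta>: "0 < \<theta>"
  shows "(LINT x|lborel. indicator {0<..} x * (exp (- \<theta> * x) * (LINT z|resolvent p. m (x + z)))) = (LINT y|lborel. m y * P p \<theta> (- y))"
    "integrable lborel (\<lambda>y. m y * P p \<theta> (- y))"
proof -
  define f where "f z x = indicator {0<..} x * (exp (- \<theta> * x) * m (x + z))" for z x
  define g where "g z y = m y * (indicator {..<y} z * exp (\<theta> * (- y + z)))" for z y
  have gf: "g z (z + 1 * x) = f z x" for z x
    by (auto simp: f_def g_def add.commute split: split_indicator)
  have mf: "(\<lambda>z. f (fst z) (snd z)) \<in> borel_measurable (borel \<Otimes>\<^sub>M borel)"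
    and mf'[measurable]: "\<And>z. f z \<in> borel_measurable borel" unfolding f_def by measurable
  have ge: "g z y = (if z < y then m y * exp (\<theta> * (- y + z)) else 0)" for z y by (simp add: g_def)
  have mg: "(\<lambda>z. g (fst z) (snd z)) \<in> borel_measurable (borel \<Otimes>\<^sub>M borel)"
    and mg'[measurable]: "\<And>z. g z \<in> borel_measurable borel" unfolding ge[abs_def] by measurable
  have bf: "(\<integral>\<^sup>+x. ennreal \<bar>f z x\<bar> \<partial>lborel) \<le> ennreal (Bm * (1 / \<theta>))" for z
  proof -
    have "(\<integral>\<^sup>+x. ennreal \<bar>f z x\<bar> \<partial>lborel) \<le> (\<integral>\<^sup>+x. ennreal (Bm * (indicator {0<..} x * exp (- \<theta> * x))) \<partial>lborel)"
    proof (intro nn_integral_mono ennreal_leI)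
      fix x
      show "\<bar>f z x\<bar> \<le> Bm * (indicator {0<..} x * exp (- \<theta> * x))"
        using mult_right_mono[OF m_bdd[of "x + z"], of "exp (- \<theta> * x)"]
        by (auto simp: f_def abs_mult mult.commute split: split_indicator)
    qed
    also have "\<dots> = ennreal (Bm * (1 / \<theta>))"
      using has_bochner_integral_exp_tail[OF \<theta>, of 0] Bm_nonneg
      by (subst nn_integral_eq_integral) (auto simp: has_bochner_integral_iff)
    finally show ?thesis .
  qed
  have bg: "(\<integral>\<^sup>+y. ennreal \<bar>g z y\<bar> \<partial>lborel) \<le> ennreal (Bm * (1 / \<theta>))" for z
    using nn_integral_real_affine[of "\<lambda>y. ennreal \<bar>g z y\<bar>" 1 z] bf[of z] by (simp add: gf[simplified])
  note Ff = integrable_pair_resolvent[OF mf bf] and Fg = integrable_pair_resolvent[OF mg bg]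
  have eg: "(LINT z|resolvent p. g z y) = m y * P p \<theta> (- y)" for y unfolding g_def P_def by simp
  have "(LINT x|lborel. indicator {0<..} x * (exp (- \<theta> * x) * (LINT z|resolvent p. m (x + z)))) = (LINT x|lborel. LINT z|resolvent p. f z x)"
    unfolding f_def by simp
  also have "\<dots> = (LINT z|resolvent p. LINT x|lborel. f z x)" by (rule Ff(1))
  also have "\<dots> = (LINT z|resolvent p. LINT y|lborel. g z y)"
  proof (rule Bochner_Integration.integral_cong[OF refl])
    fix z
    show "(LINT x|lborel. f z x) = (LINT y|lborel. g z y)"
      unfolding gf[symmetric] using lborel_integral_real_affine[of 1 "g z" z] by simp
  qed
  also have "\<dots> = (LINT y|lborel. LINT z|resolvent p. g z y)" by (rule Fg(1)[symmetric])
  finally show "(LINT x|lborel. indicator {0<..} x * (exp (- \<theta> * x) * (LINT z|resolvent p. m (x + z)))) = (LINT y|lborel. m y * P p \<theta> (- y))"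
    unfolding eg .
  show "integrable lborel (\<lambda>y. m y * P p \<theta> (- y))" using Fg(2) unfolding eg .
qed

text \<open>The expression of \<open>H_pos\<close> at \<theta> = \<Phi>(q), where p -
  \<kappa>(\<theta>) is \<open>r\<close>. It agrees with the passage transform at every nonzero
  argument.\<close>

definition H0 :: "real \<Rightarrow> real" where
  "H0 x = exp (\<Phi> q * x) * (1 + r * I p (\<Phi> q) x) - r / (\<Phi> p - \<Phi> q) * W p x"

lemma \<Phi>_qp: "0 < \<Phi> q" "\<Phi> q < \<Phi> p" "p - \<kappa> (\<Phi> q) = r"
  using \<Phi>_root(1,2)[OF q] \<Phi>_less[of q p] q r by auto

text \<open>For positive \<open>x\<close> the potential of \<open>m\<close> is
  \<open>F x + q * \<phi> 0 / p\<close>. Its transform at \<Phi>(q) is computed once from this and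
  once by \<open>laplace_potential\<close>; the transform of \<open>F\<close> occurs on both sides
  with coefficient 1, because 1/(p - \<kappa>(\<Phi>(q))) = 1/r meets the factor \<open>r\<close> in
  \<open>m\<close>. What remains is a linear equation for \<open>\<phi> 0\<close>.\<close>

lemma \<phi>_0:
  "\<phi> 0 = p / (q * r) * (\<Phi> q * (\<Phi> p - \<Phi> q) / \<Phi> p) * (LINT y|lborel. h y * H0 (- y))"
  "integrable lborel (\<lambda>y. h y * H0 (- y))"
proof -
  let ?t = "\<Phi> q" and ?d = "\<Phi> p - \<Phi> q"
  have t: "0 < ?t" "0 < ?d" using \<Phi>_qp by auto
  interpret R: finite_measure "resolvent p" using finite_resolvent p by simp
  define E where "E y = exp (- ?t * y)" for y
  define Fh where "Fh = (LINT y|lborel. F y * E y)"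
  have iM: "integrable lborel (\<lambda>y. m y * E y)" unfolding E_def by (rule m_exp_integrable[OF t(1)])
  have ih: "integrable lborel (\<lambda>y. h y * E y)"
  proof (rule integrable_compact_supp[where u="- \<bar>K\<bar>" and v="\<bar>K\<bar>" and B="B * exp (?t * \<bar>K\<bar>)"])
    show out: "y \<notin> {- \<bar>K\<bar>..\<bar>K\<bar>} \<Longrightarrow> h y * E y = 0" for y using h_supp[of y] by (auto simp: abs_if split: if_splits)
    show "\<bar>h y * E y\<bar> \<le> B * exp (?t * \<bar>K\<bar>)" for y
    proof (cases "y \<in> {- \<bar>K\<bar>..\<bar>K\<bar>}")
      case True
      then have "?t * (- y) \<le> ?t * \<bar>K\<bar>" using t(1) by (intro mult_left_mono) auto
      then have "\<bar>E y\<bar> \<le> exp (?t * \<bar>K\<bar>)" by (simp add: E_def)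
      then show ?thesis unfolding abs_mult using h_bdd[of y] B_nonneg by (intro mult_mono) auto
    next
      case False
      show ?thesis unfolding out[OF False] using B_nonneg by simp
    qed
  qed (simp add: E_def)
  have iF: "integrable lborel (\<lambda>y. F y * E y)"
  proof -
    have "F y * E y = (m y * E y - h y * E y) / r" for y using r by (simp add: m_def algebra_simps)
    then show ?thesis using iM ih by simp
  qed
  have iT: "integrable lborel (\<lambda>x. indicator {0<..} x * E x)" "(LINT x|lborel. indicator {0<..} x * E x) = 1 / ?t"
    using has_bochner_integral_exp_tail[OF t(1), of 0] by (auto simp: has_bochner_integral_iff E_def)
  have mpos: "(LINT z|resolvent p. m (x + z)) = F x + q * \<phi> 0 / p" if "0 < x" for x
  proof -
    have "(LINT z|resolvent p. m (x + z)) = \<phi> x - r * \<phi> 0 / p"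
      using \<phi>_decomp[of x] potential_formula(3)[OF p m_measurable m_exp_integrable[OF \<Phi>_root(1)[OF p]], of x]
      by (simp add: A_def mult.commute mult.left_commute)
    moreover have "r * \<phi> 0 / p = \<phi> 0 - q * \<phi> 0 / p" using p by (simp add: field_simps)
    ultimately show ?thesis using that by (simp add: F_def)
  qed
  have "(LINT x|lborel. indicator {0<..} x * (exp (- ?t * x) * (LINT z|resolvent p. m (x + z))))
      = (LINT x|lborel. F x * E x + q * \<phi> 0 / p * (indicator {0<..} x * E x))"
  proof (intro Bochner_Integration.integral_cong refl)
    fix x
    show "indicator {0<..} x * (exp (- ?t * x) * (LINT z|resolvent p. m (x + z))) = F x * E x + q * \<phi> 0 / p * (indicator {0<..} x * E x)"
      using mpos[of x] F_neg[of x] by (cases "0 < x") (simp_all add: E_def algebra_simps)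
  qed
  also have "\<dots> = Fh + q * \<phi> 0 / p * (1 / ?t)"
    unfolding Fh_def using iF iT by (subst Bochner_Integration.integral_add) auto
  finally have L: "(LINT y|lborel. m y * P p ?t (- y)) = Fh + q * \<phi> 0 / p * (1 / ?t)"
    unfolding laplace_potential(1)[OF t(1)] .
  define J where "J y = E y * I p ?t (- y)" for y
  have mP: "m y * P p ?t (- y) = 1 / r * (m y * E y) + h y * J y - c p / ?d * (m y * exp (- \<Phi> p * y))" for y
  proof -
    have "P p ?t (- y) = E y * (1 / r + I p ?t (- y)) - c p / ?d * exp (- \<Phi> p * y)"
    proof -
      have "c p * exp (\<Phi> p * (- y)) / (?t - \<Phi> p) = - (c p / ?d * exp (- \<Phi> p * y))"
        by (subst minus_diff_eq[symmetric], subst divide_minus_right) simp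
      then show ?thesis using P_eq[OF p, of ?t "- y"] \<Phi>_qp by (simp add: E_def)
    qed
    \<comment> \<open>\<open>F\<close> lives on positive \<open>y\<close> and
      \<open>I p ?t (- y)\<close> on negative \<open>y\<close>, so the unknown part of
      \<open>m\<close> drops out of this term.\<close>
    moreover have "m y * I p ?t (- y) = h y * I p ?t (- y)"
      using I_neg[OF p, of "- y" ?t] F_neg[of y] by (cases "0 \<le> y") (auto simp: m_def)
    moreover have "m' * (E' * (e + i) - u * x) = e * (m' * E') + h' * (E' * i) - u * (m' * x)"
      if "m' * i = h' * i" for m' E' e i u x h' :: real
    proof -
      have e: "h' * (E' * i) = E' * (m' * i)" by (simp only: that mult.left_commute)
      show ?thesis unfolding e by (simp add: algebra_simps)
    qed
    ultimately show ?thesis by (simp only: J_def)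
  qed
  have iJ: "integrable lborel (\<lambda>y. h y * J y)"
  proof -
    have "h y * J y = m y * P p ?t (- y) - 1 / r * (m y * E y) + c p / ?d * (m y * exp (- \<Phi> p * y))" for y
      using mP[of y] by linarith
    then show ?thesis
      using laplace_potential(2)[OF t(1)] iM m_exp_integrable[OF \<Phi>_root(1)[OF p]] by auto
  qed
  have "(LINT y|lborel. m y * P p ?t (- y)) = 1 / r * (LINT y|lborel. m y * E y) + (LINT y|lborel. h y * J y) - c p / ?d * (LINT y|lborel. m y * exp (- \<Phi> p * y))"
    unfolding mP using iM iJ m_exp_integrable[OF \<Phi>_root(1)[OF p]] by simp
  also have "(LINT y|lborel. m y * E y) = (LINT y|lborel. h y * E y) + r * Fh"
  proof -
    have "m y * E y = h y * E y + r * (F y * E y)" for y by (simp add: m_def algebra_simps)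
    then show ?thesis unfolding Fh_def using ih iF by simp
  qed
  finally have R: "q * \<phi> 0 / p * (1 / ?t) = 1 / r * (LINT y|lborel. h y * E y) + (LINT y|lborel. h y * J y) - A / ?d"
    unfolding L A_def using r by (simp add: algebra_simps)
  have hH: "h y * H0 (- y) = h y * E y + r * (h y * J y) - r / ?d * (h y * W p (0 - y))" for y
    by (simp add: H0_def E_def J_def algebra_simps)
  show "integrable lborel (\<lambda>y. h y * H0 (- y))"
    unfolding hH using ih iJ hW_integrable[of 0] by auto
  have HI: "(LINT y|lborel. h y * H0 (- y)) = (LINT y|lborel. h y * E y) + r * (LINT y|lborel. h y * J y) - r / ?d * w0"
    unfolding hH w0_def using ih iJ hW_integrable[of 0] by simp
  \<comment> \<open>Solves the linear equation for \<open>f\<close>, standing for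
    \<open>\<phi> 0\<close>. With \<open>t' + d'\<close> standing for \<Phi>(p), the reciprocal of
    1/t' + 1/d' is the source of the factor \<Phi>(q) (\<Phi>(p) - \<Phi>(q)) / \<Phi>(p).\<close>
  have gen: "f = p' / (q' * r') * (t' * d' / (t' + d')) * (hE + r' * hJ - r' / d' * w')"
    if e: "q' * f / p' * (1 / t') = 1 / r' * hE + hJ - (q' * f / p' + w') / d'" and "0 < q'" "0 < p'" "0 < r'" "0 < t'" "0 < d'"
    for f p' q' r' t' d' hE hJ w' :: real
  proof -
    define a where "a = q' * f / p'"
    have f: "f = p' / q' * a" using that by (simp add: a_def)
    have "hE + r' * hJ - r' / d' * w' = r' * (1 / r' * hE + hJ - w' / d')" using that by (simp add: distrib_left right_diff_distrib)
    also have "1 / r' * hE + hJ - w' / d' = a * (1 / t') + a / d'" using e unfolding a_def[symmetric] by (simp add: add_divide_distrib)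
    also have "a * (1 / t') + a / d' = a * ((t' + d') / (t' * d'))" using that by (simp add: add_divide_distrib distrib_left)
    finally have "p' / (q' * r') * (t' * d' / (t' + d')) * (hE + r' * hJ - r' / d' * w')
      = p' / (q' * r') * (t' * d' / (t' + d')) * (r' * (a * ((t' + d') / (t' * d'))))" by simp
    also have "\<dots> = p' / q' * a"
    proof -
      define s where "s = t' + d'"
      have "s \<noteq> 0" using that by (simp add: s_def)
      then show ?thesis unfolding s_def[symmetric] using that by simp
    qed
    finally show ?thesis using f by simp
  qed
  have "\<phi> 0 = p / (q * r) * (?t * ?d / (?t + ?d)) * ((LINT y|lborel. h y * E y) + r * (LINT y|lborel. h y * J y) - r / ?d * w0)"
    using R unfolding A_eq by (rule gen) (use q r p t in auto)
  then show "\<phi> 0 = p / (q * r) * (?t * ?d / \<Phi> p) * (LINT y|lborel. h y * H0 (- y))"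
    unfolding HI by simp
qed

end

section \<open>The density in terms of the passage transform\<close>

context spectrally_negative begin

lemma passage_transform_eq: "passage_transform M X p x \<theta> = H p x \<theta>"
  unfolding passage_transform_def hit_transform_def hits_def hit_time_def passage_time_def Let_def
proof (rule Bochner_Integration.integral_cong[OF refl])
  fix \<omega>
  show "(if \<exists>t>0. x + X t \<omega> < 0 then exp (- p * Inf {t. 0 < t \<and> x + X t \<omega> < 0} + \<theta> * (x + X (Inf {t. 0 < t \<and> x + X t \<omega> < 0}) \<omega>)) else 0)
     = (if \<exists>t>0. x + X t \<omega> \<in> {..<0} then exp (- p * Inf {t. 0 < t \<and> x + X t \<omega> \<in> {..<0}}) * exp (\<theta> * (x + X (Inf {t. 0 < t \<and> x + X t \<omega> \<in> {..<0}}) \<omega>)) else 0)"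
    by (simp only: exp_add lessThan_iff)
qed

end

context reflected_resolvent begin

lemma passage_H0: "x \<noteq> 0 \<Longrightarrow> passage_transform M X p x (\<Phi> q) = H0 x"
proof (cases "0 < x")
  case True
  then show ?thesis using H_pos[OF p True, of "\<Phi> q"] \<Phi>_qp by (simp add: passage_transform_eq H0_def)
next
  case False
  assume "x \<noteq> 0"
  with False show ?thesis
    using H_neg[of x p "\<Phi> q"] I_neg[OF p, of x] W_neg[OF p, of x] by (simp add: passage_transform_eq H0_def)
qed

text \<open>Away from 0 the transform is the measurable expression \<open>H0\<close>; the one
  remaining point affects neither measurability nor the integral against \<open>h\<close>.\<close>

lemma passage_measurable: "(\<lambda>x. passage_transform M X p x (\<Phi> q)) \<in> borel_measurable borel"
proof -
  have "I p (\<Phi> q) = (\<lambda>x. LINT s|lborel. (if s \<le> x then exp (- \<Phi> q * s) * W p s else 0))"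
    unfolding I_def[abs_def] by (intro ext Bochner_Integration.integral_cong refl) auto
  then have [measurable]: "I p (\<Phi> q) \<in> borel_measurable borel" by simp
  have [measurable]: "H0 \<in> borel_measurable borel" unfolding H0_def[abs_def] by measurable
  have "(\<lambda>x. passage_transform M X p x (\<Phi> q)) = (\<lambda>x. if x = 0 then passage_transform M X p 0 (\<Phi> q) else H0 x)"
    using passage_H0 by auto
  then show ?thesis by simp
qed

theorem \<phi>_density:
  "\<phi> x = (LINT y|lborel. h y * resolvent_density M X \<kappa> W q r 0 x y)"
  "integrable lborel (\<lambda>y. h y * resolvent_density M X \<kappa> W q r 0 x y)"
proof -
  define C where "C = p / (q * r) * (\<Phi> q * (\<Phi> p - \<Phi> q) / \<Phi> p)"
  define Z where "Z = scale_Z_mixed \<kappa> W q r x"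
  have d: "h y * resolvent_density M X \<kappa> W q r 0 x y = C * Z * (h y * passage_transform M X p (- y) (\<Phi> q)) - h y * Upsilon \<kappa> W q r x y" for y
    by (simp add: resolvent_density_def C_def Z_def Let_def algebra_simps)
  have mP: "(\<lambda>y. h y * passage_transform M X p (- y) (\<Phi> q)) \<in> borel_measurable lborel"
    using measurable_compose[OF _ passage_measurable, of uminus lborel] by simp
  have mH: "(\<lambda>y. h y * H0 (- y)) \<in> borel_measurable lborel" by (rule borel_measurable_integrable[OF \<phi>_0(2)])
  have ae: "AE y in lborel. h y * passage_transform M X p (- y) (\<Phi> q) = h y * H0 (- y)"
    using AE_lborel_singleton[of 0] by eventually_elim (simp add: passage_H0)
  have iP: "integrable lborel (\<lambda>y. h y * passage_transform M X p (- y) (\<Phi> q))"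
    using \<phi>_0(2) integrable_cong_AE[OF mP mH ae] by simp
  show "integrable lborel (\<lambda>y. h y * resolvent_density M X \<kappa> W q r 0 x y)"
    unfolding d using iP \<phi>_eq_scale(2)[of x] by auto
  have "(LINT y|lborel. h y * resolvent_density M X \<kappa> W q r 0 x y) = C * Z * (LINT y|lborel. h y * passage_transform M X p (- y) (\<Phi> q)) - (LINT y|lborel. h y * Upsilon \<kappa> W q r x y)"
    unfolding d using iP \<phi>_eq_scale(2)[of x] by simp
  also have "(LINT y|lborel. h y * passage_transform M X p (- y) (\<Phi> q)) = (LINT y|lborel. h y * H0 (- y))"
    by (rule integral_cong_AE[OF mP mH ae])
  also have "C * Z * (LINT y|lborel. h y * H0 (- y)) = \<phi> 0 * Z" using \<phi>_0(1) by (simp add: C_def)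
  finally show "\<phi> x = (LINT y|lborel. h y * resolvent_density M X \<kappa> W q r 0 x y)"
    using \<phi>_eq_scale(1)[of x] by (simp add: Z_def)
qed

end

section \<open>One step of the grid chain\<close>

lemma lipschitz_continuous:
  fixes f :: "real \<Rightarrow> real"
  assumes L: "\<And>y z. \<bar>f y - f z\<bar> \<le> L * \<bar>y - z\<bar>"
  shows "continuous_on UNIV f" "f \<in> borel_measurable borel" "0 \<le> L"
proof -
  show L0: "0 \<le> L" using L[of 1 0] by simp
  show "continuous_on UNIV f"
    using L L0 by (intro lipschitz_on_continuous_on[of L] lipschitz_onI) (auto simp: dist_real_def)
  then show "f \<in> borel_measurable borel" by (rule borel_measurable_continuous_onI)
qed

context levy begin

lemma measure_resolvent: "0 < p \<Longrightarrow> measure (resolvent p) UNIV = 1 / p"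
  using emeasure_resolvent[of p] by (simp add: measure_def)

lemma potential_lipschitz:
  fixes g :: "real \<Rightarrow> real"
  assumes p: "0 < p" and g: "\<And>y. \<bar>g y\<bar> \<le> C" and L: "\<And>y z. \<bar>g y - g z\<bar> \<le> L * \<bar>y - z\<bar>"
  shows "\<bar>potential p g y - potential p g z\<bar> \<le> L / p * \<bar>y - z\<bar>"
proof -
  interpret R: finite_measure "resolvent p" using finite_resolvent p by simp
  note gm = lipschitz_continuous(2)[OF L]
  have i: "integrable (resolvent p) (\<lambda>v. g (y + v))" for y
    by (rule integrable_resolvent[OF p gm g])
  have "potential p g y - potential p g z = (LINT v|resolvent p. g (y + v) - g (z + v))"
    unfolding potential_def using i by simp
  moreover have "\<bar>LINT v|resolvent p. g (y + v) - g (z + v)\<bar> \<le> (LINT v|resolvent p. \<bar>g (y + v) - g (z + v)\<bar>)"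
    by (rule integral_abs_bound)
  moreover have "(LINT v|resolvent p. \<bar>g (y + v) - g (z + v)\<bar>) \<le> (LINT v|resolvent p. L * \<bar>y - z\<bar>)"
  proof (rule integral_mono)
    show "\<bar>g (y + v) - g (z + v)\<bar> \<le> L * \<bar>y - z\<bar>" for v using L[of "y + v" "z + v"] by simp
  qed (use i in auto)
  moreover have "(LINT v|resolvent p. L * \<bar>y - z\<bar>) = L / p * \<bar>y - z\<bar>"
    using measure_resolvent[OF p] by simp
  ultimately show ?thesis by linarith
qed

text \<open>Iteration from 0 is increasing, because the source is monotone in \<open>f\<close>. The
  class \<open>good\<close> is invariant and closed under pointwise limits, so the limit keeps its
  bound and Lipschitz constant and solves the equation by dominated convergence.\<close>

lemma fixpoint:
  fixes h :: "real \<Rightarrow> real"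
  assumes q: "0 < q" and r: "0 < r" and h: "\<And>y. 0 \<le> h y" "\<And>y. h y \<le> B"
    and L: "\<And>y z. \<bar>h y - h z\<bar> \<le> L * \<bar>y - z\<bar>"
  obtains \<phi> where "\<And>y. 0 \<le> \<phi> y" "\<And>y. \<phi> y \<le> B / q" "\<And>y z. \<bar>\<phi> y - \<phi> z\<bar> \<le> L / q * \<bar>y - z\<bar>"
    "\<And>x. \<phi> x = potential (q + r) (\<lambda>y. h y + r * \<phi> (max b y)) x"
proof -
  have p: "0 < q + r" using q r by simp
  interpret R: finite_measure "resolvent (q + r)" using finite_resolvent p by simp
  have L0: "0 \<le> L" and hm: "h \<in> borel_measurable borel" using lipschitz_continuous[OF L] by auto
  have B0: "0 \<le> B" using h[of 0] by linarith
  define good where "good f \<longleftrightarrow> (\<forall>y. 0 \<le> f y \<and> f y \<le> B / q) \<and> (\<forall>y z. \<bar>f y - f z\<bar> \<le> L / q * \<bar>y - z\<bar>)" for f :: "real \<Rightarrow> real"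
  define src where "src f y = h y + r * f (max b y)" for f and y :: real
  define step where "step f = potential (q + r) (src f)" for f
  \<comment> \<open>Why the class is invariant: both the bound and the Lipschitz constant pass from
    c/q for the iterate to c + r c/q for the source, and division by q + r returns c/q. Used with c
    = B and c = L.\<close>
  have gen: "(c + r * (c / q)) / (q + r) = c / q" for c
  proof -
    have "q * (c / q) = c" using q by simp
    then have "c + r * (c / q) = (q + r) * (c / q)" by (simp only: distrib_right)
    moreover have "(q + r) * (c / q) / (q + r) = c / q" using p by (intro nonzero_mult_div_cancel_left) simp
    ultimately show ?thesis by (simp only:)
  qed
  have src: "0 \<le> src f y" "src f y \<le> B + r * (B / q)" "\<bar>src f y - src f z\<bar> \<le> (L + r * (L / q)) * \<bar>y - z\<bar>"
    if "good f" for f y z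
  proof -
    have "0 \<le> f (max b y)" "f (max b y) \<le> B / q" using that by (auto simp: good_def)
    then have "0 \<le> r * f (max b y)" "r * f (max b y) \<le> r * (B / q)" using r by (simp, intro mult_left_mono) auto
    then show "0 \<le> src f y" "src f y \<le> B + r * (B / q)" using h[of y] unfolding src_def by linarith+
    have "\<bar>f (max b y) - f (max b z)\<bar> \<le> L / q * \<bar>max b y - max b z\<bar>" using that unfolding good_def by auto
    also have "L / q * \<bar>max b y - max b z\<bar> \<le> L / q * \<bar>y - z\<bar>" using L0 q by (intro mult_left_mono) auto
    finally have "r * \<bar>f (max b y) - f (max b z)\<bar> \<le> r * (L / q * \<bar>y - z\<bar>)" using r by (intro mult_left_mono) auto
    moreover have "\<bar>src f y - src f z\<bar> \<le> \<bar>h y - h z\<bar> + \<bar>r * (f (max b y) - f (max b z))\<bar>"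
      unfolding src_def by (simp only: right_diff_distrib)
    moreover have "\<bar>r * (f (max b y) - f (max b z))\<bar> = r * \<bar>f (max b y) - f (max b z)\<bar>" using r by (simp add: abs_mult)
    ultimately have "\<bar>src f y - src f z\<bar> \<le> L * \<bar>y - z\<bar> + r * (L / q * \<bar>y - z\<bar>)" using L[of y z] by linarith
    then show "\<bar>src f y - src f z\<bar> \<le> (L + r * (L / q)) * \<bar>y - z\<bar>" by (simp add: distrib_right)
  qed
  have srcm: "src f \<in> borel_measurable borel" if "good f" for f
    by (rule lipschitz_continuous(2)[OF src(3)[OF that]])
  have srcb: "\<bar>src f y\<bar> \<le> B + r * (B / q)" if "good f" for f y using src(1,2)[OF that, of y] by simp
  have step: "good (step f)" if "good f" for f
    unfolding good_def step_def
    using potential_bounds[OF p srcm[OF that] src(1,2)[OF that]] potential_lipschitz[OF p srcb[OF that] src(3)[OF that]]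
    unfolding gen by blast
  have mono: "step f y \<le> step f' y" if "good f" "good f'" "\<And>y. f y \<le> f' y" for f f' y
    unfolding step_def potential_def
  proof (rule integral_mono)
    show "integrable (resolvent (q + r)) (\<lambda>z. src f (y + z))" "integrable (resolvent (q + r)) (\<lambda>z. src f' (y + z))"
      using integrable_resolvent[OF p srcm srcb] that by auto
    show "src f (y + z) \<le> src f' (y + z)" for z using that(3) r by (simp add: src_def)
  qed
  define f where "f n = (step ^^ n) (\<lambda>_. 0)" for n
  have f: "good (f n)" for n
  proof (induction n)
    case 0
    show ?case using B0 L0 q by (simp add: good_def f_def)
  next
    case (Suc n)
    then show ?case using step by (simp add: f_def)
  qed
  have fS: "f (Suc n) = step (f n)" for n by (simp add: f_def)
  have inc: "f n y \<le> f (Suc n) y" for n y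
  proof (induction n arbitrary: y)
    case 0
    show ?case using f[of 1] by (simp add: f_def good_def)
  next
    case (Suc n)
    show ?case using mono[OF f f Suc] by (simp only: fS[symmetric])
  qed
  define \<phi> where "\<phi> y = lim (\<lambda>n. f n y)" for y
  have lim: "(\<lambda>n. f n y) \<longlonglongrightarrow> \<phi> y" for y
  proof -
    have "incseq (\<lambda>n. f n y)" using inc by (intro incseq_SucI) auto
    moreover have "\<forall>n. f n y \<le> B / q" using f by (simp add: good_def)
    ultimately obtain l where "(\<lambda>n. f n y) \<longlonglongrightarrow> l" by (rule incseq_convergent)
    then show ?thesis unfolding \<phi>_def by (simp add: limI)
  qed
  have "0 \<le> \<phi> y" "\<phi> y \<le> B / q" for y
    using LIMSEQ_le_const[OF lim, of 0 y] LIMSEQ_le_const2[OF lim, of y "B / q"] f by (auto simp: good_def)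
  moreover have "\<bar>\<phi> y - \<phi> z\<bar> \<le> L / q * \<bar>y - z\<bar>" for y z
    by (rule LIMSEQ_le_const2[OF tendsto_rabs[OF tendsto_diff[OF lim lim]]]) (use f in \<open>auto simp: good_def\<close>)
  ultimately have good: "good \<phi>" by (simp add: good_def)
  have fix_eq: "\<phi> x = step \<phi> x" for x
  proof (rule LIMSEQ_unique)
    show "(\<lambda>n. f (Suc n) x) \<longlonglongrightarrow> \<phi> x" using lim[of x] by (rule LIMSEQ_Suc)
    show "(\<lambda>n. f (Suc n) x) \<longlonglongrightarrow> step \<phi> x"
      unfolding fS step_def potential_def
    proof (rule integral_dominated_convergence[where w="\<lambda>_. B + r * (B / q)"])
      have [measurable]: "src \<phi> \<in> borel_measurable borel" "src (f n) \<in> borel_measurable borel" for n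
        by (rule srcm[OF good], rule srcm[OF f])
      show "(\<lambda>z. src \<phi> (x + z)) \<in> borel_measurable (resolvent (q + r))" by measurable
      show "(\<lambda>z. src (f n) (x + z)) \<in> borel_measurable (resolvent (q + r))" for n by measurable
      show "AE z in resolvent (q + r). (\<lambda>n. src (f n) (x + z)) \<longlonglongrightarrow> src \<phi> (x + z)"
        unfolding src_def by (intro AE_I2 tendsto_intros lim)
      show "AE z in resolvent (q + r). norm (src (f n) (x + z)) \<le> B + r * (B / q)" for n
        using srcb[OF f] by simp
    qed simp
  qed
  show thesis
    by (rule that[OF _ _ _ fix_eq[unfolded step_def src_def[abs_def]]]) (use good in \<open>simp_all add: good_def\<close>)
qed

text \<open>Right continuity at time 0, where \<open>X\<close> vanishes almost surely. Truncation at
  1 supplies the dominating function.\<close>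

lemma small_increments:
  assumes "0 < \<epsilon>"
  shows "\<exists>d>0. \<forall>s. 0 \<le> s \<and> s \<le> d \<longrightarrow> (LINT \<omega>|M. min 1 \<bar>X s \<omega>\<bar>) \<le> \<epsilon>"
proof (rule ccontr)
  assume "\<not> ?thesis"
  then have "\<forall>n. \<exists>s. 0 \<le> s \<and> s \<le> mesh n \<and> \<epsilon> < (LINT \<omega>|M. min 1 \<bar>X s \<omega>\<bar>)"
    by (metis not_le of_nat_0_less_iff zero_less_Suc zero_less_divide_1_iff)
  then obtain s where s: "\<And>n. 0 \<le> s n" "\<And>n. s n \<le> mesh n" "\<And>n. \<epsilon> < (LINT \<omega>|M. min 1 \<bar>X (s n) \<omega>\<bar>)"
    by metis
  have s0: "s \<longlonglongrightarrow> 0"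
    by (rule tendsto_sandwich[OF _ _ tendsto_const mesh_tendsto]) (use s in auto)
  have [measurable]: "X (s n) \<in> borel_measurable M" "X 0 \<in> borel_measurable M" for n using s by (auto intro: X_measurable)
  have "(\<lambda>n. LINT \<omega>|M. min 1 \<bar>X (s n) \<omega>\<bar>) \<longlonglongrightarrow> (LINT \<omega>|M. min 1 \<bar>X 0 \<omega>\<bar>)"
  proof (rule integral_dominated_convergence[where w="\<lambda>_. 1"])
    show "AE \<omega> in M. (\<lambda>n. min 1 \<bar>X (s n) \<omega>\<bar>) \<longlonglongrightarrow> min 1 \<bar>X 0 \<omega>\<bar>"
    proof (rule AE_I2)
      fix \<omega> assume "\<omega> \<in> space M"
      then have "(\<lambda>n. X (s n) \<omega>) \<longlonglongrightarrow> X 0 \<omega>" using cadlag_tendsto_right[OF X_cadlag _ s0] s(1) by simp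
      then show "(\<lambda>n. min 1 \<bar>X (s n) \<omega>\<bar>) \<longlonglongrightarrow> min 1 \<bar>X 0 \<omega>\<bar>" by (intro tendsto_intros)
    qed
  qed auto
  moreover have "(LINT \<omega>|M. min 1 \<bar>X 0 \<omega>\<bar>) = 0"
    by (rule integral_eq_zero_AE) (use X_0 in eventually_elim, simp)
  ultimately have "\<epsilon> \<le> 0" using LIMSEQ_le_const[of _ 0 \<epsilon>] s(3) by (metis less_imp_le)
  then show False using assms by simp
qed

text \<open>Large displacements are controlled by the bound \<open>C\<close>, small ones by the
  Lipschitz constant \<open>L\<close>; hence the truncated displacement.\<close>

lemma expectation_near:
  fixes \<psi> :: "real \<Rightarrow> real"
  assumes s: "0 \<le> s" and \<psi>: "\<And>y. 0 \<le> \<psi> y" "\<And>y. \<psi> y \<le> C" and L: "\<And>y z. \<bar>\<psi> y - \<psi> z\<bar> \<le> L * \<bar>y - z\<bar>"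
  shows "\<bar>(LINT \<omega>|M. \<psi> (y + X s \<omega>)) - \<psi> y\<bar> \<le> (C + L) * (LINT \<omega>|M. min 1 \<bar>X s \<omega>\<bar>)"
    "integrable M (\<lambda>\<omega>. \<psi> (y + X s \<omega>))" "0 \<le> (LINT \<omega>|M. \<psi> (y + X s \<omega>))" "(LINT \<omega>|M. \<psi> (y + X s \<omega>)) \<le> C"
proof -
  have [measurable]: "X s \<in> borel_measurable M" "\<psi> \<in> borel_measurable borel"
    using s lipschitz_continuous(2)[OF L] by (auto intro: X_measurable)
  show i: "integrable M (\<lambda>\<omega>. \<psi> (y + X s \<omega>))" by (rule integrable_const_bound[where B=C]) (use \<psi> in auto)
  show "0 \<le> (LINT \<omega>|M. \<psi> (y + X s \<omega>))" using \<psi> by simp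
  have "(LINT \<omega>|M. \<psi> (y + X s \<omega>)) \<le> (LINT \<omega>|M. C)" using i \<psi> by (intro integral_mono) auto
  then show "(LINT \<omega>|M. \<psi> (y + X s \<omega>)) \<le> C" by (simp add: prob_space)
  have L0: "0 \<le> L" and C0: "0 \<le> C" using lipschitz_continuous(3)[OF L] \<psi>[of 0] by auto
  have i1: "integrable M (\<lambda>\<omega>. min 1 \<bar>X s \<omega>\<bar>)" by (rule integrable_const_bound[where B=1]) auto
  have "(LINT \<omega>|M. \<psi> (y + X s \<omega>)) - \<psi> y = (LINT \<omega>|M. \<psi> (y + X s \<omega>) - \<psi> y)"
    using i by (simp add: prob_space)
  moreover have "\<bar>LINT \<omega>|M. \<psi> (y + X s \<omega>) - \<psi> y\<bar> \<le> (LINT \<omega>|M. \<bar>\<psi> (y + X s \<omega>) - \<psi> y\<bar>)" by (rule integral_abs_bound)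
  moreover have "(LINT \<omega>|M. \<bar>\<psi> (y + X s \<omega>) - \<psi> y\<bar>) \<le> (LINT \<omega>|M. (C + L) * min 1 \<bar>X s \<omega>\<bar>)"
  proof (rule integral_mono)
    fix \<omega>
    have "\<bar>\<psi> (y + X s \<omega>) - \<psi> y\<bar> \<le> C" using \<psi>[of y] \<psi>[of "y + X s \<omega>"] by linarith
    moreover have "\<bar>\<psi> (y + X s \<omega>) - \<psi> y\<bar> \<le> L * \<bar>X s \<omega>\<bar>" using L[of "y + X s \<omega>" y] by simp
    moreover have "0 \<le> C * \<bar>X s \<omega>\<bar>" using C0 by simp
    ultimately have "\<bar>\<psi> (y + X s \<omega>) - \<psi> y\<bar> \<le> C + L" "\<bar>\<psi> (y + X s \<omega>) - \<psi> y\<bar> \<le> (C + L) * \<bar>X s \<omega>\<bar>"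
      using L0 unfolding distrib_right by linarith+
    then show "\<bar>\<psi> (y + X s \<omega>) - \<psi> y\<bar> \<le> (C + L) * min 1 \<bar>X s \<omega>\<bar>" by (simp add: min_def)
  qed (use i i1 in auto)
  moreover have "(LINT \<omega>|M. (C + L) * min 1 \<bar>X s \<omega>\<bar>) = (C + L) * (LINT \<omega>|M. min 1 \<bar>X s \<omega>\<bar>)" by simp
  ultimately show "\<bar>(LINT \<omega>|M. \<psi> (y + X s \<omega>)) - \<psi> y\<bar> \<le> (C + L) * (LINT \<omega>|M. min 1 \<bar>X s \<omega>\<bar>)" by linarith
qed

lemma exp_near_1: "0 \<le> (x::real) \<Longrightarrow> 0 \<le> u \<Longrightarrow> u \<le> C \<Longrightarrow> u - x * C \<le> exp (- x) * u \<and> exp (- x) * u \<le> u"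
proof -
  assume a: "0 \<le> x" "0 \<le> u" "u \<le> C"
  have "1 - x \<le> exp (- x)" using exp_ge_add_one_self[of "- x"] by simp
  then have "(1 - x) * u \<le> exp (- x) * u" using a by (intro mult_right_mono) auto
  moreover have "x * u \<le> x * C" using a by (intro mult_left_mono) auto
  moreover have "exp (- x) * u \<le> 1 * u" using a by (intro mult_right_mono) auto
  ultimately show ?thesis by (simp add: left_diff_distrib)
qed

text \<open>By \<open>resolvent_semigroup\<close> the error is the difference between \<delta> g(y)
  and the discounted occupation during [0,\<delta>]. Discounting changes the integrand by at most
  \<open>p * \<delta> * C\<close>, displacement by at most \<open>(C + L) * \<eta>\<close>; the
  bound is uniform in \<open>y\<close>.\<close>

lemma potential_step:
  fixes g :: "real \<Rightarrow> real"
  assumes p: "0 < p" and \<delta>: "0 < \<delta>" and g: "\<And>y. 0 \<le> g y" "\<And>y. g y \<le> C" and L: "\<And>y z. \<bar>g y - g z\<bar> \<le> L * \<bar>y - z\<bar>"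
    and \<eta>: "\<And>s. 0 \<le> s \<Longrightarrow> s \<le> \<delta> \<Longrightarrow> (LINT \<omega>|M. min 1 \<bar>X s \<omega>\<bar>) \<le> \<eta>"
  shows "\<bar>exp (- p * \<delta>) * (LINT \<omega>|M. potential p g (y + X \<delta> \<omega>)) - potential p g y + \<delta> * g y\<bar> \<le> \<delta> * (p * \<delta> * C + (C + L) * \<eta>)"
proof -
  define e where "e = (C + L) * \<eta>"
  have L0: "0 \<le> L" and C0: "0 \<le> C" using lipschitz_continuous(3)[OF L] g[of 0] by auto
  have gm[measurable]: "g \<in> borel_measurable borel" by (rule lipschitz_continuous(2)[OF L])
  have [measurable]: "X \<delta> \<in> borel_measurable M" using \<delta> by (intro X_measurable) simp
  note pb = potential_bounds[OF p gm g]
  have gb: "\<bar>g y\<bar> \<le> C" for y using g[of y] by simp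
  note pl = potential_lipschitz[OF p gb L]
  define E where "E s = (LINT \<omega>|M. g (y + X (max 0 s) \<omega>))" for s
  define G where "G = (LINT \<omega>|M. potential p g (y + X \<delta> \<omega>))"
  note near = expectation_near[OF _ g L]
  have E: "g y - e \<le> E s" "E s \<le> g y + e" "0 \<le> E s" "E s \<le> C" if "0 \<le> s" "s \<le> \<delta>" for s
  proof -
    have "(C + L) * (LINT \<omega>|M. min 1 \<bar>X s \<omega>\<bar>) \<le> e" unfolding e_def using \<eta>[OF that] C0 L0 by (intro mult_left_mono) auto
    then show "g y - e \<le> E s" "E s \<le> g y + e" using near(1)[OF that(1), of y] that unfolding E_def by (simp_all add: abs_le_iff)
    show "0 \<le> E s" "E s \<le> C" using near(3,4)[OF that(1), of y] that unfolding E_def by simp_all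
  qed
  have nnE: "(\<integral>\<^sup>+\<omega>. ennreal (g (y + X (max 0 s) \<omega>)) \<partial>M) = ennreal (E s)" for s
    unfolding E_def using near(2)[of "max 0 s" y] g by (intro nn_integral_eq_integral) auto
  have G: "(\<integral>\<^sup>+\<omega>. ennreal (potential p g (y + X \<delta> \<omega>)) \<partial>M) = ennreal G"
    unfolding G_def using expectation_near(2)[of \<delta> "potential p g", OF _ pb pl] \<delta> pb by (intro nn_integral_eq_integral) auto
  have G0: "0 \<le> G" unfolding G_def using pb by simp
  define A where "A = (\<integral>\<^sup>+s. indicator {0..<\<delta>} s * ennreal (exp (- p * s)) * ennreal (E s) \<partial>lborel)"
  have S: "ennreal (potential p g y) = A + ennreal (exp (- p * \<delta>) * G)"
    using resolvent_semigroup[OF p \<delta>, of "\<lambda>y. ennreal (g y)" y] G0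
    by (simp add: Res_potential[OF p gm g] nnE G A_def ennreal_mult)
  have const: "(\<integral>\<^sup>+s. indicator {0..<\<delta>} s * ennreal k \<partial>lborel) = ennreal (\<delta> * k)" if "0 \<le> k" for k
    using that \<delta> by (subst nn_integral_multc) (auto simp: ennreal_mult)
  have A1: "A \<le> ennreal (\<delta> * (g y + e))"
  proof -
    have k: "0 \<le> g y + e" using E(2,3)[of 0] \<delta> by auto
    have "A \<le> (\<integral>\<^sup>+s. indicator {0..<\<delta>} s * ennreal (g y + e) \<partial>lborel)"
      unfolding A_def
    proof (rule nn_integral_mono)
      fix s
      show "indicator {0..<\<delta>} s * ennreal (exp (- p * s)) * ennreal (E s) \<le> indicator {0..<\<delta>} s * ennreal (g y + e)"
      proof (cases "s \<in> {0..<\<delta>}")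
        case True
        then have s: "0 \<le> s" "s \<le> \<delta>" by auto
        have "exp (- (p * s)) * E s \<le> g y + e"
          using exp_near_1[of "p * s" "E s" C] E[OF s] s p by auto
        then show ?thesis using True E[OF s] by (simp flip: ennreal_mult)
      qed simp
    qed
    then show ?thesis using const[OF k] by simp
  qed
  have A2: "ennreal (\<delta> * (g y - e - p * \<delta> * C)) \<le> A"
  proof (cases "0 \<le> g y - e - p * \<delta> * C")
    case True
    have "(\<integral>\<^sup>+s. indicator {0..<\<delta>} s * ennreal (g y - e - p * \<delta> * C) \<partial>lborel) \<le> A"
      unfolding A_def
    proof (rule nn_integral_mono)
      fix s
      show "indicator {0..<\<delta>} s * ennreal (g y - e - p * \<delta> * C) \<le> indicator {0..<\<delta>} s * ennreal (exp (- p * s)) * ennreal (E s)"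
      proof (cases "s \<in> {0..<\<delta>}")
        case True
        then have s: "0 \<le> s" "s \<le> \<delta>" by auto
        have "p * s * C \<le> p * \<delta> * C" using s p C0 by (intro mult_right_mono mult_left_mono) auto
        moreover have "E s - p * s * C \<le> exp (- (p * s)) * E s"
          using exp_near_1[of "p * s" "E s" C] E[OF s] s p by auto
        ultimately have "g y - e - p * \<delta> * C \<le> exp (- (p * s)) * E s" using E(1)[OF s] by linarith
        then show ?thesis using True E[OF s] by (simp flip: ennreal_mult add: ennreal_leI)
      qed simp
    qed
    then show ?thesis using const[OF True] by simp
  next
    case False
    then have "\<delta> * (g y - e - p * \<delta> * C) \<le> 0" using \<delta> by (simp add: mult_le_0_iff)
    then show ?thesis by (simp add: ennreal_neg)
  qed
  have "A \<noteq> \<top>" using A1 by (auto simp: top_unique)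
  then obtain a where a: "A = ennreal a" "0 \<le> a" by (cases A) auto
  have k: "0 \<le> g y + e" using E(2,3)[of 0] \<delta> by auto
  have "a \<le> \<delta> * (g y + e)" using A1 k \<delta> unfolding a(1) by (subst (asm) ennreal_le_iff) auto
  moreover have "\<delta> * (g y - e - p * \<delta> * C) \<le> a" using A2 a(2) unfolding a(1) by (cases "0 \<le> \<delta> * (g y - e - p * \<delta> * C)") auto
  moreover have "potential p g y = a + exp (- p * \<delta>) * G"
    using S a(2) G0 pb(1)[of y] unfolding a(1) by (simp flip: ennreal_plus)
  ultimately have "- (\<delta> * (g y + e)) \<le> exp (- p * \<delta>) * G - potential p g y" "exp (- p * \<delta>) * G - potential p g y \<le> - (\<delta> * (g y - e - p * \<delta> * C))"
    by linarith+
  moreover have "0 \<le> \<delta> * (p * \<delta> * C)" using p \<delta> C0 by simp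
  ultimately show ?thesis unfolding G_def[symmetric] e_def[symmetric] abs_le_iff
    by (simp add: distrib_left right_diff_distrib)
qed

text \<open>Only 0 or 1 arrivals matter to first order: the probability of more is at most the
  square of \<open>l\<close>, because 1 - l is at most exp(-l).\<close>

lemma poisson_split:
  fixes u :: "nat \<Rightarrow> real"
  assumes l: "0 < l" and u: "\<And>n. 0 \<le> u n" "\<And>n. u n \<le> C"
  shows "\<exists>e. (LINT n|measure_pmf (poisson_pmf l). u n) = exp (- l) * u 0 + l * exp (- l) * u 1 + e \<and> 0 \<le> e \<and> e \<le> l\<^sup>2 * C"
proof (intro exI conjI)
  let ?P = "poisson_pmf l"
  let ?e = "LINT n|measure_pmf ?P. indicator {2..} n * u n"
  have C0: "0 \<le> C" using u[of 0] by linarith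
  have P: "pmf ?P 0 = exp (- l)" "pmf ?P 1 = l * exp (- l)" using l by simp_all
  have i: "integrable (measure_pmf ?P) (\<lambda>n. indicator A n * u n)" for A
    using u C0 by (intro measure_pmf.integrable_const_bound[where B=C]) (auto split: split_indicator)
  have s: "(LINT n|measure_pmf ?P. indicator {k} n * u n) = pmf ?P k * u k" for k
  proof -
    have "(LINT n|measure_pmf ?P. indicator {k} n * u n) = (LINT n|measure_pmf ?P. indicator {k} n * u k)"
      by (intro Bochner_Integration.integral_cong refl) (auto split: split_indicator)
    then show ?thesis by (simp add: measure_pmf_single)
  qed
  have e: "u n = indicator {0} n * u n + indicator {1} n * u n + indicator {2..} n * u n" for n
    by (auto split: split_indicator)
  have "(LINT n|measure_pmf ?P. u n) = (LINT n|measure_pmf ?P. indicator {0} n * u n + indicator {1} n * u n + indicator {2..} n * u n)"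
    using e by simp
  also have "\<dots> = (LINT n|measure_pmf ?P. indicator {0} n * u n) + (LINT n|measure_pmf ?P. indicator {1} n * u n) + ?e"
    by (intro trans[OF Bochner_Integration.integral_add] arg_cong2[where f="(+)"] Bochner_Integration.integral_add Bochner_Integration.integrable_add i refl)
  finally show "(LINT n|measure_pmf ?P. u n) = exp (- l) * u 0 + l * exp (- l) * u 1 + ?e"
    unfolding s P .
  show "0 \<le> ?e" using u by (intro integral_nonneg_AE) auto
  have "?e \<le> (LINT n|measure_pmf ?P. indicator {2..} n * C)"
    using u C0 by (intro integral_mono i measure_pmf.integrable_const_bound[where B=C]) (auto split: split_indicator)
  also have "\<dots> = measure (measure_pmf ?P) {2..} * C" by simp
  also have "measure (measure_pmf ?P) {2..} = 1 - measure (measure_pmf ?P) {0, 1}"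
  proof -
    have "{2..} = space (measure_pmf ?P) - {0, 1}" by (auto simp: numeral_2_eq_2 not_less_eq_eq)
    then show ?thesis using measure_pmf.prob_compl[of "{0, 1}" ?P] by simp
  qed
  also have "measure (measure_pmf ?P) {0, 1} = exp (- l) + l * exp (- l)"
    by (subst measure_measure_pmf_finite) (use P in auto)
  also have "(1 - (exp (- l) + l * exp (- l))) * C \<le> l\<^sup>2 * C"
  proof (rule mult_right_mono[OF _ C0])
    have "(1 - l) * (1 + l) \<le> exp (- l) * (1 + l)"
      using exp_ge_add_one_self[of "- l"] l by (intro mult_right_mono) auto
    then show "1 - (exp (- l) + l * exp (- l)) \<le> l\<^sup>2" by (simp add: algebra_simps power2_eq_square)
  qed
  finally show "?e \<le> l\<^sup>2 * C" .
qed

text \<open>Without arrival the discounts combine to exp(-p \<delta>), and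
  \<open>potential_step\<close> gives \<phi>(y) - \<delta> g(y) up to small errors. One arrival
  contributes about r \<delta> \<phi>(max b y), which cancels that part of the source
  \<open>g\<close> and leaves only \<open>h\<close>. More arrivals are of second order in \<delta>.
  The threshold does not depend on \<open>y\<close>, so the bound can later be integrated over the
  law of the walk.\<close>

lemma walk_step:
  fixes h \<phi> :: "real \<Rightarrow> real"
  assumes q: "0 < q" and r: "0 < r" and h: "\<And>y. 0 \<le> h y" "\<And>y. h y \<le> B" and hL: "\<And>y z. \<bar>h y - h z\<bar> \<le> L * \<bar>y - z\<bar>"
    and \<phi>: "\<And>y. 0 \<le> \<phi> y" "\<And>y. \<phi> y \<le> B'" and \<phi>L: "\<And>y z. \<bar>\<phi> y - \<phi> z\<bar> \<le> L' * \<bar>y - z\<bar>"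
    and eq: "\<And>x. \<phi> x = potential (q + r) (\<lambda>y. h y + r * \<phi> (max b y)) x" and \<epsilon>: "0 < \<epsilon>"
  shows "\<exists>d>0. \<forall>\<delta> y. 0 < \<delta> \<and> \<delta> \<le> d \<longrightarrow>
    \<bar>exp (- q * \<delta>) * (LINT n|measure_pmf (poisson_pmf (r * \<delta>)). LINT \<omega>|M. \<phi> (y + X \<delta> \<omega> + real n * max 0 (b - y))) - \<phi> y + \<delta> * h y\<bar> \<le> \<delta> * \<epsilon>"
proof -
  let ?p = "q + r"
  have p: "0 < ?p" using q r by simp
  define g where "g y = h y + r * \<phi> (max b y)" for y
  define Cg where "Cg = B + r * B'"
  define Lg where "Lg = L + r * L'"
  have L0: "0 \<le> L" "0 \<le> L'" using lipschitz_continuous(3)[OF hL] lipschitz_continuous(3)[OF \<phi>L] by auto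
  have B0: "0 \<le> B" "0 \<le> B'" using h[of 0] \<phi>[of 0] by auto
  have g: "0 \<le> g y" "g y \<le> Cg" for y
    using h[of y] \<phi>[of "max b y"] r unfolding g_def Cg_def by (auto intro!: add_mono mult_left_mono)
  have gL: "\<bar>g y - g z\<bar> \<le> Lg * \<bar>y - z\<bar>" for y z
  proof -
    have "\<bar>\<phi> (max b y) - \<phi> (max b z)\<bar> \<le> L' * \<bar>max b y - max b z\<bar>" by (rule \<phi>L)
    also have "L' * \<bar>max b y - max b z\<bar> \<le> L' * \<bar>y - z\<bar>" using L0 by (intro mult_left_mono) auto
    finally have "r * \<bar>\<phi> (max b y) - \<phi> (max b z)\<bar> \<le> r * (L' * \<bar>y - z\<bar>)" using r by (intro mult_left_mono) auto
    moreover have "\<bar>g y - g z\<bar> \<le> \<bar>h y - h z\<bar> + \<bar>r * (\<phi> (max b y) - \<phi> (max b z))\<bar>"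
      unfolding g_def by (simp only: right_diff_distrib)
    moreover have "\<bar>r * (\<phi> (max b y) - \<phi> (max b z))\<bar> = r * \<bar>\<phi> (max b y) - \<phi> (max b z)\<bar>" using r by (simp add: abs_mult)
    ultimately have "\<bar>g y - g z\<bar> \<le> L * \<bar>y - z\<bar> + r * (L' * \<bar>y - z\<bar>)" using hL[of y z] by linarith
    then show ?thesis by (simp add: Lg_def distrib_right)
  qed
  have eq': "\<phi> = potential ?p g" unfolding g_def[abs_def] by (rule ext) (rule eq)
  \<comment> \<open>\<open>C1\<close> collects the coefficients of \<delta> (discounting and
    multiple arrivals), \<open>C2\<close> those of the displacement \<eta>; each source of error is
    given \<epsilon>/2. Dividing by \<open>C1 + 1\<close> and \<open>C2 + 1\<close> avoids a zero
    denominator.\<close>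
  define C1 where "C1 = ?p * Cg + r * (?p * B') + r\<^sup>2 * B'"
  define C2 where "C2 = (Cg + Lg) + r * (B' + L')"
  have C0: "0 \<le> C1" "0 \<le> C2" using p r q B0 L0 by (auto simp: C1_def C2_def Cg_def Lg_def)
  have half: "(c + 1) * (\<epsilon> / (2 * (c + 1))) = \<epsilon> / 2" if "0 \<le> c" for c
  proof -
    define k where "k = c + 1"
    have "k \<noteq> 0" using that by (simp add: k_def)
    then show ?thesis unfolding k_def[symmetric] by simp
  qed
  define \<eta> where "\<eta> = \<epsilon> / (2 * (C2 + 1))"
  have \<eta>: "0 < \<eta>" "C2 * \<eta> \<le> \<epsilon> / 2"
  proof -
    show "0 < \<eta>" using \<epsilon> C0 by (simp add: \<eta>_def)
    have "C2 * \<eta> \<le> (C2 + 1) * \<eta>" using \<open>0 < \<eta>\<close> by (intro mult_right_mono) auto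
    also have "(C2 + 1) * \<eta> = \<epsilon> / 2" unfolding \<eta>_def by (rule half[OF C0(2)])
    finally show "C2 * \<eta> \<le> \<epsilon> / 2" .
  qed
  obtain d1 where d1: "0 < d1" "\<And>s. 0 \<le> s \<Longrightarrow> s \<le> d1 \<Longrightarrow> (LINT \<omega>|M. min 1 \<bar>X s \<omega>\<bar>) \<le> \<eta>"
    using small_increments[OF \<eta>(1)] by blast
  define d where "d = min d1 (\<epsilon> / (2 * (C1 + 1)))"
  have d0: "0 < d" using d1 \<epsilon> C0 by (simp add: d_def)
  show ?thesis
  proof (intro exI[of _ d] conjI d0 allI impI)
    fix \<delta> y assume "0 < \<delta> \<and> \<delta> \<le> d"
    then have \<delta>: "0 < \<delta>" "\<delta> \<le> d1" "\<delta> \<le> \<epsilon> / (2 * (C1 + 1))" by (auto simp: d_def)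
    have C1\<delta>: "C1 * \<delta> \<le> \<epsilon> / 2"
    proof -
      have "C1 * \<delta> \<le> (C1 + 1) * \<delta>" using \<delta> by (intro mult_right_mono) auto
      also have "(C1 + 1) * \<delta> \<le> (C1 + 1) * (\<epsilon> / (2 * (C1 + 1)))" using \<delta> C0 by (intro mult_left_mono) auto
      also have "(C1 + 1) * (\<epsilon> / (2 * (C1 + 1))) = \<epsilon> / 2" by (rule half[OF C0(1)])
      finally show ?thesis .
    qed
    have small: "(LINT \<omega>|M. min 1 \<bar>X s \<omega>\<bar>) \<le> \<eta>" if "0 \<le> s" "s \<le> \<delta>" for s using d1(2) that \<delta> by simp
    let ?m = "max 0 (b - y)"
    define u where "u n = (LINT \<omega>|M. \<phi> (y + real n * ?m + X \<delta> \<omega>))" for n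
    have u: "0 \<le> u n" "u n \<le> B'" for n
      unfolding u_def using expectation_near(3,4)[OF _ \<phi> \<phi>L] \<delta> by auto
    obtain e where e: "(LINT n|measure_pmf (poisson_pmf (r * \<delta>)). u n) = exp (- (r * \<delta>)) * u 0 + r * \<delta> * exp (- (r * \<delta>)) * u 1 + e"
      "0 \<le> e" "e \<le> (r * \<delta>)\<^sup>2 * B'"
      using poisson_split[of "r * \<delta>" u B', OF _ u] r \<delta> by auto
    define z where "z = max b y"
    have u1: "u 1 = (LINT \<omega>|M. \<phi> (z + X \<delta> \<omega>))" unfolding u_def z_def by (simp add: max_def)
    have n1: "\<bar>u 1 - \<phi> z\<bar> \<le> (B' + L') * \<eta>"
    proof -
      have "\<bar>u 1 - \<phi> z\<bar> \<le> (B' + L') * (LINT \<omega>|M. min 1 \<bar>X \<delta> \<omega>\<bar>)"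
        unfolding u1 using \<delta> by (intro expectation_near(1) \<phi> \<phi>L) simp
      also have "(B' + L') * (LINT \<omega>|M. min 1 \<bar>X \<delta> \<omega>\<bar>) \<le> (B' + L') * \<eta>"
        using B0 L0 \<delta> by (intro mult_left_mono small) auto
      finally show ?thesis .
    qed
    define a where "a = exp (- (?p * \<delta>)) * u 1"
    have a: "\<bar>a - \<phi> z\<bar> \<le> ?p * \<delta> * B' + (B' + L') * \<eta>"
      using n1 exp_near_1[of "?p * \<delta>" "u 1" B'] u[of 1] p \<delta> unfolding a_def by (auto simp: abs_le_iff)
    define c where "c = exp (- (?p * \<delta>)) * u 0 - \<phi> y + \<delta> * g y"
    have c: "\<bar>c\<bar> \<le> \<delta> * (?p * \<delta> * Cg + (Cg + Lg) * \<eta>)"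
      using potential_step[OF p \<delta>(1) g gL small, of y]
      unfolding c_def u_def eq'[symmetric] mult_minus_left[of ?p \<delta>] by simp
    define e' where "e' = exp (- (q * \<delta>)) * e"
    have e': "\<bar>e'\<bar> \<le> \<delta> * (r\<^sup>2 * \<delta> * B')"
    proof -
      have "0 \<le> e'" "e' \<le> e" using exp_near_1[of "q * \<delta>" e e] e(2) q \<delta> unfolding e'_def by auto
      then show ?thesis using e(3) by (simp add: power2_eq_square mult_ac)
    qed
    have ex: "exp (- q * \<delta>) * exp (- (r * \<delta>)) = exp (- (?p * \<delta>))" by (simp add: distrib_right flip: exp_add)
    have "exp (- q * \<delta>) * (LINT n|measure_pmf (poisson_pmf (r * \<delta>)). u n)
       = (exp (- q * \<delta>) * exp (- (r * \<delta>))) * u 0 + r * \<delta> * ((exp (- q * \<delta>) * exp (- (r * \<delta>))) * u 1) + exp (- q * \<delta>) * e"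
      unfolding e(1) by (simp only: distrib_left mult_ac)
    then have "exp (- q * \<delta>) * (LINT n|measure_pmf (poisson_pmf (r * \<delta>)). u n) - \<phi> y + \<delta> * h y
       = c + r * \<delta> * (a - \<phi> z) + e'"
      unfolding ex by (simp add: c_def a_def e'_def g_def z_def algebra_simps)
    moreover have "\<bar>r * \<delta> * (a - \<phi> z)\<bar> \<le> r * \<delta> * (?p * \<delta> * B' + (B' + L') * \<eta>)"
      using a r \<delta> by (simp add: abs_mult)
    ultimately have "\<bar>exp (- q * \<delta>) * (LINT n|measure_pmf (poisson_pmf (r * \<delta>)). u n) - \<phi> y + \<delta> * h y\<bar>
      \<le> \<delta> * (?p * \<delta> * Cg + (Cg + Lg) * \<eta>) + r * \<delta> * (?p * \<delta> * B' + (B' + L') * \<eta>) + \<delta> * (r\<^sup>2 * \<delta> * B')"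
      using c e' by linarith
    also have "\<dots> = \<delta> * (C1 * \<delta> + C2 * \<eta>)" unfolding C1_def C2_def by (simp only: distrib_left distrib_right mult_ac add_ac)
    also have "\<dots> \<le> \<delta> * \<epsilon>" using C1\<delta> \<eta>(2) \<delta>(1) by (intro mult_left_mono) auto
    finally show "\<bar>exp (- q * \<delta>) * (LINT n|measure_pmf (poisson_pmf (r * \<delta>)). LINT \<omega>|M. \<phi> (y + X \<delta> \<omega> + real n * ?m)) - \<phi> y + \<delta> * h y\<bar> \<le> \<delta> * \<epsilon>"
      unfolding u_def by (simp add: add_ac)
  qed
qed

end

section \<open>The grid chain and its limit\<close>

lemma reflected_walk_measurable [measurable (raw)]:
  fixes f g :: "'c \<Rightarrow> nat \<Rightarrow> real"
  assumes f: "f \<in> N \<rightarrow>\<^sub>M PiM {..<k} (\<lambda>_. borel)" and g: "g \<in> N \<rightarrow>\<^sub>M PiM {..<k} (\<lambda>_. borel)"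
  shows "(\<lambda>z. reflected_walk b y (f z) (g z) k) \<in> borel_measurable N"
proof -
  have "(\<lambda>z. reflected_walk b y (f z) (g z) j) \<in> borel_measurable N" if "j \<le> k" for j
    using that
  proof (induction j)
    case (Suc j)
    then have j: "j \<in> {..<k}" by simp
    have [measurable]: "(\<lambda>z. f z j) \<in> borel_measurable N" "(\<lambda>z. g z j) \<in> borel_measurable N"
      using measurable_compose[OF f measurable_component_singleton[OF j]] measurable_compose[OF g measurable_component_singleton[OF j]] by auto
    have [measurable]: "(\<lambda>z. reflected_walk b y (f z) (g z) j) \<in> borel_measurable N" using Suc by simp
    show ?case by simp
  qed simp
  then show ?thesis by simp
qed

lemma (in levy) increments_measurable [measurable]:
  assumes "0 \<le> \<delta>" shows "increments \<delta> k \<in> M \<rightarrow>\<^sub>M PiM {..<k} (\<lambda>_. borel)"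
proof -
  have [measurable]: "X (\<delta> * real i) \<in> borel_measurable M" for i using assms by (intro X_measurable) simp
  show ?thesis unfolding increments_def[abs_def] by (rule measurable_restrict) measurable
qed

locale levy_poisson = levy M X for M :: "'w measure" and X +
  fixes r :: real and N :: "real \<Rightarrow> 'w \<Rightarrow> nat"
  assumes r: "0 < r" and poisson: "poisson_process M r N" and indep: "independent_processes M X N"

text \<open>The counting process is itself a Levy process, so increments, their independence and the
  Markov property are available for it under the prefix \<open>N\<close>.\<close>

sublocale levy_poisson \<subseteq> N: levy M "\<lambda>t \<omega>. real (N t \<omega>)"
  using poisson by unfold_locales (simp add: poisson_process_def)

context levy_poisson begin

lemma indep_paths:
  assumes \<delta>: "0 < \<delta>"
    and f[measurable]: "(\<lambda>z. f (fst z) (snd z)) \<in> borel_measurable (PiM {..<k} (\<lambda>_. borel) \<Otimes>\<^sub>M PiM {..<k} (\<lambda>_. borel))"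
  shows "(\<integral>\<^sup>+\<omega>. f (increments \<delta> k \<omega>) (N.increments \<delta> k \<omega>) \<partial>M) =
    (\<integral>\<^sup>+\<omega>. (\<integral>\<^sup>+\<omega>'. f (increments \<delta> k \<omega>) (N.increments \<delta> k \<omega>') \<partial>M) \<partial>M)"
proof (rule nn_integral_indep_var[OF _ f])
  define G :: "(real \<Rightarrow> real) \<Rightarrow> nat \<Rightarrow> real" where "G z = (\<lambda>i\<in>{..<k}. z (\<delta> * real (Suc i)) - z (\<delta> * real i))" for z
  have m: "G \<in> PiM {0..} (\<lambda>_. L) \<rightarrow>\<^sub>M PiM {..<k} (\<lambda>_. borel)" if L: "(\<lambda>x. x) \<in> L \<rightarrow>\<^sub>M (borel :: real measure)" for L
    unfolding G_def[abs_def]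
  proof (rule measurable_restrict)
    fix i
    have "(\<lambda>z. z (\<delta> * real j)) \<in> PiM {0..} (\<lambda>_. L) \<rightarrow>\<^sub>M L" for j
      by (rule measurable_component_singleton) (use \<delta> in simp)
    from measurable_compose[OF this L] have "(\<lambda>z. z (\<delta> * real j)) \<in> PiM {0..} (\<lambda>_. L) \<rightarrow>\<^sub>M borel" for j .
    from this[of "Suc i"] this[of i]
    show "(\<lambda>z. z (\<delta> * real (Suc i)) - z (\<delta> * real i)) \<in> borel_measurable (PiM {0..} (\<lambda>_. L))" by measurable
  qed
  have "indep_var (PiM {..<k} (\<lambda>_. borel)) (G \<circ> (\<lambda>\<omega>. \<lambda>t\<in>{0..}. X t \<omega>))
     (PiM {..<k} (\<lambda>_. borel)) (G \<circ> (\<lambda>\<omega> t. real ((\<lambda>t\<in>{0..}. N t \<omega>) t)))"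
    using indep unfolding independent_processes_def by (rule indep_var_compose) (auto intro: m)
  moreover have "G \<circ> (\<lambda>\<omega>. \<lambda>t\<in>{0..}. X t \<omega>) = increments \<delta> k" "G \<circ> (\<lambda>\<omega> t. real ((\<lambda>t\<in>{0..}. N t \<omega>) t)) = N.increments \<delta> k"
    using \<delta> by (auto simp: fun_eq_iff G_def increments_def N.increments_def)
  ultimately show "indep_var (PiM {..<k} (\<lambda>_. borel)) (increments \<delta> k) (PiM {..<k} (\<lambda>_. borel)) (N.increments \<delta> k)" by simp
qed

definition walk :: "real \<Rightarrow> real \<Rightarrow> real \<Rightarrow> nat \<Rightarrow> 'w \<Rightarrow> real" where
  "walk b y \<delta> k \<omega> = reflected_walk b y (\<lambda>i. X (\<delta> * real (Suc i)) \<omega> - X (\<delta> * real i) \<omega>)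
     (\<lambda>i. real (N (\<delta> * real (Suc i)) \<omega>) - real (N (\<delta> * real i) \<omega>)) k"

lemma walk_increments: "j \<le> k \<Longrightarrow> walk b y \<delta> j \<omega> = reflected_walk b y (increments \<delta> k \<omega>) (N.increments \<delta> k \<omega>) j"
  unfolding walk_def by (rule reflected_walk_cong) (auto simp: increments_def N.increments_def)

lemma walk_measurable: assumes "0 < \<delta>" shows "walk b y \<delta> k \<in> borel_measurable M"
proof -
  have "0 \<le> \<delta>" using assms by simp
  note [measurable] = increments_measurable[OF this] N.increments_measurable[OF this]
  show ?thesis unfolding walk_increments[OF order_refl, abs_def] by measurable
qed

text \<open>The last increments of \<open>X\<close> and \<open>N\<close> are replaced by fresh
  copies. Independence of the processes first separates the two paths; the grid Markov property is
  then applied to \<open>N\<close> and to \<open>X\<close> one after the other, and the same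
  independence, read backwards, joins the two pasts again into one walk.\<close>

lemma walk_markov:
  fixes \<phi> :: "real \<Rightarrow> ennreal"
  assumes \<delta>: "0 < \<delta>" and [measurable]: "\<phi> \<in> borel_measurable borel"
  shows "(\<integral>\<^sup>+\<omega>. \<phi> (walk b y \<delta> (Suc k) \<omega>) \<partial>M) =
    (\<integral>\<^sup>+\<omega>. (\<integral>\<^sup>+\<omega>2. (\<integral>\<^sup>+\<omega>3. \<phi> (walk b y \<delta> k \<omega> + X \<delta> \<omega>2 + real (N \<delta> \<omega>3) * max 0 (b - walk b y \<delta> k \<omega>)) \<partial>M) \<partial>M) \<partial>M)"
proof -
  have \<delta>0: "0 \<le> \<delta>" using \<delta> by simp
  note [measurable] = increments_measurable[OF \<delta>0] N.increments_measurable[OF \<delta>0] X_measurable[OF \<delta>0] N.X_measurable[OF \<delta>0]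
  define w where "w a n = reflected_walk b y a n k" for a n
  have [measurable (raw)]: "(\<lambda>z. w (f z) (g z)) \<in> borel_measurable L"
    if "f \<in> L \<rightarrow>\<^sub>M PiM {..<k} (\<lambda>_. borel)" "g \<in> L \<rightarrow>\<^sub>M PiM {..<k} (\<lambda>_. borel)" for f g and L :: "'c measure"
    unfolding w_def using that by measurable
  let ?P = "PiM {..<k} (\<lambda>_. borel :: real measure)"
  let ?x = "\<lambda>\<omega>. X (\<delta> * real k + \<delta>) \<omega> - X (\<delta> * real k) \<omega>"
  let ?n = "\<lambda>\<omega>. real (N (\<delta> * real k + \<delta>) \<omega>) - real (N (\<delta> * real k) \<omega>)"
  let ?a = "increments \<delta> k" and ?b = "N.increments \<delta> k"
  define G where "G a x n v = \<phi> (w a n + x + v * max 0 (b - w a n))" for a x n v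
  have wS: "reflected_walk b y (increments \<delta> (Suc k) \<omega>) (N.increments \<delta> (Suc k) \<omega>') (Suc k) =
      w (?a \<omega>) (?b \<omega>') + ?x \<omega> + ?n \<omega>' * max 0 (b - w (?a \<omega>) (?b \<omega>'))" for \<omega> \<omega>'
  proof -
    have "reflected_walk b y (increments \<delta> (Suc k) \<omega>) (N.increments \<delta> (Suc k) \<omega>') k = w (?a \<omega>) (?b \<omega>')"
      unfolding w_def by (rule reflected_walk_cong) (auto simp: increments_def N.increments_def)
    moreover have "increments \<delta> (Suc k) \<omega> k = ?x \<omega>" "N.increments \<delta> (Suc k) \<omega>' k = ?n \<omega>'"
      by (simp_all add: increments_def N.increments_def distrib_left add.commute)
    ultimately show ?thesis by simp
  qed
  have sa: "?a \<omega> \<in> space ?P" for \<omega> by (auto simp: increments_def space_PiM)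
  have "(\<integral>\<^sup>+\<omega>. \<phi> (walk b y \<delta> (Suc k) \<omega>) \<partial>M) = (\<integral>\<^sup>+\<omega>. (\<integral>\<^sup>+\<omega>'. G (?a \<omega>) (?x \<omega>) (?b \<omega>') (?n \<omega>') \<partial>M) \<partial>M)"
    unfolding walk_increments[OF order_refl] G_def wS[symmetric]
    by (rule indep_paths[OF \<delta>]) measurable
  also have "\<dots> = (\<integral>\<^sup>+\<omega>. (\<integral>\<^sup>+\<omega>'. (\<integral>\<^sup>+\<omega>3. G (?a \<omega>) (?x \<omega>) (?b \<omega>') (real (N \<delta> \<omega>3)) \<partial>M) \<partial>M) \<partial>M)"
  proof (rule nn_integral_cong, rule N.markov_grid[OF \<delta> \<delta>0])
    fix \<omega>
    have [measurable]: "(\<lambda>z. ?a \<omega>) \<in> L \<rightarrow>\<^sub>M ?P" for L :: "'c measure" using sa by (rule measurable_const)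
    show "(\<lambda>z. G (?a \<omega>) (?x \<omega>) (fst z) (snd z)) \<in> borel_measurable (?P \<Otimes>\<^sub>M borel)"
      unfolding G_def by measurable
  qed
  also have "\<dots> = (\<integral>\<^sup>+\<omega>. (\<integral>\<^sup>+\<omega>2. (\<integral>\<^sup>+\<omega>'. (\<integral>\<^sup>+\<omega>3. G (?a \<omega>) (X \<delta> \<omega>2) (?b \<omega>') (real (N \<delta> \<omega>3)) \<partial>M) \<partial>M) \<partial>M) \<partial>M)"
    by (rule markov_grid[OF \<delta> \<delta>0]) (unfold G_def, measurable)
  also have "\<dots> = (\<integral>\<^sup>+\<omega>. (\<integral>\<^sup>+\<omega>'. (\<integral>\<^sup>+\<omega>2. (\<integral>\<^sup>+\<omega>3. G (?a \<omega>) (X \<delta> \<omega>2) (?b \<omega>') (real (N \<delta> \<omega>3)) \<partial>M) \<partial>M) \<partial>M) \<partial>M)"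
  proof (rule nn_integral_cong)
    fix \<omega>
    interpret MM: pair_sigma_finite M M ..
    have [measurable]: "(\<lambda>z. ?a \<omega>) \<in> L \<rightarrow>\<^sub>M ?P" for L :: "'c measure" using sa by (rule measurable_const)
    show "(\<integral>\<^sup>+\<omega>2. (\<integral>\<^sup>+\<omega>'. (\<integral>\<^sup>+\<omega>3. G (?a \<omega>) (X \<delta> \<omega>2) (?b \<omega>') (real (N \<delta> \<omega>3)) \<partial>M) \<partial>M) \<partial>M) =
      (\<integral>\<^sup>+\<omega>'. (\<integral>\<^sup>+\<omega>2. (\<integral>\<^sup>+\<omega>3. G (?a \<omega>) (X \<delta> \<omega>2) (?b \<omega>') (real (N \<delta> \<omega>3)) \<partial>M) \<partial>M) \<partial>M)"
      by (rule MM.Fubini') (unfold G_def, measurable)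
  qed
  also have "\<dots> = (\<integral>\<^sup>+\<omega>. (\<integral>\<^sup>+\<omega>2. (\<integral>\<^sup>+\<omega>3. G (?a \<omega>) (X \<delta> \<omega>2) (?b \<omega>) (real (N \<delta> \<omega>3)) \<partial>M) \<partial>M) \<partial>M)"
    by (rule indep_paths[OF \<delta>, symmetric, where f="\<lambda>a n. \<integral>\<^sup>+\<omega>2. (\<integral>\<^sup>+\<omega>3. G a (X \<delta> \<omega>2) n (real (N \<delta> \<omega>3)) \<partial>M) \<partial>M"])
       (unfold G_def, measurable)
  finally show ?thesis
    unfolding G_def w_def walk_increments[OF order_refl, of _ _ _ k] .
qed

lemma N_measurable: assumes "0 < t" shows "N t \<in> M \<rightarrow>\<^sub>M count_space UNIV"
proof -
  have "(\<lambda>\<omega>. real (N t \<omega>)) \<in> borel_measurable M" using assms by (intro N.X_measurable) simp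
  then have "(\<lambda>\<omega>. nat \<lfloor>real (N t \<omega>)\<rfloor>) \<in> M \<rightarrow>\<^sub>M count_space UNIV" by measurable
  then show ?thesis by simp
qed

text \<open>The one-step bound is uniform in the position, so it may be integrated over the law of
  the walk at time \<open>k\<close>. \<open>D\<close> is the mean after one step, taken over fresh
  copies of the increments and rewritten with the Poisson law.\<close>

lemma walk_expectation:
  fixes h \<phi> :: "real \<Rightarrow> real"
  assumes \<delta>: "0 < \<delta>" and h: "\<And>y. 0 \<le> h y" "\<And>y. h y \<le> B" and [measurable]: "h \<in> borel_measurable borel"
    and \<phi>: "\<And>y. 0 \<le> \<phi> y" "\<And>y. \<phi> y \<le> B'" and [measurable]: "\<phi> \<in> borel_measurable borel"
    and step: "\<And>y. \<bar>exp (- q * \<delta>) * (LINT n|measure_pmf (poisson_pmf (r * \<delta>)). LINT \<omega>|M. \<phi> (y + X \<delta> \<omega> + real n * max 0 (b - y))) - \<phi> y + \<delta> * h y\<bar> \<le> \<delta> * \<epsilon>"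
  shows "\<bar>exp (- q * \<delta>) * (LINT \<omega>|M. \<phi> (walk b x \<delta> (Suc k) \<omega>)) - (LINT \<omega>|M. \<phi> (walk b x \<delta> k \<omega>)) + \<delta> * (LINT \<omega>|M. h (walk b x \<delta> k \<omega>))\<bar> \<le> \<delta> * \<epsilon>"
proof -
  let ?Q = "measure_pmf (poisson_pmf (r * \<delta>))"
  have [measurable]: "X \<delta> \<in> borel_measurable M" "N \<delta> \<in> M \<rightarrow>\<^sub>M count_space UNIV" "\<And>k. walk b x \<delta> k \<in> borel_measurable M"
    using \<delta> N_measurable walk_measurable by (auto intro: X_measurable)
  have [measurable]: "(\<lambda>\<omega>. real (N \<delta> \<omega>)) \<in> borel_measurable M" using \<delta> by (intro N.X_measurable) simp
  have B0: "0 \<le> B" "0 \<le> B'" using h[of 0] \<phi>[of 0] by auto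
  interpret MM: pair_sigma_finite M M ..
  have i\<phi>: "integrable M (\<lambda>\<omega>. \<phi> (f \<omega>))" and ih: "integrable M (\<lambda>\<omega>. h (f \<omega>))" if [measurable]: "f \<in> borel_measurable M" for f
    using \<phi> h by (auto intro: integrable_const_bound[where B=B'], auto intro: integrable_const_bound[where B=B])
  define u where "u y n = (LINT \<omega>|M. \<phi> (y + X \<delta> \<omega> + real n * max 0 (b - y)))" for y n
  define D where "D y = (LINT n|?Q. u y n)" for y
  have u: "0 \<le> u y n" "u y n \<le> B'" for y n
  proof -
    show "0 \<le> u y n" unfolding u_def using \<phi> by simp
    have "u y n \<le> (LINT \<omega>|M. B')" unfolding u_def using \<phi> by (intro integral_mono i\<phi>) auto
    then show "u y n \<le> B'" by (simp add: prob_space)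
  qed
  have D: "0 \<le> D y" "D y \<le> B'" for y
  proof -
    show "0 \<le> D y" unfolding D_def using u by simp
    have "D y \<le> (LINT n|?Q. B')" unfolding D_def using u B0
      by (intro integral_mono measure_pmf.integrable_const_bound[where B=B']) auto
    then show "D y \<le> B'" by simp
  qed
  have nnD: "(\<integral>\<^sup>+\<omega>2. (\<integral>\<^sup>+\<omega>3. ennreal (\<phi> (y + X \<delta> \<omega>2 + real (N \<delta> \<omega>3) * max 0 (b - y))) \<partial>M) \<partial>M) = ennreal (D y)" for y
  proof -
    have "(\<integral>\<^sup>+\<omega>2. (\<integral>\<^sup>+\<omega>3. ennreal (\<phi> (y + X \<delta> \<omega>2 + real (N \<delta> \<omega>3) * max 0 (b - y))) \<partial>M) \<partial>M)
       = (\<integral>\<^sup>+\<omega>3. (\<integral>\<^sup>+\<omega>2. ennreal (\<phi> (y + X \<delta> \<omega>2 + real (N \<delta> \<omega>3) * max 0 (b - y))) \<partial>M) \<partial>M)"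
      by (rule MM.Fubini') measurable
    also have "\<dots> = (\<integral>\<^sup>+\<omega>3. ennreal (u y (N \<delta> \<omega>3)) \<partial>M)"
      unfolding u_def using \<phi> by (intro nn_integral_cong nn_integral_eq_integral i\<phi>) auto
    also have "\<dots> = (\<integral>\<^sup>+n. ennreal (u y n) \<partial>distr M (count_space UNIV) (N \<delta>))"
      by (rule nn_integral_distr[symmetric]) auto
    also have "distr M (count_space UNIV) (N \<delta>) = ?Q"
      using poisson \<delta> by (simp add: poisson_process_def)
    also have "(\<integral>\<^sup>+n. ennreal (u y n) \<partial>?Q) = ennreal (D y)"
      unfolding D_def using u by (intro nn_integral_eq_integral measure_pmf.integrable_const_bound[where B=B']) auto
    finally show ?thesis .
  qed
  have [measurable]: "D \<in> borel_measurable borel"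
  proof -
    have "D = (\<lambda>y. enn2real (\<integral>\<^sup>+\<omega>2. (\<integral>\<^sup>+\<omega>3. ennreal (\<phi> (y + X \<delta> \<omega>2 + real (N \<delta> \<omega>3) * max 0 (b - y))) \<partial>M) \<partial>M))"
      unfolding nnD using D by simp
    also have "\<dots> \<in> borel_measurable borel" by measurable
    finally show ?thesis .
  qed
  let ?w = "walk b x \<delta> k"
  have iD: "integrable M (\<lambda>\<omega>. D (?w \<omega>))" by (rule integrable_const_bound[where B=B']) (use D in auto)
  have "ennreal (LINT \<omega>|M. \<phi> (walk b x \<delta> (Suc k) \<omega>)) = (\<integral>\<^sup>+\<omega>. ennreal (\<phi> (walk b x \<delta> (Suc k) \<omega>)) \<partial>M)"
    using \<phi> by (intro nn_integral_eq_integral[symmetric] i\<phi>) auto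
  also have "\<dots> = (\<integral>\<^sup>+\<omega>. ennreal (D (?w \<omega>)) \<partial>M)"
    by (subst walk_markov[OF \<delta>]) (simp_all add: nnD)
  also have "\<dots> = ennreal (LINT \<omega>|M. D (?w \<omega>))" using D by (intro nn_integral_eq_integral iD) auto
  finally have E: "(LINT \<omega>|M. \<phi> (walk b x \<delta> (Suc k) \<omega>)) = (LINT \<omega>|M. D (?w \<omega>))"
    using \<phi> D by (subst (asm) ennreal_inj) (auto intro!: integral_nonneg_AE)
  have "exp (- q * \<delta>) * (LINT \<omega>|M. D (?w \<omega>)) - (LINT \<omega>|M. \<phi> (?w \<omega>)) + \<delta> * (LINT \<omega>|M. h (?w \<omega>))
     = (LINT \<omega>|M. exp (- q * \<delta>) * D (?w \<omega>) - \<phi> (?w \<omega>) + \<delta> * h (?w \<omega>))"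
    using iD i\<phi>[of ?w] ih[of ?w] by simp
  moreover have "\<bar>LINT \<omega>|M. exp (- q * \<delta>) * D (?w \<omega>) - \<phi> (?w \<omega>) + \<delta> * h (?w \<omega>)\<bar> \<le> (LINT \<omega>|M. \<bar>exp (- q * \<delta>) * D (?w \<omega>) - \<phi> (?w \<omega>) + \<delta> * h (?w \<omega>)\<bar>)" by (rule integral_abs_bound)
  moreover have "(LINT \<omega>|M. \<bar>exp (- q * \<delta>) * D (?w \<omega>) - \<phi> (?w \<omega>) + \<delta> * h (?w \<omega>)\<bar>) \<le> (LINT \<omega>|M. \<delta> * \<epsilon>)"
    using iD i\<phi>[of ?w] ih[of ?w] step by (intro integral_mono integrable_abs) (auto simp: D_def u_def)
  moreover have "(LINT \<omega>|M. \<delta> * \<epsilon>) = \<delta> * \<epsilon>" by (simp add: prob_space)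
  ultimately show ?thesis unfolding E by linarith
qed

end

text \<open>The start may depend on the outcome: the pathwise convergence holds for the walk from
  \<open>x + X 0\<close>, which is \<open>x\<close> only almost surely, and is used for every
  outcome.\<close>

lemma (in levy_poisson) walk_start_measurable:
  assumes \<delta>: "0 < \<delta>" and [measurable]: "v \<in> borel_measurable M"
  shows "(\<lambda>\<omega>. walk b (v \<omega>) \<delta> k \<omega>) \<in> borel_measurable M"
proof (induction k)
  case (Suc k)
  have [measurable]: "X (\<delta> * real i) \<in> borel_measurable M" "(\<lambda>\<omega>. real (N (\<delta> * real i) \<omega>)) \<in> borel_measurable M" for i
    using \<delta> by (intro X_measurable N.X_measurable, simp)+
  note [measurable] = Suc[unfolded walk_def]
  show ?case unfolding walk_def reflected_walk.simps by measurable
qed (simp add: walk_def)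

lemma (in levy_poisson) parisian_path:
  assumes U: "parisian_reflected b (path x \<omega>) (\<lambda>t. N t \<omega>) u" and \<omega>: "\<omega> \<in> space M"
  shows "parisian_path b (path x \<omega>) u (\<lambda>t. N t \<omega>)"
  by (rule parisian_path.intro[OF U path_cadlag[OF \<omega>] N.X_cadlag[OF \<omega>]])
     (use poisson \<omega> in \<open>simp_all add: poisson_process_def\<close>)

lemma (in levy_poisson) walk_tendsto:
  assumes U: "parisian_reflected b (path x \<omega>) (\<lambda>t. N t \<omega>) u" and \<omega>: "\<omega> \<in> space M" and t: "0 \<le> t"
  shows "(\<lambda>j. walk b (x + X 0 \<omega>) (mesh j) (Suc (nat \<lfloor>t / mesh j\<rfloor>)) \<omega>) \<longlonglongrightarrow> u t"
proof -
  interpret P: parisian_path b "path x \<omega>" u "\<lambda>t. N t \<omega>" by (rule parisian_path[OF U \<omega>])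
  have "0 < mesh j" "mesh j \<le> 1" for j by simp_all
  from P.walk_tendsto[OF t this mesh_tendsto] show ?thesis
    unfolding walk_def by (simp only: add_diff_cancel_left)
qed

text \<open>\<open>U\<close> is given path by path through its reflection equation. Its
  measurability in the outcome is inherited from the walks that converge to it.\<close>

lemma (in levy_poisson) reflected_measurable:
  assumes U: "\<And>\<omega>. \<omega> \<in> space M \<Longrightarrow> parisian_reflected b (path x \<omega>) (\<lambda>t. N t \<omega>) (\<lambda>t. U t \<omega>)" and t: "0 \<le> t"
  shows "U t \<in> borel_measurable M"
proof (rule borel_measurable_LIMSEQ_real)
  show "(\<lambda>j. walk b (x + X 0 \<omega>) (mesh j) (Suc (nat \<lfloor>t / mesh j\<rfloor>)) \<omega>) \<longlonglongrightarrow> U t \<omega>" if "\<omega> \<in> space M" for \<omega>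
    by (rule walk_tendsto[where u="\<lambda>t. U t \<omega>", OF U[OF that] that t])
  have "(\<lambda>\<omega>. x + X 0 \<omega>) \<in> borel_measurable M" using X_measurable[of 0] by simp
  then show "(\<lambda>\<omega>. walk b (x + X 0 \<omega>) (mesh j) (Suc (nat \<lfloor>t / mesh j\<rfloor>)) \<omega>) \<in> borel_measurable M" for j
    by (rule walk_start_measurable[rotated]) simp
qed

section \<open>From summed one-step errors to the discounted time integral\<close>

lemma has_bochner_integral_exp_Ici:
  assumes k: "0 < (k::real)" shows "has_bochner_integral lborel (\<lambda>s. indicator {0..} s * exp (- k * s)) (1 / k)"
proof -
  have "has_bochner_integral lborel (\<lambda>s. indicator {0<..} s * exp (- k * s)) (1 / k)"
    using has_bochner_integral_exp_tail[OF k, of 0] by simp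
  moreover have "AE s in lborel. indicator {0<..} s * exp (- k * s) = indicator {0..} s * exp (- k * s)"
    using AE_lborel_singleton[of 0] by eventually_elim (auto split: split_indicator)
  ultimately show ?thesis by (subst (asm) has_bochner_integral_cong_AE) auto
qed

lemma exp_difference_quotient: assumes z: "0 < (z::real)" shows "\<bar>(1 - exp (- z)) / z - exp (- z)\<bar> \<le> z"
proof -
  have e: "1 - z \<le> exp (- z)" using exp_ge_add_one_self[of "- z"] by simp
  have "(1 - exp (- z)) / z \<le> 1" using e z by (simp add: field_simps)
  moreover have "exp (- z) \<le> (1 - exp (- z)) / z"
  proof -
    have "exp (- z) * (1 + z) \<le> exp (- z) * exp z" using exp_ge_add_one_self[of z] by (intro mult_left_mono) auto
    then have "exp (- z) * (1 + z) \<le> 1" by (simp flip: exp_add)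
    then show ?thesis using z by (simp add: field_simps)
  qed
  ultimately show ?thesis using e by simp
qed

text \<open>The one-step inequality is telescoped inside the continuous time integral. The index
  jumps by one when time moves by \<delta>, so the shifted and the unshifted integrals of
  \<open>e\<close> differ only by a boundary term over the first cell. The errors sum to
  \<epsilon>/q because the discount is integrable. The index starts at 1, hence \<open>e 1\<close>
  in the boundary term.\<close>

lemma discrete_resolvent:
  fixes e g :: "nat \<Rightarrow> real"
  assumes q: "0 < q" and \<delta>: "0 < \<delta>" and e: "\<And>k. \<bar>e k\<bar> \<le> B'" and g: "\<And>k. \<bar>g k\<bar> \<le> B"
    and step: "\<And>k. \<bar>exp (- q * \<delta>) * e (Suc k) - e k + \<delta> * g k\<bar> \<le> \<delta> * \<epsilon>"
  shows "\<bar>(LINT t|lborel. indicator {0..} t * (exp (- q * t) * g (Suc (nat \<lfloor>t / \<delta>\<rfloor>)))) - (1 - exp (- (q * \<delta>))) / (q * \<delta>) * e 1\<bar> \<le> \<epsilon> / q"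
proof -
  define K where "K t = Suc (nat \<lfloor>t / \<delta>\<rfloor>)" for t
  have Km: "(\<lambda>t. f (K t)) \<in> borel_measurable borel" for f :: "nat \<Rightarrow> real"
  proof -
    have "(\<lambda>t. nat \<lfloor>t / \<delta>\<rfloor>) \<in> borel \<rightarrow>\<^sub>M count_space UNIV" by measurable
    from measurable_compose[OF this, of "\<lambda>k. f (Suc k)" borel] show ?thesis by (simp add: K_def)
  qed
  have T: "integrable lborel (\<lambda>t. indicator {0..} t * exp (- q * t))" "(LINT t|lborel. indicator {0..} t * exp (- q * t)) = 1 / q"
    using has_bochner_integral_exp_Ici[OF q] by (auto simp: has_bochner_integral_iff)
  have int: "integrable lborel (\<lambda>t. indicator {0..} t * (exp (- q * t) * f (K t)))" if f: "\<And>k. \<bar>f k\<bar> \<le> C" for f and C :: real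
  proof (rule Bochner_Integration.integrable_bound[where f="\<lambda>t. C * (indicator {0..} t * exp (- q * t))"])
    show "integrable lborel (\<lambda>t. C * (indicator {0..} t * exp (- q * t)))" using T by simp
    show "(\<lambda>t. indicator {0..} t * (exp (- q * t) * f (K t))) \<in> borel_measurable lborel" using Km[of f] by measurable
    have C: "0 \<le> C" using f[of 0] by linarith
    show "AE t in lborel. norm (indicator {0..} t * (exp (- q * t) * f (K t))) \<le> norm (C * (indicator {0..} t * exp (- q * t)))"
      using f C by (intro AE_I2) (auto simp: abs_mult mult.commute split: split_indicator intro!: mult_left_mono)
  qed
  define v where "v t = indicator {0..} t * (exp (- q * t) * e (K t))" for t
  have iv: "integrable lborel v" unfolding v_def by (rule int[OF e])
  have KS: "K (t + \<delta>) = Suc (K t)" if "0 \<le> t" for t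
  proof -
    have "(t + \<delta>) / \<delta> = t / \<delta> + 1" using \<delta> by (simp add: add_divide_distrib)
    moreover have "0 \<le> \<lfloor>t / \<delta>\<rfloor>" using that \<delta> by simp
    ultimately show ?thesis by (simp add: K_def nat_add_distrib)
  qed
  have K1: "K t = 1" if "0 \<le> t" "t < \<delta>" for t
  proof -
    have "\<lfloor>t / \<delta>\<rfloor> = 0" using that \<delta> by (intro floor_unique) auto
    then show ?thesis by (simp add: K_def)
  qed
  define v1 where "v1 t = indicator {0..} t * (exp (- q * t) * (exp (- q * \<delta>) * e (Suc (K t))))" for t
  have iv1: "integrable lborel v1"
    unfolding v1_def
  proof (rule int[where C="exp (- q * \<delta>) * B'" and f="\<lambda>k. exp (- q * \<delta>) * e (Suc k)"])
    show "\<bar>exp (- q * \<delta>) * e (Suc k)\<bar> \<le> exp (- q * \<delta>) * B'" for k using e[of "Suc k"] by (simp add: abs_mult)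
  qed
  \<comment> \<open>The discounted next-step term is the time shift of the current one, except that
    the shift also brings in the first cell, where the index is 1; this piece is removed.\<close>
  have v1: "v1 t = v (t + \<delta>) - indicator {- \<delta>..<0} t * (exp (- q * (t + \<delta>)) * e 1)" for t
  proof -
    consider "0 \<le> t" | "- \<delta> \<le> t" "t < 0" | "t < - \<delta>" by linarith
    then show ?thesis
    proof cases
      case 1
      have "exp (- q * (t + \<delta>)) = exp (- q * t) * exp (- q * \<delta>)" by (simp add: distrib_left flip: exp_add)
      then show ?thesis using 1 \<delta> KS[OF 1] by (simp add: v1_def v_def)
    next
      case 2
      then show ?thesis using K1[of "t + \<delta>"] by (simp add: v1_def v_def)
    qed (use \<delta> in \<open>simp add: v1_def v_def\<close>)
  qed
  have sh: "integrable lborel (\<lambda>t. f (t + \<delta>))" "(LINT t|lborel. f (t + \<delta>)) = (LINT t|lborel. f t)" if "integrable lborel f" for f :: "real \<Rightarrow> real"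
    using lborel_integrable_real_affine[OF that, of 1 \<delta>] lborel_integral_real_affine[of 1 f \<delta>] by (simp_all add: add.commute)
  define w where "w t = indicator {0..<\<delta>} t * (exp (- q * t) * e 1)" for t
  have w: "has_bochner_integral lborel w ((1 - exp (- (q * \<delta>))) / q * e 1)"
  proof -
    have tl: "has_bochner_integral lborel (\<lambda>t. indicator {\<delta>..} t * exp (- q * t)) (exp (- (q * \<delta>)) / q)"
    proof -
      have "has_bochner_integral lborel (\<lambda>s. indicator {\<delta><..} s * exp (- q * s)) (exp (- (q * \<delta>)) / q)"
        using has_bochner_integral_exp_tail[OF q, of \<delta>] by simp
      moreover have "AE s in lborel. indicator {\<delta><..} s * exp (- q * s) = indicator {\<delta>..} s * exp (- q * s)"
        using AE_lborel_singleton[of \<delta>] by eventually_elim (auto split: split_indicator)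
      ultimately show ?thesis by (subst (asm) has_bochner_integral_cong_AE) auto
    qed
    have "has_bochner_integral lborel (\<lambda>t. (indicator {0..} t * exp (- q * t) - indicator {\<delta>..} t * exp (- q * t)) * e 1)
       ((1 / q - exp (- (q * \<delta>)) / q) * e 1)"
      using has_bochner_integral_diff[OF has_bochner_integral_exp_Ici[OF q] tl] by (rule has_bochner_integral_mult_left)
    moreover have "(\<lambda>t. (indicator {0..} t * exp (- q * t) - indicator {\<delta>..} t * exp (- q * t)) * e 1) = w"
      using \<delta> by (auto simp: fun_eq_iff w_def split: split_indicator)
    ultimately show ?thesis by (simp add: diff_divide_distrib)
  qed
  have iw: "integrable lborel w" and wI: "(LINT t|lborel. w t) = (1 - exp (- (q * \<delta>))) / q * e 1"
    using w by (auto simp: has_bochner_integral_iff)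
  have v1w: "v1 t = v (t + \<delta>) - w (t + \<delta>)" for t
  proof -
    have "indicator {- \<delta>..<0} t = (indicator {0..<\<delta>} (t + \<delta>) :: real)" by (auto split: split_indicator)
    then show ?thesis unfolding v1 w_def by simp
  qed
  have I1: "(LINT t|lborel. v1 t) = (LINT t|lborel. v t) - (LINT t|lborel. w t)"
    unfolding v1w using sh[OF iv] sh[OF iw] by simp
  define G where "G t = indicator {0..} t * (exp (- q * t) * g (K t))" for t
  have iG: "integrable lborel G" unfolding G_def by (rule int[OF g])
  have "(LINT t|lborel. v1 t - v t + \<delta> * G t) = - (LINT t|lborel. w t) + \<delta> * (LINT t|lborel. G t)"
    using iv iv1 iG I1 by simp
  moreover have "\<bar>LINT t|lborel. v1 t - v t + \<delta> * G t\<bar> \<le> (LINT t|lborel. \<bar>v1 t - v t + \<delta> * G t\<bar>)" by (rule integral_abs_bound)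
  moreover have "(LINT t|lborel. \<bar>v1 t - v t + \<delta> * G t\<bar>) \<le> (LINT t|lborel. (\<delta> * \<epsilon>) * (indicator {0..} t * exp (- q * t)))"
  proof (rule integral_mono)
    show "integrable lborel (\<lambda>t. \<bar>v1 t - v t + \<delta> * G t\<bar>)" using iv iv1 iG by simp
    show "integrable lborel (\<lambda>t. (\<delta> * \<epsilon>) * (indicator {0..} t * exp (- q * t)))" using T by simp
    fix t
    have "v1 t - v t + \<delta> * G t = indicator {0..} t * (exp (- q * t) * (exp (- q * \<delta>) * e (Suc (K t)) - e (K t) + \<delta> * g (K t)))"
      by (simp add: v1_def v_def G_def algebra_simps)
    then have "\<bar>v1 t - v t + \<delta> * G t\<bar> = indicator {0..} t * (exp (- q * t) * \<bar>exp (- q * \<delta>) * e (Suc (K t)) - e (K t) + \<delta> * g (K t)\<bar>)"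
      by (simp add: abs_mult)
    also have "\<dots> \<le> indicator {0..} t * (exp (- q * t) * (\<delta> * \<epsilon>))" by (intro mult_left_mono step) auto
    finally show "\<bar>v1 t - v t + \<delta> * G t\<bar> \<le> (\<delta> * \<epsilon>) * (indicator {0..} t * exp (- q * t))" by (simp add: mult_ac)
  qed
  moreover have "(LINT t|lborel. (\<delta> * \<epsilon>) * (indicator {0..} t * exp (- q * t))) = \<delta> * (\<epsilon> / q)" using T(2) by simp
  ultimately have main: "\<bar>\<delta> * (LINT t|lborel. G t) - (1 - exp (- (q * \<delta>))) / q * e 1\<bar> \<le> \<delta> * (\<epsilon> / q)" unfolding wI by linarith
  have "\<delta> * ((LINT t|lborel. G t) - (1 - exp (- (q * \<delta>))) / (q * \<delta>) * e 1) = \<delta> * (LINT t|lborel. G t) - (1 - exp (- (q * \<delta>))) / q * e 1"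
    using \<delta> by (simp add: right_diff_distrib)
  with main have "\<delta> * \<bar>(LINT t|lborel. G t) - (1 - exp (- (q * \<delta>))) / (q * \<delta>) * e 1\<bar> \<le> \<delta> * (\<epsilon> / q)"
    using \<delta> by (metis abs_mult abs_of_pos)
  then show ?thesis using \<delta> unfolding G_def K_def by (simp only: mult_le_cancel_left_pos)
qed

context levy_poisson begin

text \<open>Along the meshes the discounted mean of \<open>h\<close> over the walk tends to that
  over the reflected process by dominated convergence. The one-step bounds keep it within
  \<epsilon>/q of \<phi>(x), up to terms that vanish with the mesh; finally \<epsilon> is
  arbitrary.\<close>

lemma reflected_representation:
  fixes h \<phi> :: "real \<Rightarrow> real" and U :: "real \<Rightarrow> 'w \<Rightarrow> real"
  assumes q: "0 < q" and h: "\<And>y. 0 \<le> h y" "\<And>y. h y \<le> B" and hL: "\<And>y z. \<bar>h y - h z\<bar> \<le> L * \<bar>y - z\<bar>"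
    and \<phi>: "\<And>y. 0 \<le> \<phi> y" "\<And>y. \<phi> y \<le> B'" and \<phi>L: "\<And>y z. \<bar>\<phi> y - \<phi> z\<bar> \<le> L' * \<bar>y - z\<bar>"
    and eq: "\<And>x. \<phi> x = potential (q + r) (\<lambda>y. h y + r * \<phi> (max b y)) x"
    and U: "\<And>\<omega>. \<omega> \<in> space M \<Longrightarrow> parisian_reflected b (path x \<omega>) (\<lambda>t. N t \<omega>) (\<lambda>t. U t \<omega>)"
  shows "\<phi> x = (LINT t|lborel. indicator {0..} t * (exp (- q * t) * (LINT \<omega>|M. h (U t \<omega>))))"
proof -
  have hm[measurable]: "h \<in> borel_measurable borel" and \<phi>m[measurable]: "\<phi> \<in> borel_measurable borel"
    and hc: "continuous_on UNIV h"
    using lipschitz_continuous[OF hL] lipschitz_continuous[OF \<phi>L] by auto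
  have B0: "0 \<le> B" "0 \<le> B'" using h[of 0] \<phi>[of 0] by auto
  define K where "K \<delta> t = Suc (nat \<lfloor>t / \<delta>\<rfloor>)" for \<delta> t :: real
  define e where "e \<delta> k = (LINT \<omega>|M. \<phi> (walk b x \<delta> k \<omega>))" for \<delta> k
  define g where "g \<delta> k = (LINT \<omega>|M. h (walk b x \<delta> k \<omega>))" for \<delta> k
  have mean: "0 \<le> (LINT \<omega>|M. f (walk b x \<delta> k \<omega>))" "(LINT \<omega>|M. f (walk b x \<delta> k \<omega>)) \<le> C"
    if "0 < \<delta>" "\<And>y. 0 \<le> f y" "\<And>y. f y \<le> C" and [measurable]: "f \<in> borel_measurable borel" for f \<delta> k and C :: real
  proof -
    have [measurable]: "walk b x \<delta> k \<in> borel_measurable M" using that by (intro walk_measurable)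
    show "0 \<le> (LINT \<omega>|M. f (walk b x \<delta> k \<omega>))" using that by simp
    have "(LINT \<omega>|M. f (walk b x \<delta> k \<omega>)) \<le> (LINT \<omega>|M. C)"
      using that order_trans[OF that(2)[of 0] that(3)[of 0]] by (intro integral_mono integrable_const_bound[where B=C]) auto
    then show "(LINT \<omega>|M. f (walk b x \<delta> k \<omega>)) \<le> C" by (simp add: prob_space)
  qed
  have e: "\<bar>e \<delta> k\<bar> \<le> B'" "0 \<le> e \<delta> k" and g: "\<bar>g \<delta> k\<bar> \<le> B" "0 \<le> g \<delta> k" if "0 < \<delta>" for \<delta> k
    using mean[OF that \<phi> \<phi>m] mean[OF that h hm] by (simp_all add: e_def g_def)
  have e0: "e \<delta> 0 = \<phi> x" for \<delta> by (simp add: e_def walk_def prob_space)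
  define J where "J \<delta> = (LINT t|lborel. indicator {0..} t * (exp (- q * t) * g \<delta> (K \<delta> t)))" for \<delta>
  define T where "T = (LINT t|lborel. indicator {0..} t * (exp (- q * t) * (LINT \<omega>|M. h (U t \<omega>))))"
  have Km: "(\<lambda>t. f (K \<delta> t)) \<in> borel_measurable borel" for f :: "nat \<Rightarrow> real" and \<delta>
  proof -
    have "(\<lambda>t. nat \<lfloor>t / \<delta>\<rfloor>) \<in> borel \<rightarrow>\<^sub>M count_space UNIV" by measurable
    from measurable_compose[OF this, of "\<lambda>k. f (Suc k)" borel] show ?thesis by (simp add: K_def)
  qed
  have tail: "integrable lborel (\<lambda>t. indicator {0..} t * exp (- q * t))"
    and tail_int: "(LINT t|lborel. indicator {0..} t * exp (- q * t)) = 1 / q"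
    using has_bochner_integral_exp_Ici[OF q] by (auto simp: has_bochner_integral_iff)
  have conv_ae: "AE \<omega> in M. (\<lambda>j. h (walk b x (mesh j) (K (mesh j) t) \<omega>)) \<longlonglongrightarrow> h (U t \<omega>)" if t: "0 \<le> t" for t
    using X_0 AE_space
  proof eventually_elim
    case (elim \<omega>)
    have "(\<lambda>j. walk b x (mesh j) (K (mesh j) t) \<omega>) \<longlonglongrightarrow> U t \<omega>"
      using walk_tendsto[where u="\<lambda>t. U t \<omega>", OF U[OF elim(2)] elim(2) t] unfolding elim(1) add_0_right K_def .
    then show ?case by (rule continuous_on_tendsto_compose[OF hc]) auto
  qed
  have conv: "(\<lambda>j. g (mesh j) (K (mesh j) t)) \<longlonglongrightarrow> (LINT \<omega>|M. h (U t \<omega>))" if t: "0 \<le> t" for t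
    unfolding g_def
  proof (rule integral_dominated_convergence[where w="\<lambda>_. B"])
    have [measurable]: "walk b x (mesh j) k \<in> borel_measurable M" for j k by (rule walk_measurable) simp
    show "(\<lambda>\<omega>. h (walk b x (mesh j) (K (mesh j) t) \<omega>)) \<in> borel_measurable M" for j by measurable
    have [measurable]: "U t \<in> borel_measurable M" by (rule reflected_measurable[OF U t])
    show "(\<lambda>\<omega>. h (U t \<omega>)) \<in> borel_measurable M" by measurable
  qed (use conv_ae[OF t] h in auto)
  have JT: "(\<lambda>j. J (mesh j)) \<longlonglongrightarrow> T"
    unfolding J_def T_def
  proof (rule integral_dominated_convergence[where w="\<lambda>t. B * (indicator {0..} t * exp (- q * t))"])
    show 1: "(\<lambda>t. indicator {0..} t * (exp (- q * t) * g (mesh j) (K (mesh j) t))) \<in> borel_measurable lborel" for j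
      using Km[of "g (mesh j)" "mesh j"] by measurable
    have 2: "(\<lambda>j. indicator {0..} t * (exp (- q * t) * g (mesh j) (K (mesh j) t))) \<longlonglongrightarrow> indicator {0..} t * (exp (- q * t) * (LINT \<omega>|M. h (U t \<omega>)))" for t
      using conv[of t] by (cases "0 \<le> t") (auto intro!: tendsto_intros)
    then show "AE t in lborel. (\<lambda>j. indicator {0..} t * (exp (- q * t) * g (mesh j) (K (mesh j) t))) \<longlonglongrightarrow> indicator {0..} t * (exp (- q * t) * (LINT \<omega>|M. h (U t \<omega>)))" by simp
    show "(\<lambda>t. indicator {0..} t * (exp (- q * t) * (LINT \<omega>|M. h (U t \<omega>)))) \<in> borel_measurable lborel"
      by (rule borel_measurable_LIMSEQ_real[OF 2 1])
    show "integrable lborel (\<lambda>t. B * (indicator {0..} t * exp (- q * t)))" using tail by simp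
    show "AE t in lborel. norm (indicator {0..} t * (exp (- q * t) * g (mesh j) (K (mesh j) t))) \<le> B * (indicator {0..} t * exp (- q * t))" for j
    proof (rule AE_I2)
      fix t
      show "norm (indicator {0..} t * (exp (- q * t) * g (mesh j) (K (mesh j) t))) \<le> B * (indicator {0..} t * exp (- q * t))"
        using mult_right_mono[OF g(1)[of "mesh j" "K (mesh j) t"], of "exp (- q * t)"]
        by (auto simp: abs_mult mult.commute split: split_indicator)
    qed
  qed
  have close: "\<bar>T - \<phi> x\<bar> \<le> \<epsilon> / q" if \<epsilon>: "0 < \<epsilon>" for \<epsilon>
  proof -
    obtain d where d: "0 < d" "\<And>\<delta> y. 0 < \<delta> \<Longrightarrow> \<delta> \<le> d \<Longrightarrow>
      \<bar>exp (- q * \<delta>) * (LINT n|measure_pmf (poisson_pmf (r * \<delta>)). LINT \<omega>|M. \<phi> (y + X \<delta> \<omega> + real n * max 0 (b - y))) - \<phi> y + \<delta> * h y\<bar> \<le> \<delta> * \<epsilon>"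
      using walk_step[OF q r h hL \<phi> \<phi>L eq \<epsilon>] by blast
    \<comment> \<open>Three differences: the summed step errors, the averaging factor (1 - exp(-q
      \<delta>))/(q \<delta>) against exp(-q \<delta>), and the step from index 0 to index 1, where
      the time integral begins.\<close>
    have bound: "\<bar>J \<delta> - \<phi> x\<bar> \<le> \<epsilon> / q + (q * \<delta> * B' + \<delta> * (\<epsilon> + B))" if \<delta>: "0 < \<delta>" "\<delta> \<le> d" for \<delta>
    proof -
      have st: "\<bar>exp (- q * \<delta>) * e \<delta> (Suc k) - e \<delta> k + \<delta> * g \<delta> k\<bar> \<le> \<delta> * \<epsilon>" for k
        unfolding e_def g_def by (rule walk_expectation[OF \<delta>(1) h hm \<phi> \<phi>m d(2)[OF \<delta>]])
      define c where "c = (1 - exp (- (q * \<delta>))) / (q * \<delta>)"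
      have "\<bar>J \<delta> - c * e \<delta> 1\<bar> \<le> \<epsilon> / q"
        unfolding J_def c_def K_def
        by (rule discrete_resolvent[where e="e \<delta>" and g="g \<delta>", OF q \<delta>(1) e(1)[OF \<delta>(1)] g(1)[OF \<delta>(1)] st])
      moreover have "\<bar>c * e \<delta> 1 - exp (- (q * \<delta>)) * e \<delta> 1\<bar> \<le> q * \<delta> * B'"
      proof -
        have z: "0 < q * \<delta>" using q \<delta> by simp
        have "\<bar>c - exp (- (q * \<delta>))\<bar> \<le> q * \<delta>" unfolding c_def by (rule exp_difference_quotient[OF z])
        then have "\<bar>c - exp (- (q * \<delta>))\<bar> * \<bar>e \<delta> 1\<bar> \<le> q * \<delta> * B'"
          using e(1)[OF \<delta>(1), of 1] z by (intro mult_mono) auto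
        then show ?thesis by (simp only: abs_mult[symmetric] left_diff_distrib)
      qed
      moreover have "\<bar>exp (- (q * \<delta>)) * e \<delta> 1 - \<phi> x\<bar> \<le> \<delta> * (\<epsilon> + B)"
      proof -
        have "\<delta> * \<bar>g \<delta> 0\<bar> \<le> \<delta> * B" using g(1)[OF \<delta>(1), of 0] \<delta> by (intro mult_left_mono) auto
        then have "\<bar>\<delta> * g \<delta> 0\<bar> \<le> \<delta> * B" using \<delta> by (simp add: abs_mult)
        then show ?thesis using st[of 0] unfolding e0 distrib_left by simp
      qed
      ultimately show ?thesis by linarith
    qed
    have ev: "eventually (\<lambda>j. mesh j < d) sequentially" using order_tendstoD(2)[OF mesh_tendsto d(1)] .
    have "(\<lambda>j. \<epsilon> / q + (q * mesh j * B' + mesh j * (\<epsilon> + B))) \<longlonglongrightarrow> \<epsilon> / q + (q * 0 * B' + 0 * (\<epsilon> + B))"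
      by (intro tendsto_intros mesh_tendsto)
    then have R: "(\<lambda>j. \<epsilon> / q + (q * mesh j * B' + mesh j * (\<epsilon> + B))) \<longlonglongrightarrow> \<epsilon> / q" by simp
    show ?thesis
    proof (rule tendsto_le[OF _ R])
      show "(\<lambda>j. \<bar>J (mesh j) - \<phi> x\<bar>) \<longlonglongrightarrow> \<bar>T - \<phi> x\<bar>" by (intro tendsto_intros JT)
      show "eventually (\<lambda>j. \<bar>J (mesh j) - \<phi> x\<bar> \<le> \<epsilon> / q + (q * mesh j * B' + mesh j * (\<epsilon> + B))) sequentially"
        using ev by eventually_elim (rule bound, auto)
    qed simp
  qed
  have "\<bar>T - \<phi> x\<bar> \<le> 0 + \<epsilon>" if "0 < \<epsilon>" for \<epsilon>
    using close[of "\<epsilon> * q"] that q by simp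
  then have "\<bar>T - \<phi> x\<bar> \<le> 0" by (rule field_le_epsilon)
  then show ?thesis unfolding T_def by simp
qed

end

section \<open>From Lipschitz to bounded measurable functions\<close>

locale parisian_reflection = spectrally_negative M X \<kappa> W + levy_poisson M X r N
  for M :: "'w measure" and X \<kappa> W r N +
  fixes q x b :: real and U :: "real \<Rightarrow> 'w \<Rightarrow> real"
  assumes q: "0 < q"
    and U: "\<And>\<omega>. \<omega> \<in> space M \<Longrightarrow> parisian_reflected b (path x \<omega>) (\<lambda>t. N t \<omega>) (\<lambda>t. U t \<omega>)"
begin

abbreviation "\<rho>U \<equiv> resolvent_density M X \<kappa> W q r b x"

lemma U_joint [measurable]: "(\<lambda>z. U (max 0 (fst z)) (snd z)) \<in> borel_measurable (borel \<Otimes>\<^sub>M M)"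
  using U by (intro cadlag_joint_measurable reflected_measurable[OF U]) (auto simp: parisian_reflected_def)

lemma U_joint2 [measurable (raw)]:
  assumes "f \<in> borel_measurable L" "g \<in> L \<rightarrow>\<^sub>M M"
  shows "(\<lambda>z. U (max 0 (f z)) (g z)) \<in> borel_measurable L"
  using measurable_compose[OF measurable_Pair[OF assms] U_joint] by simp

text \<open>The discounted occupation measure of the reflected process, built like
  \<open>resolvent\<close>; the final formula says that \<rho>U is its density.\<close>

definition \<mu> :: "real measure" where
  "\<mu> = distr (density (lborel \<Otimes>\<^sub>M M) (\<lambda>z. indicator {0..} (fst z) * ennreal (exp (- q * fst z)))) borel
     (\<lambda>z. U (max 0 (fst z)) (snd z))"

lemma sets_\<mu> [simp, measurable_cong]: "sets \<mu> = sets borel" by (simp add: \<mu>_def)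

lemma nn_integral_\<mu>:
  assumes [measurable]: "f \<in> borel_measurable borel"
  shows "(\<integral>\<^sup>+y. f y \<partial>\<mu>) = (\<integral>\<^sup>+t. indicator {0..} t * ennreal (exp (- q * t)) * (\<integral>\<^sup>+\<omega>. f (U (max 0 t) \<omega>) \<partial>M) \<partial>lborel)"
proof -
  have "(\<integral>\<^sup>+y. f y \<partial>\<mu>) =
     (\<integral>\<^sup>+z. indicator {0..} (fst z) * ennreal (exp (- q * fst z)) * f (U (max 0 (fst z)) (snd z)) \<partial>(lborel \<Otimes>\<^sub>M M))"
    unfolding \<mu>_def by (subst nn_integral_distr, simp_all, subst nn_integral_density, simp_all)
  also have "\<dots> = (\<integral>\<^sup>+t. (\<integral>\<^sup>+\<omega>. indicator {0..} t * ennreal (exp (- q * t)) * f (U (max 0 t) \<omega>) \<partial>M) \<partial>lborel)"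
    by (subst nn_integral_fst[symmetric]) simp_all
  also have "\<dots> = (\<integral>\<^sup>+t. indicator {0..} t * ennreal (exp (- q * t)) * (\<integral>\<^sup>+\<omega>. f (U (max 0 t) \<omega>) \<partial>M) \<partial>lborel)"
    by (intro nn_integral_cong nn_integral_cmult) simp
  finally show ?thesis .
qed

lemma nn_integral_\<mu>_real:
  fixes h :: "real \<Rightarrow> real"
  assumes [measurable]: "h \<in> borel_measurable borel" and h: "\<And>y. 0 \<le> h y" "\<And>y. h y \<le> B"
  shows "(\<integral>\<^sup>+y. ennreal (h y) \<partial>\<mu>) = ennreal (LINT t|lborel. indicator {0..} t * (exp (- q * t) * (LINT \<omega>|M. h (U t \<omega>))))"
proof -
  define e where "e t = (LINT \<omega>|M. h (U (max 0 t) \<omega>))" for t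
  have B0: "0 \<le> B" using h[of 0] by linarith
  have e: "0 \<le> e t" "e t \<le> B" and nn: "(\<integral>\<^sup>+\<omega>. ennreal (h (U (max 0 t) \<omega>)) \<partial>M) = ennreal (e t)" for t
  proof -
    have i: "integrable M (\<lambda>\<omega>. h (U (max 0 t) \<omega>))" by (rule integrable_const_bound[where B=B]) (use h in auto)
    show "0 \<le> e t" unfolding e_def using h by simp
    have "e t \<le> (LINT \<omega>|M. B)" unfolding e_def using h by (intro integral_mono i) auto
    then show "e t \<le> B" by (simp add: prob_space)
    show "(\<integral>\<^sup>+\<omega>. ennreal (h (U (max 0 t) \<omega>)) \<partial>M) = ennreal (e t)"
      unfolding e_def using h by (intro nn_integral_eq_integral i) auto
  qed
  have [measurable]: "e \<in> borel_measurable borel" unfolding e_def[abs_def] by measurable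
  have i: "integrable lborel (\<lambda>t. indicator {0..} t * (exp (- q * t) * e t))"
  proof (rule Bochner_Integration.integrable_bound[where f="\<lambda>t. B * (indicator {0..} t * exp (- q * t))"])
    show "integrable lborel (\<lambda>t. B * (indicator {0..} t * exp (- q * t)))"
      using has_bochner_integral_exp_Ici[OF q] by (simp add: has_bochner_integral_iff)
    show "AE t in lborel. norm (indicator {0..} t * (exp (- q * t) * e t)) \<le> norm (B * (indicator {0..} t * exp (- q * t)))"
      using e B0 by (intro AE_I2) (auto simp: abs_mult mult.commute split: split_indicator intro!: mult_left_mono)
  qed measurable
  have "(\<integral>\<^sup>+y. ennreal (h y) \<partial>\<mu>) = (\<integral>\<^sup>+t. ennreal (indicator {0..} t * (exp (- q * t) * e t)) \<partial>lborel)"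
    by (subst nn_integral_\<mu>, simp, unfold nn)
       (intro nn_integral_cong, use e in \<open>auto simp: ennreal_mult split: split_indicator\<close>)
  also have "\<dots> = ennreal (LINT t|lborel. indicator {0..} t * (exp (- q * t) * e t))"
    using e by (intro nn_integral_eq_integral i) auto
  also have "(LINT t|lborel. indicator {0..} t * (exp (- q * t) * e t)) = (LINT t|lborel. indicator {0..} t * (exp (- q * t) * (LINT \<omega>|M. h (U t \<omega>))))"
    unfolding e_def by (intro Bochner_Integration.integral_cong refl) (auto split: split_indicator)
  finally show ?thesis .
qed

text \<open>The solution obtained by iteration is at the same time the functional of the reflected
  process and, after a translation, a solution of the equation with level 0, for which the density
  is known. Nonnegativity of the integral is inherited from \<phi>.\<close>

lemma density_lipschitz:
  fixes h :: "real \<Rightarrow> real"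
  assumes h: "\<And>y. 0 \<le> h y" "\<And>y. h y \<le> B" and L: "\<And>y z. \<bar>h y - h z\<bar> \<le> L * \<bar>y - z\<bar>"
    and supp: "\<And>y. y \<notin> {- K..K} \<Longrightarrow> h y = 0"
  shows "integrable lborel (\<lambda>y. h y * \<rho>U y)" "(\<integral>\<^sup>+y. ennreal (h y) \<partial>\<mu>) = ennreal (LINT y|lborel. h y * \<rho>U y)"
    "0 \<le> (LINT y|lborel. h y * \<rho>U y)"
proof -
  have hm: "h \<in> borel_measurable borel" by (rule lipschitz_continuous(2)[OF L])
  obtain \<phi> where \<phi>: "\<And>y. 0 \<le> \<phi> y" "\<And>y. \<phi> y \<le> B / q" "\<And>y z. \<bar>\<phi> y - \<phi> z\<bar> \<le> L / q * \<bar>y - z\<bar>"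
    "\<And>x. \<phi> x = potential (q + r) (\<lambda>y. h y + r * \<phi> (max b y)) x"
  proof (rule fixpoint[OF q r h L, where b=b])
    fix \<phi> assume "\<And>y. 0 \<le> \<phi> y" "\<And>y. \<phi> y \<le> B / q" "\<And>y z. \<bar>\<phi> y - \<phi> z\<bar> \<le> L / q * \<bar>y - z\<bar>"
      "\<And>x. \<phi> x = potential (q + r) (\<lambda>y. h y + r * \<phi> (max b y)) x"
    then show thesis by (rule that)
  qed
  have \<phi>m: "\<phi> \<in> borel_measurable borel" by (rule lipschitz_continuous(2)[OF \<phi>(3)])
  have rep: "\<phi> x = (LINT t|lborel. indicator {0..} t * (exp (- q * t) * (LINT \<omega>|M. h (U t \<omega>))))"
    by (rule reflected_representation[OF q h L \<phi>(1-3) \<phi>(4) U])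
  \<comment> \<open>Translation by \<open>b\<close> moves the level to 0. The support bound grows by
    the modulus of \<open>b\<close>, and one number bounds both functions.\<close>
  interpret R: reflected_resolvent M X \<kappa> W q r "\<bar>K\<bar> + \<bar>b\<bar>" "max B (B / q)" "\<lambda>z. h (z + b)" "\<lambda>z. \<phi> (z + b)"
  proof (unfold_locales)
    show "\<bar>h (y + b)\<bar> \<le> max B (B / q)" "\<bar>\<phi> (y + b)\<bar> \<le> max B (B / q)" for y
      using h[of "y + b"] \<phi>(1,2)[of "y + b"] by auto
    show "y \<notin> {- (\<bar>K\<bar> + \<bar>b\<bar>)..\<bar>K\<bar> + \<bar>b\<bar>} \<Longrightarrow> h (y + b) = 0" for y
      by (rule supp) (auto simp: abs_if split: if_splits)
    show "\<phi> (z + b) = (LINT v|resolvent (q + r). h (z + v + b) + r * \<phi> (max 0 (z + v) + b))" for z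
    proof -
      have "max b (z + b + v) = max 0 (z + v) + b" for v by (simp add: max_def)
      then show ?thesis using \<phi>(4)[of "z + b"] unfolding potential_def by (simp add: add_ac)
    qed
    show "(\<lambda>z. h (z + b)) \<in> borel_measurable borel" "(\<lambda>z. \<phi> (z + b)) \<in> borel_measurable borel"
      using hm \<phi>m by measurable
  qed (use q r in auto)
  have d: "resolvent_density M X \<kappa> W q r 0 (x - b) (y - b) = \<rho>U y" for y
    by (simp add: resolvent_density_def)
  have sh: "integrable lborel f \<longleftrightarrow> integrable lborel (\<lambda>y. f (y - b))" "(LINT y|lborel. f y) = (LINT y|lborel. f (y - b))" for f :: "real \<Rightarrow> real"
    using lborel_integrable_real_affine_iff[of 1 f "- b"] lborel_integral_real_affine[of 1 f "- b"] by (simp_all add: add.commute)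
  show "integrable lborel (\<lambda>y. h y * \<rho>U y)"
    using R.\<phi>_density(2)[of "x - b"] by (subst (asm) sh(1)) (simp add: d)
  have "\<phi> x = (LINT y|lborel. h y * \<rho>U y)"
    using R.\<phi>_density(1)[of "x - b"] by (subst (asm) sh(2)) (simp add: d)
  with rep \<phi>(1)[of x] show "0 \<le> (LINT y|lborel. h y * \<rho>U y)" "(\<integral>\<^sup>+y. ennreal (h y) \<partial>\<mu>) = ennreal (LINT y|lborel. h y * \<rho>U y)"
    using nn_integral_\<mu>_real[OF hm h] by simp_all
qed

lemma ramp_lipschitz:
  fixes d :: "real \<Rightarrow> real"
  assumes "\<And>y z. \<bar>d y - d z\<bar> \<le> \<bar>y - z\<bar>"
  shows "\<bar>min 1 (real n * d y) - min 1 (real n * d z)\<bar> \<le> real n * \<bar>y - z\<bar>"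
proof -
  have "\<bar>min 1 (real n * d y) - min 1 (real n * d z)\<bar> \<le> \<bar>real n * d y - real n * d z\<bar>" by linarith
  also have "\<dots> = real n * \<bar>d y - d z\<bar>" by (simp add: abs_mult flip: right_diff_distrib)
  also have "\<dots> \<le> real n * \<bar>y - z\<bar>" using assms by (intro mult_left_mono) auto
  finally show ?thesis .
qed

text \<open>Continuous test functions determine the resolvent measure, but the density is not yet known to
  be nonnegative; hence its negative part is moved to the other side.\<close>

lemma density_bounded:
  fixes h :: "real \<Rightarrow> real"
  assumes hm: "h \<in> borel_measurable borel" and h: "\<And>y. 0 \<le> h y" "\<And>y. h y \<le> B"
    and supp: "\<And>y. y \<notin> {- K<..<K} \<Longrightarrow> h y = 0"
  shows "integrable lborel (\<lambda>y. h y * \<rho>U y)" "(\<integral>\<^sup>+y. ennreal (h y) \<partial>\<mu>) = ennreal (LINT y|lborel. h y * \<rho>U y)"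
    "0 \<le> (LINT y|lborel. h y * \<rho>U y)"
proof -
  \<comment> \<open>A Lipschitz function equal to 1 on (-K,K). Its product with the density is
    integrable by the Lipschitz case, which gives measurability and integrability of the density on
    the interval.\<close>
  define bump where "bump y = min 1 (real 1 * max 0 (K + 1 - \<bar>y\<bar>))" for y :: real
  have ibump: "integrable lborel (\<lambda>y. bump y * \<rho>U y)"
  proof (rule density_lipschitz(1)[where K="K + 1"])
    show "\<bar>bump y - bump z\<bar> \<le> real 1 * \<bar>y - z\<bar>" for y z
      unfolding bump_def by (rule ramp_lipschitz) linarith
    show "0 \<le> bump y" "bump y \<le> 1" for y by (auto simp: bump_def)
    show "y \<notin> {- (K + 1)..K + 1} \<Longrightarrow> bump y = 0" for y by (auto simp: bump_def abs_if)
  qed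
  define \<rho> where "\<rho> y = indicator {- K<..<K} y * (bump y * \<rho>U y)" for y
  have \<rho>_eq: "f y * \<rho>U y = f y * \<rho> y" if "\<And>y. y \<notin> {- K<..<K} \<Longrightarrow> f y = 0" for f and y
  proof (cases "y \<in> {- K<..<K}")
    case True
    then have "bump y = 1" by (auto simp: bump_def abs_if)
    then show ?thesis using True by (simp add: \<rho>_def)
  qed (use that in simp)
  have i\<rho>: "integrable lborel \<rho>" unfolding \<rho>_def
    using integrable_mult_indicator[OF _ ibump, of "{- K<..<K}"] by simp
  then have [measurable]: "\<rho> \<in> borel_measurable borel" by simp
  define \<rho>p where "\<rho>p y = max 0 (\<rho> y)" for y
  define \<rho>n where "\<rho>n y = max 0 (- \<rho> y)" for y
  have [measurable]: "\<rho>p \<in> borel_measurable borel" "\<rho>n \<in> borel_measurable borel"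
    unfolding \<rho>p_def[abs_def] \<rho>n_def[abs_def] by measurable
  have pn: "0 \<le> \<rho>p y" "0 \<le> \<rho>n y" "\<rho> y = \<rho>p y - \<rho>n y" for y by (auto simp: \<rho>p_def \<rho>n_def)
  have ipn: "integrable lborel \<rho>p" "integrable lborel \<rho>n"
    unfolding \<rho>p_def[abs_def] \<rho>n_def[abs_def] using i\<rho> by auto
  have ifpn: "integrable lborel (\<lambda>y. f y * \<rho>p y)" "integrable lborel (\<lambda>y. f y * \<rho>n y)"
    if [measurable]: "f \<in> borel_measurable borel" and f: "\<And>y. 0 \<le> f y" "\<And>y. f y \<le> C" for f and C :: real
  proof -
    have bd: "norm (f y * g) \<le> norm (C * g)" if "0 \<le> g" for y g
      using f[of y] that by (simp add: abs_mult mult_right_mono)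
    show "integrable lborel (\<lambda>y. f y * \<rho>p y)"
      by (rule Bochner_Integration.integrable_bound[where f="\<lambda>y. C * \<rho>p y"]) (use ipn bd pn in auto)
    show "integrable lborel (\<lambda>y. f y * \<rho>n y)"
      by (rule Bochner_Integration.integrable_bound[where f="\<lambda>y. C * \<rho>n y"]) (use ipn bd pn in auto)
  qed
  define S where "S = {- K<..<K}"
  define M1 where "M1 = density \<mu> (indicator S)"
  define Mn where "Mn = density lborel (\<lambda>y. ennreal (\<rho>n y))"
  define Mp where "Mp = density lborel (\<lambda>y. ennreal (\<rho>p y))"
  have [measurable]: "S \<in> sets borel" by (simp add: S_def)
  have sets: "sets Mn = sets M1" "sets M1 = sets borel" "sets Mp = sets borel" by (simp_all add: M1_def Mn_def Mp_def)
  \<comment> \<open>\<open>T\<close> is \<mu> on \<open>S\<close> plus the negative part of the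
    density; the claim becomes the equality of \<open>T\<close> with the positive part, both
    nonnegative measures.\<close>
  obtain T where T: "sets T = sets M1" "\<And>f. f \<in> borel_measurable M1 \<Longrightarrow> (\<integral>\<^sup>+y. f y \<partial>T) = (\<integral>\<^sup>+y. f y \<partial>M1) + (\<integral>\<^sup>+y. f y \<partial>Mn)"
    using sum_measure_ex[OF sets(1)] by blast
  have nnT: "(\<integral>\<^sup>+y. ennreal (f y) \<partial>T) = (\<integral>\<^sup>+y. ennreal (f y) \<partial>\<mu>) + ennreal (LINT y|lborel. f y * \<rho>n y)"
    and nnp: "(\<integral>\<^sup>+y. ennreal (f y) \<partial>Mp) = ennreal (LINT y|lborel. f y * \<rho>p y)"
    if fm[measurable]: "f \<in> borel_measurable borel" and f: "\<And>y. 0 \<le> f y" "\<And>y. f y \<le> C" and s: "\<And>y. y \<notin> S \<Longrightarrow> f y = 0"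
    for f and C :: real
  proof -
    have "(\<integral>\<^sup>+y. ennreal (f y) \<partial>M1) = (\<integral>\<^sup>+y. indicator S y * ennreal (f y) \<partial>\<mu>)"
      unfolding M1_def by (rule nn_integral_density) measurable
    also have "\<dots> = (\<integral>\<^sup>+y. ennreal (f y) \<partial>\<mu>)" using s by (intro nn_integral_cong) (auto split: split_indicator)
    finally have 1: "(\<integral>\<^sup>+y. ennreal (f y) \<partial>M1) = (\<integral>\<^sup>+y. ennreal (f y) \<partial>\<mu>)" .
    have dens: "(\<integral>\<^sup>+y. ennreal (f y) \<partial>density lborel (\<lambda>y. ennreal (g y))) = ennreal (LINT y|lborel. f y * g y)"
      if [measurable]: "g \<in> borel_measurable borel" and g: "\<And>y. 0 \<le> g y" "integrable lborel (\<lambda>y. f y * g y)" for g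
    proof -
      have "(\<integral>\<^sup>+y. ennreal (f y) \<partial>density lborel (\<lambda>y. ennreal (g y))) = (\<integral>\<^sup>+y. ennreal (f y * g y) \<partial>lborel)"
        using f g by (subst nn_integral_density) (auto simp: ennreal_mult mult.commute)
      also have "\<dots> = ennreal (LINT y|lborel. f y * g y)" using f g by (intro nn_integral_eq_integral) auto
      finally show ?thesis .
    qed
    show "(\<integral>\<^sup>+y. ennreal (f y) \<partial>Mp) = ennreal (LINT y|lborel. f y * \<rho>p y)"
      unfolding Mp_def using pn ifpn[OF fm f] by (intro dens) auto
    have "(\<lambda>y. ennreal (f y)) \<in> borel_measurable M1" using fm by (simp add: sets(2) cong: measurable_cong_sets)
    then show "(\<integral>\<^sup>+y. ennreal (f y) \<partial>T) = (\<integral>\<^sup>+y. ennreal (f y) \<partial>\<mu>) + ennreal (LINT y|lborel. f y * \<rho>n y)"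
      using T(2)[of "\<lambda>y. ennreal (f y)"] 1 dens[of \<rho>n] pn ifpn[OF fm f] by (simp add: Mn_def)
  qed
  have sub: "(LINT y|lborel. f y * \<rho>U y) = (LINT y|lborel. f y * \<rho>p y) - (LINT y|lborel. f y * \<rho>n y)"
    "integrable lborel (\<lambda>y. f y * \<rho>U y)"
    if fm[measurable]: "f \<in> borel_measurable borel" and f: "\<And>y. 0 \<le> f y" "\<And>y. f y \<le> C" and s: "\<And>y. y \<notin> S \<Longrightarrow> f y = 0"
    for f and C :: real
  proof -
    have e: "f y * \<rho>U y = f y * \<rho>p y - f y * \<rho>n y" for y
      using \<rho>_eq[of f y] s unfolding pn(3) S_def by (simp add: right_diff_distrib)
    show "(LINT y|lborel. f y * \<rho>U y) = (LINT y|lborel. f y * \<rho>p y) - (LINT y|lborel. f y * \<rho>n y)"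
      "integrable lborel (\<lambda>y. f y * \<rho>U y)"
      unfolding e using ifpn[OF fm f] by simp_all
  qed
  have "T = Mp"
  proof (rule measure_eqI_lessThan)
    show "sets T = sets borel" "sets Mp = sets borel" using T(1) sets by auto
    have out: "emeasure T (- S) = 0" "emeasure Mp (- S) = 0"
    proof -
      have "- S \<in> sets M1" by (simp add: sets(2))
      then have "emeasure T (- S) = (\<integral>\<^sup>+y. indicator (- S) y \<partial>M1) + (\<integral>\<^sup>+y. indicator (- S) y \<partial>Mn)"
        using T(2)[of "indicator (- S)"] T(1) by simp
      also have "(\<integral>\<^sup>+y. indicator (- S) y \<partial>M1) = (\<integral>\<^sup>+y. indicator S y * indicator (- S) y \<partial>\<mu>)"
        unfolding M1_def by (rule nn_integral_density) measurable
      also have "\<dots> = (\<integral>\<^sup>+y. 0 \<partial>\<mu>)" by (intro nn_integral_cong) (auto split: split_indicator)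
      also have "(\<integral>\<^sup>+y. indicator (- S) y \<partial>Mn) = (\<integral>\<^sup>+y. ennreal (\<rho>n y) * indicator (- S) y \<partial>lborel)"
        unfolding Mn_def by (rule nn_integral_density) measurable
      also have "\<dots> = (\<integral>\<^sup>+(y::real). 0 \<partial>lborel)"
        by (intro nn_integral_cong) (auto simp: \<rho>n_def \<rho>_def S_def split: split_indicator)
      finally show "emeasure T (- S) = 0" by simp
      have "emeasure Mp (- S) = (\<integral>\<^sup>+y. ennreal (\<rho>p y) * indicator (- S) y \<partial>lborel)"
        unfolding Mp_def by (rule emeasure_density) measurable
      also have "\<dots> = (\<integral>\<^sup>+(y::real). 0 \<partial>lborel)"
        by (intro nn_integral_cong) (auto simp: \<rho>p_def \<rho>_def S_def split: split_indicator)
      finally show "emeasure Mp (- S) = 0" by simp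
    qed
    fix a
    \<comment> \<open>A 1-Lipschitz function that is positive exactly on the part of the half line
      inside \<open>S\<close>. Its ramps are Lipschitz with support in [-K,K], so the Lipschitz case
      applies to them.\<close>
    define d where "d y = max 0 (min (y - max a (- K)) (K - y))" for y :: real
    have dm: "d \<in> borel_measurable borel" unfolding d_def[abs_def] by measurable
    have d0: "0 \<le> d y" for y by (simp add: d_def)
    have dL: "\<bar>d y - d z\<bar> \<le> \<bar>y - z\<bar>" for y z unfolding d_def by linarith
    have dpos: "{y. 0 < d y} = {a<..} \<inter> S" by (auto simp: d_def S_def)
    have eq: "(\<integral>\<^sup>+y. ennreal (min 1 (real n * d y)) \<partial>T) = (\<integral>\<^sup>+y. ennreal (min 1 (real n * d y)) \<partial>Mp)" for n
    proof -
      let ?f = "\<lambda>y. min 1 (real n * d y)"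
      have fm: "?f \<in> borel_measurable borel" using dm by measurable
      have f: "0 \<le> ?f y" "?f y \<le> 1" for y using d0[of y] by auto
      have s: "?f y = 0" if "y \<notin> S" for y using that by (auto simp: d_def S_def)
      have s': "?f y = 0" if "y \<notin> {- K..K}" for y using s[of y] that by (auto simp: S_def)
      note lip = density_lipschitz[where h="?f" and B=1 and L="real n" and K=K, OF f ramp_lipschitz[OF dL] s']
      have n0: "0 \<le> (LINT y|lborel. ?f y * \<rho>n y)" using f pn by (intro integral_nonneg_AE) auto
      have "(\<integral>\<^sup>+y. ennreal (?f y) \<partial>T) = (\<integral>\<^sup>+y. ennreal (?f y) \<partial>\<mu>) + ennreal (LINT y|lborel. ?f y * \<rho>n y)"
        by (rule nnT[OF fm f s])
      also have "(\<integral>\<^sup>+y. ennreal (?f y) \<partial>\<mu>) = ennreal (LINT y|lborel. ?f y * \<rho>U y)" by (rule lip(2))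
      also have "\<dots> + ennreal (LINT y|lborel. ?f y * \<rho>n y) = ennreal ((LINT y|lborel. ?f y * \<rho>U y) + (LINT y|lborel. ?f y * \<rho>n y))"
        using lip(3) n0 by (rule ennreal_plus[symmetric])
      also have "(LINT y|lborel. ?f y * \<rho>U y) + (LINT y|lborel. ?f y * \<rho>n y) = (LINT y|lborel. ?f y * \<rho>p y)"
        using sub(1)[OF fm f s] by linarith
      also have "ennreal (LINT y|lborel. ?f y * \<rho>p y) = (\<integral>\<^sup>+y. ennreal (?f y) \<partial>Mp)"
        by (rule nnp[OF fm f s, symmetric])
      finally show ?thesis .
    qed
    have part: "emeasure Q {a<..} = emeasure Q {y. 0 < d y}" if Q: "sets Q = sets borel" "emeasure Q (- S) = 0" for Q
    proof -
      have "emeasure Q {a<..} = emeasure Q ({a<..} \<inter> S) + emeasure Q ({a<..} - S)"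
        by (subst plus_emeasure) (auto simp: Q(1) Int_Diff_Un)
      moreover have "emeasure Q ({a<..} - S) = 0"
        by (rule emeasure_eq_0[OF _ Q(2)]) (auto simp: Q(1))
      ultimately show ?thesis unfolding dpos by simp
    qed
    have sT: "sets T = sets borel" using T(1) sets by simp
    show "emeasure T {a<..} = emeasure Mp {a<..}"
      unfolding part[OF sT out(1)] part[OF sets(3) out(2)]
      using LIMSEQ_unique[OF nn_integral_ramp_LIMSEQ[OF sT dm d0] nn_integral_ramp_LIMSEQ[OF sets(3) dm d0, folded eq]] .
    have "emeasure T {a<..} = emeasure Mp {a<..}" by fact
    also have "\<dots> \<le> (\<integral>\<^sup>+y. ennreal (\<rho>p y) \<partial>lborel)"
      unfolding Mp_def by (subst emeasure_density) (auto intro!: nn_integral_mono split: split_indicator)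
    also have "\<dots> < \<infinity>" using ipn pn by (subst nn_integral_eq_integral) auto
    finally show "emeasure T {a<..} < \<infinity>" .
  qed
  have hs: "h y = 0" if "y \<notin> S" for y using supp that by (simp add: S_def)
  have main: "(\<integral>\<^sup>+y. ennreal (h y) \<partial>\<mu>) + ennreal (LINT y|lborel. h y * \<rho>n y) = ennreal (LINT y|lborel. h y * \<rho>p y)"
    using nnT[OF hm h hs] nnp[OF hm h hs] \<open>T = Mp\<close> by simp
  show "integrable lborel (\<lambda>y. h y * \<rho>U y)" by (rule sub(2)[OF hm h hs])
  have 0: "0 \<le> (LINT y|lborel. h y * \<rho>n y)" "0 \<le> (LINT y|lborel. h y * \<rho>p y)"
    using h pn by (auto intro!: integral_nonneg_AE)
  have "(\<integral>\<^sup>+y. ennreal (h y) \<partial>\<mu>) \<noteq> \<top>" unfolding nn_integral_\<mu>_real[OF hm h] by simp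
  then obtain v where v: "(\<integral>\<^sup>+y. ennreal (h y) \<partial>\<mu>) = ennreal v" "0 \<le> v" by (cases "\<integral>\<^sup>+y. ennreal (h y) \<partial>\<mu>") auto
  have "v + (LINT y|lborel. h y * \<rho>n y) = (LINT y|lborel. h y * \<rho>p y)"
    using main 0 v by (simp flip: ennreal_plus)
  then have "v = (LINT y|lborel. h y * \<rho>U y)" using sub(1)[OF hm h hs] by linarith
  with v show "(\<integral>\<^sup>+y. ennreal (h y) \<partial>\<mu>) = ennreal (LINT y|lborel. h y * \<rho>U y)" "0 \<le> (LINT y|lborel. h y * \<rho>U y)" by simp_all
qed

text \<open>Fubini exchanges expectation and time integral, which turns the left side into the
  integral of \<open>h\<close> against \<mu>. The nonnegative integral yields integrability and the
  value together.\<close>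

lemma resolvent_identity:
  fixes h :: "real \<Rightarrow> real"
  assumes hm[measurable]: "h \<in> borel_measurable borel" and h: "\<And>y. 0 \<le> h y" "\<And>y. h y \<le> B"
    and supp: "\<And>y. y \<notin> {- K<..<K} \<Longrightarrow> h y = 0"
  shows "has_bochner_integral M (\<lambda>\<omega>. LBINT t=0..\<infinity>. exp (- q * t) * h (U t \<omega>)) (LINT y|lborel. h y * \<rho>U y)"
proof -
  have B0: "0 \<le> B" using h[of 0] by linarith
  define V where "V \<omega> t = indicator {0..} t * (exp (- q * t) * h (U (max 0 t) \<omega>))" for \<omega> t
  have Vm[measurable]: "(\<lambda>z. V (fst z) (snd z)) \<in> borel_measurable (M \<Otimes>\<^sub>M lborel)" unfolding V_def by measurable
  have V0: "0 \<le> V \<omega> t" for \<omega> t using h by (simp add: V_def)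
  have I: "(LBINT t=0..\<infinity>. exp (- q * t) * h (U t \<omega>)) = (LINT t|lborel. V \<omega> t)" if \<omega>: "\<omega> \<in> space M" for \<omega>
  proof -
    have "(LBINT t=0..\<infinity>. exp (- q * t) * h (U t \<omega>)) = (LINT t|lborel. indicator {0<..} t * V \<omega> t)"
      unfolding interval_lebesgue_integral_0_infty set_lebesgue_integral_def
      by (intro Bochner_Integration.integral_cong refl) (auto simp: V_def split: split_indicator)
    also have "\<dots> = (LINT t|lborel. V \<omega> t)"
    proof (rule integral_cong_AE)
      have "(\<lambda>t. V \<omega> t) \<in> borel_measurable lborel" using measurable_compose[OF measurable_Pair1'[OF \<omega>] Vm] by simp
      then show "(\<lambda>t. indicator {0<..} t * V \<omega> t) \<in> borel_measurable lborel" "V \<omega> \<in> borel_measurable lborel" by measurable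
      show "AE t in lborel. indicator {0<..} t * V \<omega> t = V \<omega> t"
        using AE_lborel_singleton[of 0] by eventually_elim (auto simp: V_def split: split_indicator)
    qed
    finally show ?thesis .
  qed
  have iV: "integrable lborel (V \<omega>)" if \<omega>: "\<omega> \<in> space M" for \<omega>
  proof (rule Bochner_Integration.integrable_bound[where f="\<lambda>t. B * (indicator {0..} t * exp (- q * t))"])
    show "integrable lborel (\<lambda>t. B * (indicator {0..} t * exp (- q * t)))"
      using has_bochner_integral_exp_Ici[OF q] by (simp add: has_bochner_integral_iff)
    show "V \<omega> \<in> borel_measurable lborel" using measurable_compose[OF measurable_Pair1'[OF \<omega>] Vm] by simp
    show "AE t in lborel. norm (V \<omega> t) \<le> norm (B * (indicator {0..} t * exp (- q * t)))"
      using h B0 by (intro AE_I2) (auto simp: V_def abs_mult mult.commute split: split_indicator intro!: mult_left_mono)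
  qed
  have "has_bochner_integral M (\<lambda>\<omega>. LINT t|lborel. V \<omega> t) (LINT y|lborel. h y * \<rho>U y)"
  proof (rule has_bochner_integral_nn_integral)
    show "(\<lambda>\<omega>. LINT t|lborel. V \<omega> t) \<in> borel_measurable M" using Vm by measurable
    show "AE \<omega> in M. 0 \<le> (LINT t|lborel. V \<omega> t)" using V0 by (intro AE_I2 integral_nonneg_AE) auto
    show "0 \<le> (LINT y|lborel. h y * \<rho>U y)" by (rule density_bounded(3)[OF hm h supp])
    have "(\<integral>\<^sup>+\<omega>. ennreal (LINT t|lborel. V \<omega> t) \<partial>M) = (\<integral>\<^sup>+\<omega>. (\<integral>\<^sup>+t. ennreal (V \<omega> t) \<partial>lborel) \<partial>M)"
      using iV V0 by (intro nn_integral_cong nn_integral_eq_integral[symmetric]) auto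
    also have "\<dots> = (\<integral>\<^sup>+t. (\<integral>\<^sup>+\<omega>. ennreal (V \<omega> t) \<partial>M) \<partial>lborel)"
      by (rule nn_integral_lborel_swap) (unfold V_def, measurable)
    also have "\<dots> = (\<integral>\<^sup>+t. indicator {0..} t * ennreal (exp (- q * t)) * (\<integral>\<^sup>+\<omega>. ennreal (h (U (max 0 t) \<omega>)) \<partial>M) \<partial>lborel)"
    proof (rule nn_integral_cong)
      fix t :: real
      have "(\<integral>\<^sup>+\<omega>. ennreal (V \<omega> t) \<partial>M) = (\<integral>\<^sup>+\<omega>. (indicator {0..} t * ennreal (exp (- q * t))) * ennreal (h (U (max 0 t) \<omega>)) \<partial>M)"
        using h by (intro nn_integral_cong) (auto simp: V_def ennreal_mult split: split_indicator)
      also have "\<dots> = indicator {0..} t * ennreal (exp (- q * t)) * (\<integral>\<^sup>+\<omega>. ennreal (h (U (max 0 t) \<omega>)) \<partial>M)"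
        by (rule nn_integral_cmult) measurable
      finally show "(\<integral>\<^sup>+\<omega>. ennreal (V \<omega> t) \<partial>M) = indicator {0..} t * ennreal (exp (- q * t)) * (\<integral>\<^sup>+\<omega>. ennreal (h (U (max 0 t) \<omega>)) \<partial>M)" .
    qed
    also have "\<dots> = (\<integral>\<^sup>+y. ennreal (h y) \<partial>\<mu>)" by (rule nn_integral_\<mu>[symmetric]) measurable
    also have "\<dots> = ennreal (LINT y|lborel. h y * \<rho>U y)" by (rule density_bounded(2)[OF hm h supp])
    finally show "(\<integral>\<^sup>+\<omega>. ennreal (LINT t|lborel. V \<omega> t) \<partial>M) = ennreal (LINT y|lborel. h y * \<rho>U y)" .
  qed
  then show ?thesis by (subst has_bochner_integral_cong[OF refl I refl])
qed

end

theorem theorem4p1: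
  fixes M :: "'w measure"
    and X U :: "real \<Rightarrow> 'w \<Rightarrow> real"
    and N :: "real \<Rightarrow> 'w \<Rightarrow> nat"
    and \<nu> :: "real measure"
    and \<sigma> \<gamma> q r x b :: real
    and \<kappa> h :: "real \<Rightarrow> real"
    and W :: "real \<Rightarrow> real \<Rightarrow> real"
  assumes q: "q > 0" and r: "r > 0"
    and X: "spectrally_negative_levy M X"
    and \<sigma>: "\<sigma> \<ge> 0" and \<nu>: "negative_levy_measure \<nu>"
    and \<kappa>: "\<kappa> = laplace_exponent \<sigma> \<gamma> \<nu>"
    and X_\<kappa>: "\<And>\<theta> t. \<theta> \<ge> 0 \<Longrightarrow> t \<ge> 0 \<Longrightarrow>
                 (LINT \<omega>|M. exp (\<theta> * X t \<omega>)) = exp (t * \<kappa> \<theta>)"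
    and exp_moment: "\<exists>\<theta>'>0. (\<integral>\<^sup>+z\<in>{..-1}. ennreal (exp (\<theta>' * \<bar>z\<bar>)) \<partial>\<nu>) < \<infinity>"
    and N: "poisson_process M r N"
    and indep: "independent_processes M X N"
    and U: "\<And>\<omega>. \<omega> \<in> space M \<Longrightarrow>
              parisian_reflected b (\<lambda>t. x + X t \<omega>) (\<lambda>t. N t \<omega>) (\<lambda>t. U t \<omega>)"
    and W: "\<And>p. p > 0 \<Longrightarrow> scale_function \<kappa> p (W p)"
    and h_meas: "h \<in> borel_measurable borel"
    and h_nonneg: "\<And>y. h y \<ge> 0"
    and h_bdd: "bounded (range h)"
    and h_supp: "compact (closure {y. h y \<noteq> 0})"
  shows "integrable M (\<lambda>\<omega>. LBINT t=0..\<infinity>. exp (- q * t) * h (U t \<omega>)) \<and>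
         integrable lborel (\<lambda>y. h y * resolvent_density M X \<kappa> W q r b x y) \<and>
         (LINT \<omega>|M. LBINT t=0..\<infinity>. exp (- q * t) * h (U t \<omega>)) =
         (LBINT y. h y * resolvent_density M X \<kappa> W q r b x y)"
proof -
  have L: "levy_process M X" and J: "AE \<omega> in M. \<forall>t>0. X t \<omega> \<le> Lim (at_left t) (\<lambda>s. X s \<omega>)"
    using X unfolding spectrally_negative_levy_def by blast+
  interpret prob_space M using L unfolding levy_process_def by blast
  interpret parisian_reflection M X \<kappa> W r N q x b U
    by unfold_locales (fact L J q r N indep | (rule X_\<kappa> W U; assumption))+
  obtain B where B: "\<And>y. h y \<le> B"
    using h_bdd unfolding bounded_iff by (auto simp: abs_le_iff)
  obtain K where K: "\<And>y. h y \<noteq> 0 \<Longrightarrow> \<bar>y\<bar> < K"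
  proof -
    have "bounded {y. h y \<noteq> 0}" using compact_imp_bounded[OF h_supp] by (rule bounded_subset) (rule closure_subset)
    then obtain a where a: "\<And>y. h y \<noteq> 0 \<Longrightarrow> \<bar>y\<bar> \<le> a" unfolding bounded_iff by auto
    \<comment> \<open>The added 1 makes the bound strict, since the support is required to lie in an
      open interval.\<close>
    show thesis by (rule that[of "a + 1"]) (use a in force)
  qed
  have supp: "h y = 0" if "y \<notin> {- K<..<K}" for y
  proof (rule ccontr)
    assume "h y \<noteq> 0"
    then show False using K[of y] that by (auto simp: abs_less_iff)
  qed
  show ?thesis
    using resolvent_identity[OF h_meas h_nonneg B supp] density_bounded(1)[OF h_meas h_nonneg B supp]
    by (simp add: has_bochner_integral_iff)
qed

end
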